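(* Let $\lambda>0$, $B\in\{1,-1\}$, $T_{fin}>0$, and let $\psi,s_0,c_0$ satisfy the Data Assumption (see context). There exists a constant $\mu\ge0$, depending on $m,C_0,\varphi_m,\lambda,\eta,T_{fin},\|\psi\|_{C^\beta},\|s_0\|_{L^2},\|\partial_xc_0\|_{L^2}$, such that for every $T\in[0,T_{fin}]$, if $(s,c)$ is a bounded positive mild solution on $[0,T]\times\mathbb{R}_+$ (see context) of $$\partial_t s=\partial_x^2 s+\frac{B\,\partial_x c}{1+Bc}\,\partial_x s+\lambda c\,s(Bs-1),\qquad \partial_t c=-\lambda s(1+Bc)c,$$ with $s(0,\cdot)=s_0$, $c(0,\cdot)=c_0$, $s(\cdot,0)=\psi$, then $$\sup_{t\in[0,T]}\|s(t,\cdot)\|_{L^2(\mathbb{R}_+)}^2+\int_0^T\|\partial_xs(t,\cdot)\|_{L^2(\mathbb{R}_+)}^2dt\le2\mu.$$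
   Context: Notation: $\mathbb{R}_+=(0,\infty)$; $\varphi(c)=1+Bc$; $G(t,x)=\frac{1}{\sqrt{4\pi t}}e^{-x^2/(4t)}$. For $f$ on $\mathbb{R}_+$, $(\overline{G}(t,\cdot)*_D f)(x)=\int_0^\infty (G(t,x-y)-G(t,x+y))f(y)\,dy$. Data Assumption: there are constants $\eta\ge 0$ and $C_0\ge m>0$ such that (B1) $\psi\in C^\beta([0,T_{fin}])$ for some $1/4<\beta<1/2$, $\psi(0)=0$, $0\le\psi\le\eta$; (B2) $0\le s_0(x)\le\eta$ and $0<m\le c_0(x)\le C_0$ for all $x\in[0,\infty)$; $C_0<1$ if $B=-1$; $s_0\in W^{1,2}(\mathbb{R}_+)$, $C_0-c_0\in W^{1,2}(\mathbb{R}_+)$; $s_0(0)=0$; (B3) if $B=1$ then $\eta<1$. Put $\varphi_m=\min_{c\in[0,C_0]}\varphi(c)>0$. Bounded positive mild solution on $[0,T]$: a couple $(s,c)$ with $s\in L^\infty([0,T],W^{1,2}(\mathbb{R}_+))\cap L^\infty([0,T]\times\mathbb{R}_+)$ and $c$ a bounded Borel function on $[0,T]\times\mathbb{R}_+$, such that (i) $c(t,x)=\dfrac{c_0(x)}{\varphi(c_0(x))e^{\lambda\int_0^t s(\tau,x)d\tau}-Bc_0(x)}$; (ii) $0\le s(t,x)\le\eta$ for every $(t,x)\in[0,T]\times\mathbb{R}_+$, and for every $t\in[0,T]$ $$s(t,\cdot)=-2\int_0^t\partial_xG(t-\tau,\cdot)\psi(\tau)\,d\tau+\overline{G}(t,\cdot)*_D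 s_0+\int_0^t\overline{G}(t-\tau,\cdot)*_D\big(b_c(\tau,\cdot)\partial_x s(\tau,\cdot)+\gamma_c(\tau,\cdot)s(\tau,\cdot)(Bs(\tau,\cdot)-1)\big)d\tau,$$ where $b_c=B\,\partial_xc/(1+Bc)$ and $\gamma_c=\lambda c$. *)

theory Defs
  imports "HOL-Analysis.Analysis"
begin

text \<open>Functions on \<open>(0,\<infinity>)\<close> are functions on all reals of which only the values on \<open>{0<..}\<close> matter.\<close>

abbreviation Rplus :: "real measure" where
  "Rplus \<equiv> lebesgue_on {0<..}"

definition test_function :: "(real \<Rightarrow> real) \<Rightarrow> bool" where
  "test_function p \<longleftrightarrow>
     (\<forall>n x. ((deriv ^^ n) p) differentiable (at x)) \<and>
     (\<exists>a b. 0 < a \<and> a < b \<and> (\<forall>x. x \<notin> {a..b} \<longrightarrow> p x = 0))"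

definition loc_integrable :: "(real \<Rightarrow> real) \<Rightarrow> bool" where
  "loc_integrable f \<longleftrightarrow> (\<forall>a b. 0 < a \<and> a < b \<longrightarrow> integrable (lebesgue_on {a..b}) f)"

definition has_weak_deriv :: "(real \<Rightarrow> real) \<Rightarrow> (real \<Rightarrow> real) \<Rightarrow> bool" where
  "has_weak_deriv f g \<longleftrightarrow>
     loc_integrable f \<and> loc_integrable g \<and>
     (\<forall>p. test_function p \<longrightarrow>
        (LINT x|Rplus. f x * deriv p x) = - (LINT x|Rplus. g x * p x))"

text \<open>A weak derivative is unique only up to null sets; \<open>weak_deriv\<close> picks some version,
  and is used below only underneath integrals.\<close>

definition weak_deriv :: "(real \<Rightarrow> real) \<Rightarrow> real \<Rightarrow> real" where
  "weak_deriv f = (SOME g. has_weak_deriv f g)"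

definition L2_sq :: "(real \<Rightarrow> real) \<Rightarrow> ennreal" where
  "L2_sq f = (\<integral>\<^sup>+ x. ennreal ((f x)\<^sup>2) \<partial>Rplus)"

definition L2_norm_Rplus :: "(real \<Rightarrow> real) \<Rightarrow> real" where
  "L2_norm_Rplus f = sqrt (enn2real (L2_sq f))"

definition in_L2 :: "(real \<Rightarrow> real) \<Rightarrow> bool" where
  "in_L2 f \<longleftrightarrow> f \<in> borel_measurable Rplus \<and> L2_sq f < \<infinity>"

definition in_W12 :: "(real \<Rightarrow> real) \<Rightarrow> bool" where
  "in_W12 f \<longleftrightarrow> in_L2 f \<and> (\<exists>g. has_weak_deriv f g \<and> in_L2 g)"

definition W12_norm :: "(real \<Rightarrow> real) \<Rightarrow> real" where
  "W12_norm f = sqrt ((L2_norm_Rplus f)\<^sup>2 + (L2_norm_Rplus (weak_deriv f))\<^sup>2)"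

text \<open>\<open>L\<^sup>\<infinity>([0,T], W\<^sup>1\<^sup>,\<^sup>2)\<close> in the sense of Bochner: an almost everywhere limit, in the norm of
  \<open>W\<^sup>1\<^sup>,\<^sup>2\<close>, of simple functions with values in \<open>W\<^sup>1\<^sup>,\<^sup>2\<close>, with essentially bounded norm.\<close>

definition in_Linf_W12 :: "real \<Rightarrow> (real \<Rightarrow> real \<Rightarrow> real) \<Rightarrow> bool" where
  "in_Linf_W12 T u \<longleftrightarrow>
     (AE t in lebesgue_on {0..T}. in_W12 (u t)) \<and>
     (\<exists>S. (\<forall>n. simple_function (lebesgue_on {0..T}) (S n)) \<and>
          (\<forall>n. \<forall>t\<in>{0..T}. in_W12 (S n t)) \<and>
          (AE t in lebesgue_on {0..T}.
             (\<lambda>n. W12_norm (\<lambda>x. S n t x - u t x)) \<longlonglongrightarrow> 0)) \<and>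
     (\<exists>K. AE t in lebesgue_on {0..T}. W12_norm (u t) \<le> K)"

definition in_Linf :: "(real \<times> real) set \<Rightarrow> (real \<Rightarrow> real \<Rightarrow> real) \<Rightarrow> bool" where
  "in_Linf S u \<longleftrightarrow>
     (\<lambda>(t,x). u t x) \<in> borel_measurable (lebesgue_on S) \<and>
     (\<exists>K. AE (t,x) in lebesgue_on S. \<bar>u t x\<bar> \<le> K)"

definition holder_quotients :: "real \<Rightarrow> real set \<Rightarrow> (real \<Rightarrow> real) \<Rightarrow> real set" where
  "holder_quotients \<beta> S f =
     {\<bar>f x - f y\<bar> / \<bar>x - y\<bar> powr \<beta> | x y. x \<in> S \<and> y \<in> S \<and> x \<noteq> y}"

definition in_holder :: "real \<Rightarrow> real set \<Rightarrow> (real \<Rightarrow> real) \<Rightarrow> bool" where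
  "in_holder \<beta> S f \<longleftrightarrow> bounded (f ` S) \<and> bdd_above (holder_quotients \<beta> S f)"

definition holder_norm :: "real \<Rightarrow> real set \<Rightarrow> (real \<Rightarrow> real) \<Rightarrow> real" where
  "holder_norm \<beta> S f = (SUP x\<in>S. \<bar>f x\<bar>) + Sup (holder_quotients \<beta> S f)"

definition phi :: "real \<Rightarrow> real \<Rightarrow> real" where
  "phi B c = 1 + B * c"

text \<open>The infimum is attained, \<open>phi B\<close> being continuous.\<close>

definition phi_min :: "real \<Rightarrow> real \<Rightarrow> real" where
  "phi_min B C0 = (INF c\<in>{0..C0}. phi B c)"

text \<open>The condition \<open>s0 0 = 0\<close> refers to the continuous representative of
  \<open>s0 \<in> W\<^sup>1\<^sup>,\<^sup>2\<close>, hence the continuity requirement on \<open>s0\<close>.\<close>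

definition data_assumption ::
  "real \<Rightarrow> real \<Rightarrow> real \<Rightarrow> real \<Rightarrow> real \<Rightarrow> real \<Rightarrow>
     (real \<Rightarrow> real) \<Rightarrow> (real \<Rightarrow> real) \<Rightarrow> (real \<Rightarrow> real) \<Rightarrow> bool" where
  "data_assumption B \<beta> \<eta> C0 m Tfin \<psi> s0 c0 \<longleftrightarrow>
     0 \<le> \<eta> \<and> 0 < m \<and> m \<le> C0 \<and>
     1/4 < \<beta> \<and> \<beta> < 1/2 \<and> in_holder \<beta> {0..Tfin} \<psi> \<and> \<psi> 0 = 0 \<and>
     (\<forall>t\<in>{0..Tfin}. 0 \<le> \<psi> t \<and> \<psi> t \<le> \<eta>) \<and>
     (\<forall>x\<ge>0. 0 \<le> s0 x \<and> s0 x \<le> \<eta>) \<and>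
     (\<forall>x\<ge>0. m \<le> c0 x \<and> c0 x \<le> C0) \<and>
     (B = -1 \<longrightarrow> C0 < 1) \<and>
     in_W12 s0 \<and> in_W12 (\<lambda>x. C0 - c0 x) \<and>
     continuous_on {0..} s0 \<and> s0 0 = 0 \<and>
     (B = 1 \<longrightarrow> \<eta> < 1)"

definition heat_kernel :: "real \<Rightarrow> real \<Rightarrow> real" where
  "heat_kernel t x = 1 / sqrt (4 * pi * t) * exp (- (x\<^sup>2 / (4 * t)))"

text \<open>At time 0 the Dirichlet heat semigroup is the identity; the kernel formula is meaningless there.\<close>

definition dirichlet_conv :: "real \<Rightarrow> (real \<Rightarrow> real) \<Rightarrow> real \<Rightarrow> real" where
  "dirichlet_conv t f x =
     (if t = 0 then f x
      else (LINT y|Rplus. (heat_kernel t (x - y) - heat_kernel t (x + y)) * f y))"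

definition b_coeff :: "real \<Rightarrow> (real \<Rightarrow> real \<Rightarrow> real) \<Rightarrow> real \<Rightarrow> real \<Rightarrow> real" where
  "b_coeff B c t x = B * weak_deriv (c t) x / (1 + B * c t x)"

definition gamma_coeff :: "real \<Rightarrow> (real \<Rightarrow> real \<Rightarrow> real) \<Rightarrow> real \<Rightarrow> real \<Rightarrow> real" where
  "gamma_coeff lam c t x = lam * c t x"

text \<open>The integral equation is an identity of functions of \<open>x\<close> in \<open>W\<^sup>1\<^sup>,\<^sup>2\<close>, that is, for almost
  every \<open>x\<close>. At \<open>t = 0\<close> it says \<open>s 0 = s0\<close>; the boundary value \<open>\<psi>\<close> enters through the first
  integral.\<close>

definition bounded_positive_mild_solution ::
  "real \<Rightarrow> real \<Rightarrow> real \<Rightarrow> (real \<Rightarrow> real) \<Rightarrow> (real \<Rightarrow> real) \<Rightarrow> (real \<Rightarrow> real) \<Rightarrow> real \<Rightarrow>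
     (real \<Rightarrow> real \<Rightarrow> real) \<Rightarrow> (real \<Rightarrow> real \<Rightarrow> real) \<Rightarrow> bool" where
  "bounded_positive_mild_solution B lam \<eta> \<psi> s0 c0 T s c \<longleftrightarrow>
     in_Linf_W12 T s \<and> in_Linf ({0..T} \<times> {0<..}) s \<and>
     (\<lambda>(t,x). c t x) \<in> borel_measurable (restrict_space borel ({0..T} \<times> {0<..})) \<and>
     (\<exists>K. \<forall>t\<in>{0..T}. \<forall>x>0. \<bar>c t x\<bar> \<le> K) \<and>
     (\<forall>t\<in>{0..T}. \<forall>x>0.
        c t x = c0 x / (phi B (c0 x) * exp (lam * (LINT \<tau>|lebesgue_on {0..t}. s \<tau> x)) - B * c0 x)) \<and>
     (\<forall>t\<in>{0..T}. \<forall>x>0. 0 \<le> s t x \<and> s t x \<le> \<eta>) \<and>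
     (\<forall>t\<in>{0..T}. AE x in Rplus.
        s t x =
          - 2 * (LINT \<tau>|lebesgue_on {0..t}. deriv (heat_kernel (t - \<tau>)) x * \<psi> \<tau>)
          + dirichlet_conv t s0 x
          + (LINT \<tau>|lebesgue_on {0..t}. dirichlet_conv (t - \<tau>)
               (\<lambda>y. b_coeff B c \<tau> y * weak_deriv (s \<tau>) y
                  + gamma_coeff lam c \<tau> y * s \<tau> y * (B * s \<tau> y - 1)) x))"

end

theory Submission
  imports Defs "HOL-Probability.Distributions"
begin

text \<open>
  Write \<open>s = f + V\<close>, where \<open>f\<close> is the boundary integral and \<open>V\<close> solves the Dirichlet problem with
  source \<open>F1 + F2\<close>, \<open>F1 = b\<^sub>c \<partial>\<^sub>x s \<in> L\<^sup>1\<close> and \<open>F2 = \<gamma>\<^sub>c s (B s - 1) \<le> 0\<close> bounded. The energy estimate for \<open>V\<close>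
  is read off from the mild formulation, without any regularity in time: restarting the semigroup \<open>S\<close>
  at time \<open>t\<close> gives \<open>V (t + d) = S d (V t) + r\<close>, hence \<open>V (t + d)\<^sup>2 \<le> (S d (V t))\<^sup>2 + 2 V (t + d) r\<close>, and the
  last term is controlled by the \<open>L\<^sup>1\<close> norm of \<open>F1\<close>, because \<open>V\<close> is bounded, and by \<open>f \<in> L\<^sup>1\<close>, because
  \<open>V \<ge> - f\<close> and \<open>F2 \<le> 0\<close>. The loss \<open>\<parallel>V t\<parallel>\<^sup>2 - \<parallel>S d (V t)\<parallel>\<^sup>2\<close> dominates the quadratic form of the kernel
  of \<open>S (2 d)\<close>. Averaging over \<open>t\<close>, dividing by \<open>d\<close> and letting \<open>d \<rightarrow> 0\<close> turns this form, by Fatou's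
  lemma, into a multiple of \<open>\<integral>\<parallel>\<partial>\<^sub>x V\<parallel>\<^sup>2\<close>. The term \<open>\<partial>\<^sub>x f\<close> is square integrable because \<open>\<beta> > 1/4\<close>.
  Finally \<open>\<parallel>\<partial>\<^sub>x c t\<parallel>\<^sup>2\<close> is bounded by \<open>\<parallel>\<partial>\<^sub>x c0\<parallel>\<^sup>2\<close> and the time integral of \<open>\<parallel>\<partial>\<^sub>x s\<parallel>\<^sup>2\<close> up to \<open>t\<close>, so that
  Young's and Gronwall's inequalities close the estimate.\<close>

subsection \<open>The Dirichlet heat kernel\<close>

text \<open>In \<open>x\<close> the derivatives of \<open>c\<close> and of \<open>s\<close> are
  known only to be square integrable, so the drift term is no better than integrable and has to be
  paired with a bounded function. The bound \<open>2 * \<eta>\<close> for \<open>V\<close> is not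
  derived from the equation but read off from \<open>0 \<le> s \<le> \<eta>\<close> and the bound on
  the boundary integral. The gradient estimate is a loop: the drift costs a small multiple of the
  gradient energy plus a time integral of it. In the extended nonnegative reals such a loop closes
  only if the energy is finite beforehand. The bound \<open>K\<close>, which comes from
  \<open>s\<close> being essentially bounded in the Sobolev norm, serves only for finiteness and
  integrability; neither \<open>K\<close> nor \<open>T\<close> enters a final constant, which makes
  the estimate uniform. A second difficulty is measurability: \<open>weak_deriv\<close> is chosen
  separately at each time and \<open>s\<close> is only Lebesgue measurable on the product, so the
  solution is replaced by jointly Borel representatives before integrals are exchanged.\<close>

lemma heat_kernel_eq_normal_density:
  "t > 0 \<Longrightarrow> heat_kernel t x = normal_density 0 (sqrt (2 * t)) x"
  by (simp add: heat_kernel_def normal_density_def)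

lemma heat_kernel_nonneg: "t \<ge> 0 \<Longrightarrow> 0 \<le> heat_kernel t x"
  by (simp add: heat_kernel_def)

lemma heat_kernel_minus [simp]: "heat_kernel t (- x) = heat_kernel t x"
  by (simp add: heat_kernel_def)

lemma heat_kernel_commute: "heat_kernel t (x - y) = heat_kernel t (y - x)"
  by (metis heat_kernel_minus minus_diff_eq)

lemma measurable_heat_kernel [measurable (raw)]:
  assumes [measurable]: "f \<in> borel_measurable M" "g \<in> borel_measurable M"
  shows "(\<lambda>x. heat_kernel (f x) (g x)) \<in> borel_measurable M"
  unfolding heat_kernel_def by measurable

lemma heat_kernel_antimono:
  assumes "t > 0" "\<bar>x\<bar> \<le> \<bar>y\<bar>" shows "heat_kernel t y \<le> heat_kernel t x"
proof -
  have "x\<^sup>2 \<le> y\<^sup>2" using assms(2) by (simp add: abs_le_square_iff)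
  with assms(1) show ?thesis
    by (simp add: heat_kernel_def divide_right_mono)
qed

lemma nn_integral_heat_kernel: 
  assumes "t > 0" shows "(\<integral>\<^sup>+y. ennreal (heat_kernel t y) \<partial>lborel) = 1"
proof -
  interpret prob_space "density lborel (normal_density 0 (sqrt (2*t)))"
    using assms by (intro prob_space_normal_density) auto
  show ?thesis
    using emeasure_space_1 assms 
    by (simp add: heat_kernel_eq_normal_density emeasure_density)
qed

lemma nn_integral_shift:
  assumes [measurable]: "f \<in> borel_measurable borel"
  shows "(\<integral>\<^sup>+x. f (x + a :: real) \<partial>lborel) = (\<integral>\<^sup>+x. f x \<partial>lborel)"
  using nn_integral_real_affine[of f 1 a] by (simp add: add.commute)

lemma nn_integral_reflect:
  assumes [measurable]: "f \<in> borel_measurable borel"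
  shows "(\<integral>\<^sup>+x. f (- x :: real) \<partial>lborel) = (\<integral>\<^sup>+x. f x \<partial>lborel)"
  using nn_integral_real_affine[of f "-1" 0] by simp

lemma heat_kernel_convolution:
  assumes "a > 0" "b > 0"
  shows "(\<integral>\<^sup>+z. ennreal (heat_kernel a (x - z) * heat_kernel b (z - y)) \<partial>lborel) = heat_kernel (a + b) (x - y)"
proof -
  have "(\<integral>\<^sup>+z. ennreal (heat_kernel a (x - z) * heat_kernel b (z - y)) \<partial>lborel)
      = (\<integral>\<^sup>+z. ennreal (heat_kernel a (x - (z + y)) * heat_kernel b ((z + y) - y)) \<partial>lborel)"
    by (rule nn_integral_shift[symmetric]) measurable
  also have "\<dots> = (\<integral>\<^sup>+z. ennreal (normal_density 0 (sqrt (2*a)) ((x - y) - z) * normal_density 0 (sqrt (2*b)) z) \<partial>lborel)"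
    using assms by (simp add: heat_kernel_eq_normal_density algebra_simps)
  also have "\<dots> = normal_density 0 (sqrt ((sqrt (2*a))\<^sup>2 + (sqrt (2*b))\<^sup>2)) (x - y)"
    using assms by (intro fun_cong[OF conv_normal_density_zero_mean]) auto
  also have "\<dots> = heat_kernel (a + b) (x - y)"
    using assms by (simp add: heat_kernel_eq_normal_density)
  finally show ?thesis .
qed

lemma has_bochner_heat_kernel_convolution:
  assumes "a > 0" "b > 0"
  shows "has_bochner_integral lborel (\<lambda>z. heat_kernel a (x - z) * heat_kernel b (z - y)) (heat_kernel (a + b) (x - y))"
  using assms heat_kernel_convolution[OF assms]
  by (intro has_bochner_integral_nn_integral) (auto intro!: heat_kernel_nonneg mult_nonneg_nonneg)

text \<open>Extended by 0, so that all integrals run over the whole line and positivity and the mass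
  bound hold without side conditions. In particular the kernel at time 0 gives 0 and not the
  identity.\<close>

definition dirichlet_kernel :: "real \<Rightarrow> real \<Rightarrow> real \<Rightarrow> real" where
  "dirichlet_kernel t x y =
     (if 0 < t \<and> 0 < x \<and> 0 < y then heat_kernel t (x - y) - heat_kernel t (x + y) else 0)"

lemma measurable_dirichlet_kernel [measurable (raw)]:
  assumes [measurable]: "f \<in> borel_measurable M" "g \<in> borel_measurable M" "h \<in> borel_measurable M"
  shows "(\<lambda>x. dirichlet_kernel (f x) (g x) (h x)) \<in> borel_measurable M"
  unfolding dirichlet_kernel_def by measurable

lemma dirichlet_kernel_nonneg [simp]: "0 \<le> dirichlet_kernel t x y"
  by (auto simp: dirichlet_kernel_def intro!: heat_kernel_antimono)

lemma dirichlet_kernel_commute: "dirichlet_kernel t x y = dirichlet_kernel t y x"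
  by (simp add: dirichlet_kernel_def add.commute heat_kernel_commute)

lemma dirichlet_kernel_le: "t > 0 \<Longrightarrow> dirichlet_kernel t x y \<le> heat_kernel t (x - y)"
  by (simp add: dirichlet_kernel_def heat_kernel_nonneg)

lemma nn_integral_dirichlet_kernel_le:
  "(\<integral>\<^sup>+y. ennreal (dirichlet_kernel t x y) \<partial>lborel) \<le> 1"
proof (cases "t > 0")
  case True
  have "(\<integral>\<^sup>+y. ennreal (dirichlet_kernel t x y) \<partial>lborel) \<le> (\<integral>\<^sup>+y. ennreal (heat_kernel t (x - y)) \<partial>lborel)"
    by (intro nn_integral_mono ennreal_leI dirichlet_kernel_le True)
  also have "\<dots> = (\<integral>\<^sup>+y. ennreal (heat_kernel t (y + (- x))) \<partial>lborel)"
    by (simp add: heat_kernel_commute[of t x])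
  also have "\<dots> = (\<integral>\<^sup>+y. ennreal (heat_kernel t y) \<partial>lborel)"
    by (rule nn_integral_shift) measurable
  finally show ?thesis using nn_integral_heat_kernel[OF True] by simp
qed (simp add: dirichlet_kernel_def)

lemma nn_integral_dirichlet_kernel_le':
  "(\<integral>\<^sup>+x. ennreal (dirichlet_kernel t x y) \<partial>lborel) \<le> 1"
  using nn_integral_dirichlet_kernel_le[of t y] by (simp add: dirichlet_kernel_commute[of t y])

text \<open>As functions of \<open>z\<close> both factors extend oddly to the whole line, so the integral over the
  half line is half of a convolution of Gaussians.\<close>

lemma dirichlet_kernel_semigroup:
  assumes "a > 0" "b > 0"
  shows "(\<integral>\<^sup>+z. ennreal (dirichlet_kernel a x z * dirichlet_kernel b z y) \<partial>lborel) = dirichlet_kernel (a + b) x y"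
proof (cases "x > 0 \<and> y > 0")
  case True
  define h where "h z = (heat_kernel a (x - z) - heat_kernel a (x + z)) * (heat_kernel b (z - y) - heat_kernel b (z + y))" for z
  have [measurable]: "h \<in> borel_measurable borel" unfolding h_def by measurable
  have even: "h (- z) = h z" for z
  proof -
    have "heat_kernel b (- z - y) = heat_kernel b (z + y)" "heat_kernel b (- z + y) = heat_kernel b (z - y)"
      using heat_kernel_minus[of b "z + y"] heat_kernel_minus[of b "z - y"] by (simp_all del: heat_kernel_minus)
    then show ?thesis by (simp add: h_def algebra_simps)
  qed
  have pos: "z > 0 \<Longrightarrow> dirichlet_kernel a x z * dirichlet_kernel b z y = h z" for z
    using True assms by (simp add: dirichlet_kernel_def h_def)
  have h_pos: "0 \<le> h z" if "z > 0" for z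
    using pos[OF that] by (metis dirichlet_kernel_nonneg mult_nonneg_nonneg)
  have h0: "0 \<le> h z" for z
    using h_pos[of z] h_pos[of "- z"] even[of z] by (cases z "0 :: real" rule: linorder_cases) (auto simp: h_def)
  \<comment> \<open>The four products are Gaussian convolutions between the points \<open>x\<close>,
    \<open>- x\<close> and \<open>y\<close>, \<open>- y\<close>, because the even kernel takes the
    same value at \<open>x + z\<close> and \<open>- x - z\<close>.\<close>
  have "has_bochner_integral lborel h (heat_kernel (a + b) (x - y) - heat_kernel (a + b) (- x - y)
     - (heat_kernel (a + b) (x + y) - heat_kernel (a + b) (- x + y)))"
    unfolding h_def
    using has_bochner_heat_kernel_convolution[OF assms, of x y] has_bochner_heat_kernel_convolution[OF assms, of x "-y"]
      has_bochner_heat_kernel_convolution[OF assms, of "-x" y] has_bochner_heat_kernel_convolution[OF assms, of "-x" "-y"]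
    apply (simp add: left_diff_distrib right_diff_distrib)
    apply (intro has_bochner_integral_diff)
    using heat_kernel_minus[of a "x + z" for z] by (simp_all)
  moreover have "heat_kernel (a + b) (- x - y) = heat_kernel (a + b) (x + y)" "heat_kernel (a + b) (- x + y) = heat_kernel (a + b) (x - y)"
    using heat_kernel_minus[of "a+b" "x + y"] heat_kernel_minus[of "a+b" "x - y"] by (simp_all del: heat_kernel_minus)
  ultimately have "has_bochner_integral lborel h (2 * dirichlet_kernel (a + b) x y)"
    using True assms by (simp add: dirichlet_kernel_def)
  then have "(\<integral>\<^sup>+z. ennreal (h z) \<partial>lborel) = ennreal (2 * dirichlet_kernel (a + b) x y)"
    using h0 by (simp add: has_bochner_integral_iff nn_integral_eq_integral)
  also have "(\<integral>\<^sup>+z. ennreal (h z) \<partial>lborel) = (\<integral>\<^sup>+z. ennreal (h z) * indicator {0<..} z + ennreal (h z) * indicator {..<0} z \<partial>lborel)"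
    by (intro nn_integral_cong_AE AE_I'[of "{0}"]) (auto split: split_indicator)
  also have "\<dots> = (\<integral>\<^sup>+z. ennreal (h z) * indicator {0<..} z \<partial>lborel) + (\<integral>\<^sup>+z. ennreal (h z) * indicator {..<0} z \<partial>lborel)"
    by (rule nn_integral_add) auto
  also have "(\<integral>\<^sup>+z. ennreal (h z) * indicator {..<0} z \<partial>lborel) = (\<integral>\<^sup>+z. ennreal (h (- z)) * indicator {..<0} (- z) \<partial>lborel)"
    by (rule nn_integral_reflect[symmetric]) measurable
  also have "\<dots> = (\<integral>\<^sup>+z. ennreal (h z) * indicator {0<..} z \<partial>lborel)"
    by (intro nn_integral_cong) (auto simp: even split: split_indicator)
  also have "(\<integral>\<^sup>+z. ennreal (h z) * indicator {0<..} z \<partial>lborel) = (\<integral>\<^sup>+z. ennreal (dirichlet_kernel a x z * dirichlet_kernel b z y) \<partial>lborel)"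
  proof (intro nn_integral_cong)
    show "ennreal (h z) * indicator {0<..} z = ennreal (dirichlet_kernel a x z * dirichlet_kernel b z y)" for z
      using pos[of z] by (cases "z > 0") (simp_all add: dirichlet_kernel_def)
  qed
  finally have "ennreal (2 * dirichlet_kernel (a + b) x y) = 2 * (\<integral>\<^sup>+z. ennreal (dirichlet_kernel a x z * dirichlet_kernel b z y) \<partial>lborel)"
    by (simp only: mult_2[symmetric])
  moreover have "ennreal (2 * dirichlet_kernel (a + b) x y) = 2 * ennreal (dirichlet_kernel (a + b) x y)"
    by (simp add: ennreal_mult)
  ultimately show ?thesis by (metis ennreal_mult_cancel_left ennreal_numeral ennreal_neq_top zero_neq_numeral)
qed (auto simp: dirichlet_kernel_def)


section \<open>The Dirichlet semigroup and its loss in the L2 norm\<close>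

definition dsg :: "real \<Rightarrow> (real \<Rightarrow> real) \<Rightarrow> real \<Rightarrow> real" where
  "dsg t u x = (LINT y|lborel. dirichlet_kernel t x y * u y)"

text \<open>The time is doubled because integrating
  \<open>dirichlet_kernel t x y * dirichlet_kernel t x y'\<close> over \<open>x\<close> gives the
  kernel at time \<open>2 * t\<close>. Being an integral in \<open>ennreal\<close>, the form makes
  sense for functions with no derivative.\<close>

definition dirichlet_form :: "real \<Rightarrow> (real \<Rightarrow> real) \<Rightarrow> ennreal" where
  "dirichlet_form t u =
     (\<integral>\<^sup>+x. \<integral>\<^sup>+y. ennreal (dirichlet_kernel (2 * t) x y * (u x - u y)\<^sup>2) \<partial>lborel \<partial>lborel)"

text \<open>The variance identity for a weight not normalised to mass 1: the double integral is
  exactly what Jensen's inequality loses.\<close>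

lemma nn_integral_weighted_square_diff:
  fixes k u :: "real \<Rightarrow> real"
  assumes k0: "\<And>y. 0 \<le> k y" and k: "integrable lborel k"
    and ku: "integrable lborel (\<lambda>y. k y * u y)" "integrable lborel (\<lambda>y. k y * (u y)\<^sup>2)"
  shows "(\<integral>\<^sup>+y. \<integral>\<^sup>+y'. ennreal (k y * k y' * (u y - u y')\<^sup>2) \<partial>lborel \<partial>lborel)
    = ennreal (2 * (LINT y|lborel. k y) * (LINT y|lborel. k y * (u y)\<^sup>2) - 2 * (LINT y|lborel. k y * u y)\<^sup>2)"
proof -
  define m a q where "m = (LINT y|lborel. k y)" and "a = (LINT y|lborel. k y * u y)"
    and "q = (LINT y|lborel. k y * (u y)\<^sup>2)"
  have expand: "k y' * (u y - u y')\<^sup>2 = (u y)\<^sup>2 * k y' - (2 * u y) * (k y' * u y') + k y' * (u y')\<^sup>2" for y y'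
    by (simp add: power2_diff algebra_simps)
  have int: "integrable lborel (\<lambda>y'. k y' * (u y - u y')\<^sup>2)" for y
    unfolding expand by (intro Bochner_Integration.integrable_add Bochner_Integration.integrable_diff integrable_mult_right k ku)
  have eq: "(LINT y'|lborel. k y' * (u y - u y')\<^sup>2) = (u y)\<^sup>2 * m - 2 * u y * a + q" for y
    unfolding expand m_def a_def q_def using k ku by simp
  have inner: "(\<integral>\<^sup>+y'. ennreal (k y * k y' * (u y - u y')\<^sup>2) \<partial>lborel) = ennreal (m * (k y * (u y)\<^sup>2) - (2 * a) * (k y * u y) + q * k y)" for y
  proof -
    have "(\<integral>\<^sup>+y'. ennreal (k y * k y' * (u y - u y')\<^sup>2) \<partial>lborel) = ennreal (LINT y'|lborel. k y * (k y' * (u y - u y')\<^sup>2))"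
      unfolding mult.assoc by (intro nn_integral_eq_integral integrable_mult_right int) (simp add: k0)
    then show ?thesis by (simp only: integral_mult_right_zero eq) (simp add: algebra_simps)
  qed
  have nonneg: "0 \<le> m * (k y * (u y)\<^sup>2) - (2 * a) * (k y * u y) + q * k y" for y
  proof -
    have "0 \<le> (LINT y'|lborel. k y' * (u y - u y')\<^sup>2)" by (simp add: k0)
    then have "0 \<le> k y * ((u y)\<^sup>2 * m - 2 * u y * a + q)" by (simp add: eq k0)
    then show ?thesis by (simp add: algebra_simps)
  qed
  have "(\<integral>\<^sup>+y. ennreal (m * (k y * (u y)\<^sup>2) - (2 * a) * (k y * u y) + q * k y) \<partial>lborel)
    = ennreal (LINT y|lborel. m * (k y * (u y)\<^sup>2) - (2 * a) * (k y * u y) + q * k y)"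
    by (intro nn_integral_eq_integral Bochner_Integration.integrable_add Bochner_Integration.integrable_diff integrable_mult_right k ku)
       (simp add: nonneg)
  also have "(LINT y|lborel. m * (k y * (u y)\<^sup>2) - (2 * a) * (k y * u y) + q * k y) = m * q - 2 * a * a + q * m"
    using k ku by (simp add: m_def a_def q_def)
  finally show ?thesis
    unfolding inner m_def[symmetric] a_def[symmetric] q_def[symmetric] by (simp add: power2_eq_square algebra_simps)
qed

lemma integrable_dirichlet_kernel_bounded:
  assumes [measurable]: "u \<in> borel_measurable borel" and u: "AE y in lborel. \<bar>u y\<bar> \<le> C"
  shows "integrable lborel (\<lambda>y. dirichlet_kernel t x y * u y)"
proof -
  have "integrable lborel (\<lambda>y. dirichlet_kernel t x y)"
    using nn_integral_dirichlet_kernel_le[of t x] by (intro integrableI_bounded) (auto intro: le_less_trans)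
  then have "integrable lborel (\<lambda>y. C * dirichlet_kernel t x y)"
    by simp
  then show ?thesis
  proof (rule Bochner_Integration.integrable_bound)
    show "AE y in lborel. norm (dirichlet_kernel t x y * u y) \<le> norm (C * dirichlet_kernel t x y)"
      using u
    proof eventually_elim
      case (elim y)
      then have "dirichlet_kernel t x y * \<bar>u y\<bar> \<le> dirichlet_kernel t x y * \<bar>C\<bar>"
        by (intro mult_left_mono) auto
      then show ?case by (simp add: abs_mult mult.commute)
    qed
  qed measurable
qed

lemma measurable_dsg [measurable]:
  assumes [measurable]: "u \<in> borel_measurable borel"
  shows "dsg t u \<in> borel_measurable borel"
  unfolding dsg_def by measurable

text \<open>At each \<open>x\<close> the variance identity is applied with the weight
  \<open>dirichlet_kernel t x\<close>, whose mass is at most 1, so that the identity becomes an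
  inequality. Integration over \<open>x\<close> then uses the mass bound in the other variable and
  the semigroup law.\<close>

lemma dsg_dissipation:
  assumes [measurable]: "u \<in> borel_measurable borel" and u: "AE y in lborel. \<bar>u y\<bar> \<le> C" and t: "t > 0"
  shows "2 * (\<integral>\<^sup>+x. ennreal ((dsg t u x)\<^sup>2) \<partial>lborel) + dirichlet_form t u \<le> 2 * (\<integral>\<^sup>+x. ennreal ((u x)\<^sup>2) \<partial>lborel)"
proof -
  let ?K = "dirichlet_kernel t"
  have u2: "AE y in lborel. \<bar>(u y)\<^sup>2\<bar> \<le> C\<^sup>2"
    using u
  proof eventually_elim
    case (elim y)
    then show ?case using power_mono[OF elim abs_ge_zero, of 2] by simp
  qed
  have iK: "integrable lborel (?K x)" for x
    using integrable_dirichlet_kernel_bounded[of "\<lambda>_. 1" 1 t x] by simp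
  note ku = integrable_dirichlet_kernel_bounded[OF _ u] integrable_dirichlet_kernel_bounded[OF _ u2]
  have ptw: "2 * ennreal ((dsg t u x)\<^sup>2) + (\<integral>\<^sup>+y. \<integral>\<^sup>+y'. ennreal (?K x y * ?K x y' * (u y - u y')\<^sup>2) \<partial>lborel \<partial>lborel)
     \<le> 2 * (\<integral>\<^sup>+y. ennreal (?K x y * (u y)\<^sup>2) \<partial>lborel)" for x
  proof -
    define m q where "m = (LINT y|lborel. ?K x y)" and "q = (LINT y|lborel. ?K x y * (u y)\<^sup>2)"
    have "ennreal m \<le> 1" unfolding m_def
      using nn_integral_dirichlet_kernel_le[of t x] nn_integral_eq_integral[OF iK] by simp
    then have m: "m \<le> 1" by simp
    have q: "0 \<le> q" "ennreal q = (\<integral>\<^sup>+y. ennreal (?K x y * (u y)\<^sup>2) \<partial>lborel)"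
      unfolding q_def by (auto intro!: nn_integral_eq_integral[symmetric] ku)
    have form: "(\<integral>\<^sup>+y. \<integral>\<^sup>+y'. ennreal (?K x y * ?K x y' * (u y - u y')\<^sup>2) \<partial>lborel \<partial>lborel) = ennreal (2 * m * q - 2 * (dsg t u x)\<^sup>2)"
      unfolding m_def q_def dsg_def by (rule nn_integral_weighted_square_diff) (auto intro!: ku iK)
    have "2 * ennreal ((dsg t u x)\<^sup>2) + ennreal (2 * m * q - 2 * (dsg t u x)\<^sup>2) \<le> 2 * ennreal q"
    \<comment> \<open>\<open>form\<close> is an equation in \<open>ennreal\<close> and does not
      reveal the sign of the real number inside. If it is negative, truncation leaves 0, and
      \<open>(dsg t u x)\<^sup>2 \<le> q\<close> is obtained by expanding the square around the
      mean.\<close>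
    proof (cases "2 * m * q - 2 * (dsg t u x)\<^sup>2 \<ge> 0")
      case True
      have "2 * ennreal ((dsg t u x)\<^sup>2) + ennreal (2 * m * q - 2 * (dsg t u x)\<^sup>2) = ennreal (2 * m * q)"
        using True by (simp add: ennreal_plus[symmetric] ennreal_mult''[symmetric] flip: ennreal_numeral del: ennreal_plus)
      also have "\<dots> \<le> ennreal (2 * q)" using mult_right_mono[OF m q(1)] by (intro ennreal_leI) simp
      finally show ?thesis using q by (simp add: ennreal_mult)
    next
      case False
      have "0 \<le> (LINT y|lborel. ?K x y * (u y - dsg t u x)\<^sup>2)" by simp
      also have "(\<lambda>y. ?K x y * (u y - dsg t u x)\<^sup>2) = (\<lambda>y. ?K x y * (u y)\<^sup>2 - (2 * dsg t u x) * (?K x y * u y) + (dsg t u x)\<^sup>2 * ?K x y)"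
        by (simp add: power2_diff algebra_simps)
      also have "(LINT y|lborel. ?K x y * (u y)\<^sup>2 - (2 * dsg t u x) * (?K x y * u y) + (dsg t u x)\<^sup>2 * ?K x y)
        = q - 2 * dsg t u x * dsg t u x + (dsg t u x)\<^sup>2 * m"
        unfolding q_def m_def using ku[of t x] iK[of x] by (simp add: dsg_def)
      also have "\<dots> \<le> q - (dsg t u x)\<^sup>2"
        using mult_left_mono[OF m, of "(dsg t u x)\<^sup>2"] by (simp add: power2_eq_square)
      finally have "(dsg t u x)\<^sup>2 \<le> q" by simp
      with False show ?thesis by (simp add: ennreal_neg) (intro mult_left_mono ennreal_leI; simp)
    qed
    then show ?thesis unfolding form q .
  qed
  have "2 * (\<integral>\<^sup>+x. ennreal ((dsg t u x)\<^sup>2) \<partial>lborel) + (\<integral>\<^sup>+x. \<integral>\<^sup>+y. \<integral>\<^sup>+y'. ennreal (?K x y * ?K x y' * (u y - u y')\<^sup>2) \<partial>lborel \<partial>lborel \<partial>lborel)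
     = (\<integral>\<^sup>+x. 2 * ennreal ((dsg t u x)\<^sup>2) + (\<integral>\<^sup>+y. \<integral>\<^sup>+y'. ennreal (?K x y * ?K x y' * (u y - u y')\<^sup>2) \<partial>lborel \<partial>lborel) \<partial>lborel)"
    by (subst nn_integral_add) (auto simp: nn_integral_cmult)
  also have "\<dots> \<le> (\<integral>\<^sup>+x. 2 * (\<integral>\<^sup>+y. ennreal (?K x y * (u y)\<^sup>2) \<partial>lborel) \<partial>lborel)"
    by (intro nn_integral_mono ptw)
  also have "\<dots> = 2 * (\<integral>\<^sup>+x. \<integral>\<^sup>+y. ennreal (?K x y * (u y)\<^sup>2) \<partial>lborel \<partial>lborel)"
    by (subst nn_integral_cmult) auto
  also have "(\<integral>\<^sup>+x. \<integral>\<^sup>+y. ennreal (?K x y * (u y)\<^sup>2) \<partial>lborel \<partial>lborel) = (\<integral>\<^sup>+y. \<integral>\<^sup>+x. ennreal (?K x y * (u y)\<^sup>2) \<partial>lborel \<partial>lborel)"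
    by (intro lborel_pair.Fubini') measurable
  also have "\<dots> = (\<integral>\<^sup>+y. ennreal ((u y)\<^sup>2) * (\<integral>\<^sup>+x. ennreal (?K x y) \<partial>lborel) \<partial>lborel)"
    by (intro nn_integral_cong) (simp add: ennreal_mult'' nn_integral_multc mult.commute)
  also have "\<dots> \<le> (\<integral>\<^sup>+y. ennreal ((u y)\<^sup>2) * 1 \<partial>lborel)"
    by (intro nn_integral_mono mult_left_mono nn_integral_dirichlet_kernel_le') auto
  \<comment> \<open>The \<open>x\<close> integral is moved inside, where the semigroup law merges
    the two kernels.\<close>
  also have "(\<integral>\<^sup>+x. \<integral>\<^sup>+y. \<integral>\<^sup>+y'. ennreal (?K x y * ?K x y' * (u y - u y')\<^sup>2) \<partial>lborel \<partial>lborel \<partial>lborel)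
     = (\<integral>\<^sup>+y. \<integral>\<^sup>+x. \<integral>\<^sup>+y'. ennreal (?K x y * ?K x y' * (u y - u y')\<^sup>2) \<partial>lborel \<partial>lborel \<partial>lborel)"
    by (intro lborel_pair.Fubini') measurable
  also have "\<dots> = (\<integral>\<^sup>+y. \<integral>\<^sup>+y'. \<integral>\<^sup>+x. ennreal (?K x y * ?K x y' * (u y - u y')\<^sup>2) \<partial>lborel \<partial>lborel \<partial>lborel)"
    by (intro nn_integral_cong lborel_pair.Fubini') measurable
  also have "\<dots> = dirichlet_form t u"
    unfolding dirichlet_form_def
  proof (intro nn_integral_cong)
    fix y y'
    have "(\<integral>\<^sup>+x. ennreal (?K x y * ?K x y' * (u y - u y')\<^sup>2) \<partial>lborel) = (\<integral>\<^sup>+x. ennreal (?K y x * ?K x y') * ennreal ((u y - u y')\<^sup>2) \<partial>lborel)"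
      by (simp add: dirichlet_kernel_commute[of t _ y] ennreal_mult'')
    also have "\<dots> = ennreal (dirichlet_kernel (2 * t) y y') * ennreal ((u y - u y')\<^sup>2)"
      by (simp add: nn_integral_multc dirichlet_kernel_semigroup[OF t t])
    finally show "(\<integral>\<^sup>+x. ennreal (?K x y * ?K x y' * (u y - u y')\<^sup>2) \<partial>lborel) = ennreal (dirichlet_kernel (2 * t) y y' * (u y - u y')\<^sup>2)"
      by (simp add: ennreal_mult'')
  qed
  finally show ?thesis by (simp add: mult_left_mono)
qed

subsection \<open>Duhamel's formula and the energy inequality\<close>

lemma sigma_finite_lborel_pair: "sigma_finite_measure (lborel \<Otimes>\<^sub>M lborel)"
  by (rule lborel_pair.P.sigma_finite_measure_axioms)

text \<open>Fubini's theorem for \<open>dsg\<close> applied to an integral operator with nonnegative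
  kernel. The parameter space \<open>M\<close> is abstract because \<open>mild_restart\<close> needs
  two cases: space-time for the Duhamel integral and the line for the initial datum.\<close>

lemma dsg_integral_kernel:
  fixes k :: "real \<Rightarrow> 'a \<Rightarrow> real" and F c :: "'a \<Rightarrow> real"
  assumes M: "sigma_finite_measure M"
    and [measurable]: "case_prod k \<in> borel_measurable (lborel \<Otimes>\<^sub>M M)" "F \<in> borel_measurable M"
    and k0: "\<And>z p. 0 \<le> k z p" and c0: "\<And>p. 0 \<le> c p"
    and c: "\<And>p. p \<in> space M \<Longrightarrow> (\<integral>\<^sup>+z. ennreal (dirichlet_kernel t x z * k z p) \<partial>lborel) = ennreal (c p)"
    and fin: "(\<integral>\<^sup>+p. ennreal (c p * \<bar>F p\<bar>) \<partial>M) < \<infinity>"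
  shows "dsg t (\<lambda>z. LINT p|M. k z p * F p) x = (LINT p|M. c p * F p)" (is ?eq)
    and "integrable lborel (\<lambda>z. dirichlet_kernel t x z * (LINT p|M. k z p * F p))" (is ?int)
proof -
  interpret M: sigma_finite_measure M by fact
  interpret pair_sigma_finite lborel M ..
  define h where "h z p = dirichlet_kernel t x z * (k z p * F p)" for z p
  have [measurable]: "case_prod h \<in> borel_measurable (lborel \<Otimes>\<^sub>M M)"
    unfolding h_def by measurable
  have "(\<integral>\<^sup>+q. ennreal (norm (case_prod h q)) \<partial>(lborel \<Otimes>\<^sub>M M)) = (\<integral>\<^sup>+p. \<integral>\<^sup>+z. ennreal (norm (h z p)) \<partial>lborel \<partial>M)"
    by (subst nn_integral_snd[symmetric]) auto
  also have "\<dots> = (\<integral>\<^sup>+p. ennreal (c p * \<bar>F p\<bar>) \<partial>M)"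
  proof (rule nn_integral_cong)
    fix p assume p: "p \<in> space M"
    have "(\<integral>\<^sup>+z. ennreal (norm (h z p)) \<partial>lborel) = (\<integral>\<^sup>+z. ennreal (dirichlet_kernel t x z * k z p) * ennreal \<bar>F p\<bar> \<partial>lborel)"
      by (intro nn_integral_cong) (simp add: h_def abs_mult k0 ennreal_mult'' mult.assoc[symmetric])
    also have "\<dots> = ennreal (c p) * ennreal \<bar>F p\<bar>"
      using p by (subst nn_integral_multc) (auto simp: c)
    finally show "(\<integral>\<^sup>+z. ennreal (norm (h z p)) \<partial>lborel) = ennreal (c p * \<bar>F p\<bar>)"
      by (simp add: ennreal_mult'')
  qed
  finally have int: "integrable (lborel \<Otimes>\<^sub>M M) (case_prod h)"
    using fin by (intro integrableI_bounded) auto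
  have pull: "(LINT p|M. h z p) = dirichlet_kernel t x z * (LINT p|M. k z p * F p)" for z
    by (simp add: h_def)
  from integrable_fst[OF int] show ?int by (simp add: pull)
  have "dsg t (\<lambda>z. LINT p|M. k z p * F p) x = (LINT z|lborel. LINT p|M. h z p)"
    by (simp add: pull dsg_def)
  also have "\<dots> = (LINT p|M. LINT z|lborel. h z p)"
    using Fubini_integral[OF int] by simp
  also have "\<dots> = (LINT p|M. c p * F p)"
  proof (rule Bochner_Integration.integral_cong[OF refl])
    fix p assume p: "p \<in> space M"
    have [measurable]: "(\<lambda>z. k z p) \<in> borel_measurable lborel" using p by measurable
    have "(LINT z|lborel. dirichlet_kernel t x z * k z p) = c p"
      by (subst integral_eq_nn_integral) (use p in \<open>auto simp: c c0 k0\<close>)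
    moreover have "(LINT z|lborel. h z p) = (LINT z|lborel. (dirichlet_kernel t x z * k z p) * F p)"
      by (simp add: h_def mult.assoc)
    ultimately show "(LINT z|lborel. h z p) = c p * F p" by simp
  qed
  finally show ?eq .
qed

section \<open>Duhamel integrals and their L1 bounds\<close>

definition duhamel_kernel :: "real \<Rightarrow> real \<Rightarrow> real \<Rightarrow> real \<times> real \<Rightarrow> real" where
  "duhamel_kernel a b x p = indicator {a<..<b} (fst p) * dirichlet_kernel (b - fst p) x (snd p)"

text \<open>One integral over space-time instead of an iterated one: absolute convergence is then a
  single condition on \<open>x\<close>, namely that \<open>duhamel_abs a b F x\<close> is
  finite.\<close>

definition duhamel :: "real \<Rightarrow> real \<Rightarrow> (real \<Rightarrow> real \<Rightarrow> real) \<Rightarrow> real \<Rightarrow> real" where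
  "duhamel a b F x = (LINT p|(lborel \<Otimes>\<^sub>M lborel). duhamel_kernel a b x p * F (fst p) (snd p))"

definition duhamel_abs :: "real \<Rightarrow> real \<Rightarrow> (real \<Rightarrow> real \<Rightarrow> real) \<Rightarrow> real \<Rightarrow> ennreal" where
  "duhamel_abs a b F x = (\<integral>\<^sup>+p. ennreal (duhamel_kernel a b x p * \<bar>F (fst p) (snd p)\<bar>) \<partial>(lborel \<Otimes>\<^sub>M lborel))"

lemma duhamel_kernel_nonneg [simp]: "0 \<le> duhamel_kernel a b x p"
  by (simp add: duhamel_kernel_def)

lemma measurable_duhamel_kernel [measurable (raw)]:
  assumes [measurable]: "a \<in> borel_measurable M" "b \<in> borel_measurable M" "f \<in> borel_measurable M" "g \<in> M \<rightarrow>\<^sub>M lborel \<Otimes>\<^sub>M lborel"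
  shows "(\<lambda>q. duhamel_kernel (a q) (b q) (f q) (g q)) \<in> borel_measurable M"
proof -
  have [measurable]: "(\<lambda>q. fst (g q)) \<in> borel_measurable M" "(\<lambda>q. snd (g q)) \<in> borel_measurable M"
    using measurable_compose[OF assms(4) measurable_fst] measurable_compose[OF assms(4) measurable_snd] by simp_all
  show ?thesis
    unfolding duhamel_kernel_def indicator_def greaterThanLessThan_iff by measurable
qed

lemma duhamel_abs_bounded:
  assumes [measurable]: "case_prod F \<in> borel_measurable (borel \<Otimes>\<^sub>M borel)"
    and F: "\<And>t y. \<bar>F t y\<bar> \<le> M" and ab: "a \<le> b" and M: "0 \<le> M"
  shows "duhamel_abs a b F x \<le> ennreal (M * (b - a))"
proof -
  have "duhamel_abs a b F x = (\<integral>\<^sup>+s. \<integral>\<^sup>+y. ennreal (duhamel_kernel a b x (s, y) * \<bar>F s y\<bar>) \<partial>lborel \<partial>lborel)"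
    unfolding duhamel_abs_def by (subst lborel.nn_integral_fst[symmetric]) auto
  also have "\<dots> \<le> (\<integral>\<^sup>+s. ennreal M * indicator {a<..<b} s \<partial>lborel)"
  proof (rule nn_integral_mono)
    fix s
    have "(\<integral>\<^sup>+y. ennreal (duhamel_kernel a b x (s, y) * \<bar>F s y\<bar>) \<partial>lborel)
       \<le> (\<integral>\<^sup>+y. (ennreal M * indicator {a<..<b} s) * ennreal (dirichlet_kernel (b - s) x y) \<partial>lborel)"
      by (intro nn_integral_mono)
         (use F M in \<open>auto simp: duhamel_kernel_def mult.commute ennreal_mult'[symmetric] intro!: ennreal_leI mult_right_mono split: split_indicator\<close>)
    also have "\<dots> = (ennreal M * indicator {a<..<b} s) * (\<integral>\<^sup>+y. ennreal (dirichlet_kernel (b - s) x y) \<partial>lborel)"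
      by (rule nn_integral_cmult) measurable
    also have "\<dots> \<le> ennreal M * indicator {a<..<b} s"
      using mult_left_mono[OF nn_integral_dirichlet_kernel_le[of "b - s" x], of "ennreal M * indicator {a<..<b} s"] by simp
    finally show "(\<integral>\<^sup>+y. ennreal (duhamel_kernel a b x (s, y) * \<bar>F s y\<bar>) \<partial>lborel) \<le> ennreal M * indicator {a<..<b} s" .
  qed
  also have "\<dots> = ennreal (M * (b - a))"
    using ab M by (simp add: nn_integral_cmult ennreal_mult)
  finally show ?thesis .
qed

text \<open>Tonelli's theorem: the kernel has mass at most 1 in the outer variable \<open>x\<close>
  too, so an integrable source costs only its L1 norm.\<close>

lemma nn_integral_duhamel_abs_le:
  assumes [measurable]: "case_prod F \<in> borel_measurable (borel \<Otimes>\<^sub>M borel)"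
  shows "(\<integral>\<^sup>+x. duhamel_abs a b F x \<partial>lborel) \<le> (\<integral>\<^sup>+s. indicator {a<..<b} s * (\<integral>\<^sup>+y. ennreal \<bar>F s y\<bar> \<partial>lborel) \<partial>lborel)"
proof -
  interpret Q: pair_sigma_finite "lborel :: real measure" "lborel \<Otimes>\<^sub>M lborel :: (real \<times> real) measure"
    by (intro pair_sigma_finite.intro sigma_finite_lborel_pair lborel.sigma_finite_measure_axioms)
  have "(\<integral>\<^sup>+x. duhamel_abs a b F x \<partial>lborel)
    = (\<integral>\<^sup>+p. \<integral>\<^sup>+x. ennreal (duhamel_kernel a b x p * \<bar>F (fst p) (snd p)\<bar>) \<partial>lborel \<partial>(lborel \<Otimes>\<^sub>M lborel))"
    unfolding duhamel_abs_def by (intro Q.Fubini'[symmetric]) measurable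
  also have "\<dots> \<le> (\<integral>\<^sup>+p. indicator {a<..<b} (fst p) * ennreal \<bar>F (fst p) (snd p)\<bar> \<partial>(lborel \<Otimes>\<^sub>M lborel))"
  proof (rule nn_integral_mono)
    fix p :: "real \<times> real"
    have "(\<integral>\<^sup>+x. ennreal (duhamel_kernel a b x p * \<bar>F (fst p) (snd p)\<bar>) \<partial>lborel)
       = (\<integral>\<^sup>+x. (indicator {a<..<b} (fst p) * ennreal \<bar>F (fst p) (snd p)\<bar>) * ennreal (dirichlet_kernel (b - fst p) x (snd p)) \<partial>lborel)"
      by (intro nn_integral_cong) (auto simp: duhamel_kernel_def ennreal_mult'' mult.commute split: split_indicator)
    also have "\<dots> = (indicator {a<..<b} (fst p) * ennreal \<bar>F (fst p) (snd p)\<bar>) * (\<integral>\<^sup>+x. ennreal (dirichlet_kernel (b - fst p) x (snd p)) \<partial>lborel)"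
      by (rule nn_integral_cmult) measurable
    also have "\<dots> \<le> (indicator {a<..<b} (fst p) * ennreal \<bar>F (fst p) (snd p)\<bar>) * 1"
      by (intro mult_left_mono nn_integral_dirichlet_kernel_le') auto
    finally show "(\<integral>\<^sup>+x. ennreal (duhamel_kernel a b x p * \<bar>F (fst p) (snd p)\<bar>) \<partial>lborel)
       \<le> indicator {a<..<b} (fst p) * ennreal \<bar>F (fst p) (snd p)\<bar>" by simp
  qed
  also have "\<dots> = (\<integral>\<^sup>+s. \<integral>\<^sup>+y. indicator {a<..<b} s * ennreal \<bar>F s y\<bar> \<partial>lborel \<partial>lborel)"
    by (subst lborel.nn_integral_fst[symmetric]) auto
  also have "\<dots> = (\<integral>\<^sup>+s. indicator {a<..<b} s * (\<integral>\<^sup>+y. ennreal \<bar>F s y\<bar> \<partial>lborel) \<partial>lborel)"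
    by (intro nn_integral_cong nn_integral_cmult) measurable
  finally show ?thesis .
qed

lemma measurable_duhamel_abs [measurable (raw)]:
  assumes [measurable]: "case_prod F \<in> borel_measurable (borel \<Otimes>\<^sub>M borel)"
    "a \<in> borel_measurable M" "b \<in> borel_measurable M" "f \<in> borel_measurable M"
  shows "(\<lambda>q. duhamel_abs (a q) (b q) F (f q)) \<in> borel_measurable M"
proof -
  interpret sigma_finite_measure "lborel \<Otimes>\<^sub>M lborel :: (real \<times> real) measure" by (rule sigma_finite_lborel_pair)
  show ?thesis unfolding duhamel_abs_def by measurable
qed

lemma measurable_duhamel [measurable (raw)]:
  assumes [measurable]: "case_prod F \<in> borel_measurable (borel \<Otimes>\<^sub>M borel)"
    "a \<in> borel_measurable M" "b \<in> borel_measurable M" "f \<in> borel_measurable M"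
  shows "(\<lambda>q. duhamel (a q) (b q) F (f q)) \<in> borel_measurable M"
proof -
  interpret sigma_finite_measure "lborel \<Otimes>\<^sub>M lborel :: (real \<times> real) measure" by (rule sigma_finite_lborel_pair)
  show ?thesis unfolding duhamel_def by measurable
qed

lemma integrable_duhamel:
  assumes [measurable]: "case_prod F \<in> borel_measurable (borel \<Otimes>\<^sub>M borel)"
    and fin: "duhamel_abs a b F x < \<infinity>"
  shows "integrable (lborel \<Otimes>\<^sub>M lborel) (\<lambda>p. duhamel_kernel a b x p * F (fst p) (snd p))"
  using fin by (intro integrableI_bounded) (auto simp: duhamel_abs_def abs_mult)

lemma abs_duhamel_le:
  assumes [measurable]: "case_prod F \<in> borel_measurable (borel \<Otimes>\<^sub>M borel)"
    and fin: "duhamel_abs a b F x < \<infinity>"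
  shows "ennreal \<bar>duhamel a b F x\<bar> \<le> duhamel_abs a b F x"
  using integral_norm_bound_ennreal[OF integrable_duhamel[OF assms]]
  by (simp add: duhamel_def duhamel_abs_def abs_mult)

text \<open>\<open>F1\<close> stands for the drift and \<open>F2\<close> for the absorption.
  \<open>F2\<close> is bounded, but nothing is assumed about its integral over the half line; it is
  therefore estimated pointwise, through its sign and size, and never through its L1 norm.\<close>

locale heat_source =
  fixes F1 F2 :: "real \<Rightarrow> real \<Rightarrow> real" and M2 T :: real
  assumes F1 [measurable]: "case_prod F1 \<in> borel_measurable (borel \<Otimes>\<^sub>M borel)"
    and F2 [measurable]: "case_prod F2 \<in> borel_measurable (borel \<Otimes>\<^sub>M borel)"
    and F2_le: "\<And>t y. F2 t y \<le> 0" and F2_ge: "\<And>t y. - M2 \<le> F2 t y"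
    and F1_fin: "(\<integral>\<^sup>+s. indicator {0<..<T} s * (\<integral>\<^sup>+y. ennreal \<bar>F1 s y\<bar> \<partial>lborel) \<partial>lborel) < \<infinity>"
begin

abbreviation "F \<equiv> (\<lambda>t y. F1 t y + F2 t y)"

definition k1 :: "real \<Rightarrow> ennreal" where "k1 s = (\<integral>\<^sup>+y. ennreal \<bar>F1 s y\<bar> \<partial>lborel)"

lemma measurable_k1 [measurable]: "k1 \<in> borel_measurable borel"
  unfolding k1_def by measurable

lemma M2_nonneg: "0 \<le> M2"
  using F2_le[of 0 0] F2_ge[of 0 0] by simp

lemma k1_fin:
  assumes "0 \<le> a" "b \<le> T"
  shows "(\<integral>\<^sup>+s. indicator {a<..<b} s * k1 s \<partial>lborel) < \<infinity>"
  using assms by (intro le_less_trans[OF nn_integral_mono F1_fin]) (auto simp: k1_def split: split_indicator)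

lemma duhamel_abs_F1_fin:
  assumes "0 \<le> a" "b \<le> T"
  shows "AE x in lborel. duhamel_abs a b F1 x < \<infinity>"
proof -
  have "(\<integral>\<^sup>+x. duhamel_abs a b F1 x \<partial>lborel) \<noteq> \<infinity>"
    using nn_integral_duhamel_abs_le[OF F1, of a b] k1_fin[OF assms] by (auto simp: k1_def top_unique)
  from nn_integral_PInf_AE[OF _ this] show ?thesis by (auto simp: less_top)
qed

lemma duhamel_abs_F2: "a \<le> b \<Longrightarrow> duhamel_abs a b F2 x \<le> ennreal (M2 * (b - a))"
  using F2_le F2_ge M2_nonneg by (intro duhamel_abs_bounded[OF F2]) (auto simp: abs_le_iff, smt (verit))

lemma duhamel_abs_F_fin:
  assumes "a \<le> b" "duhamel_abs a b F1 x < \<infinity>"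
  shows "duhamel_abs a b F x < \<infinity>"
proof -
  have "duhamel_abs a b F x \<le> (\<integral>\<^sup>+p. ennreal (duhamel_kernel a b x p * \<bar>F1 (fst p) (snd p)\<bar>) + ennreal (duhamel_kernel a b x p * \<bar>F2 (fst p) (snd p)\<bar>) \<partial>(lborel \<Otimes>\<^sub>M lborel))"
    unfolding duhamel_abs_def
    by (intro nn_integral_mono) (simp add: ennreal_plus[symmetric] distrib_left[symmetric] mult_left_mono del: ennreal_plus)
  also have "\<dots> = duhamel_abs a b F1 x + duhamel_abs a b F2 x"
    unfolding duhamel_abs_def by (rule nn_integral_add) measurable
  also have "\<dots> < \<infinity>"
    using assms duhamel_abs_F2[of a b x] by (auto simp: ennreal_add_less_top le_less_trans)
  finally show ?thesis .
qed

lemma duhamel_F: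
  assumes "a \<le> b" "duhamel_abs a b F1 x < \<infinity>"
  obtains r1 r2 where "duhamel a b F x = r1 + r2" "ennreal \<bar>r1\<bar> \<le> duhamel_abs a b F1 x" "r2 \<le> 0" "- (M2 * (b - a)) \<le> r2"
proof (rule that)
  have fin2: "duhamel_abs a b F2 x < \<infinity>"
    using duhamel_abs_F2[OF assms(1), of x] by (auto simp: le_less_trans)
  show "duhamel a b F x = duhamel a b F1 x + duhamel a b F2 x"
    unfolding duhamel_def distrib_left
    using integrable_duhamel[OF F1 assms(2)] integrable_duhamel[OF F2 fin2] by simp
  show "ennreal \<bar>duhamel a b F1 x\<bar> \<le> duhamel_abs a b F1 x"
    by (rule abs_duhamel_le[OF F1 assms(2)])
  show "duhamel a b F2 x \<le> 0"
  proof -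
    have "0 \<le> (LINT p|(lborel \<Otimes>\<^sub>M lborel). duhamel_kernel a b x p * - F2 (fst p) (snd p))"
      by (intro integral_nonneg_AE AE_I2) (simp add: mult_nonneg_nonpos F2_le)
    then show ?thesis unfolding duhamel_def by simp
  qed
  have "ennreal \<bar>duhamel a b F2 x\<bar> \<le> ennreal (M2 * (b - a))"
    using abs_duhamel_le[OF F2 fin2] duhamel_abs_F2[OF assms(1), of x] by simp
  then show "- (M2 * (b - a)) \<le> duhamel a b F2 x"
    using assms M2_nonneg by (simp add: ennreal_le_iff)
qed

text \<open>Since \<open>V = w + r\<close> gives \<open>V\<^sup>2 \<le> w\<^sup>2 + 2 V r\<close>, no differentiation in time is needed. The
  absorption term \<open>r2 \<le> 0\<close> is only harmful where \<open>V < 0\<close>, and there \<open>V \<ge> - g\<close>.\<close>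

lemma energy_step:
  assumes ab: "0 \<le> a" "a < b" "b \<le> T"
    and [measurable]: "u \<in> borel_measurable borel" "V \<in> borel_measurable borel" "g \<in> borel_measurable borel"
    and u: "AE x in lborel. \<bar>u x\<bar> \<le> C"
    and V: "AE x in lborel. V x = dsg (b - a) u x + duhamel a b F x"
    and V_bd: "AE x in lborel. \<bar>V x\<bar> \<le> \<beta> \<and> - g x \<le> V x" and g0: "\<And>x. 0 \<le> g x"
    and g: "(\<integral>\<^sup>+x. ennreal (g x) \<partial>lborel) \<le> ennreal A" and nn: "0 \<le> \<beta>" "0 \<le> A"
  shows "2 * (\<integral>\<^sup>+x. ennreal ((V x)\<^sup>2) \<partial>lborel) + dirichlet_form (b - a) u
    \<le> 2 * (\<integral>\<^sup>+x. ennreal ((u x)\<^sup>2) \<partial>lborel) + (4 * ennreal \<beta> * (\<integral>\<^sup>+s. indicator {a<..<b} s * k1 s \<partial>lborel) + ennreal (4 * M2 * A * (b - a)))"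
proof -
  let ?w = "dsg (b - a) u"
  have ptw: "AE x in lborel. 2 * ennreal ((V x)\<^sup>2) \<le> 2 * ennreal ((?w x)\<^sup>2) + (4 * ennreal \<beta> * duhamel_abs a b F1 x + ennreal (4 * M2 * (b - a)) * ennreal (g x))"
    using V V_bd duhamel_abs_F1_fin[OF ab(1,3)]
  proof eventually_elim
    case (elim x)
    obtain r1 r2 where r: "duhamel a b F x = r1 + r2" "ennreal \<bar>r1\<bar> \<le> duhamel_abs a b F1 x" "r2 \<le> 0" "- (M2 * (b - a)) \<le> r2"
      using duhamel_F[of a b x] ab elim(3) by auto
    define r where "r = r1 + r2"
    have Vw: "V x = ?w x + r" using elim(1) r(1) by (simp add: r_def)
    have "(V x)\<^sup>2 = (?w x)\<^sup>2 + 2 * V x * r - r\<^sup>2"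
      by (simp add: Vw power2_eq_square algebra_simps)
    also have "\<dots> \<le> (?w x)\<^sup>2 + 2 * (V x * r1) + 2 * (V x * r2)"
      by (simp add: r_def algebra_simps)
    also have "V x * r1 \<le> \<beta> * \<bar>r1\<bar>"
      using mult_mono[of "\<bar>V x\<bar>" \<beta> "\<bar>r1\<bar>" "\<bar>r1\<bar>"] elim(2) nn by (simp add: abs_mult[symmetric])
    also have "V x * r2 \<le> g x * (M2 * (b - a))"
    proof -
      have "V x * r2 \<le> (- g x) * r2" using elim(2) r(3) by (intro mult_right_mono_neg) auto
      also have "\<dots> \<le> g x * (M2 * (b - a))"
        using mult_left_mono[OF r(4) g0[of x]] by (simp add: algebra_simps)
      finally show ?thesis .
    qed
    finally have "2 * (V x)\<^sup>2 \<le> 2 * (?w x)\<^sup>2 + (4 * \<beta> * \<bar>r1\<bar> + 4 * M2 * (b - a) * g x)"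
      by (simp add: algebra_simps)
    then have "ennreal (2 * (V x)\<^sup>2) \<le> ennreal (2 * (?w x)\<^sup>2 + (4 * \<beta> * \<bar>r1\<bar> + 4 * M2 * (b - a) * g x))"
      by (rule ennreal_leI)
    also have "\<dots> = 2 * ennreal ((?w x)\<^sup>2) + (4 * ennreal \<beta> * ennreal \<bar>r1\<bar> + ennreal (4 * M2 * (b - a)) * ennreal (g x))"
      using nn ab M2_nonneg g0[of x] by (simp add: ennreal_plus ennreal_mult)
    also have "\<dots> \<le> 2 * ennreal ((?w x)\<^sup>2) + (4 * ennreal \<beta> * duhamel_abs a b F1 x + ennreal (4 * M2 * (b - a)) * ennreal (g x))"
      by (intro add_mono mult_left_mono r(2)) auto
    finally show ?case by (simp add: ennreal_mult)
  qed
  have "2 * (\<integral>\<^sup>+x. ennreal ((V x)\<^sup>2) \<partial>lborel) = (\<integral>\<^sup>+x. 2 * ennreal ((V x)\<^sup>2) \<partial>lborel)"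
    by (simp add: nn_integral_cmult)
  also have "\<dots> \<le> (\<integral>\<^sup>+x. 2 * ennreal ((?w x)\<^sup>2) + (4 * ennreal \<beta> * duhamel_abs a b F1 x + ennreal (4 * M2 * (b - a)) * ennreal (g x)) \<partial>lborel)"
    by (rule nn_integral_mono_AE[OF ptw])
  also have "\<dots> = 2 * (\<integral>\<^sup>+x. ennreal ((?w x)\<^sup>2) \<partial>lborel) + (4 * ennreal \<beta> * (\<integral>\<^sup>+x. duhamel_abs a b F1 x \<partial>lborel) + ennreal (4 * M2 * (b - a)) * (\<integral>\<^sup>+x. ennreal (g x) \<partial>lborel))"
    by (simp add: nn_integral_add nn_integral_cmult)
  also have "\<dots> \<le> 2 * (\<integral>\<^sup>+x. ennreal ((?w x)\<^sup>2) \<partial>lborel) + (4 * ennreal \<beta> * (\<integral>\<^sup>+s. indicator {a<..<b} s * k1 s \<partial>lborel) + ennreal (4 * M2 * (b - a)) * ennreal A)"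
    unfolding k1_def by (intro add_mono mult_left_mono nn_integral_duhamel_abs_le[OF F1] g order_refl) auto
  also have "ennreal (4 * M2 * (b - a)) * ennreal A = ennreal (4 * M2 * A * (b - a))"
    using nn ab M2_nonneg by (simp add: ennreal_mult[symmetric] ac_simps)
  finally have "2 * (\<integral>\<^sup>+x. ennreal ((V x)\<^sup>2) \<partial>lborel) + dirichlet_form (b - a) u \<le>
    2 * (\<integral>\<^sup>+x. ennreal ((?w x)\<^sup>2) \<partial>lborel) + (4 * ennreal \<beta> * (\<integral>\<^sup>+s. indicator {a<..<b} s * k1 s \<partial>lborel) + ennreal (4 * M2 * A * (b - a))) + dirichlet_form (b - a) u"
    by (rule add_right_mono)
  also have "\<dots> = (2 * (\<integral>\<^sup>+x. ennreal ((?w x)\<^sup>2) \<partial>lborel) + dirichlet_form (b - a) u) + (4 * ennreal \<beta> * (\<integral>\<^sup>+s. indicator {a<..<b} s * k1 s \<partial>lborel) + ennreal (4 * M2 * A * (b - a)))"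
    by (simp add: ac_simps)
  also have "\<dots> \<le> 2 * (\<integral>\<^sup>+x. ennreal ((u x)\<^sup>2) \<partial>lborel) + (4 * ennreal \<beta> * (\<integral>\<^sup>+s. indicator {a<..<b} s * k1 s \<partial>lborel) + ennreal (4 * M2 * A * (b - a)))"
    using ab by (intro add_right_mono dsg_dissipation[OF _ u]) auto
  finally show ?thesis .
qed

section \<open>The mild solution and its restart at a later time\<close>

definition mild :: "(real \<Rightarrow> real) \<Rightarrow> real \<Rightarrow> real \<Rightarrow> real" where
  "mild v0 t x = dsg t v0 x + duhamel 0 t F x"

lemma measurable_mild [measurable]:
  assumes [measurable]: "v0 \<in> borel_measurable borel"
  shows "case_prod (mild v0) \<in> borel_measurable (borel \<Otimes>\<^sub>M borel)"
  unfolding mild_def dsg_def by measurable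

text \<open>By the semigroup law, \<open>dsg (b - a)\<close> turns the kernel of
  \<open>duhamel 0 a\<close> into the part of the kernel of \<open>duhamel 0 b\<close> that belongs
  to times before \<open>a\<close>; the rest is \<open>duhamel a b\<close>. The exceptional
  \<open>x\<close> are those where the Duhamel integral of \<open>F1\<close> up to \<open>b\<close>
  diverges absolutely.\<close>

lemma mild_restart:
  assumes ab: "0 < a" "a < b" "b \<le> T"
    and [measurable]: "v0 \<in> borel_measurable borel" and v0: "\<And>x. \<bar>v0 x\<bar> \<le> C"
  shows "AE x in lborel. mild v0 b x = dsg (b - a) (mild v0 a) x + duhamel a b F x"
proof -
  have F_meas: "case_prod F \<in> borel_measurable (borel \<Otimes>\<^sub>M borel)" by measurable
  have ae: "AE x in lborel. duhamel_abs 0 b F1 x < \<infinity>"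
    using ab by (intro duhamel_abs_F1_fin) auto
  then show ?thesis
  proof eventually_elim
    case (elim x)
    have fin: "duhamel_abs 0 b F x < \<infinity>"
      using ab elim by (intro duhamel_abs_F_fin) auto
    define c where "c p = indicator {0<..<a} (fst p) * dirichlet_kernel (b - fst p) x (snd p)" for p :: "real \<times> real"
    have c_le: "c p \<le> duhamel_kernel 0 b x p" for p
      using ab by (auto simp: c_def duhamel_kernel_def split: split_indicator)
    have c_fin: "(\<integral>\<^sup>+p. ennreal (c p * \<bar>F (fst p) (snd p)\<bar>) \<partial>(lborel \<Otimes>\<^sub>M lborel)) < \<infinity>"
      using fin unfolding duhamel_abs_def
      by (rule le_less_trans[rotated]) (intro nn_integral_mono ennreal_leI mult_right_mono c_le; simp)
    have c_kernel: "(\<integral>\<^sup>+z. ennreal (dirichlet_kernel (b - a) x z * duhamel_kernel 0 a z p) \<partial>lborel) = ennreal (c p)" for p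
    proof (cases "fst p \<in> {0<..<a}")
      case True
      then have "(\<integral>\<^sup>+z. ennreal (dirichlet_kernel (b - a) x z * duhamel_kernel 0 a z p) \<partial>lborel)
        = ennreal (dirichlet_kernel ((b - a) + (a - fst p)) x (snd p))"
        using ab by (subst dirichlet_kernel_semigroup[symmetric]) (auto simp: duhamel_kernel_def)
      then show ?thesis using True by (simp add: c_def)
    qed (simp add: c_def duhamel_kernel_def)
    have Fm: "(\<lambda>p. F (fst p) (snd p)) \<in> borel_measurable (lborel \<Otimes>\<^sub>M lborel)" by measurable
    have km: "(\<lambda>(z, p). duhamel_kernel 0 a z p) \<in> borel_measurable (lborel \<Otimes>\<^sub>M (lborel \<Otimes>\<^sub>M lborel))" by measurable
    note D = dsg_integral_kernel[OF sigma_finite_lborel_pair km Fm duhamel_kernel_nonneg _ c_kernel c_fin]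
    have D1: "dsg (b - a) (\<lambda>z. duhamel 0 a F z) x = (LINT p|(lborel \<Otimes>\<^sub>M lborel). c p * F (fst p) (snd p))"
      and D2: "integrable lborel (\<lambda>z. dirichlet_kernel (b - a) x z * duhamel 0 a F z)"
      unfolding duhamel_def using D by (auto simp: c_def)
    have v_fin: "(\<integral>\<^sup>+p. ennreal (dirichlet_kernel b x p * \<bar>v0 p\<bar>) \<partial>lborel) < \<infinity>"
    proof -
      have "(\<lambda>p. norm (dirichlet_kernel b x p * v0 p)) = (\<lambda>p. dirichlet_kernel b x p * \<bar>v0 p\<bar>)"
        by (auto simp: abs_mult)
      then show ?thesis
        using integrable_dirichlet_kernel_bounded[of v0 C b x] v0
        unfolding integrable_iff_bounded by (simp add: abs_mult)
    qed
    have v_kernel: "(\<integral>\<^sup>+z. ennreal (dirichlet_kernel (b - a) x z * dirichlet_kernel a z p) \<partial>lborel) = ennreal (dirichlet_kernel b x p)" for p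
      using dirichlet_kernel_semigroup[of "b - a" a x p] ab by simp
    have km': "case_prod (dirichlet_kernel a) \<in> borel_measurable (lborel \<Otimes>\<^sub>M lborel)" by measurable
    note E = dsg_integral_kernel[OF lborel.sigma_finite_measure_axioms km' _ dirichlet_kernel_nonneg _ v_kernel v_fin]
    have E1: "dsg (b - a) (dsg a v0) x = dsg b v0 x"
      and E2: "integrable lborel (\<lambda>z. dirichlet_kernel (b - a) x z * dsg a v0 z)"
      using E unfolding dsg_def by (auto simp: dsg_def)
    have "dsg (b - a) (mild v0 a) x = dsg (b - a) (dsg a v0) x + dsg (b - a) (\<lambda>z. duhamel 0 a F z) x"
      using D2 E2 unfolding dsg_def[of "b - a"] mild_def distrib_left by simp
    also have "\<dots> = dsg b v0 x + (LINT p|(lborel \<Otimes>\<^sub>M lborel). c p * F (fst p) (snd p))"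
      by (simp add: D1 E1)
    finally have 1: "dsg (b - a) (mild v0 a) x = dsg b v0 x + (LINT p|(lborel \<Otimes>\<^sub>M lborel). c p * F (fst p) (snd p))" .
    have kab_le: "duhamel_kernel a b x p \<le> duhamel_kernel 0 b x p" for p
      using ab by (auto simp: duhamel_kernel_def split: split_indicator)
    have fin': "duhamel_abs a b F x < \<infinity>"
      using fin unfolding duhamel_abs_def
      by (rule le_less_trans[rotated]) (intro nn_integral_mono ennreal_leI mult_right_mono kab_le; simp)
    have c_int: "integrable (lborel \<Otimes>\<^sub>M lborel) (\<lambda>p. c p * F (fst p) (snd p))"
      using c_fin by (intro integrableI_bounded) (auto simp: abs_mult c_def[abs_def])
    \<comment> \<open>The intervals \<open>(0, a)\<close> and \<open>(a, b)\<close> miss the time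
      \<open>a\<close>, a null set of space-time.\<close>
    have null: "AE p in (lborel \<Otimes>\<^sub>M lborel :: (real \<times> real) measure). fst p \<noteq> a"
    proof (rule lborel_pair.AE_pair_measure)
      have [measurable]: "fst \<in> borel_measurable (lborel \<Otimes>\<^sub>M lborel :: (real \<times> real) measure)" 
         using measurable_fst[of "lborel::real measure" "lborel :: real measure"] by simp
      show "{p \<in> space (lborel \<Otimes>\<^sub>M lborel). fst p \<noteq> a} \<in> sets (lborel \<Otimes>\<^sub>M lborel :: (real \<times> real) measure)"
        by (rule borel_measurable_neq) auto
      show "AE s in lborel. AE y in lborel :: real measure. fst (s, y) \<noteq> a"
        using AE_lborel_singleton[of a] by eventually_elim simp
    qed
    have "duhamel 0 b F x = (LINT p|(lborel \<Otimes>\<^sub>M lborel). c p * F (fst p) (snd p) + duhamel_kernel a b x p * F (fst p) (snd p))"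
      unfolding duhamel_def
    proof (rule integral_cong_AE)
      show "AE p in lborel \<Otimes>\<^sub>M lborel. duhamel_kernel 0 b x p * F (fst p) (snd p) = c p * F (fst p) (snd p) + duhamel_kernel a b x p * F (fst p) (snd p)"
        using null by eventually_elim (use ab in \<open>auto simp: c_def duhamel_kernel_def split: split_indicator\<close>)
    qed (simp_all add: c_def[abs_def])
    also have "\<dots> = (LINT p|(lborel \<Otimes>\<^sub>M lborel). c p * F (fst p) (snd p)) + duhamel a b F x"
      unfolding duhamel_def using c_int integrable_duhamel[OF F_meas fin'] by simp
    finally show ?case by (simp add: 1 mild_def)
  qed
qed

section \<open>Energy and dissipation of the mild solution\<close>

definition remainder :: "real \<Rightarrow> real \<Rightarrow> real \<Rightarrow> real \<Rightarrow> ennreal" where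
  "remainder \<beta> A a b = 4 * ennreal \<beta> * (\<integral>\<^sup>+s. indicator {a<..<b} s * k1 s \<partial>lborel) + ennreal (4 * M2 * A * (b - a))"

lemma remainder_mono:
  assumes "0 \<le> A" "c \<le> a" "b \<le> d" 
  shows "remainder \<beta> A a b \<le> remainder \<beta> A c d"
  unfolding remainder_def using assms M2_nonneg
  by (intro add_mono mult_left_mono nn_integral_mono ennreal_leI) (auto split: split_indicator)

lemma remainder_fin: "0 \<le> a \<Longrightarrow> b \<le> T \<Longrightarrow> remainder \<beta> A a b < \<infinity>"
  using k1_fin[of a b] by (auto simp: remainder_def ennreal_mult_less_top)

definition energy :: "(real \<Rightarrow> real) \<Rightarrow> real \<Rightarrow> ennreal" where
  "energy v0 t = (\<integral>\<^sup>+x. ennreal ((mild v0 t x)\<^sup>2) \<partial>lborel)"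

lemma measurable_energy [measurable]:
  assumes [measurable]: "v0 \<in> borel_measurable borel"
  shows "energy v0 \<in> borel_measurable borel"
  unfolding energy_def by measurable

text \<open>\<open>g\<close> will be the boundary integral \<open>lift\<close>: the full solution
  \<open>g + mild\<close> is nonnegative, which gives the lower bound on
  \<open>mild\<close>.\<close>

context
  fixes v0 :: "real \<Rightarrow> real" and C \<beta> A :: real and g :: "real \<Rightarrow> real \<Rightarrow> real"
  assumes v0_meas [measurable]: "v0 \<in> borel_measurable borel" and v0: "\<And>x. \<bar>v0 x\<bar> \<le> C"
    and g_meas: "\<And>t. g t \<in> borel_measurable borel" and g0: "\<And>t x. 0 \<le> g t x"
    and g_int: "\<And>t. 0 < t \<Longrightarrow> t \<le> T \<Longrightarrow> (\<integral>\<^sup>+x. ennreal (g t x) \<partial>lborel) \<le> ennreal A"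
    and bd: "\<And>t. 0 < t \<Longrightarrow> t \<le> T \<Longrightarrow> AE x in lborel. \<bar>mild v0 t x\<bar> \<le> \<beta> \<and> - g t x \<le> mild v0 t x"
    and nn: "0 \<le> \<beta>" "0 \<le> A"
begin

text \<open>The comparison is with \<open>v0\<close> itself and not with \<open>mild v0 0\<close>,
  which is 0 because \<open>dirichlet_kernel\<close> vanishes at time 0. For this reason the first
  step is separate from \<open>energy_increment\<close>.\<close>

lemma energy_le:
  assumes t: "0 < t" "t \<le> T"
  shows "2 * energy v0 t \<le> 2 * (\<integral>\<^sup>+x. ennreal ((v0 x)\<^sup>2) \<partial>lborel) + remainder \<beta> A 0 t"
proof -
  have "2 * energy v0 t + dirichlet_form (t - 0) v0 \<le> 2 * (\<integral>\<^sup>+x. ennreal ((v0 x)\<^sup>2) \<partial>lborel) + remainder \<beta> A 0 t"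
    unfolding energy_def remainder_def using t v0
    by (intro energy_step[where g = "g t" and C = C] bd g0 g_int nn g_meas) (auto simp: mild_def)
  then show ?thesis by (rule order_trans[rotated]) simp
qed

lemma energy_increment:
  assumes ab: "0 < a" "a < b" "b \<le> T"
  shows "2 * energy v0 b + dirichlet_form (b - a) (mild v0 a) \<le> 2 * energy v0 a + remainder \<beta> A a b"
  unfolding energy_def remainder_def using ab bd[of a]
  by (intro energy_step[where g = "g b" and C = \<beta>] bd g0 g_int nn g_meas mild_restart[OF _ _ _ v0_meas v0]) auto

text \<open>\<open>energy_increment\<close> between \<open>t\<close> and \<open>t + d\<close> is
  integrated over \<open>t\<close>. The energies telescope up to a time interval of length
  \<open>d\<close>, and the averaged remainders also gain a factor \<open>d\<close>, so that the
  bound stays finite after division by \<open>d\<close>.\<close>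

lemma dissipation_le:
  assumes d: "0 < d" "2 * d < T1" "T1 \<le> T" and fin: "(\<integral>\<^sup>+x. ennreal ((v0 x)\<^sup>2) \<partial>lborel) < \<infinity>"
  shows "(\<integral>\<^sup>+t. indicator {0<..<T1 - d} t * dirichlet_form d (mild v0 t) \<partial>lborel)
    \<le> ennreal d * (2 * (\<integral>\<^sup>+x. ennreal ((v0 x)\<^sup>2) \<partial>lborel) + 2 * remainder \<beta> A 0 T1)"
proof -
  define e0 where "e0 = (\<integral>\<^sup>+x. ennreal ((v0 x)\<^sup>2) \<partial>lborel)"
  define D where "D = (\<integral>\<^sup>+t. indicator {0<..<T1 - d} t * dirichlet_form d (mild v0 t) \<partial>lborel)"
  \<comment> \<open>The part common to the energy integral and its shift by \<open>d\<close>. It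
    must be finite in order to be cancelled at the end; \<open>energy_le\<close> and the finite norm
    of \<open>v0\<close> provide that.\<close>
  define X where "X = (\<integral>\<^sup>+t. indicator {d<..<T1 - d} t * (2 * energy v0 t) \<partial>lborel)"
  have [measurable]: "(\<lambda>t. dirichlet_form d (mild v0 t)) \<in> borel_measurable borel"
    unfolding dirichlet_form_def by measurable
  have [measurable]: "(\<lambda>t. remainder \<beta> A t (t + d)) \<in> borel_measurable borel"
    unfolding remainder_def indicator_def greaterThanLessThan_iff by measurable
  have bound: "2 * energy v0 t \<le> 2 * e0 + remainder \<beta> A 0 T1" if "0 < t" "t \<le> T1" for t
    using energy_le[of t] remainder_mono[OF nn(2), of 0 0 t T1 \<beta>] that d unfolding e0_def
    by (meson add_left_mono dual_order.trans order_refl)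
  have R_fin: "2 * e0 + remainder \<beta> A 0 T1 < \<infinity>"
    using fin remainder_fin[of 0 T1] d by (auto simp: e0_def ennreal_mult_less_top)
  have "X \<le> (\<integral>\<^sup>+t. indicator {d<..<T1 - d} t * (2 * e0 + remainder \<beta> A 0 T1) \<partial>lborel)"
    unfolding X_def
  proof (rule nn_integral_mono)
    show "indicator {d<..<T1 - d} t * (2 * energy v0 t) \<le> indicator {d<..<T1 - d} t * (2 * e0 + remainder \<beta> A 0 T1)" for t
    proof (cases "t \<in> {d<..<T1 - d}")
      case True
      then have "2 * energy v0 t \<le> 2 * e0 + remainder \<beta> A 0 T1" using bound d by auto
      then show ?thesis by (rule mult_left_mono) simp
    qed simp
  qed
  also have "\<dots> < \<infinity>"
    using d R_fin by (simp add: nn_integral_multc ennreal_mult_less_top)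
  finally have X_fin: "X < \<infinity>" .
  \<comment> \<open>A given time \<open>s\<close> lies in \<open>(t, t + d)\<close> only for
    \<open>t\<close> in an interval of length \<open>d\<close>, so Fubini's theorem yields the
    factor \<open>d\<close>.\<close>
  have Rint: "(\<integral>\<^sup>+t. indicator {0<..<T1 - d} t * remainder \<beta> A t (t + d) \<partial>lborel) \<le> ennreal d * remainder \<beta> A 0 T1"
  proof -
    have "(\<integral>\<^sup>+t. \<integral>\<^sup>+s. indicator {0<..<T1 - d} t * indicator {t<..<t + d} s * k1 s \<partial>lborel \<partial>lborel)
       = (\<integral>\<^sup>+s. \<integral>\<^sup>+t. indicator {0<..<T1 - d} t * indicator {t<..<t + d} s * k1 s \<partial>lborel \<partial>lborel)"
      unfolding indicator_def greaterThanLessThan_iff by (intro lborel_pair.Fubini') measurable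
    also have "\<dots> \<le> (\<integral>\<^sup>+s. \<integral>\<^sup>+t. indicator {s - d<..<s} t * (indicator {0<..<T1} s * k1 s) \<partial>lborel \<partial>lborel)"
    proof (intro nn_integral_mono)
      fix s t
      have "indicator {0<..<T1 - d} t * indicator {t<..<t + d} s \<le> (indicator {s - d<..<s} t * indicator {0<..<T1} s :: ennreal)"
        by (simp split: split_indicator)
      then show "indicator {0<..<T1 - d} t * indicator {t<..<t + d} s * k1 s \<le> indicator {s - d<..<s} t * (indicator {0<..<T1} s * k1 s)"
        unfolding mult.assoc[symmetric] by (rule mult_right_mono) simp
    qed
    also have "\<dots> = ennreal d * (\<integral>\<^sup>+s. indicator {0<..<T1} s * k1 s \<partial>lborel)"
      using d by (simp add: nn_integral_multc nn_integral_cmult)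
    finally have P: "(\<integral>\<^sup>+t. \<integral>\<^sup>+s. indicator {0<..<T1 - d} t * indicator {t<..<t + d} s * k1 s \<partial>lborel \<partial>lborel)
       \<le> ennreal d * (\<integral>\<^sup>+s. indicator {0<..<T1} s * k1 s \<partial>lborel)" .
    have "(\<integral>\<^sup>+t. indicator {0<..<T1 - d} t * remainder \<beta> A t (t + d) \<partial>lborel)
      = (\<integral>\<^sup>+t. 4 * ennreal \<beta> * (\<integral>\<^sup>+s. indicator {0<..<T1 - d} t * indicator {t<..<t + d} s * k1 s \<partial>lborel) + ennreal (4 * M2 * A * d) * indicator {0<..<T1 - d} t \<partial>lborel)"
      by (intro nn_integral_cong) (auto simp: remainder_def split: split_indicator)
    also have "\<dots> = 4 * ennreal \<beta> * (\<integral>\<^sup>+t. \<integral>\<^sup>+s. indicator {0<..<T1 - d} t * indicator {t<..<t + d} s * k1 s \<partial>lborel \<partial>lborel) + ennreal (4 * M2 * A * d) * ennreal (T1 - d)"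
      using d unfolding indicator_def[of "{t<..<t + d}" for t] greaterThanLessThan_iff 
      by (subst nn_integral_add) (simp_all add: nn_integral_cmult)
    also have "\<dots> \<le> ennreal d * (4 * ennreal \<beta> * (\<integral>\<^sup>+s. indicator {0<..<T1} s * k1 s \<partial>lborel)) + ennreal d * ennreal (4 * M2 * A * (T1 - 0))"
    proof (intro add_mono)
      have "4 * M2 * A * d * (T1 - d) \<le> d * (4 * M2 * A * T1)"
        using d nn M2_nonneg by (simp add: algebra_simps)
      then show "ennreal (4 * M2 * A * d) * ennreal (T1 - d) \<le> ennreal d * ennreal (4 * M2 * A * (T1 - 0))"
        using d nn M2_nonneg by (simp add: ennreal_mult[symmetric] ennreal_leI)
    next
      have "4 * ennreal \<beta> * (\<integral>\<^sup>+t. \<integral>\<^sup>+s. indicator {0<..<T1 - d} t * indicator {t<..<t + d} s * k1 s \<partial>lborel \<partial>lborel)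
        \<le> 4 * ennreal \<beta> * (ennreal d * (\<integral>\<^sup>+s. indicator {0<..<T1} s * k1 s \<partial>lborel))"
        by (rule mult_left_mono[OF P]) simp
      then show "4 * ennreal \<beta> * (\<integral>\<^sup>+t. \<integral>\<^sup>+s. indicator {0<..<T1 - d} t * indicator {t<..<t + d} s * k1 s \<partial>lborel \<partial>lborel)
        \<le> ennreal d * (4 * ennreal \<beta> * (\<integral>\<^sup>+s. indicator {0<..<T1} s * k1 s \<partial>lborel))"
        by (simp add: ac_simps)
    qed
    finally show ?thesis
      by (simp add: remainder_def distrib_left mult_left_mono add_mono)
  qed
  have "X + D \<le> (\<integral>\<^sup>+t. indicator {d<..<T1} t * (2 * energy v0 t) \<partial>lborel) + D"
    unfolding X_def using d by (intro add_right_mono nn_integral_mono mult_right_mono) (auto split: split_indicator)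
  also have "(\<integral>\<^sup>+t. indicator {d<..<T1} t * (2 * energy v0 t) \<partial>lborel) = (\<integral>\<^sup>+t. indicator {d<..<T1} (t + d) * (2 * energy v0 (t + d)) \<partial>lborel)"
    by (rule nn_integral_shift[symmetric]) measurable
  also have "\<dots> = (\<integral>\<^sup>+t. indicator {0<..<T1 - d} t * (2 * energy v0 (t + d)) \<partial>lborel)"
    by (intro nn_integral_cong) (auto split: split_indicator)
  also have "\<dots> + D = (\<integral>\<^sup>+t. indicator {0<..<T1 - d} t * (2 * energy v0 (t + d)) + indicator {0<..<T1 - d} t * dirichlet_form d (mild v0 t) \<partial>lborel)"
    unfolding D_def by (rule nn_integral_add[symmetric]) measurable
  also have "\<dots> \<le> (\<integral>\<^sup>+t. indicator {0<..<T1 - d} t * (2 * energy v0 t) + indicator {0<..<T1 - d} t * remainder \<beta> A t (t + d) \<partial>lborel)"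
  proof (intro nn_integral_mono)
    fix t show "indicator {0<..<T1 - d} t * (2 * energy v0 (t + d)) + indicator {0<..<T1 - d} t * dirichlet_form d (mild v0 t)
       \<le> indicator {0<..<T1 - d} t * (2 * energy v0 t) + indicator {0<..<T1 - d} t * remainder \<beta> A t (t + d)"
    proof (cases "t \<in> {0<..<T1 - d}")
      case True
      then show ?thesis using energy_increment[of t "t + d"] d by simp
    qed simp
  qed
  also have "\<dots> = (\<integral>\<^sup>+t. indicator {0<..<T1 - d} t * (2 * energy v0 t) \<partial>lborel) + (\<integral>\<^sup>+t. indicator {0<..<T1 - d} t * remainder \<beta> A t (t + d) \<partial>lborel)"
    by (rule nn_integral_add) measurable
  \<comment> \<open>What is left after cancelling \<open>X\<close> is the energy on
    \<open>(0, d]\<close>, at most \<open>d\<close> times its uniform bound.\<close>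
  also have "\<dots> \<le> (X + ennreal d * (2 * e0 + remainder \<beta> A 0 T1)) + ennreal d * remainder \<beta> A 0 T1"
  proof (rule add_mono[OF _ Rint])
    have "(\<integral>\<^sup>+t. indicator {0<..<T1 - d} t * (2 * energy v0 t) \<partial>lborel) 
      \<le> (\<integral>\<^sup>+t. indicator {d<..<T1 - d} t * (2 * energy v0 t) + indicator {0<..d} t * (2 * e0 + remainder \<beta> A 0 T1) \<partial>lborel)"
    proof (rule nn_integral_mono)
      show "indicator {0<..<T1 - d} t * (2 * energy v0 t) \<le> indicator {d<..<T1 - d} t * (2 * energy v0 t) + indicator {0<..d} t * (2 * e0 + remainder \<beta> A 0 T1)" for t
      proof (cases "t \<in> {0<..d}")
        case True
        then have "2 * energy v0 t \<le> 2 * e0 + remainder \<beta> A 0 T1" using bound d by auto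
        then show ?thesis using True by (simp split: split_indicator)
      qed (auto split: split_indicator)
    qed
    also have "\<dots> = X + (\<integral>\<^sup>+t. indicator {0<..d} t * (2 * e0 + remainder \<beta> A 0 T1) \<partial>lborel)"
      unfolding X_def by (rule nn_integral_add) measurable
    also have "\<dots> = X + ennreal d * (2 * e0 + remainder \<beta> A 0 T1)"
      using d by (simp add: nn_integral_multc)
    finally show "(\<integral>\<^sup>+t. indicator {0<..<T1 - d} t * (2 * energy v0 t) \<partial>lborel) \<le> X + ennreal d * (2 * e0 + remainder \<beta> A 0 T1)" .
  qed
  also have "\<dots> = X + ennreal d * (2 * e0 + 2 * remainder \<beta> A 0 T1)"
    by (simp add: distrib_left mult_2 ac_simps)
  finally have "X + D \<le> X + ennreal d * (2 * e0 + 2 * remainder \<beta> A 0 T1)" .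
  then show ?thesis
    using X_fin by (auto simp: ennreal_add_left_cancel_le D_def e0_def)
qed

end

end

subsection \<open>Primitives of locally integrable functions\<close>

text \<open>Local absolute continuity of \<open>f\<close> on the open half line, with derivative
  \<open>h\<close>. Weak derivatives are handled in this form throughout.\<close>

definition primitive_of :: "(real \<Rightarrow> real) \<Rightarrow> (real \<Rightarrow> real) \<Rightarrow> bool" where
  "primitive_of f h \<longleftrightarrow> (\<forall>a b. 0 < a \<and> a \<le> b \<longrightarrow>
     h absolutely_integrable_on {a..b} \<and> f b - f a = integral {a..b} h)"

lemma primitive_ofD:
  assumes "primitive_of f h" "0 < a" "a \<le> b"
  shows "h absolutely_integrable_on {a..b}" "h integrable_on {a..b}" "f b - f a = integral {a..b} h"
  using assms set_lebesgue_integral_eq_integral(1) unfolding primitive_of_def by blast+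

lemma primitive_of_abs_le:
  assumes "primitive_of f h" "0 < a" "a \<le> b"
  shows "\<bar>f b - f a\<bar> \<le> integral {a..b} (\<lambda>x. \<bar>h x\<bar>)"
  using primitive_ofD[OF assms] absolutely_integrable_on_def
  by (metis (mono_tags, lifting) absolutely_integrable_on_def integral_norm_bound_integral norm_ge_zero order_refl real_norm_def
      set_integral_norm_bound abs_le_self_iff integral_cong)

text \<open>The Lebesgue differentiation theorem of the library requires integrability on every interval,
  hence the truncations of \<open>h\<close> to \<open>[1/n, n]\<close>.\<close>

lemma primitive_of_AE_has_derivative:
  assumes f: "primitive_of f h"
  shows "AE x in lebesgue. 0 < x \<longrightarrow> ((\<lambda>d. (f (x + d) - f x) / d) \<longlongrightarrow> h x) (at_right 0)"
proof -
  define hn where "hn n x = (if x \<in> {1 / Suc n..Suc n} then h x else 0)" for n :: nat and x :: real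
  have int: "hn n integrable_on cbox a b" for n a b
  proof -
    have "h integrable_on {1 / Suc n..Suc n} \<inter> {a..b}"
    proof (cases "max (1 / Suc n) a \<le> min (Suc n) b")
      case True
      have "0 < max (1 / real (Suc n)) a" by (simp add: max.strict_coboundedI1)
      from primitive_ofD(2)[OF f this True] show ?thesis by (simp only: Int_atLeastAtMost)
    qed (simp only: Int_atLeastAtMost atLeastatMost_empty not_le integrable_on_empty)
    then show ?thesis unfolding hn_def integrable_restrict_Int by (simp add: Int_commute)
  qed
  have "\<exists>N. \<forall>n. negligible (N n) \<and> (\<forall>x e. x \<notin> N n \<longrightarrow> 0 < e \<longrightarrow>
      (\<exists>d>0. \<forall>d'. 0 < d' \<and> d' < d \<longrightarrow> norm (integral (cbox x (x + d' *\<^sub>R One)) (hn n) /\<^sub>R d' ^ DIM(real) - hn n x) < e))"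
    using integrable_ccontinuous_explicit[OF int] by (intro choice) metis
  then obtain N where N: "\<And>n :: nat. negligible (N n)"
    and diff: "\<And>n x e. x \<notin> N n \<Longrightarrow> 0 < e \<Longrightarrow>
      (\<exists>d>0. \<forall>d'. 0 < d' \<and> d' < d \<longrightarrow> norm (integral (cbox x (x + d' *\<^sub>R One)) (hn n) /\<^sub>R d' ^ DIM(real) - hn n x) < e)"
    by metis
  have "negligible (\<Union>n. N n)" using N by (rule negligible_Union_nat)
  then have "AE x in lebesgue. x \<notin> (\<Union>n. N n)"
    by (intro AE_not_in) (simp add: negligible_iff_null_sets)
  then show ?thesis
  proof eventually_elim
    case (elim x)
    show ?case
    proof (intro impI tendstoI)
      fix e :: real assume "0 < x" "0 < e"
      obtain n1 where "1 / x < Suc n1" using reals_Archimedean2[of "1 / x"] by (metis less_trans lessI of_nat_less_iff)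
      obtain n2 where "x < Suc n2" using reals_Archimedean2[of x] by (metis less_trans lessI of_nat_less_iff)
      define n where "n = max n1 n2"
      have "1 / x < Suc n" "x < Suc n" using \<open>1 / x < Suc n1\<close> \<open>x < Suc n2\<close> by (auto simp: n_def)
      then have n: "1 / Suc n < x" "x < Suc n" using \<open>0 < x\<close> by (auto simp: field_simps)
      obtain d where d: "d > 0" "\<And>d'. 0 < d' \<Longrightarrow> d' < d \<Longrightarrow> norm (integral (cbox x (x + d' *\<^sub>R One)) (hn n) /\<^sub>R d' ^ DIM(real) - hn n x) < e"
        using diff[of x n e] elim \<open>0 < e\<close> by blast
      have "dist ((f (x + d') - f x) / d') (h x) < e" if d': "0 < d'" "d' < min d (Suc n - x)" for d'
      proof -
        have "integral {x..x + d'} (hn n) = integral {x..x + d'} h"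
          using n d' by (intro Henstock_Kurzweil_Integration.integral_cong) (auto simp: hn_def)
        moreover have "hn n x = h x" using n by (simp add: hn_def)
        moreover have "integral {x..x + d'} h = f (x + d') - f x"
          using primitive_ofD(3)[OF f, of x "x + d'"] \<open>0 < x\<close> d' by simp
        ultimately show ?thesis using d(2)[of d'] d' by (simp add: dist_norm divide_inverse_commute)
      qed
      moreover have "eventually (\<lambda>d'. d' < min d (Suc n - x)) (at_right 0)"
        using d n by (intro eventually_at_rightI[of 0 "min d (Suc n - x)"]) auto
      ultimately show "eventually (\<lambda>d'. dist ((f (x + d') - f x) / d') (h x) < e) (at_right 0)"
        using eventually_at_right_less[of 0] by (auto elim: eventually_elim2)
    qed
  qed
qed

text \<open>Along a sequence only countably many null sets arise from translating the argument, and
  the limits are measurable; both are used for representatives.\<close>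

lemma primitive_of_AE_difference_quotient:
  assumes "primitive_of f h"
  shows "AE x in lebesgue. 0 < x \<longrightarrow> (\<lambda>n. real (Suc n) * (f (x + 1 / Suc n) - f x)) \<longlonglongrightarrow> h x"
  using primitive_of_AE_has_derivative[OF assms]
proof eventually_elim
  case (elim x)
  have "filterlim (\<lambda>n. 1 / real (Suc n)) (at_right 0) sequentially"
    using LIMSEQ_inverse_real_of_nat by (intro tendsto_imp_filterlim_at_right) (auto simp: divide_inverse)
  from filterlim_compose[OF _ this, of "\<lambda>d. (f (x + d) - f x) / d" "nhds (h x)"] elim
  show ?case by (auto simp: divide_inverse mult.commute)
qed

text \<open>Let \<open>E\<close> be the value of \<open>\<Phi>\<close> along the curve minus the
  primitive of the expected derivative. On short intervals its increment is at most
  \<open>2 * e\<close> times the integral of \<open>\<bar>h1\<bar> + \<bar>h2\<bar>\<close>;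
  bisection extends this to the whole interval, and \<open>e\<close> is arbitrary, so
  \<open>E\<close> is constant. Derivatives are taken within \<open>S\<close>, so that
  \<open>S\<close> may be a closed set.\<close>

lemma primitive_of_chain2:
  fixes \<Phi> :: "real \<times> real \<Rightarrow> real"
  assumes f1: "primitive_of f1 h1" and f2: "primitive_of f2 h2"
    and S: "\<And>x. 0 < x \<Longrightarrow> (f1 x, f2 x) \<in> S"
    and deriv: "\<And>p. p \<in> S \<Longrightarrow> (\<Phi> has_derivative (\<lambda>q. D1 p * fst q + D2 p * snd q)) (at p within S)"
    and cont: "continuous_on S D1" "continuous_on S D2"
  shows "primitive_of (\<lambda>x. \<Phi> (f1 x, f2 x)) (\<lambda>x. D1 (f1 x, f2 x) * h1 x + D2 (f1 x, f2 x) * h2 x)"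
  unfolding primitive_of_def
proof (intro allI impI)
  fix a b :: real assume ab: "0 < a \<and> a \<le> b"
  define \<gamma> where "\<gamma> x = (f1 x, f2 x)" for x
  have cont_prim: "continuous_on {a..b} f" if "primitive_of f h" for f h
  proof -
    have "continuous_on {a..b} (\<lambda>x. f a + integral {a..x} h)"
      using primitive_ofD[OF that, of a b] ab by (intro continuous_intros indefinite_integral_continuous_1) auto
    moreover have "f a + integral {a..x} h = f x" if "x \<in> {a..b}" for x
      using primitive_ofD(3)[OF \<open>primitive_of f h\<close>, of a x] that ab by auto
    ultimately show ?thesis by (rule continuous_on_eq)
  qed
  have c\<gamma>: "continuous_on {a..b} \<gamma>" unfolding \<gamma>_def using f1 f2 by (intro continuous_intros cont_prim)
  have \<gamma>S: "\<gamma> x \<in> S" if "x \<in> {a..b}" for x using S[of x] ab that by (auto simp: \<gamma>_def)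
  define h where "h x = D1 (\<gamma> x) * h1 x + D2 (\<gamma> x) * h2 x" for x
  define H where "H x = \<bar>h1 x\<bar> + \<bar>h2 x\<bar>" for x
  have cD: "continuous_on {a..b} (\<lambda>x. D1 (\<gamma> x))" "continuous_on {a..b} (\<lambda>x. D2 (\<gamma> x))"
    using \<gamma>S by (auto intro!: continuous_on_compose2[OF cont(1) c\<gamma>] continuous_on_compose2[OF cont(2) c\<gamma>])
  have prod_ai: "(\<lambda>x. D (\<gamma> x) * k x) absolutely_integrable_on {a..b}"
    if "continuous_on {a..b} (\<lambda>x. D (\<gamma> x))" "k absolutely_integrable_on {a..b}" for D :: "real \<times> real \<Rightarrow> real" and k
  proof (rule absolutely_integrable_bounded_measurable_product_real[OF _ _ _ that(2)])
    show "(\<lambda>x. D (\<gamma> x)) \<in> borel_measurable (lebesgue_on {a..b})"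
      using that(1) by (rule continuous_imp_measurable_on_sets_lebesgue) auto
    show "bounded ((\<lambda>x. D (\<gamma> x)) ` {a..b})"
      by (intro compact_imp_bounded compact_continuous_image that(1)) auto
  qed auto
  have h_ai: "h absolutely_integrable_on {a..b}"
    unfolding h_def using primitive_ofD(1)[OF f1] primitive_ofD(1)[OF f2] ab
    by (intro set_integral_add prod_ai cD) auto
  have H_ai: "H absolutely_integrable_on {a..b}"
    unfolding H_def using primitive_ofD(1)[OF f1, of a b] primitive_ofD(1)[OF f2, of a b] ab
    by (intro set_integral_add set_integrable_abs) auto
  have sub: "h integrable_on {u..v}" "H integrable_on {u..v}" "h1 integrable_on {u..v}" "h2 integrable_on {u..v}"
    "(\<lambda>x. \<bar>h1 x\<bar>) integrable_on {u..v}" "(\<lambda>x. \<bar>h2 x\<bar>) integrable_on {u..v}"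
    if "a \<le> u" "v \<le> b" for u v
  proof -
    have s: "{u..v} \<subseteq> {a..b}" using that by auto
    show "h integrable_on {u..v}" "H integrable_on {u..v}"
      using h_ai H_ai s integrable_on_subinterval set_lebesgue_integral_eq_integral(1) by blast+
    show "h1 integrable_on {u..v}" "h2 integrable_on {u..v}"
      using primitive_ofD(2)[OF f1, of a b] primitive_ofD(2)[OF f2, of a b] ab s by (auto intro: integrable_on_subinterval)
    show "(\<lambda>x. \<bar>h1 x\<bar>) integrable_on {u..v}" "(\<lambda>x. \<bar>h2 x\<bar>) integrable_on {u..v}"
      using primitive_ofD(1)[OF f1, of a b] primitive_ofD(1)[OF f2, of a b] ab s
      by (auto intro: integrable_on_subinterval simp: absolutely_integrable_on_def)
  qed
  define E where "E x = \<Phi> (\<gamma> x) - integral {a..x} h" for x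
  \<comment> \<open>One \<open>e\<close> pays for the linearisation of \<open>\<Phi>\<close> at
    \<open>x\<close>, the other for replacing \<open>D1\<close> and \<open>D2\<close> along the
    curve by their values at \<open>x\<close>. Differentiability is used only at an end point
    \<open>x\<close>, hence the split of an interval around \<open>x\<close> below.\<close>
  have small: "\<bar>E v - E u\<bar> \<le> 2 * e * integral {u..v} H"
    if e: "e > 0" and uv: "a \<le> u" "u \<le> v" "v \<le> b" and x: "x = u \<or> x = v"
    and D: "\<And>y. y \<in> {u..v} \<Longrightarrow> \<bar>D1 (\<gamma> y) - D1 (\<gamma> x)\<bar> \<le> e \<and> \<bar>D2 (\<gamma> y) - D2 (\<gamma> x)\<bar> \<le> e"
    and \<Phi>: "\<And>y. y \<in> {u..v} \<Longrightarrow> \<bar>\<Phi> (\<gamma> y) - \<Phi> (\<gamma> x) - (D1 (\<gamma> x) * (f1 y - f1 x) + D2 (\<gamma> x) * (f2 y - f2 x))\<bar> \<le> e * (\<bar>f1 y - f1 x\<bar> + \<bar>f2 y - f2 x\<bar>)"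
    for e u v x
  proof -
    have Hint: "integral {u..v} H = integral {u..v} (\<lambda>x. \<bar>h1 x\<bar>) + integral {u..v} (\<lambda>x. \<bar>h2 x\<bar>)"
      unfolding H_def using sub uv by (intro Henstock_Kurzweil_Integration.integral_add) auto
    have f_le: "\<bar>f1 v - f1 u\<bar> + \<bar>f2 v - f2 u\<bar> \<le> integral {u..v} H"
      unfolding Hint using primitive_of_abs_le[OF f1, of u v] primitive_of_abs_le[OF f2, of u v] ab uv by auto
    have Eeq: "E v - E u = \<Phi> (\<gamma> v) - \<Phi> (\<gamma> u) - integral {u..v} h"
      using Henstock_Kurzweil_Integration.integral_combine[OF uv(1,2) sub(1)[OF order_refl uv(3)]] by (simp add: E_def)
    have f1v: "f1 v - f1 u = integral {u..v} h1" and f2v: "f2 v - f2 u = integral {u..v} h2"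
      using primitive_ofD(3)[OF f1, of u v] primitive_ofD(3)[OF f2, of u v] ab uv by auto
    define d1 d2 where "d1 = D1 (\<gamma> x)" and "d2 = D2 (\<gamma> x)"
    have lin: "d1 * (f1 v - f1 u) + d2 * (f2 v - f2 u) = integral {u..v} (\<lambda>y. d1 * h1 y + d2 * h2 y)"
      unfolding f1v f2v using sub uv by (subst Henstock_Kurzweil_Integration.integral_add) (auto intro!: integrable_on_mult_right)
    have "\<bar>\<Phi> (\<gamma> v) - \<Phi> (\<gamma> u) - (d1 * (f1 v - f1 u) + d2 * (f2 v - f2 u))\<bar> \<le> e * (\<bar>f1 v - f1 u\<bar> + \<bar>f2 v - f2 u\<bar>)"
      using x
    proof
      assume "x = u" then show ?thesis using \<Phi>[of v] uv by (simp add: d1_def d2_def)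
    next
      assume "x = v"
      have "\<Phi> (\<gamma> v) - \<Phi> (\<gamma> u) - (d1 * (f1 v - f1 u) + d2 * (f2 v - f2 u)) = - (\<Phi> (\<gamma> u) - \<Phi> (\<gamma> v) - (d1 * (f1 u - f1 v) + d2 * (f2 u - f2 v)))"
        by (simp add: algebra_simps)
      then show ?thesis using \<Phi>[of u] uv \<open>x = v\<close> by (simp add: d1_def d2_def abs_minus_commute)
    qed
    also have "\<dots> \<le> e * integral {u..v} H" using f_le e by (intro mult_left_mono) auto
    finally have 1: "\<bar>\<Phi> (\<gamma> v) - \<Phi> (\<gamma> u) - integral {u..v} (\<lambda>y. d1 * h1 y + d2 * h2 y)\<bar> \<le> e * integral {u..v} H"
      unfolding lin .
    have "\<bar>integral {u..v} (\<lambda>y. d1 * h1 y + d2 * h2 y) - integral {u..v} h\<bar>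
        = \<bar>integral {u..v} (\<lambda>y. (d1 * h1 y + d2 * h2 y) - h y)\<bar>"
      using sub uv by (subst Henstock_Kurzweil_Integration.integral_diff) (auto intro!: integrable_on_mult_right integrable_add)
    also have "\<dots> \<le> integral {u..v} (\<lambda>y. e * H y)"
      unfolding real_norm_def[symmetric]
    proof (rule integral_norm_bound_integral)
      show "(\<lambda>y. (d1 * h1 y + d2 * h2 y) - h y) integrable_on {u..v}"
        using sub uv by (intro integrable_diff integrable_add integrable_on_mult_right) auto
      show "(\<lambda>y. e * H y) integrable_on {u..v}"
        using sub uv by (intro integrable_on_mult_right) auto
      fix y assume y: "y \<in> {u..v}"
      have "norm (d1 * h1 y + d2 * h2 y - h y) = \<bar>(D1 (\<gamma> y) - d1) * h1 y + (D2 (\<gamma> y) - d2) * h2 y\<bar>"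
        by (simp add: h_def algebra_simps abs_minus_commute)
      also have "\<dots> \<le> \<bar>D1 (\<gamma> y) - d1\<bar> * \<bar>h1 y\<bar> + \<bar>D2 (\<gamma> y) - d2\<bar> * \<bar>h2 y\<bar>"
        by (metis abs_mult abs_triangle_ineq)
      also have "\<dots> \<le> e * \<bar>h1 y\<bar> + e * \<bar>h2 y\<bar>"
        using D[OF y] by (intro add_mono mult_right_mono) (auto simp: d1_def d2_def)
      finally show "norm (d1 * h1 y + d2 * h2 y - h y) \<le> e * H y"
        by (simp add: H_def distrib_left)
    qed
    also have "\<dots> = e * integral {u..v} H" by simp
    finally show ?thesis using 1 Eeq by linarith
  qed
  have main: "\<bar>E b - E a\<bar> \<le> 2 * e * integral {a..b} H" if e: "e > 0" for e
  proof -
    have "a \<le> a \<and> b \<le> b \<longrightarrow> \<bar>E b - E a\<bar> \<le> 2 * e * integral {a..b} H"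
    \<comment> \<open>The estimate passes to adjacent intervals because the integral of
      \<open>H\<close> is additive. The guard \<open>a \<le> u \<and> v \<le> b\<close> is needed
      since the intervals around a point may leave \<open>[a, b]\<close>.\<close>
    proof (rule Bolzano[where P = "\<lambda>u v. a \<le> u \<and> v \<le> b \<longrightarrow> \<bar>E v - E u\<bar> \<le> 2 * e * integral {u..v} H"])
      show "a \<le> b" using ab by simp
    next
      fix u v w assume *: "a \<le> u \<and> v \<le> b \<longrightarrow> \<bar>E v - E u\<bar> \<le> 2 * e * integral {u..v} H"
        "a \<le> v \<and> w \<le> b \<longrightarrow> \<bar>E w - E v\<bar> \<le> 2 * e * integral {v..w} H" "u \<le> v" "v \<le> w"
      show "a \<le> u \<and> w \<le> b \<longrightarrow> \<bar>E w - E u\<bar> \<le> 2 * e * integral {u..w} H"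
      proof
        assume uw: "a \<le> u \<and> w \<le> b"
        have "integral {u..w} H = integral {u..v} H + integral {v..w} H"
          using Henstock_Kurzweil_Integration.integral_combine[OF *(3,4) sub(2)] uw by auto
        then show "\<bar>E w - E u\<bar> \<le> 2 * e * integral {u..w} H"
          using * uw by (auto simp: distrib_left)
      qed
    next
      fix x assume x: "a \<le> x" "x \<le> b"
      have "\<exists>d>0. \<forall>p\<in>S. norm (p - \<gamma> x) < d \<longrightarrow> norm (\<Phi> p - \<Phi> (\<gamma> x) - (D1 (\<gamma> x) * fst (p - \<gamma> x) + D2 (\<gamma> x) * snd (p - \<gamma> x))) \<le> e * norm (p - \<gamma> x)"
        using deriv[OF \<gamma>S, of x] x e unfolding has_derivative_within_alt by auto
      then obtain d1 where d1: "d1 > 0" "\<And>p. p \<in> S \<Longrightarrow> norm (p - \<gamma> x) < d1 \<Longrightarrow>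
         norm (\<Phi> p - \<Phi> (\<gamma> x) - (D1 (\<gamma> x) * fst (p - \<gamma> x) + D2 (\<gamma> x) * snd (p - \<gamma> x))) \<le> e * norm (p - \<gamma> x)" by blast
      have ev: "eventually (\<lambda>y. dist (\<gamma> y) (\<gamma> x) < d1 \<and> dist (D1 (\<gamma> y)) (D1 (\<gamma> x)) < e \<and> dist (D2 (\<gamma> y)) (D2 (\<gamma> x)) < e) (at x within {a..b})"
        using c\<gamma> cD x d1 e unfolding continuous_on_def by (intro eventually_conj tendstoD) auto
      then obtain d where d: "d > 0" "\<And>y. y \<in> {a..b} \<Longrightarrow> dist y x < d \<Longrightarrow> y \<noteq> x \<Longrightarrow>
         dist (\<gamma> y) (\<gamma> x) < d1 \<and> dist (D1 (\<gamma> y)) (D1 (\<gamma> x)) < e \<and> dist (D2 (\<gamma> y)) (D2 (\<gamma> x)) < e"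
        unfolding eventually_at by blast
      have near: "\<bar>D1 (\<gamma> y) - D1 (\<gamma> x)\<bar> \<le> e \<and> \<bar>D2 (\<gamma> y) - D2 (\<gamma> x)\<bar> \<le> e \<and>
         \<bar>\<Phi> (\<gamma> y) - \<Phi> (\<gamma> x) - (D1 (\<gamma> x) * (f1 y - f1 x) + D2 (\<gamma> x) * (f2 y - f2 x))\<bar> \<le> e * (\<bar>f1 y - f1 x\<bar> + \<bar>f2 y - f2 x\<bar>)"
        if y: "y \<in> {a..b}" "dist y x < d" for y
      proof (cases "y = x")
        case False
        note n = d(2)[OF y False]
        have "\<bar>\<Phi> (\<gamma> y) - \<Phi> (\<gamma> x) - (D1 (\<gamma> x) * (f1 y - f1 x) + D2 (\<gamma> x) * (f2 y - f2 x))\<bar> \<le> e * norm (\<gamma> y - \<gamma> x)"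
          using d1(2)[OF \<gamma>S[OF y(1)]] n by (auto simp: dist_norm \<gamma>_def)
        also have "\<dots> \<le> e * (\<bar>f1 y - f1 x\<bar> + \<bar>f2 y - f2 x\<bar>)"
          using e norm_Pair_le[of "f1 y - f1 x" "f2 y - f2 x"] by (intro mult_left_mono) (auto simp: \<gamma>_def)
        finally show ?thesis using n by (auto simp: dist_real_def)
      qed (use e in auto)
      show "\<exists>d>0. \<forall>u v. u \<le> x \<and> x \<le> v \<and> v - u < d \<longrightarrow> a \<le> u \<and> v \<le> b \<longrightarrow> \<bar>E v - E u\<bar> \<le> 2 * e * integral {u..v} H"
      proof (intro exI[of _ d] conjI allI impI d(1))
        fix u v assume uv: "u \<le> x \<and> x \<le> v \<and> v - u < d" "a \<le> u \<and> v \<le> b"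
        have "\<bar>E v - E x\<bar> \<le> 2 * e * integral {x..v} H"
          using uv x by (intro small[where x = x] e) (auto intro!: near[THEN conjunct1] near[THEN conjunct2, THEN conjunct1] near[THEN conjunct2, THEN conjunct2] simp: dist_real_def)
        moreover have "\<bar>E x - E u\<bar> \<le> 2 * e * integral {u..x} H"
          using uv x by (intro small[where x = x] e) (auto intro!: near[THEN conjunct1] near[THEN conjunct2, THEN conjunct1] near[THEN conjunct2, THEN conjunct2] simp: dist_real_def)
        moreover have "integral {u..v} H = integral {u..x} H + integral {x..v} H"
          using Henstock_Kurzweil_Integration.integral_combine[of u x v H] uv sub(2) by auto
        ultimately show "\<bar>E v - E u\<bar> \<le> 2 * e * integral {u..v} H" by (simp add: distrib_left)
      qed
    qed
    then show ?thesis by simp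
  qed
  have "\<bar>E b - E a\<bar> \<le> 0"
  proof (rule field_le_epsilon)
    fix e :: real assume e: "e > 0"
    define I where "I = integral {a..b} H"
    have "0 \<le> I" unfolding I_def using sub(2)[of a b] ab by (intro Henstock_Kurzweil_Integration.integral_nonneg) (auto simp: H_def)
    then have "2 * (e / (2 * (I + 1))) * I \<le> e" using e by (simp add: field_simps)
    moreover have "\<bar>E b - E a\<bar> \<le> 2 * (e / (2 * (I + 1))) * I"
      unfolding I_def by (rule main) (use e \<open>0 \<le> I\<close> in \<open>simp add: I_def\<close>)
    ultimately show "\<bar>E b - E a\<bar> \<le> 0 + e" by simp
  qed
  then show "(\<lambda>x. D1 (f1 x, f2 x) * h1 x + D2 (f1 x, f2 x) * h2 x) absolutely_integrable_on {a..b} \<and>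
    \<Phi> (f1 b, f2 b) - \<Phi> (f1 a, f2 a) = integral {a..b} (\<lambda>x. D1 (f1 x, f2 x) * h1 x + D2 (f1 x, f2 x) * h2 x)"
    using h_ai by (simp add: E_def h_def[abs_def] \<gamma>_def)
qed

lemma primitive_of_mult:
  assumes "primitive_of f1 h1" "primitive_of f2 h2"
  shows "primitive_of (\<lambda>x. f1 x * f2 x) (\<lambda>x. f2 x * h1 x + f1 x * h2 x)"
proof -
  have "primitive_of (\<lambda>x. fst (f1 x, f2 x) * snd (f1 x, f2 x)) (\<lambda>x. snd (f1 x, f2 x) * h1 x + fst (f1 x, f2 x) * h2 x)"
    by (rule primitive_of_chain2[OF assms, where S = UNIV and \<Phi> = "\<lambda>p. fst p * snd p"])
       (auto intro!: derivative_eq_intros continuous_intros simp: mult.commute)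
  then show ?thesis by simp
qed

subsection \<open>Test functions\<close>

text \<open>The functions P(1/x) exp(-1/x) for all polynomials P. With u = 1/x the derivative
  replaces P by u^2 (P - P'), so the family is closed under differentiation and contains the
  standard smooth step.\<close>

definition flat :: "real poly \<Rightarrow> real \<Rightarrow> real" where
  "flat P x = (if x \<le> 0 then 0 else poly P (1 / x) / exp (1 / x))"

lemma poly_div_exp_tendsto_0: "((\<lambda>u. poly P u / exp u) \<longlongrightarrow> (0 :: real)) at_top"
proof -
  have "((\<lambda>u. \<Sum>i\<le>degree P. coeff P i * (u ^ i / exp u)) \<longlongrightarrow> (0 :: real)) at_top"
    by (intro tendsto_null_sum tendsto_mult_right_zero tendsto_power_div_exp_0)
  then show ?thesis by (simp add: poly_altdef sum_divide_distrib)
qed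

lemma has_real_derivative_flat: "(flat P has_real_derivative flat ([:0, 0, 1:] * (P - pderiv P)) x) (at x)"
proof (cases x "0 :: real" rule: linorder_cases)
  case less
  have "((\<lambda>x. 0) has_real_derivative 0) (at x)" by simp
  then have "(flat P has_real_derivative 0) (at x)"
    by (rule has_field_derivative_transform_within_open[where S = "{..<0}"]) (use less in \<open>auto simp: flat_def\<close>)
  then show ?thesis using less by (simp add: flat_def)
next
  case greater
  have "((\<lambda>x. poly P (1 / x) / exp (1 / x)) has_real_derivative flat ([:0, 0, 1:] * (P - pderiv P)) x) (at x)"
    using greater
    by (auto intro!: derivative_eq_intros DERIV_chain2[OF poly_DERIV] simp: flat_def field_simps power2_eq_square)
  then show ?thesis
    by (rule has_field_derivative_transform_within_open[where S = "{0<..}"]) (use greater in \<open>auto simp: flat_def\<close>)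
next
  case equal
  have "((\<lambda>y. (flat P y - flat P 0) / (y - 0)) \<longlongrightarrow> 0) (at 0)"
  proof (rule filterlim_split_at)
    have "((\<lambda>y. 0 :: real) \<longlongrightarrow> 0) (at_left 0)" by simp
    then show "((\<lambda>y. (flat P y - flat P 0) / (y - 0)) \<longlongrightarrow> 0) (at_left 0)"
      by (rule Lim_transform_eventually)
         (intro eventually_at_leftI[of "-1"]; simp add: flat_def)
    \<comment> \<open>\<open>pCons 0 P\<close> is the polynomial u P(u); its extra factor u = 1/y is
      the denominator of the difference quotient.\<close>
    have "((\<lambda>y. poly (pCons 0 P) (inverse y) / exp (inverse y)) \<longlongrightarrow> 0) (at_right 0)"
      by (rule filterlim_compose[OF poly_div_exp_tendsto_0 filterlim_inverse_at_top_right])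
    then show "((\<lambda>y. (flat P y - flat P 0) / (y - 0)) \<longlongrightarrow> 0) (at_right 0)"
      by (rule Lim_transform_eventually)
         (intro eventually_at_rightI[of 0 1]; simp add: flat_def divide_simps)
  qed
  then show ?thesis using equal by (simp add: has_field_derivative_iff flat_def)
qed

text \<open>By the product rule this class is closed under differentiation, which gives at once the
  derivatives of all orders that \<open>test_function\<close> demands.\<close>

inductive bump_sum :: "(real \<Rightarrow> real) \<Rightarrow> bool" where
  bump_prod: "bump_sum (\<lambda>x. flat P (\<alpha> * x + \<beta>) * flat Q (\<gamma> * x + \<delta>))"
| bump_add: "bump_sum f \<Longrightarrow> bump_sum g \<Longrightarrow> bump_sum (\<lambda>x. f x + g x)"

lemma flat_smult: "flat (smult c P) x = c * flat P x"
  by (simp add: flat_def)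

lemma has_real_derivative_flat_affine:
  "((\<lambda>x. flat P (\<alpha> * x + \<beta>)) has_real_derivative flat (smult \<alpha> ([:0, 0, 1:] * (P - pderiv P))) (\<alpha> * x + \<beta>)) (at x)"
  by (rule DERIV_cong[OF DERIV_chain2[OF has_real_derivative_flat]])
     (auto intro!: derivative_eq_intros simp: flat_smult simp del: mult_pCons_left)

lemma bump_sum_deriv: "bump_sum f \<Longrightarrow> \<exists>g. bump_sum g \<and> (\<forall>x. (f has_real_derivative g x) (at x))"
proof (induction rule: bump_sum.induct)
  case (bump_prod P \<alpha> \<beta> Q \<gamma> \<delta>)
  let ?d = "\<lambda>\<alpha> P. smult \<alpha> ([:0, 0, 1:] * (P - pderiv P))"
  show ?case
  proof (intro exI conjI allI)
    show "bump_sum (\<lambda>x. flat (?d \<alpha> P) (\<alpha> * x + \<beta>) * flat Q (\<gamma> * x + \<delta>) + flat P (\<alpha> * x + \<beta>) * flat (?d \<gamma> Q) (\<gamma> * x + \<delta>))"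
      by (intro bump_sum.intros)
    show "((\<lambda>x. flat P (\<alpha> * x + \<beta>) * flat Q (\<gamma> * x + \<delta>)) has_real_derivative
        flat (?d \<alpha> P) (\<alpha> * x + \<beta>) * flat Q (\<gamma> * x + \<delta>) + flat P (\<alpha> * x + \<beta>) * flat (?d \<gamma> Q) (\<gamma> * x + \<delta>)) (at x)" for x
      by (rule DERIV_cong[OF DERIV_mult[OF has_real_derivative_flat_affine has_real_derivative_flat_affine]])
         (simp del: mult_pCons_left)
  qed
next
  case (bump_add f g)
  then obtain f' g' where "bump_sum f'" "\<And>x. (f has_real_derivative f' x) (at x)" "bump_sum g'" "\<And>x. (g has_real_derivative g' x) (at x)"
    by blast
  then show ?case
    by (intro exI[of _ "\<lambda>x. f' x + g' x"]) (auto intro: bump_sum.bump_add DERIV_add)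
qed

lemma bump_sum_deriv_iter: "bump_sum f \<Longrightarrow> bump_sum ((deriv ^^ n) f)"
proof (induction n)
  case (Suc n)
  then obtain g where g: "bump_sum g" "\<And>x. ((deriv ^^ n) f has_real_derivative g x) (at x)"
    using bump_sum_deriv by blast
  then have "deriv ((deriv ^^ n) f) = g" by (auto intro: DERIV_imp_deriv)
  with g show ?case by simp
qed simp

lemma bump_sum_differentiable: "bump_sum f \<Longrightarrow> f differentiable (at x)"
  using bump_sum_deriv real_differentiable_def by blast

text \<open>Only the derivative of \<open>p\<close> has to be a bump sum, because the test functions
  used here are primitives.\<close>

lemma test_function_of_bump_sum:
  assumes q: "bump_sum q" and p: "\<And>x. (p has_real_derivative q x) (at x)"
    and ab: "0 < a" "a < b" and supp: "\<And>x. x \<notin> {a..b} \<Longrightarrow> p x = 0"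
  shows "test_function p" "deriv p = q"
proof -
  show dp: "deriv p = q" using p by (auto intro: DERIV_imp_deriv)
  have "(deriv ^^ n) p differentiable (at x)" for n x
  proof (cases n)
    case 0 then show ?thesis using p real_differentiable_def by auto
  next
    case (Suc k)
    have "(deriv ^^ n) p = (deriv ^^ k) q" unfolding Suc funpow_Suc_right by (simp add: dp)
    then show ?thesis using bump_sum_differentiable[OF bump_sum_deriv_iter[OF q]] by simp
  qed
  then show "test_function p" unfolding test_function_def using ab supp by blast
qed

text \<open>A smooth approximation of the indicator of \<open>(a, b)\<close> from below: scaling by
  \<open>Suc n\<close> sends exp(-1/((n+1) y)) to 1 for every y > 0.\<close>

definition bump :: "nat \<Rightarrow> real \<Rightarrow> real \<Rightarrow> real \<Rightarrow> real" where
  "bump n a b x = flat 1 (real (Suc n) * (x - a)) * flat 1 (real (Suc n) * (b - x))"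

lemma bump_bounds: "0 \<le> bump n a b x" "bump n a b x \<le> 1"
proof -
  have *: "0 \<le> flat 1 y" "flat 1 y \<le> 1" for y
    by (auto simp: flat_def divide_simps)
  show "0 \<le> bump n a b x" "bump n a b x \<le> 1"
    unfolding bump_def using *[of "real (Suc n) * (x - a)"] *[of "real (Suc n) * (b - x)"]
    by (auto intro: mult_le_one)
qed

lemma bump_eq_0: "x \<notin> {a<..<b} \<Longrightarrow> bump n a b x = 0"
  by (auto simp: bump_def flat_def not_less mult_le_0_iff)

lemma bump_tendsto: "(\<lambda>n. bump n a b x) \<longlonglongrightarrow> indicator {a<..<b} x"
proof (cases "x \<in> {a<..<b}")
  case True
  have "(\<lambda>n. exp (- (inverse (real (Suc n)) / (x - a))) * exp (- (inverse (real (Suc n)) / (b - x)))) \<longlonglongrightarrow> exp (- (0 / (x - a))) * exp (- (0 / (b - x)))"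
    by (intro tendsto_intros LIMSEQ_inverse_real_of_nat) (use True in auto)
  then show ?thesis using True 
    by (simp add: bump_def flat_def mult_le_0_iff exp_minus inverse_eq_divide divide_simps del: of_nat_Suc)
qed (simp add: bump_eq_0)

lemma bump_shift: "bump n (a + d) (b + d) x = bump n a b (x - d)"
  by (simp add: bump_def algebra_simps)

lemma bump_sum_bump: "bump_sum (bump n a b)"
proof -
  have "bump n a b = (\<lambda>x. flat 1 (real (Suc n) * x + (- real (Suc n) * a)) * flat 1 ((- real (Suc n)) * x + real (Suc n) * b))"
    by (auto simp: bump_def algebra_simps simp del: of_nat_Suc)
  then show ?thesis by (metis bump_sum.bump_prod)
qed

lemma bump_sum_neg_bump: "bump_sum (\<lambda>x. - bump n a b x)"
proof -
  have "(\<lambda>x. - bump n a b x) = (\<lambda>x. flat (-1) (real (Suc n) * x + (- real (Suc n) * a)) * flat 1 ((- real (Suc n)) * x + real (Suc n) * b))"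
    by (auto simp: bump_def algebra_simps flat_def simp del: of_nat_Suc)
  then show ?thesis by (metis bump_sum.bump_prod)
qed

lemma bump_sum_continuous_on: "bump_sum f \<Longrightarrow> continuous_on A f"
  using bump_sum_differentiable differentiable_imp_continuous_within
  by (metis continuous_at_imp_continuous_on)

lemma bump_sum_diff_bump: "bump_sum (\<lambda>x. bump n a b x - bump n a' b' x)"
  using bump_add[OF bump_sum_bump bump_sum_neg_bump] by simp

text \<open>Its derivative is a bump minus a translate of it, so that it has compact support.\<close>

definition plateau :: "nat \<Rightarrow> real \<Rightarrow> real \<Rightarrow> real \<Rightarrow> real \<Rightarrow> real" where
  "plateau n a h d x = integral {0..x} (\<lambda>y. bump n a (a + h) y - bump n (a + d) (a + h + d) y)"

lemma plateau:
  assumes "0 < a" "0 < h" "0 < d"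
  shows "(plateau n a h d has_real_derivative (bump n a (a + h) x - bump n (a + d) (a + h + d) x)) (at x)" (is ?D)
    and "x \<notin> {a..a + h + d} \<Longrightarrow> plateau n a h d x = 0"
proof -
  let ?q = "\<lambda>y. bump n a (a + h) y - bump n (a + d) (a + h + d) y"
  have q0: "?q y = 0" if "y \<le> a" for y using that assms by (simp add: bump_eq_0)
  have cont: "continuous_on A ?q" for A by (intro bump_sum_continuous_on bump_sum_diff_bump)
  have contb: "continuous_on A (bump n a' b')" for A a' b' by (intro bump_sum_continuous_on bump_sum_bump)
  have low: "plateau n a h d x = 0" if "x \<le> a" for x
  proof -
    have "plateau n a h d x = integral {0..x} (\<lambda>y. 0)" unfolding plateau_def
      by (intro Henstock_Kurzweil_Integration.integral_cong) (use that q0 in auto)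
    then show ?thesis by simp
  qed
  show ?D
  proof (cases "x < a")
    case True
    have "((\<lambda>x. 0) has_real_derivative 0) (at x)" by simp
    then have "(plateau n a h d has_real_derivative 0) (at x)"
      by (rule has_field_derivative_transform_within_open[where S = "{..<a}"]) (use True low in auto)
    then show ?thesis using True q0[of x] by simp
  next
    case False
    then have x: "x \<in> {0<..<x + 1}" using assms by auto
    have "((\<lambda>x. integral {0..x} ?q) has_real_derivative ?q x) (at x within {0..x + 1})"
      by (rule integral_has_real_derivative[OF cont]) (use False assms in auto)
    moreover have "at x within {0..x + 1} = at x"
      using x by (intro at_within_interior) auto
    ultimately show ?thesis unfolding plateau_def by simp
  qed
  show "plateau n a h d x = 0" if x: "x \<notin> {a..a + h + d}"
  proof (cases "x < a")
    case False
    then have x: "x > a + h + d" using x by auto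
    have "integral {0..x} (bump n a (a + h)) = integral {0..x} (\<lambda>y. if y \<in> {a..a+h} then bump n a (a + h) y else 0)"
      by (intro Henstock_Kurzweil_Integration.integral_cong) (auto simp: bump_eq_0)
    also have "\<dots> = integral {a..a+h} (bump n a (a + h))"
      by (subst integral_restrict_Int) (use x assms in \<open>auto intro!: arg_cong[where f = "\<lambda>S. integral S _"]\<close>)
    also have "\<dots> = integral {a + d - d..a + h + d - d} (\<lambda>y. bump n (a + d) (a + h + d) (y + d))"
      using bump_shift[of n a d "a + h"] by simp
    also have "\<dots> = integral {a + d..a + h + d} (bump n (a + d) (a + h + d))"
      by (rule integral_shift_real_ivl)
    also have "\<dots> = integral {0..x} (\<lambda>y. if y \<in> {a+d..a+h+d} then bump n (a + d) (a + h + d) y else 0)"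
      by (subst integral_restrict_Int) (use x assms in \<open>auto intro!: arg_cong[where f = "\<lambda>S. integral S _"]\<close>)
    also have "\<dots> = integral {0..x} (bump n (a + d) (a + h + d))"
      by (intro Henstock_Kurzweil_Integration.integral_cong) (auto simp: bump_eq_0)
    finally show ?thesis unfolding plateau_def
      by (subst Henstock_Kurzweil_Integration.integral_diff) (auto intro!: integrable_continuous_real contb)
  qed (use low in auto)
qed

text \<open>The primitive of the indicator of \<open>(a, a + h)\<close>. The difference of two ramps
  is the trapezoid to which \<open>plateau\<close> converges.\<close>

definition ramp :: "real \<Rightarrow> real \<Rightarrow> real \<Rightarrow> real" where
  "ramp a h x = max 0 (min h (x - a))"

lemma plateau_tendsto:
  assumes "0 < a" "0 < h" "0 < d"
  shows "(\<lambda>n. plateau n a h d x) \<longlonglongrightarrow> ramp a h x - ramp (a + d) h x"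
proof -
  have *: "(\<lambda>n. integral {0..x} (bump n a (a + h))) \<longlonglongrightarrow> ramp a h x" if "0 < a" for a
  proof -
    have 1: "integral {0..x} (bump n a (a + h)) = (LINT y|lborel. indicator {0..x} y * bump n a (a + h) y)" for n
    proof -
      have "set_integrable lborel {0..x} (bump n a (a + h))"
        by (intro borel_integrable_compact[of "{0..x}", folded set_integrable_def]) (auto intro: bump_sum_continuous_on bump_sum_bump)
      from set_borel_integral_eq_integral(2)[OF this] show ?thesis by (simp add: set_lebesgue_integral_def)
    qed
    have m: "bump n a (a + h) \<in> borel_measurable borel" for n
      by (intro borel_measurable_continuous_onI bump_sum_continuous_on bump_sum_bump)
    have "(\<lambda>n. LINT y|lborel. indicator {0..x} y * bump n a (a + h) y) \<longlonglongrightarrow> (LINT y|lborel. indicator {0..x} y * indicator {a<..<a + h} y)"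
    proof (rule integral_dominated_convergence[where w = "indicator {0..x}"])
      show "AE y in lborel. (\<lambda>n. indicator {0..x} y * bump n a (a + h) y) \<longlonglongrightarrow> indicator {0..x} y * indicator {a<..<a + h} y"
        by (intro AE_I2 tendsto_mult bump_tendsto tendsto_const)
      show "AE y in lborel. norm (indicator {0..x} y * bump n a (a + h) y) \<le> indicator {0..x} y" for n
        using bump_bounds by (intro AE_I2) (auto split: split_indicator)
      show "integrable lborel (indicator {0..x} :: real \<Rightarrow> real)"
        by (rule integrable_real_indicator) (auto simp: emeasure_lborel_Icc_eq)
    qed (use m in auto)
    also have "(LINT y|lborel. indicator {0..x} y * indicator {a<..<a + h} y) = measure lborel ({0..x} \<inter> {a<..<a + h})"
      by (simp add: indicator_inter_arith[symmetric])
    also have "\<dots> = ramp a h x"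
    proof (cases "x \<le> a")
      case True
      then have "{0..x} \<inter> {a<..<a + h} = {}" by auto
      then show ?thesis using True assms by (simp add: ramp_def)
    next
      case False
      then have "{0..x} \<inter> {a<..<a + h} = (if x < a + h then {a<..x} else {a<..<a + h})" using that by auto
      then show ?thesis using False assms by (auto simp: ramp_def)
    qed
    finally show ?thesis unfolding 1 .
  qed
  have "plateau n a h d x = integral {0..x} (bump n a (a + h)) - integral {0..x} (bump n (a + d) (a + d + h))" for n
    unfolding plateau_def
    by (subst Henstock_Kurzweil_Integration.integral_diff)
       (auto intro!: integrable_continuous_real bump_sum_continuous_on bump_sum_bump simp: ac_simps)
  then show ?thesis using tendsto_diff[OF *[of a] *[of "a + d"]] assms by simp
qed

lemma plateau_bound:
  assumes "0 < a" "0 < h" "0 < d"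
  shows "\<bar>plateau n a h d x\<bar> \<le> indicator {a..a + h + d} x * (a + h + d)"
proof (cases "x \<in> {a..a + h + d}")
  case True
  have "norm (integral {0..x} (\<lambda>y. bump n a (a + h) y - bump n (a + d) (a + h + d) y)) \<le> integral {0..x} (\<lambda>y. 1)"
  proof (rule integral_norm_bound_integral)
    show "(\<lambda>y. bump n a (a + h) y - bump n (a + d) (a + h + d) y) integrable_on {0..x}"
      by (intro integrable_continuous_real bump_sum_continuous_on bump_sum_diff_bump)
    show "norm (bump n a (a + h) y - bump n (a + d) (a + h + d) y) \<le> 1" for y
      using bump_bounds[of n a "a + h" y] bump_bounds[of n "a + d" "a + h + d" y] by auto
  qed auto
  then show ?thesis using True assms by (simp add: plateau_def)
qed (simp add: plateau(2)[OF assms])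

subsection \<open>Weak derivatives\<close>

lemma loc_integrable_iff:
  "loc_integrable f \<longleftrightarrow> (\<forall>a b. 0 < a \<and> a \<le> b \<longrightarrow> f absolutely_integrable_on {a..b})"
proof -
  have *: "integrable (lebesgue_on {a..b}) f \<longleftrightarrow> f absolutely_integrable_on {a..b}" for a b
    unfolding set_integrable_def by (subst integrable_restrict_space) auto
  show ?thesis
  proof
    assume L: "loc_integrable f"
    show "\<forall>a b. 0 < a \<and> a \<le> b \<longrightarrow> f absolutely_integrable_on {a..b}"
    proof (intro allI impI)
      fix a b :: real assume "0 < a \<and> a \<le> b"
      then have "f absolutely_integrable_on {a..b + 1}" using L by (auto simp: loc_integrable_def *)
      then show "f absolutely_integrable_on {a..b}" by (rule set_integrable_subset) auto
    qed
  qed (auto simp: loc_integrable_def *)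
qed

lemma ex_primitive_of:
  assumes "loc_integrable h" shows "\<exists>f. primitive_of f h"
proof (intro exI)
  define f where "f x = (if 1 \<le> x then integral {1..x} h else - integral {x..1} h)" for x
  have int: "h integrable_on {a..b}" if "0 < a" for a b
    using assms that by (cases "a \<le> b") (auto simp: loc_integrable_iff intro: set_lebesgue_integral_eq_integral(1))
  show "primitive_of f h"
    unfolding primitive_of_def
  proof (intro allI impI conjI)
    fix a b :: real assume ab: "0 < a \<and> a \<le> b"
    show "h absolutely_integrable_on {a..b}" using assms ab by (auto simp: loc_integrable_iff)
    consider "b < 1" | "a < 1" "1 \<le> b" | "1 \<le> a" by linarith
    then show "f b - f a = integral {a..b} h"
    proof cases
      case 1
      then show ?thesis
        using Henstock_Kurzweil_Integration.integral_combine[of a b 1 h] ab int by (simp add: f_def)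
    next
      case 2
      then show ?thesis
        using Henstock_Kurzweil_Integration.integral_combine[of a 1 b h] ab int by (simp add: f_def)
    next
      case 3
      then show ?thesis
        using Henstock_Kurzweil_Integration.integral_combine[of 1 a b h] ab int by (simp add: f_def)
    qed
  qed
qed

lemma AE_lborel_shift:
  fixes P :: "real \<Rightarrow> bool"
  assumes "AE x in lborel. P x" shows "AE x in lborel. P (x + c)"
proof -
  obtain N where N: "N \<in> null_sets lborel" "{x. \<not> P x} \<subseteq> N"
    using assms by (auto simp: eventually_ae_filter)
  have [measurable]: "N \<in> sets borel" using N by auto
  have "AE x in lborel. x \<notin> N" using N by (rule_tac AE_not_in)
  then have "AE x in lborel. c + 1 * x \<notin> N" by (intro AE_borel_affine) auto
  then show ?thesis by eventually_elim (use N in \<open>auto simp: add.commute\<close>)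
qed

lemma integral_Rplus_eq:
  fixes f q :: "real \<Rightarrow> real"
  assumes "0 < a" "\<And>x. x \<notin> {a..b} \<Longrightarrow> q x = 0"
  shows "(LINT x|Rplus. f x * q x) = (LINT x|lebesgue. (indicator {a..b} x * f x) * q x)"
proof -
  have "(LINT x|Rplus. f x * q x) = (LINT x|lebesgue. indicator {0<..} x *\<^sub>R (f x * q x))"
    by (rule integral_restrict_space) simp
  also have "\<dots> = (LINT x|lebesgue. (indicator {a..b} x * f x) * q x)"
    using assms by (intro Bochner_Integration.integral_cong) (auto split: split_indicator)
  finally show ?thesis .
qed

lemma integral_lebesgue_indicator:
  fixes f :: "real \<Rightarrow> real"
  assumes "f absolutely_integrable_on {a..b}"
  shows "integrable lebesgue (\<lambda>x. indicator {a..b} x * f x)"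
    and "(LINT x|lebesgue. indicator {a..b} x * f x) = integral {a..b} f"
  using assms set_lebesgue_integral_eq_integral(2)[OF assms]
  by (auto simp: set_integrable_def set_lebesgue_integral_def)

lemma AE_lebesgue_not_eq: "AE x in lebesgue. x \<noteq> (c :: real)"
  using AE_lborel_singleton[of c] by (rule AE_completion)

lemma measurable_ramp: "ramp a h \<in> borel_measurable lebesgue"
proof -
  have "ramp a h \<in> borel_measurable lborel" unfolding ramp_def[abs_def] by measurable
  then show ?thesis by (rule measurable_completion)
qed

text \<open>The definition of the weak derivative is tested with \<open>plateau n a h d\<close> and
  \<open>n\<close> tends to infinity. The test functions tend to a trapezoid and their derivatives
  to a difference of two indicators.\<close>

lemma weak_deriv_ramp:
  assumes wd: "has_weak_deriv f g" and pos: "0 < a" "0 < h" "0 < d"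
  shows "integral {a..a + h} f - integral {a + d..a + h + d} f
    = - (LINT x|lebesgue. (indicator {a..a + h + d} x * g x) * (ramp a h x - ramp (a + d) h x))"
proof -
  let ?I = "{a..a + h + d}"
  let ?q = "\<lambda>n x. bump n a (a + h) x - bump n (a + d) (a + h + d) x"
  let ?p = "\<lambda>n. plateau n a h d"
  have f: "f absolutely_integrable_on {u..v}" and g: "g absolutely_integrable_on {u..v}" if "0 < u" "u \<le> v" for u v
    using wd that by (auto simp: has_weak_deriv_def loc_integrable_iff)
  have If: "integrable lebesgue (\<lambda>x. indicator ?I x * f x)" and Ig: "integrable lebesgue (\<lambda>x. indicator ?I x * g x)"
    using f[of a "a + h + d"] g[of a "a + h + d"] pos by (auto intro!: integral_lebesgue_indicator)
  have test: "test_function (?p n)" "deriv (?p n) = ?q n" for n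
    using test_function_of_bump_sum[where a = a and b = "a + h + d", OF bump_sum_diff_bump plateau(1)[OF pos] pos(1) _ plateau(2)[OF pos]] pos by auto
  have eq: "(LINT x|lebesgue. (indicator ?I x * f x) * ?q n x) = - (LINT x|lebesgue. (indicator ?I x * g x) * ?p n x)" for n
  proof -
    have "(LINT x|Rplus. f x * deriv (?p n) x) = - (LINT x|Rplus. g x * ?p n x)"
      using wd test(1) unfolding has_weak_deriv_def by blast
    moreover have "?q n x = 0" if "x \<notin> ?I" for x
      using that pos bump_eq_0[of x a "a + h" n] bump_eq_0[of x "a + d" "a + h + d" n] by auto
    ultimately show ?thesis unfolding test(2)
      using integral_Rplus_eq[OF pos(1), of "a + h + d" "?q n" f] integral_Rplus_eq[OF pos(1), of "a + h + d" "?p n" g] plateau(2)[OF pos]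
      by simp
  qed
  have qm: "?q n \<in> borel_measurable lebesgue" for n
  proof -
    have "?q n \<in> borel_measurable borel"
      by (intro borel_measurable_continuous_onI bump_sum_continuous_on bump_sum_diff_bump)
    then show ?thesis by (simp add: measurable_completion)
  qed
  have pm: "?p n \<in> borel_measurable lebesgue" for n
  proof -
    have "continuous_on UNIV (?p n)" using plateau(1)[OF pos, of n] by (meson DERIV_isCont continuous_at_imp_continuous_on)
    then have "?p n \<in> borel_measurable lborel" by (simp add: borel_measurable_continuous_onI)
    then show ?thesis by (rule measurable_completion)
  qed
  let ?L = "\<lambda>x. (indicator ?I x * f x) * (indicator {a<..<a + h} x - indicator {a + d<..<a + h + d} x)"
  have "(\<lambda>n. LINT x|lebesgue. (indicator ?I x * f x) * ?q n x) \<longlonglongrightarrow> (LINT x|lebesgue. ?L x)"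
  proof (rule integral_dominated_convergence[where w = "\<lambda>x. \<bar>indicator ?I x * f x\<bar>"])
    show "AE x in lebesgue. (\<lambda>n. (indicator ?I x * f x) * ?q n x) \<longlonglongrightarrow> ?L x"
      by (intro AE_I2 tendsto_intros bump_tendsto)
    show "AE x in lebesgue. norm ((indicator ?I x * f x) * ?q n x) \<le> \<bar>indicator ?I x * f x\<bar>" for n
    proof (intro AE_I2)
      fix x
      have "\<bar>?q n x\<bar> \<le> 1" using bump_bounds[of n a "a + h" x] bump_bounds[of n "a + d" "a + h + d" x] by auto
      then show "norm ((indicator ?I x * f x) * ?q n x) \<le> \<bar>indicator ?I x * f x\<bar>"
        by (simp add: abs_mult mult_left_le)
    qed
  qed (use If qm in \<open>auto intro!: borel_measurable_diff borel_measurable_times borel_measurable_indicator borel_measurable_integrable[OF If]\<close>)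
  moreover have "(\<lambda>n. LINT x|lebesgue. (indicator ?I x * g x) * ?p n x) \<longlonglongrightarrow> (LINT x|lebesgue. (indicator ?I x * g x) * (ramp a h x - ramp (a + d) h x))"
  proof (rule integral_dominated_convergence[where w = "\<lambda>x. (a + h + d) * \<bar>indicator ?I x * g x\<bar>"])
    show "AE x in lebesgue. (\<lambda>n. (indicator ?I x * g x) * ?p n x) \<longlonglongrightarrow> (indicator ?I x * g x) * (ramp a h x - ramp (a + d) h x)"
      by (intro AE_I2 tendsto_intros plateau_tendsto pos)
    show "AE x in lebesgue. norm ((indicator ?I x * g x) * ?p n x) \<le> (a + h + d) * \<bar>indicator ?I x * g x\<bar>" for n
    proof (intro AE_I2)
      fix x
      have "\<bar>?p n x\<bar> \<le> a + h + d" using plateau_bound[OF pos, of n x] pos by (auto split: split_indicator_asm)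
      then show "norm ((indicator ?I x * g x) * ?p n x) \<le> (a + h + d) * \<bar>indicator ?I x * g x\<bar>"
        by (simp add: abs_mult mult.commute[of _ "\<bar>?p n x\<bar>"] mult_right_mono)
    qed
    show "(\<lambda>x. (indicator ?I x * g x) * (ramp a h x - ramp (a + d) h x)) \<in> borel_measurable lebesgue"
      by (intro borel_measurable_diff borel_measurable_times borel_measurable_integrable[OF Ig] measurable_ramp)
  qed (use Ig pm in \<open>auto intro!: borel_measurable_times borel_measurable_integrable[OF Ig]\<close>)
  ultimately have "(LINT x|lebesgue. ?L x) = - (LINT x|lebesgue. (indicator ?I x * g x) * (ramp a h x - ramp (a + d) h x))"
    unfolding eq by (auto intro: LIMSEQ_unique tendsto_minus)
  moreover have "(LINT x|lebesgue. ?L x) = (LINT x|lebesgue. indicator {a..a + h} x * f x - indicator {a + d..a + h + d} x * f x)"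
  proof (rule integral_cong_AE)
    show "?L \<in> borel_measurable lebesgue"
      by (intro borel_measurable_times borel_measurable_integrable[OF If] borel_measurable_diff borel_measurable_indicator) auto
    show "(\<lambda>x. indicator {a..a + h} x * f x - indicator {a + d..a + h + d} x * f x) \<in> borel_measurable lebesgue"
      using f[of a "a + h"] f[of "a + d" "a + h + d"] pos
      by (intro borel_measurable_diff borel_measurable_integrable integral_lebesgue_indicator) auto
    show "AE x in lebesgue. ?L x = indicator {a..a + h} x * f x - indicator {a + d..a + h + d} x * f x"
      using AE_lebesgue_not_eq[of a] AE_lebesgue_not_eq[of "a + h"] AE_lebesgue_not_eq[of "a + d"] AE_lebesgue_not_eq[of "a + h + d"]
      by eventually_elim (use pos in \<open>auto split: split_indicator\<close>)
  qed
  moreover have "\<dots> = integral {a..a + h} f - integral {a + d..a + h + d} f"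
    using f[of a "a + h"] f[of "a + d" "a + h + d"] pos by (simp add: integral_lebesgue_indicator)
  ultimately show ?thesis by simp
qed

text \<open>Dividing \<open>weak_deriv_ramp\<close> by \<open>h\<close> and letting \<open>h\<close>
  tend to 0 turns the left side into a difference of two values of \<open>f\<close> and the right
  side into an integral of \<open>g\<close>. Hence \<open>f\<close> agrees with a primitive of
  \<open>g\<close>, up to a constant, at all points of \<open>L\<close>.\<close>

lemma weak_deriv_imp_primitive:
  assumes wd: "has_weak_deriv f g"
  obtains w where "primitive_of w g" "AE x in lebesgue. 0 < x \<longrightarrow> f x = w x"
proof -
  obtain F G where F: "primitive_of F f" and G: "primitive_of G g"
    using wd ex_primitive_of unfolding has_weak_deriv_def by blast
  \<comment> \<open>Points where averages of \<open>f\<close> over shrinking intervals to the right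
    converge to \<open>f\<close>; almost every positive point is one.\<close>
  define L where "L = {x. 0 < x \<and> (\<lambda>n. real (Suc n) * (F (x + 1 / Suc n) - F x)) \<longlonglongrightarrow> f x}"
  have L: "AE x in lebesgue. 0 < x \<longrightarrow> x \<in> L"
    using primitive_of_AE_difference_quotient[OF F] by eventually_elim (auto simp: L_def)
  have diff: "f (a + d) - f a = G (a + d) - G a" if a: "a \<in> L" and ad: "a + d \<in> L" and d: "0 < d" for a d
  proof -
    have a0: "0 < a" using a by (simp add: L_def)
    define I where "I = {a..a + 1 + d}"
    have Ig: "integrable lebesgue (\<lambda>x. indicator I x * g x)"
      unfolding I_def using primitive_ofD(1)[OF G a0, of "a + 1 + d"] d by (intro integral_lebesgue_indicator) auto
    \<comment> \<open>Ramps of height 1: with slope \<open>Suc n\<close> they converge to jumps, so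
      \<open>r n\<close> converges to the indicator of \<open>(a, a + d]\<close>.\<close>
    define r where "r n x = real (Suc n) * (ramp a (1 / Suc n) x - ramp (a + d) (1 / Suc n) x)" for n x
    have r_conv: "(\<lambda>n. r n x) \<longlonglongrightarrow> indicator {a<..a + d} x" for x
    proof -
      have *: "(\<lambda>n. real (Suc n) * ramp b (1 / Suc n) x) \<longlonglongrightarrow> indicator {b<..} x" for b
      proof (cases "x \<le> b")
        case False
        obtain N where N: "1 / (x - b) < real N" using reals_Archimedean2 by blast
        have "real (Suc n) * ramp b (1 / Suc n) x = 1" if "N \<le> n" for n
        proof -
          have "1 / (x - b) < real (Suc n)" using N that by linarith
          then have "1 / real (Suc n) < x - b" using False by (simp add: field_simps)
          then show ?thesis using False by (simp add: ramp_def)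
        qed
        then have "eventually (\<lambda>n. real (Suc n) * ramp b (1 / Suc n) x = 1) sequentially"
          unfolding eventually_sequentially by blast
        then show ?thesis using False by (simp add: tendsto_eventually)
      qed (simp add: ramp_def)
      have "indicator {a<..a + d} x = (indicator {a<..} x - indicator {a + d<..} x :: real)"
        using d by (auto split: split_indicator)
      then show ?thesis using tendsto_diff[OF *[of a] *[of "a + d"]] by (simp add: r_def right_diff_distrib)
    qed
    have ramp01: "0 \<le> real (Suc n) * ramp b (1 / Suc n) x" "real (Suc n) * ramp b (1 / Suc n) x \<le> 1" for b n x
    proof -
      show "0 \<le> real (Suc n) * ramp b (1 / Suc n) x" by (simp add: ramp_def)
      have "ramp b (1 / Suc n) x \<le> 1 / Suc n" by (simp add: ramp_def)
      then show "real (Suc n) * ramp b (1 / Suc n) x \<le> 1" by (simp add: field_simps)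
    qed
    have r_bound: "\<bar>r n x\<bar> \<le> 1" for n x
      using ramp01[of n a x] ramp01[of n "a + d" x] unfolding r_def right_diff_distrib by auto
    have r_meas: "r n \<in> borel_measurable lebesgue" for n
      unfolding r_def[abs_def] by (intro borel_measurable_times borel_measurable_diff measurable_ramp) auto
    have key: "real (Suc n) * (F (a + 1 / Suc n) - F a) - real (Suc n) * (F (a + d + 1 / Suc n) - F (a + d))
       = - (LINT x|lebesgue. (indicator I x * g x) * r n x)" for n
    proof -
      let ?h = "1 / real (Suc n)"
      have "(LINT x|lebesgue. (indicator {a..a + ?h + d} x * g x) * (ramp a ?h x - ramp (a + d) ?h x))
        = (LINT x|lebesgue. (indicator I x * g x) * (ramp a ?h x - ramp (a + d) ?h x))"
      proof (intro Bochner_Integration.integral_cong refl)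
        fix x :: real
        have "?h \<le> 1" by simp
        then have "x \<in> {a..a + ?h + d} \<Longrightarrow> x \<in> I" using d unfolding I_def atLeastAtMost_iff by linarith
        moreover have "ramp a ?h x - ramp (a + d) ?h x = 0" if "x \<notin> {a..a + ?h + d}"
          using that d by (auto simp: ramp_def simp del: of_nat_Suc)
        ultimately show "(indicator {a..a + ?h + d} x * g x) * (ramp a ?h x - ramp (a + d) ?h x)
            = (indicator I x * g x) * (ramp a ?h x - ramp (a + d) ?h x)"
          by (cases "x \<in> {a..a + ?h + d}") (simp_all del: of_nat_Suc)
      qed
      then have "integral {a..a + ?h} f - integral {a + d..a + ?h + d} f = - (LINT x|lebesgue. (indicator I x * g x) * (ramp a ?h x - ramp (a + d) ?h x))"
        using weak_deriv_ramp[OF wd a0 _ d, of ?h] by simp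
      moreover have "integral {a..a + ?h} f = F (a + ?h) - F a" "integral {a + d..a + ?h + d} f = F (a + d + ?h) - F (a + d)"
        using primitive_ofD(3)[OF F, of a "a + ?h"] primitive_ofD(3)[OF F, of "a + d" "a + d + ?h"] a0 d by (simp_all add: ac_simps)
      moreover have "(LINT x|lebesgue. (indicator I x * g x) * r n x) = real (Suc n) * (LINT x|lebesgue. (indicator I x * g x) * (ramp a ?h x - ramp (a + d) ?h x))"
        by (subst integral_mult_right_zero[symmetric]) (simp add: r_def ac_simps del: of_nat_Suc)
      ultimately show ?thesis
        by (simp only: right_diff_distrib[symmetric] mult_minus_right[symmetric])
    qed
    have A: "(\<lambda>n. LINT x|lebesgue. (indicator I x * g x) * r n x) \<longlonglongrightarrow> (LINT x|lebesgue. (indicator I x * g x) * indicator {a<..a + d} x)"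
    proof (rule integral_dominated_convergence[where w = "\<lambda>x. \<bar>indicator I x * g x\<bar>"])
      show "AE x in lebesgue. (\<lambda>n. (indicator I x * g x) * r n x) \<longlonglongrightarrow> (indicator I x * g x) * indicator {a<..a + d} x"
        by (intro AE_I2 tendsto_intros r_conv)
      show "AE x in lebesgue. norm ((indicator I x * g x) * r n x) \<le> \<bar>indicator I x * g x\<bar>" for n
        using r_bound by (intro AE_I2) (simp add: abs_mult mult_left_le)
    qed (use Ig r_meas in \<open>auto intro!: borel_measurable_times borel_measurable_indicator borel_measurable_integrable[OF Ig]\<close>)
    have B: "(LINT x|lebesgue. (indicator I x * g x) * indicator {a<..a + d} x) = G (a + d) - G a"
    proof -
      have "(LINT x|lebesgue. (indicator I x * g x) * indicator {a<..a + d} x) = (LINT x|lebesgue. indicator {a..a + d} x * g x)"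
      proof (rule integral_cong_AE)
        show "(\<lambda>x. indicator {a..a + d} x * g x) \<in> borel_measurable lebesgue"
          using primitive_ofD(1)[OF G a0, of "a + d"] d by (intro borel_measurable_integrable integral_lebesgue_indicator) auto
        show "AE x in lebesgue. (indicator I x * g x) * indicator {a<..a + d} x = indicator {a..a + d} x * g x"
          using AE_lebesgue_not_eq[of a] by eventually_elim (use d in \<open>auto simp: I_def split: split_indicator\<close>)
      qed (auto intro!: borel_measurable_times borel_measurable_indicator borel_measurable_integrable[OF Ig])
      then show ?thesis using primitive_ofD[OF G a0, of "a + d"] d by (simp add: integral_lebesgue_indicator)
    qed
    have C: "(\<lambda>n. real (Suc n) * (F (a + 1 / Suc n) - F a) - real (Suc n) * (F (a + d + 1 / Suc n) - F (a + d))) \<longlonglongrightarrow> f a - f (a + d)"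
      using a ad by (intro tendsto_diff) (auto simp: L_def)
    have "f a - f (a + d) = - (G (a + d) - G a)"
      by (rule LIMSEQ_unique[OF C[unfolded key] tendsto_minus[OF A[unfolded B]]])
    then show ?thesis by simp
  qed
  \<comment> \<open>A base point in \<open>L\<close> fixes the additive constant of the
    primitive.\<close>
  have "L \<noteq> {}"
  proof
    assume "L = {}"
    with L have "AE x in lborel. \<not> 0 < (x :: real)" by (simp add: AE_completion_iff)
    then have "emeasure lborel {x \<in> space lborel. \<not> \<not> 0 < (x :: real)} = 0"
      by (subst (asm) AE_iff_measurable[OF _ refl]) auto
    moreover have "emeasure lborel {0<..1 :: real} \<le> emeasure lborel {0 :: real<..}"
      by (intro emeasure_mono) auto
    ultimately show False by (simp add: greaterThan_def[symmetric])
  qed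
  then obtain x0 where x0: "x0 \<in> L" by blast
  show ?thesis
  proof
    show "primitive_of (\<lambda>x. G x + (f x0 - G x0)) g" using G by (simp add: primitive_of_def)
    show "AE x in lebesgue. 0 < x \<longrightarrow> f x = G x + (f x0 - G x0)"
      using L
    proof eventually_elim
      case (elim x)
      show ?case
      proof
        assume "0 < x"
        then have x: "x \<in> L" using elim by simp
        show "f x = G x + (f x0 - G x0)"
          using diff[OF x0, of "x - x0"] diff[OF x, of "x0 - x"] x x0 by (cases x x0 rule: linorder_cases) auto
      qed
    qed
  qed
qed

lemma primitive_of_continuous:
  assumes f: "primitive_of f h" and x: "0 < x" shows "isCont f x"
proof -
  have "continuous_on {x/2..x+1} (\<lambda>y. f (x/2) + integral {x/2..y} h)"
    using primitive_ofD[OF f, of "x/2" "x+1"] x by (intro continuous_intros indefinite_integral_continuous_1) auto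
  moreover have "f (x/2) + integral {x/2..y} h = f y" if "y \<in> {x/2..x+1}" for y
    using primitive_ofD(3)[OF f, of "x/2" y] that x by auto
  ultimately have "continuous_on {x/2..x+1} f" by (rule continuous_on_eq)
  then show ?thesis by (rule continuous_on_interior) (use x in auto)
qed

text \<open>Integration by parts, that is \<open>primitive_of_mult\<close> for \<open>w\<close> and
  the test function.\<close>

lemma primitive_imp_weak_deriv:
  assumes w: "primitive_of w g" and fw: "AE x in lebesgue. 0 < x \<longrightarrow> f x = w x"
  shows "has_weak_deriv f g"
proof -
  have w_ai: "w absolutely_integrable_on {a..b}" if "0 < a" for a b
    using that primitive_of_continuous[OF w]
    by (intro absolutely_integrable_continuous_real continuous_at_imp_continuous_on) auto
  have f_ai: "f absolutely_integrable_on {a..b}" if "0 < a" for a b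
  proof (rule absolutely_integrable_spike[OF w_ai[OF that]])
    show "negligible {x. 0 < x \<and> f x \<noteq> w x}"
      using fw unfolding completion.AE_iff_null_sets negligible_iff_null_sets by simp
  qed (use that in auto)
  show ?thesis
    unfolding has_weak_deriv_def
  proof (intro conjI allI impI)
    show "loc_integrable f" "loc_integrable g"
      using f_ai primitive_ofD(1)[OF w] by (auto simp: loc_integrable_iff)
    fix p assume p: "test_function p"
    then obtain a b where ab: "0 < a" "a < b" and supp: "\<And>x. x \<notin> {a..b} \<Longrightarrow> p x = 0"
      by (auto simp: test_function_def)
    have "((deriv ^^ 0) p) differentiable (at x)" "((deriv ^^ 1) p) differentiable (at x)" for x
      using p unfolding test_function_def by blast+
    then have D: "(p has_real_derivative deriv p x) (at x)" and dD: "isCont (deriv p) x" for x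
      by (auto simp: DERIV_deriv_iff_real_differentiable differentiable_imp_continuous_within)
    have supp': "deriv p x = 0" if "x \<notin> {a..b}" for x
    proof -
      have "((\<lambda>x. 0) has_real_derivative 0) (at x)" by simp
      then have "(p has_real_derivative 0) (at x)"
        by (rule has_field_derivative_transform_within_open[where S = "- {a..b}"]) (use that supp in auto)
      then show ?thesis by (rule DERIV_imp_deriv)
    qed
    have pp: "primitive_of p (deriv p)"
      unfolding primitive_of_def
    proof (intro allI impI conjI)
      fix u v :: real assume "0 < u \<and> u \<le> v"
      then show "deriv p absolutely_integrable_on {u..v}" "p v - p u = integral {u..v} (deriv p)"
        using D dD
        by (auto intro!: absolutely_integrable_continuous_real continuous_at_imp_continuous_on integral_unique[symmetric] fundamental_theorem_of_calculus
             simp: has_real_derivative_iff_has_vector_derivative[symmetric] has_field_derivative_at_within)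
    qed
    \<comment> \<open>Strictly larger than the support, so that \<open>p\<close> vanishes at both
      end points and no boundary terms remain.\<close>
    define I where "I = {a/2..b+1}"
    have I: "0 < a/2" "a/2 \<le> b+1" using ab by auto
    have bounded_mult: "(\<lambda>x. q x * k x) absolutely_integrable_on I" if "\<And>x. isCont q x" "k absolutely_integrable_on I" for q k :: "real \<Rightarrow> real"
    proof (rule absolutely_integrable_bounded_measurable_product_real[OF _ _ _ that(2)])
      have "continuous_on I q" using that by (auto intro: continuous_at_imp_continuous_on)
      then show "q \<in> borel_measurable (lebesgue_on I)" "bounded (q ` I)"
        by (auto intro!: continuous_imp_measurable_on_sets_lebesgue compact_imp_bounded compact_continuous_image simp: I_def)
    qed (simp add: I_def)
    have 1: "(LINT x|Rplus. k x * q x) = integral I (\<lambda>x. q x * k x)"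
      if "\<And>x. isCont q x" "k absolutely_integrable_on I" "\<And>x. x \<notin> {a..b} \<Longrightarrow> q x = 0" for k q :: "real \<Rightarrow> real"
    proof -
      have "(LINT x|Rplus. k x * q x) = (LINT x|lebesgue. (indicator I x * k x) * q x)"
        unfolding I_def by (rule integral_Rplus_eq) (use ab that in auto)
      also have "\<dots> = (LINT x|lebesgue. indicator I x * (q x * k x))" by (simp add: ac_simps)
      also have "\<dots> = integral I (\<lambda>x. q x * k x)"
        using bounded_mult[OF that(1,2)] unfolding I_def by (rule integral_lebesgue_indicator)
      finally show ?thesis .
    qed
    have "(LINT x|Rplus. f x * deriv p x) = integral I (\<lambda>x. deriv p x * f x)"
      using f_ai[OF I(1)] dD supp' by (intro 1) (auto simp: I_def)
    also have "\<dots> = integral I (\<lambda>x. deriv p x * w x)"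
      by (rule integral_spike[of "{x. 0 < x \<and> f x \<noteq> w x}"])
         (use fw ab in \<open>auto simp: I_def completion.AE_iff_null_sets negligible_iff_null_sets\<close>)
    also have "\<dots> = - integral I (\<lambda>x. p x * g x)"
    proof -
      have "integral I (\<lambda>x. p x * g x + w x * deriv p x) = w (b+1) * p (b+1) - w (a/2) * p (a/2)"
        using primitive_ofD(3)[OF primitive_of_mult[OF w pp] I] by (simp add: I_def)
      also have "\<dots> = 0" using ab supp by simp
      moreover have "integral I (\<lambda>x. p x * g x + w x * deriv p x) = integral I (\<lambda>x. p x * g x) + integral I (\<lambda>x. deriv p x * w x)"
        using bounded_mult[of p g] bounded_mult[of "deriv p" w] DERIV_isCont[OF D] dD w_ai[OF I(1)] primitive_ofD(1)[OF w I]
        by (subst Henstock_Kurzweil_Integration.integral_add) (auto simp: I_def mult.commute intro: set_lebesgue_integral_eq_integral(1))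
      ultimately show ?thesis by simp
    qed
    also have "integral I (\<lambda>x. p x * g x) = (LINT x|Rplus. g x * p x)"
      using primitive_ofD(1)[OF w I] DERIV_isCont[OF D] supp by (intro 1[symmetric]) (auto simp: I_def)
    finally show "(LINT x|Rplus. f x * deriv p x) = - (LINT x|Rplus. g x * p x)" .
  qed
qed

lemma weak_deriv_difference_quotient:
  assumes wd: "has_weak_deriv f g"
  shows "AE x in lborel. 0 < x \<longrightarrow> (\<lambda>n. real (Suc n) * (f (x + 1 / Suc n) - f x)) \<longlonglongrightarrow> g x"
proof -
  obtain w where w: "primitive_of w g" "AE x in lebesgue. 0 < x \<longrightarrow> f x = w x"
    using weak_deriv_imp_primitive[OF wd] .
  have fw: "AE x in lborel. 0 < x \<longrightarrow> f x = w x" using w(2) by (simp add: AE_completion_iff)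
  have "AE x in lborel. \<forall>n. 0 < x + 1 / Suc n \<longrightarrow> f (x + 1 / Suc n) = w (x + 1 / Suc n)"
    unfolding AE_all_countable using AE_lborel_shift[OF fw] by blast
  moreover have "AE x in lborel. 0 < x \<longrightarrow> (\<lambda>n. real (Suc n) * (w (x + 1 / Suc n) - w x)) \<longlonglongrightarrow> g x"
    using primitive_of_AE_difference_quotient[OF w(1)] by (simp add: AE_completion_iff)
  ultimately show ?thesis using fw
  proof eventually_elim
    case (elim x)
    show ?case
    proof
      assume "0 < x"
      then have "0 < x + 1 / Suc n" for n by (simp add: add_pos_pos)
      then have "(\<lambda>n. real (Suc n) * (f (x + 1 / Suc n) - f x)) = (\<lambda>n. real (Suc n) * (w (x + 1 / Suc n) - w x))"
        using elim \<open>0 < x\<close> by auto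
      then show "(\<lambda>n. real (Suc n) * (f (x + 1 / Suc n) - f x)) \<longlonglongrightarrow> g x" using elim \<open>0 < x\<close> by simp
    qed
  qed
qed

lemma has_weak_deriv_weak_deriv: "has_weak_deriv f g \<Longrightarrow> has_weak_deriv f (weak_deriv f)"
  unfolding weak_deriv_def by (rule someI[of "has_weak_deriv f"])

text \<open>Both versions are limits almost everywhere of the same difference quotients of
  \<open>f\<close>.\<close>

lemma weak_deriv_unique:
  assumes "has_weak_deriv f g" "has_weak_deriv f h"
  shows "AE x in lborel. 0 < x \<longrightarrow> g x = h x"
  using weak_deriv_difference_quotient[OF assms(1)] weak_deriv_difference_quotient[OF assms(2)]
  by eventually_elim (auto intro: LIMSEQ_unique)

subsection \<open>The Dirichlet form controls the derivative\<close>

text \<open>In units of \<open>1/N\<close>: two points at distance at most 1 lie at distance at least 4 from each other's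
  mirror image as soon as both are to the right of 2.\<close>

definition form_const :: real where "form_const = (exp (- 1 / 8) - exp (- 2)) / sqrt (8 * pi)"

lemma form_const_pos: "0 < form_const"
  by (simp add: form_const_def)

lemma heat_kernel_scaled:
  assumes "N > 0" shows "heat_kernel (2 * (1 / N\<^sup>2)) y = N / sqrt (8 * pi) * exp (- ((N * y)\<^sup>2 / 8))"
proof -
  have "sqrt (4 * pi * (2 * (1 / N\<^sup>2))) = sqrt (8 * pi / N\<^sup>2)" by (simp add: field_simps)
  also have "\<dots> = sqrt (8 * pi) / N" using assms by (simp add: real_sqrt_divide)
  finally show ?thesis using assms by (simp add: heat_kernel_def power_mult_distrib)
qed

lemma dirichlet_kernel_lower:
  assumes N: "N > 0" and x: "2 / N < x" and y: "x < y" "y < x + 1 / N"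
  shows "N * form_const \<le> dirichlet_kernel (2 * (1 / N\<^sup>2)) x y"
proof -
  have x0: "0 < x" using N x by (meson divide_pos_pos less_trans zero_less_numeral)
  have "(N * (x - y))\<^sup>2 \<le> 1"
  proof -
    have "\<bar>N * (x - y)\<bar> \<le> 1" using N y by (simp add: abs_mult field_simps)
    then show ?thesis using power_mono[of "\<bar>N * (x - y)\<bar>" 1 2] by simp
  qed
  then have 1: "exp (- 1 / 8) \<le> exp (- ((N * (x - y))\<^sup>2 / 8))" by simp
  \<comment> \<open>Both points exceed \<open>2 / N\<close>; the exponent of the mirror term is thus
    at least 16/8, which is the 2 in \<open>form_const\<close>.\<close>
  have "4 \<le> N * (x + y)"
    using N x y by (simp add: field_simps) (smt (verit) mult_less_cancel_left_pos)
  then have "4\<^sup>2 \<le> (N * (x + y))\<^sup>2" by (intro power_mono) auto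
  then have 2: "exp (- ((N * (x + y))\<^sup>2 / 8)) \<le> exp (- 2)" by simp
  have "N * form_const = N / sqrt (8 * pi) * (exp (- 1 / 8) - exp (- 2))"
    by (simp add: form_const_def)
  also have "\<dots> \<le> N / sqrt (8 * pi) * (exp (- ((N * (x - y))\<^sup>2 / 8)) - exp (- ((N * (x + y))\<^sup>2 / 8)))"
    using N by (intro mult_left_mono diff_mono 1 2) auto
  also have "\<dots> = dirichlet_kernel (2 * (1 / N\<^sup>2)) x y"
    using N x0 y unfolding dirichlet_kernel_def heat_kernel_scaled[OF N] by (simp add: right_diff_distrib)
  finally show ?thesis .
qed

text \<open>Only the pairs with \<open>x > 2 / N\<close> and \<open>x < y < x + 1 / N\<close> are
  kept, where \<open>dirichlet_kernel_lower\<close> applies. The substitution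
  \<open>y = x + z / N\<close> turns the form into an average of squared difference
  quotients.\<close>

lemma dirichlet_form_lower:
  assumes [measurable]: "w \<in> borel_measurable borel" and N: "N > 0"
  shows "ennreal form_const * (\<integral>\<^sup>+x. \<integral>\<^sup>+z. indicator {2 / N<..} x * indicator {0<..<1} z * ennreal ((N * (w (x + z / N) - w x))\<^sup>2) \<partial>lborel \<partial>lborel)
    \<le> ennreal (N\<^sup>2) * dirichlet_form (1 / N\<^sup>2) w"
proof -
  have "ennreal form_const * (\<integral>\<^sup>+x. \<integral>\<^sup>+z. indicator {2 / N<..} x * indicator {0<..<1} z * ennreal ((N * (w (x + z / N) - w x))\<^sup>2) \<partial>lborel \<partial>lborel)
    = (\<integral>\<^sup>+x. ennreal form_const * (\<integral>\<^sup>+z. indicator {2 / N<..} x * indicator {0<..<1} z * ennreal ((N * (w (x + z / N) - w x))\<^sup>2) \<partial>lborel) \<partial>lborel)"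
    by (intro nn_integral_cmult[symmetric]) measurable
  also have "\<dots> \<le> (\<integral>\<^sup>+x. ennreal (N\<^sup>2) * (\<integral>\<^sup>+y. ennreal (dirichlet_kernel (2 * (1 / N\<^sup>2)) x y * (w x - w y)\<^sup>2) \<partial>lborel) \<partial>lborel)"
  proof (rule nn_integral_mono)
    fix x
    have "ennreal form_const * (\<integral>\<^sup>+z. indicator {2 / N<..} x * indicator {0<..<1} z * ennreal ((N * (w (x + z / N) - w x))\<^sup>2) \<partial>lborel)
      = (\<integral>\<^sup>+z. ennreal form_const * (indicator {2 / N<..} x * indicator {0<..<1} z * ennreal ((N * (w (x + z / N) - w x))\<^sup>2)) \<partial>lborel)"
      by (intro nn_integral_cmult[symmetric]) measurable
    also have "\<dots> \<le> (\<integral>\<^sup>+z. ennreal N * ennreal (dirichlet_kernel (2 * (1 / N\<^sup>2)) x (x + 1 / N * z) * (w x - w (x + 1 / N * z))\<^sup>2) \<partial>lborel)"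
    proof (rule nn_integral_mono)
      fix z
      show "ennreal form_const * (indicator {2 / N<..} x * indicator {0<..<1} z * ennreal ((N * (w (x + z / N) - w x))\<^sup>2))
        \<le> ennreal N * ennreal (dirichlet_kernel (2 * (1 / N\<^sup>2)) x (x + 1 / N * z) * (w x - w (x + 1 / N * z))\<^sup>2)"
      proof (cases "2 / N < x \<and> 0 < z \<and> z < 1")
        case True
        have "N * form_const \<le> dirichlet_kernel (2 * (1 / N\<^sup>2)) x (x + 1 / N * z)"
          using True N by (intro dirichlet_kernel_lower) (auto simp: field_simps)
        then have "N * ((N * form_const) * (w (x + z / N) - w x)\<^sup>2) \<le> N * (dirichlet_kernel (2 * (1 / N\<^sup>2)) x (x + 1 / N * z) * (w (x + z / N) - w x)\<^sup>2)"
          using N by (intro mult_left_mono mult_right_mono) auto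
        then have "form_const * (N * (w (x + z / N) - w x))\<^sup>2 \<le> N * (dirichlet_kernel (2 * (1 / N\<^sup>2)) x (x + 1 / N * z) * (w x - w (x + 1 / N * z))\<^sup>2)"
          by (simp add: power_mult_distrib power2_eq_square[of N] ac_simps power2_commute)
        then have "ennreal (form_const * (N * (w (x + z / N) - w x))\<^sup>2) \<le> ennreal (N * (dirichlet_kernel (2 * (1 / N\<^sup>2)) x (x + 1 / N * z) * (w x - w (x + 1 / N * z))\<^sup>2))"
          by (rule ennreal_leI)
        then show ?thesis using True N form_const_pos by (simp add: ennreal_mult' ennreal_mult'')
      qed auto
    qed
    also have "\<dots> = ennreal (N\<^sup>2) * (\<bar>1 / N\<bar> * (\<integral>\<^sup>+z. ennreal (dirichlet_kernel (2 * (1 / N\<^sup>2)) x (x + 1 / N * z) * (w x - w (x + 1 / N * z))\<^sup>2) \<partial>lborel))"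
    proof -
      have "ennreal (N\<^sup>2) * ennreal \<bar>1 / N\<bar> = ennreal N"
        using N by (simp add: ennreal_mult[symmetric] power2_eq_square)
      then show ?thesis by (subst nn_integral_cmult) (simp_all add: mult.assoc[symmetric])
    qed
    also have "\<dots> = ennreal (N\<^sup>2) * (\<integral>\<^sup>+y. ennreal (dirichlet_kernel (2 * (1 / N\<^sup>2)) x y * (w x - w y)\<^sup>2) \<partial>lborel)"
      using N by (subst nn_integral_real_affine[of _ "1 / N" x]) auto
    finally show "ennreal form_const * (\<integral>\<^sup>+z. indicator {2 / N<..} x * indicator {0<..<1} z * ennreal ((N * (w (x + z / N) - w x))\<^sup>2) \<partial>lborel)
      \<le> ennreal (N\<^sup>2) * (\<integral>\<^sup>+y. ennreal (dirichlet_kernel (2 * (1 / N\<^sup>2)) x y * (w x - w y)\<^sup>2) \<partial>lborel)" .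
  qed
  also have "\<dots> = ennreal (N\<^sup>2) * dirichlet_form (1 / N\<^sup>2) w"
    unfolding dirichlet_form_def by (intro nn_integral_cmult) measurable
  finally show ?thesis .
qed

lemma dirichlet_form_cong_AE:
  assumes "AE x in lborel. 0 < x \<longrightarrow> u x = w x"
  shows "dirichlet_form t u = dirichlet_form t w"
  unfolding dirichlet_form_def
proof (rule nn_integral_cong_AE, use assms in eventually_elim)
  case (elim x)
  show ?case
  proof (rule nn_integral_cong_AE, use assms in eventually_elim)
    case (elim y)
    then show ?case using \<open>0 < x \<longrightarrow> u x = w x\<close> by (auto simp: dirichlet_kernel_def)
  qed
qed

text \<open>The difference quotient with step \<open>z / Suc n\<close>, rescaled by
  \<open>Suc n\<close>, tends to \<open>z * g x\<close>. Fatou's lemma in \<open>z\<close> and in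
  \<open>x\<close> gives the bound, and the integral of z^2 over (0,1) is the factor 1/3.\<close>

lemma dirichlet_form_liminf:
  assumes w: "primitive_of w g" and [measurable]: "w \<in> borel_measurable borel" "g \<in> borel_measurable borel"
    and u: "AE x in lborel. 0 < x \<longrightarrow> u x = w x"
  shows "ennreal (form_const / 3) * (\<integral>\<^sup>+x. indicator {0<..} x * ennreal ((g x)\<^sup>2) \<partial>lborel)
    \<le> liminf (\<lambda>n. ennreal ((real (Suc n))\<^sup>2) * dirichlet_form (1 / (real (Suc n))\<^sup>2) u)"
proof -
  define h where "h n x z = ennreal form_const * (indicator {2 / real (Suc n)<..} x * indicator {0<..<1} z * ennreal ((real (Suc n) * (w (x + z / Suc n) - w x))\<^sup>2))" for n x z
  have [measurable]: "(\<lambda>(x, z). h n x z) \<in> borel_measurable (borel \<Otimes>\<^sub>M borel)" for n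
    unfolding h_def indicator_def greaterThan_iff greaterThanLessThan_iff by measurable
  have lim: "AE x in lborel. \<forall>z. liminf (\<lambda>n. h n x z) = (indicator {0<..} x * ennreal ((g x)\<^sup>2)) * (indicator {0<..<1} z * ennreal (form_const * z\<^sup>2))"
    using primitive_of_AE_has_derivative[OF w, unfolded AE_completion_iff]
  proof eventually_elim
    case (elim x)
    show ?case
    proof
      fix z :: real
      show "liminf (\<lambda>n. h n x z) = (indicator {0<..} x * ennreal ((g x)\<^sup>2)) * (indicator {0<..<1} z * ennreal (form_const * z\<^sup>2))"
      proof (cases "0 < x \<and> 0 < z \<and> z < 1")
        case True
        then have d: "((\<lambda>d. (w (x + d) - w x) / d) \<longlongrightarrow> g x) (at_right 0)" using elim by simp
        have "(\<lambda>n. z * inverse (real (Suc n))) \<longlonglongrightarrow> z * 0"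
          by (intro tendsto_intros LIMSEQ_inverse_real_of_nat)
        then have "filterlim (\<lambda>n. z / real (Suc n)) (at_right 0) sequentially"
          using True by (intro tendsto_imp_filterlim_at_right) (auto simp: divide_inverse)
        from filterlim_compose[OF d this]
        have "(\<lambda>n. (z * ((w (x + z / Suc n) - w x) / (z / Suc n)))\<^sup>2) \<longlonglongrightarrow> (z * g x)\<^sup>2"
          by (intro tendsto_intros)
        then have "(\<lambda>n. (real (Suc n) * (w (x + z / Suc n) - w x))\<^sup>2) \<longlonglongrightarrow> (g x)\<^sup>2 * z\<^sup>2"
          using True by (simp add: power_mult_distrib mult.commute)
        from tendsto_mult[OF tendsto_const this]
        have c: "(\<lambda>n. ennreal (form_const * (real (Suc n) * (w (x + z / Suc n) - w x))\<^sup>2)) \<longlonglongrightarrow> ennreal (form_const * ((g x)\<^sup>2 * z\<^sup>2))"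
          by (rule tendsto_ennrealI)
        obtain M where M: "2 / x < real M" using reals_Archimedean2 by blast
        have "h n x z = ennreal (form_const * (real (Suc n) * (w (x + z / Suc n) - w x))\<^sup>2)" if "M \<le> n" for n
        proof -
          have "2 / x < real (Suc n)" using M that by linarith
          then have "2 / real (Suc n) < x" using True by (simp add: field_simps)
          then show ?thesis using True form_const_pos by (simp add: h_def ennreal_mult)
        qed
        then have "eventually (\<lambda>n. ennreal (form_const * (real (Suc n) * (w (x + z / Suc n) - w x))\<^sup>2) = h n x z) sequentially"
          unfolding eventually_sequentially by metis
        from Lim_transform_eventually[OF c this] have "(\<lambda>n. h n x z) \<longlonglongrightarrow> ennreal (form_const * ((g x)\<^sup>2 * z\<^sup>2))" .
        then have "liminf (\<lambda>n. h n x z) = ennreal (form_const * ((g x)\<^sup>2 * z\<^sup>2))"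
          by (intro lim_imp_Liminf) auto
        then show ?thesis using True form_const_pos by (simp add: ennreal_mult ac_simps)
      next
        case False
        have "h n x z = 0" for n
        proof (cases "0 < x")
          case True then show ?thesis using False by (simp add: h_def)
        next
          case False
          have "0 < 2 / real (Suc n)" by simp
          then have "\<not> 2 / real (Suc n) < x" using False by linarith
          then show ?thesis by (simp add: h_def)
        qed
        then show ?thesis using False by (auto simp: Liminf_const)
      qed
    qed
  qed
  have third: "(\<integral>\<^sup>+z. indicator {0<..<1 :: real} z * ennreal (form_const * z\<^sup>2) \<partial>lborel) = ennreal (form_const / 3)"
  proof -
    have "(\<integral>\<^sup>+z. indicator {0<..<1 :: real} z * ennreal (form_const * z\<^sup>2) \<partial>lborel) = (\<integral>\<^sup>+z. ennreal (form_const * z\<^sup>2) * indicator {0..1} z \<partial>lborel)"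
    proof (rule nn_integral_cong_AE)
      show "AE z in lborel. indicator {0<..<1 :: real} z * ennreal (form_const * z\<^sup>2) = ennreal (form_const * z\<^sup>2) * indicator {0..1} z"
        using AE_lborel_singleton[of 0] AE_lborel_singleton[of 1] by eventually_elim (auto split: split_indicator)
    qed
    also have "\<dots> = ennreal (form_const * 1 ^ 3 / 3 - form_const * 0 ^ 3 / 3)"
      using form_const_pos
      by (intro nn_integral_FTC_Icc[where F = "\<lambda>z. form_const * z ^ 3 / 3"]) (auto intro!: derivative_eq_intros simp: power2_eq_square power3_eq_cube)
    finally show ?thesis by simp
  qed
  have "ennreal (form_const / 3) * (\<integral>\<^sup>+x. indicator {0<..} x * ennreal ((g x)\<^sup>2) \<partial>lborel)
    = (\<integral>\<^sup>+x. (indicator {0<..} x * ennreal ((g x)\<^sup>2)) * ennreal (form_const / 3) \<partial>lborel)"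
    by (subst nn_integral_multc) (auto simp: mult.commute)
  also have "\<dots> = (\<integral>\<^sup>+x. \<integral>\<^sup>+z. liminf (\<lambda>n. h n x z) \<partial>lborel \<partial>lborel)"
  proof (rule nn_integral_cong_AE, use lim in eventually_elim)
    case (elim x)
    then show ?case unfolding third[symmetric] by (simp add: nn_integral_cmult)
  qed
  also have "\<dots> \<le> (\<integral>\<^sup>+x. liminf (\<lambda>n. \<integral>\<^sup>+z. h n x z \<partial>lborel) \<partial>lborel)"
    by (intro nn_integral_mono nn_integral_liminf) measurable
  also have "\<dots> \<le> liminf (\<lambda>n. \<integral>\<^sup>+x. \<integral>\<^sup>+z. h n x z \<partial>lborel \<partial>lborel)"
    by (intro nn_integral_liminf) measurable
  also have "\<dots> \<le> liminf (\<lambda>n. ennreal ((real (Suc n))\<^sup>2) * dirichlet_form (1 / (real (Suc n))\<^sup>2) u)"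
  proof (intro Liminf_mono always_eventually allI)
    fix n
    have "(\<integral>\<^sup>+x. \<integral>\<^sup>+z. h n x z \<partial>lborel \<partial>lborel)
      = (\<integral>\<^sup>+x. ennreal form_const * (\<integral>\<^sup>+z. indicator {2 / real (Suc n)<..} x * indicator {0<..<1} z * ennreal ((real (Suc n) * (w (x + z / Suc n) - w x))\<^sup>2) \<partial>lborel) \<partial>lborel)"
      unfolding h_def by (intro nn_integral_cong nn_integral_cmult) measurable
    also have "\<dots> = ennreal form_const * (\<integral>\<^sup>+x. \<integral>\<^sup>+z. indicator {2 / real (Suc n)<..} x * indicator {0<..<1} z * ennreal ((real (Suc n) * (w (x + z / Suc n) - w x))\<^sup>2) \<partial>lborel \<partial>lborel)"
      by (rule nn_integral_cmult) measurable
    also have "\<dots> \<le> ennreal ((real (Suc n))\<^sup>2) * dirichlet_form (1 / (real (Suc n))\<^sup>2) u"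
      unfolding dirichlet_form_cong_AE[OF u] by (rule dirichlet_form_lower) auto
    finally show "(\<integral>\<^sup>+x. \<integral>\<^sup>+z. h n x z \<partial>lborel \<partial>lborel) \<le> ennreal ((real (Suc n))\<^sup>2) * dirichlet_form (1 / (real (Suc n))\<^sup>2) u" .
  qed
  finally show ?thesis .
qed

subsection \<open>The boundary term\<close>

text \<open>The Poisson kernel of the heat equation on the half line, extended by 0 like
  \<open>dirichlet_kernel\<close>.\<close>

definition boundary_kernel :: "real \<Rightarrow> real \<Rightarrow> real" where
  "boundary_kernel r x = (if 0 < r \<and> 0 < x then x / r * heat_kernel r x else 0)"

text \<open>For positive arguments this is the \<open>x\<close> derivative of
  \<open>boundary_kernel\<close> and, by the heat equation, also the \<open>r\<close> derivative of
  \<open>- 2 * heat_kernel r x\<close>. The second reading makes its time integral explicit.\<close>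

definition boundary_kernel_deriv :: "real \<Rightarrow> real \<Rightarrow> real" where
  "boundary_kernel_deriv r x = (if 0 < r \<and> 0 < x then (1 / r - x\<^sup>2 / (2 * r\<^sup>2)) * heat_kernel r x else 0)"

lemma measurable_boundary_kernel [measurable (raw)]:
  assumes [measurable]: "f \<in> borel_measurable M" "g \<in> borel_measurable M"
  shows "(\<lambda>x. boundary_kernel (f x) (g x)) \<in> borel_measurable M"
    "(\<lambda>x. boundary_kernel_deriv (f x) (g x)) \<in> borel_measurable M"
  unfolding boundary_kernel_def boundary_kernel_deriv_def by measurable

lemma boundary_kernel_nonneg [simp]: "0 \<le> boundary_kernel r x"
  by (simp add: boundary_kernel_def heat_kernel_nonneg)

lemma heat_kernel_has_derivative:
  assumes "0 < r" shows "(heat_kernel r has_real_derivative - (x / (2 * r) * heat_kernel r x)) (at x)"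
  unfolding heat_kernel_def[abs_def] using assms
  by (auto intro!: derivative_eq_intros simp: field_simps)

lemma deriv_heat_kernel: "0 < x \<Longrightarrow> 0 \<le> r \<Longrightarrow> - 2 * deriv (heat_kernel r) x = boundary_kernel r x"
proof (cases "r = 0")
  \<comment> \<open>Division by 0 makes \<open>heat_kernel 0\<close> the zero function, so the
    formula extends to \<open>r = 0\<close>.\<close>
  case True
  then have "heat_kernel r = (\<lambda>x. 0)" by (auto simp: heat_kernel_def)
  then show ?thesis using True by (simp add: boundary_kernel_def)
next
  case False
  assume "0 < x" "0 \<le> r"
  then show ?thesis using False
    by (subst DERIV_imp_deriv[OF heat_kernel_has_derivative]) (auto simp: boundary_kernel_def field_simps)
qed

lemma boundary_kernel_has_derivative:
  assumes "0 < r" "0 < x"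
  shows "(boundary_kernel r has_real_derivative boundary_kernel_deriv r x) (at x)"
proof -
  have "((\<lambda>x. x / r * heat_kernel r x) has_real_derivative boundary_kernel_deriv r x) (at x)"
    using assms by (auto intro!: derivative_eq_intros heat_kernel_has_derivative simp: boundary_kernel_deriv_def field_simps power2_eq_square)
  then show ?thesis
    by (rule has_field_derivative_transform_within_open[where S = "{0<..}"]) (use assms in \<open>auto simp: boundary_kernel_def\<close>)
qed

lemma heat_kernel_has_time_derivative:
  assumes "0 < r" "0 < x"
  shows "((\<lambda>r. - 2 * heat_kernel r x) has_real_derivative boundary_kernel_deriv r x) (at r)"
proof -
  have s: "sqrt (4 * pi * r) = 2 * sqrt pi * sqrt r" for r by (simp add: real_sqrt_mult)
  have u: "((\<lambda>r. 1 / sqrt (4 * pi * r)) has_real_derivative - (1 / sqrt (4 * pi * r) / (2 * r))) (at r)"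
    unfolding s using assms
    by (auto intro!: derivative_eq_intros simp: field_simps)
  have e: "((\<lambda>r. exp (- (x\<^sup>2 / (4 * r)))) has_real_derivative exp (- (x\<^sup>2 / (4 * r))) * (x\<^sup>2 / (4 * r\<^sup>2))) (at r)"
    using assms by (auto intro!: derivative_eq_intros simp: field_simps power2_eq_square)
  have alg: "- 2 * (- (U / (2 * r)) * E + E * (x\<^sup>2 / (4 * r\<^sup>2)) * U) = (1 / r - x\<^sup>2 / (2 * r\<^sup>2)) * (U * E)" for U E
    using assms by (simp add: field_simps power2_eq_square)
  have "((\<lambda>r. - 2 * heat_kernel r x) has_real_derivative - 2 * (- (1 / sqrt (4 * pi * r) / (2 * r)) * exp (- (x\<^sup>2 / (4 * r)))
       + exp (- (x\<^sup>2 / (4 * r))) * (x\<^sup>2 / (4 * r\<^sup>2)) * (1 / sqrt (4 * pi * r)))) (at r)"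
    unfolding heat_kernel_def by (intro DERIV_cmult DERIV_mult u e)
  also have "- 2 * (- (1 / sqrt (4 * pi * r) / (2 * r)) * exp (- (x\<^sup>2 / (4 * r)))
       + exp (- (x\<^sup>2 / (4 * r))) * (x\<^sup>2 / (4 * r\<^sup>2)) * (1 / sqrt (4 * pi * r)))
     = (1 / r - x\<^sup>2 / (2 * r\<^sup>2)) * (1 / sqrt (4 * pi * r) * exp (- (x\<^sup>2 / (4 * r))))"
    by (rule alg)
  finally show ?thesis using assms by (simp add: boundary_kernel_deriv_def heat_kernel_def)
qed

lemma exp_minus_le: "0 \<le> z \<Longrightarrow> exp (- z) \<le> 1 / (1 + z)" for z :: real
  using exp_ge_add_one_self[of z] by (simp add: exp_minus field_simps)

text \<open>The exponential is replaced by a rational majorant, after which the primitive in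
  \<open>r\<close> is an arctangent.\<close>

lemma boundary_kernel_le:
  assumes "0 < r" "0 < x"
  shows "boundary_kernel r x \<le> 2 / sqrt pi * (x / ((x\<^sup>2 + 4 * r) * sqrt r))"
proof -
  have "exp (- (x\<^sup>2 / (4 * r))) \<le> 1 / (1 + x\<^sup>2 / (4 * r))"
    using assms by (intro exp_minus_le) auto
  also have "\<dots> = 4 * r / (x\<^sup>2 + 4 * r)" using assms by (simp add: field_simps)
  finally have "x / r * (1 / sqrt (4 * pi * r) * exp (- (x\<^sup>2 / (4 * r)))) \<le> x / r * (1 / sqrt (4 * pi * r) * (4 * r / (x\<^sup>2 + 4 * r)))"
    using assms by (intro mult_left_mono) auto
  also have s: "sqrt (4 * pi * r) = 2 * sqrt pi * sqrt r" by (simp add: real_sqrt_mult)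
  also have "x / r * (1 / (2 * sqrt pi * sqrt r) * (4 * r / (x\<^sup>2 + 4 * r))) = 2 / sqrt pi * (x / ((x\<^sup>2 + 4 * r) * sqrt r))"
    using assms by (simp add: field_simps)
  finally show ?thesis using assms by (simp add: boundary_kernel_def heat_kernel_def s)
qed

text \<open>The arctangent is at most pi/2, so the integral is at most sqrt(pi), uniformly in
  \<open>x\<close> and \<open>t\<close>; the constant 2 merely rounds this up.\<close>

lemma nn_integral_boundary_kernel_time:
  assumes "0 < t"
  shows "(\<integral>\<^sup>+r. ennreal (indicator {0<..<t} r * boundary_kernel r x) \<partial>lborel) \<le> ennreal 2"
proof (cases "0 < x")
  case True
  let ?f = "\<lambda>r. 2 / sqrt pi * (x / ((x\<^sup>2 + 4 * r) * sqrt r))"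
  let ?F = "\<lambda>r. 2 / sqrt pi * arctan (2 * sqrt r / x)"
  have D: "(?F has_real_derivative ?f r) (at r)" if "0 < r" for r
  proof -
    have "((\<lambda>r. arctan (2 * sqrt r / x)) has_real_derivative inverse (1 + (2 * sqrt r / x)\<^sup>2) * (2 * (inverse (sqrt r) / 2) / x)) (at r)"
      using that True by (auto intro!: derivative_eq_intros)
    from DERIV_cmult[OF this, of "2 / sqrt pi"]
    have "(?F has_real_derivative 2 / sqrt pi * (inverse (1 + (2 * sqrt r / x)\<^sup>2) * (2 * (inverse (sqrt r) / 2) / x))) (at r)" .
    moreover have "inverse (1 + (2 * sqrt r / x)\<^sup>2) * (2 * (inverse (sqrt r) / 2) / x) = x / ((x\<^sup>2 + 4 * r) * sqrt r)"
    proof -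
      have "1 + (2 * sqrt r / x)\<^sup>2 = (x\<^sup>2 + 4 * r) / x\<^sup>2"
        using that True by (simp add: power_divide power_mult_distrib field_simps)
      then show ?thesis using that True by (simp add: divide_simps power2_eq_square)
    qed
    ultimately show ?thesis by (simp only:)
  qed
  have hi: "(?f has_integral (?F t - ?F 0)) {0..t}"
  proof (rule fundamental_theorem_of_calculus_interior)
    show "continuous_on {0..t} ?F" using True by (intro continuous_intros) auto
    show "(?F has_vector_derivative ?f r) (at r)" if "r \<in> {0<..<t}" for r
      using D that by (simp add: has_real_derivative_iff_has_vector_derivative)
  qed (use assms in auto)
  have "(\<integral>\<^sup>+r. ennreal (indicator {0<..<t} r * boundary_kernel r x) \<partial>lborel) \<le> (\<integral>\<^sup>+r. ennreal (indicator {0..t} r * ?f r) \<partial>lborel)"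
    using boundary_kernel_le True by (intro nn_integral_mono ennreal_leI) (auto split: split_indicator)
  also have "\<dots> = ennreal (?F t - ?F 0)"
    by (rule nn_integral_has_integral_lebesgue[OF _ hi]) (use True in auto)
  also have "\<dots> \<le> ennreal 2"
  proof (rule ennreal_leI)
    have "arctan (2 * sqrt t / x) \<le> pi / 2" using arctan_ubound less_imp_le by blast
    then have "?F t - ?F 0 \<le> 2 / sqrt pi * (pi / 2)" by (simp add: divide_right_mono)
    also have "\<dots> = sqrt pi" by (simp add: real_div_sqrt)
    also have "\<dots> \<le> 2" using pi_less_4 real_sqrt_le_mono[of pi 4] by simp
    finally show "?F t - ?F 0 \<le> 2" .
  qed
  finally show ?thesis .
qed (simp add: boundary_kernel_def)

lemma nn_integral_powr:
  assumes "-1 < a" "0 < t"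
  shows "(\<integral>\<^sup>+r. ennreal (indicator {0<..<t} r * r powr a) \<partial>lborel) = ennreal (t powr (a + 1) / (a + 1))"
proof -
  have "(\<integral>\<^sup>+r. ennreal (indicator {0<..<t} r * r powr a) \<partial>lborel) = (\<integral>\<^sup>+r. ennreal (indicator {0..t} r * r powr a) \<partial>lborel)"
  proof (rule nn_integral_cong_AE)
    show "AE r in lborel. ennreal (indicator {0<..<t} r * r powr a) = ennreal (indicator {0..t} r * r powr a)"
      using AE_lborel_singleton[of 0] AE_lborel_singleton[of t] by eventually_elim (auto split: split_indicator)
  qed
  also have "\<dots> = ennreal (t powr (a + 1) / (a + 1))"
    using assms by (intro nn_integral_has_integral_lebesgue has_integral_powr_from_0) auto
  finally show ?thesis .
qed

lemma nn_integral_boundary_kernel_space: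
  assumes "0 < r"
  shows "(\<integral>\<^sup>+x. ennreal (boundary_kernel r x) \<partial>lborel) \<le> ennreal (r powr (- 1 / 2))"
proof -
  have "(\<integral>\<^sup>+x. ennreal (boundary_kernel r x) \<partial>lborel) = (\<integral>\<^sup>+x. ennreal (x / r * heat_kernel r x) * indicator {0..} x \<partial>lborel)"
    by (intro nn_integral_cong) (use assms in \<open>auto simp: boundary_kernel_def split: split_indicator\<close>)
  also have "\<dots> = ennreal (0 - (- 2 * heat_kernel r 0))"
  proof (rule nn_integral_FTC_atLeast)
    show "(\<lambda>x. x / r * heat_kernel r x) \<in> borel_measurable borel" by measurable
    show "((\<lambda>x. - 2 * heat_kernel r x) has_real_derivative x / r * heat_kernel r x) (at x)" for x
      using assms by (auto intro!: derivative_eq_intros heat_kernel_has_derivative)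
    show "0 \<le> x / r * heat_kernel r x" if "0 \<le> x" for x
      using assms that by (simp add: heat_kernel_nonneg)
    have "filterlim (\<lambda>x. 1 / (4 * r) * x\<^sup>2) at_top at_top"
      by (rule filterlim_tendsto_pos_mult_at_top[OF tendsto_const])
         (use assms in \<open>auto intro!: filterlim_pow_at_top filterlim_ident\<close>)
    then have "filterlim (\<lambda>x. - (1 / (4 * r) * x\<^sup>2)) at_bot at_top"
      by (simp only: filterlim_uminus_at_bot minus_minus)
    then have "((\<lambda>x. exp (- (1 / (4 * r) * x\<^sup>2))) \<longlongrightarrow> 0) at_top"
      by (rule filterlim_compose[OF exp_at_bot])
    then show "((\<lambda>x. - 2 * heat_kernel r x) \<longlongrightarrow> 0) at_top"
      unfolding heat_kernel_def by (intro tendsto_mult_right_zero) simp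
  qed
  also have "\<dots> \<le> ennreal (r powr (- 1 / 2))"
  proof (rule ennreal_leI)
    have "1 \<le> sqrt pi" using pi_gt3 by simp
    have "0 - (- 2 * heat_kernel r 0) = 1 / (sqrt pi * sqrt r)"
      by (simp add: heat_kernel_def real_sqrt_mult)
    also have "\<dots> \<le> 1 / (1 * sqrt r)"
      using assms \<open>1 \<le> sqrt pi\<close> by (intro divide_left_mono mult_right_mono) auto
    also have "\<dots> = r powr (- 1 / 2)" using assms powr_minus_divide[of r "1 / 2"] by (simp add: powr_half_sqrt)
    finally show "0 - (- 2 * heat_kernel r 0) \<le> r powr (- 1 / 2)" .
  qed
  finally show ?thesis .
qed

text \<open>Half of the Gaussian exponent is spent on absorbing the polynomial factor, through (1 +
  4z) exp(-z) \<le> 4 with \<open>z = x\<^sup>2 / (8 * r)\<close>.\<close>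

lemma boundary_kernel_deriv_le:
  assumes r: "0 < r"
  shows "\<bar>boundary_kernel_deriv r x\<bar> \<le> 2 * (r powr (- 3 / 2) * exp (- (x\<^sup>2 / (8 * r))))"
proof (cases "0 < x")
  case True
  define z where "z = x\<^sup>2 / (8 * r)"
  have z: "0 \<le> z" using r by (simp add: z_def)
  have s: "sqrt (4 * pi * r) = 2 * sqrt pi * sqrt r" by (simp add: real_sqrt_mult)
  have "1 \<le> sqrt pi" using pi_gt3 by simp
  have pw: "1 / (r * sqrt r) = r powr (- 3 / 2)"
  proof -
    have "r powr (3 / 2) = r powr (1 + 1 / 2)" by simp
    also have "\<dots> = r * sqrt r" unfolding powr_add using r by (simp add: powr_half_sqrt)
    finally show ?thesis using powr_minus_divide[of r "3 / 2"] by simp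
  qed
  have "1 + 4 * z \<le> 4 * exp z" using exp_ge_add_one_self[of z] by linarith
  then have e: "(1 + 4 * z) * exp (- z) \<le> 4"
    by (simp add: exp_minus field_simps)
  have "\<bar>1 / r - x\<^sup>2 / (2 * r\<^sup>2)\<bar> = \<bar>1 - 4 * z\<bar> / r"
  proof -
    have "1 / r - x\<^sup>2 / (2 * r\<^sup>2) = (1 - 4 * z) / r"
      using r by (simp add: z_def field_simps power2_eq_square)
    then show ?thesis using r by simp
  qed
  then have "\<bar>boundary_kernel_deriv r x\<bar> = \<bar>1 - 4 * z\<bar> / r * (1 / (2 * sqrt pi * sqrt r) * exp (- z - z))"
    using r True by (simp add: boundary_kernel_deriv_def abs_mult heat_kernel_def s z_def)
  also have "\<dots> \<le> (1 + 4 * z) / r * (1 / (2 * 1 * sqrt r) * exp (- z - z))"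
    using r z \<open>1 \<le> sqrt pi\<close> by (intro mult_mono divide_right_mono divide_left_mono mult_right_mono mult_left_mono) auto
  also have "\<dots> = ((1 + 4 * z) * exp (- z)) * (1 / 2 * (1 / (r * sqrt r)) * exp (- z))"
    using r exp_add[of "- z" "- z"] by (simp add: field_simps)
  also have "\<dots> \<le> 4 * (1 / 2 * (1 / (r * sqrt r)) * exp (- z))"
    using r by (intro mult_right_mono e) auto
  finally show ?thesis unfolding pw by (simp add: z_def)
qed (use r in \<open>simp add: boundary_kernel_deriv_def\<close>)

text \<open>Away from \<open>x = 0\<close> the singularity at \<open>r = 0\<close> disappears:
  \<open>exp (- q) \<le> 2 / q\<^sup>2\<close> gains two powers of \<open>r\<close> against the
  exponent -3/2.\<close>

lemma boundary_kernel_deriv_bounded: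
  assumes r: "0 < r" "r \<le> t" and a: "0 < a" "a \<le> x"
  shows "\<bar>boundary_kernel_deriv r x\<bar> \<le> 256 * sqrt t / a ^ 4"
proof -
  define q where "q = x\<^sup>2 / (8 * r)"
  have q: "0 < q" using r a by (simp add: q_def)
  have "q\<^sup>2 / 2 \<le> exp q" using exp_lower_Taylor_quadratic[of q] q by simp
  then have "exp (- q) \<le> 2 / q\<^sup>2" using q by (simp add: exp_minus field_simps)
  also have "\<dots> = 128 * r\<^sup>2 / x ^ 4" using r a by (simp add: q_def field_simps power2_eq_square power4_eq_xxxx)
  also have "\<dots> \<le> 128 * r\<^sup>2 / a ^ 4" using a by (intro divide_left_mono power_mono) auto
  finally have "2 * (r powr (- 3 / 2) * exp (- q)) \<le> 2 * (r powr (- 3 / 2) * (128 * r\<^sup>2 / a ^ 4))"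
    by (intro mult_left_mono) auto
  also have "\<dots> = 256 * (r powr (- 3 / 2) * r powr 2) / a ^ 4" using r by simp
  also have "r powr (- 3 / 2) * r powr 2 = sqrt r" using powr_add[of r "- 3 / 2" 2] r by (simp add: powr_half_sqrt)
  also have "256 * sqrt r / a ^ 4 \<le> 256 * sqrt t / a ^ 4" using r a by (intro divide_right_mono mult_left_mono) auto
  finally show ?thesis using boundary_kernel_deriv_le[OF r(1), of x] by (simp add: q_def)
qed

section \<open>The boundary integral as a lift of the boundary data\<close>

locale boundary_data =
  fixes \<psi> :: "real \<Rightarrow> real" and \<eta> H \<beta> T :: real
  assumes \<psi>_meas [measurable]: "\<psi> \<in> borel_measurable borel"
    and \<psi>: "\<And>t. 0 \<le> \<psi> t" "\<And>t. \<psi> t \<le> \<eta>"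
    and holder: "\<And>t r. 0 \<le> t \<Longrightarrow> t \<le> T \<Longrightarrow> 0 \<le> r \<Longrightarrow> r \<le> T \<Longrightarrow> \<bar>\<psi> t - \<psi> r\<bar> \<le> H * \<bar>t - r\<bar> powr \<beta>"
    and \<psi>0: "\<psi> 0 = 0" and \<beta>: "1 / 4 < \<beta>" and H: "0 \<le> H"
begin

definition lift :: "real \<Rightarrow> real \<Rightarrow> real" where
  "lift t x = (LINT r|lborel. indicator {0<..<t} r * boundary_kernel r x * \<psi> (t - r))"

definition lift_deriv :: "real \<Rightarrow> real \<Rightarrow> real" where
  "lift_deriv t x = (LINT r|lborel. indicator {0<..<t} r * boundary_kernel_deriv r x * \<psi> (t - r))"

lemma \<eta>_nonneg: "0 \<le> \<eta>" using \<psi>[of 0] by simp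

lemma measurable_lift [measurable]: "lift t \<in> borel_measurable borel" "lift_deriv t \<in> borel_measurable borel"
  unfolding lift_def lift_deriv_def by measurable

lemma lift_nonneg: "0 \<le> lift t x"
  unfolding lift_def by (intro integral_nonneg_AE AE_I2) (simp add: \<psi>)

lemma nn_integral_lift:
  assumes t: "0 < t"
  shows "integrable lborel (\<lambda>r. indicator {0<..<t} r * boundary_kernel r x * \<psi> (t - r))" (is ?int)
    and "ennreal (lift t x) = (\<integral>\<^sup>+r. ennreal (indicator {0<..<t} r * boundary_kernel r x * \<psi> (t - r)) \<partial>lborel)" (is ?eq)
    and "lift t x \<le> 2 * \<eta>" (is ?le)
proof -
  have "(\<integral>\<^sup>+r. ennreal (indicator {0<..<t} r * boundary_kernel r x * \<psi> (t - r)) \<partial>lborel)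
     \<le> (\<integral>\<^sup>+r. ennreal \<eta> * ennreal (indicator {0<..<t} r * boundary_kernel r x) \<partial>lborel)"
    using \<psi> \<eta>_nonneg
    by (intro nn_integral_mono) (auto simp: ennreal_mult'[symmetric] mult.commute[of \<eta>] intro!: ennreal_leI mult_left_mono)
  also have "\<dots> = ennreal \<eta> * (\<integral>\<^sup>+r. ennreal (indicator {0<..<t} r * boundary_kernel r x) \<partial>lborel)"
    by (rule nn_integral_cmult) measurable
  also have "\<dots> \<le> ennreal \<eta> * ennreal 2"
    by (intro mult_left_mono nn_integral_boundary_kernel_time t) simp
  finally have bd: "(\<integral>\<^sup>+r. ennreal (indicator {0<..<t} r * boundary_kernel r x * \<psi> (t - r)) \<partial>lborel) \<le> ennreal (2 * \<eta>)"
    using \<eta>_nonneg by (simp add: ennreal_mult mult.commute)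
  then show i: ?int
    using \<psi> by (intro integrableI_nonneg) (auto intro: le_less_trans)
  show e: ?eq unfolding lift_def
    using \<psi> by (intro nn_integral_eq_integral[symmetric] i) auto
  show ?le using bd \<eta>_nonneg unfolding e[symmetric] by simp
qed

lemma nn_integral_lift_space:
  assumes t: "0 < t"
  shows "(\<integral>\<^sup>+x. ennreal (lift t x) \<partial>lborel) \<le> ennreal (2 * \<eta> * sqrt t)"
proof -
  have "(\<integral>\<^sup>+x. ennreal (lift t x) \<partial>lborel) = (\<integral>\<^sup>+x. \<integral>\<^sup>+r. ennreal (indicator {0<..<t} r * boundary_kernel r x * \<psi> (t - r)) \<partial>lborel \<partial>lborel)"
    by (simp add: nn_integral_lift(2)[OF t])
  also have "\<dots> = (\<integral>\<^sup>+r. \<integral>\<^sup>+x. ennreal (indicator {0<..<t} r * boundary_kernel r x * \<psi> (t - r)) \<partial>lborel \<partial>lborel)"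
    by (intro lborel_pair.Fubini') measurable
  also have "\<dots> \<le> (\<integral>\<^sup>+r. ennreal \<eta> * ennreal (indicator {0<..<t} r * r powr (- 1 / 2)) \<partial>lborel)"
  proof (rule nn_integral_mono)
    fix r
    have "(\<integral>\<^sup>+x. ennreal (indicator {0<..<t} r * boundary_kernel r x * \<psi> (t - r)) \<partial>lborel)
      = (\<integral>\<^sup>+x. ennreal (indicator {0<..<t} r * \<psi> (t - r)) * ennreal (boundary_kernel r x) \<partial>lborel)"
      by (intro nn_integral_cong) (simp add: ennreal_mult[symmetric] \<psi> ac_simps)
    also have "\<dots> = ennreal (indicator {0<..<t} r * \<psi> (t - r)) * (\<integral>\<^sup>+x. ennreal (boundary_kernel r x) \<partial>lborel)"
      by (rule nn_integral_cmult) measurable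
    also have "\<dots> \<le> ennreal \<eta> * ennreal (indicator {0<..<t} r * r powr (- 1 / 2))"
    proof (cases "0 < r \<and> r < t")
      case True
      then show ?thesis using \<psi> nn_integral_boundary_kernel_space[of r] by (auto intro!: mult_mono ennreal_leI)
    qed auto
    finally show "(\<integral>\<^sup>+x. ennreal (indicator {0<..<t} r * boundary_kernel r x * \<psi> (t - r)) \<partial>lborel) \<le> ennreal \<eta> * ennreal (indicator {0<..<t} r * r powr (- 1 / 2))" .
  qed
  also have "\<dots> = ennreal \<eta> * (\<integral>\<^sup>+r. ennreal (indicator {0<..<t} r * r powr (- 1 / 2)) \<partial>lborel)"
    by (rule nn_integral_cmult) measurable
  also have "\<dots> = ennreal \<eta> * ennreal (t powr (- 1 / 2 + 1) / (- 1 / 2 + 1))"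
    by (subst nn_integral_powr) (use t in auto)
  also have "\<dots> = ennreal (2 * \<eta> * sqrt t)"
    using t \<eta>_nonneg by (simp add: ennreal_mult[symmetric] powr_half_sqrt)
  finally show ?thesis .
qed

text \<open>Fubini's theorem on \<open>(0, t)\<close> times \<open>[a, b]\<close> replaces
  differentiation under the integral; \<open>a > 0\<close> keeps the differentiated kernel bounded
  there.\<close>

lemma primitive_of_lift:
  assumes t: "0 < t"
  shows "primitive_of (lift t) (lift_deriv t)"
  unfolding primitive_of_def
proof (intro allI impI)
  fix a b :: real assume ab: "0 < a \<and> a \<le> b"
  define C where "C = 256 * sqrt t / a ^ 4"
  have C: "0 \<le> C" using ab t by (simp add: C_def)
  define h where "h r x = indicator {a..b} x * (indicator {0<..<t} r * boundary_kernel_deriv r x * \<psi> (t - r))" for r x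
  have h_meas [measurable]: "case_prod h \<in> borel_measurable (lborel \<Otimes>\<^sub>M lborel)" unfolding h_def by measurable
  have h_bound: "norm (h r x) \<le> (C * \<eta>) * (indicator {0<..<t} r * indicator {a..b} x)" for r x
  proof (cases "x \<in> {a..b} \<and> r \<in> {0<..<t}")
    case True
    then have "\<bar>boundary_kernel_deriv r x\<bar> \<le> C" unfolding C_def using ab by (intro boundary_kernel_deriv_bounded) auto
    then have "\<bar>boundary_kernel_deriv r x\<bar> * \<bar>\<psi> (t - r)\<bar> \<le> C * \<eta>" using \<psi> C by (intro mult_mono) auto
    then show ?thesis using True by (simp add: h_def abs_mult)
  qed (auto simp: h_def)
  have "integrable (lborel \<Otimes>\<^sub>M lborel) (\<lambda>(r, x). (C * \<eta>) * (indicator {0<..<t} r * indicator {a..b} x :: real))"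
  proof (rule integrableI_nonneg)
    have "(\<integral>\<^sup>+q. ennreal (case q of (r, x) \<Rightarrow> (C * \<eta>) * (indicator {0<..<t} r * indicator {a..b} x)) \<partial>(lborel \<Otimes>\<^sub>M lborel))
      = (\<integral>\<^sup>+r. \<integral>\<^sup>+x. ennreal (C * \<eta>) * indicator {0<..<t} r * indicator {a..b} x \<partial>lborel \<partial>lborel)"
      by (subst lborel.nn_integral_fst[symmetric]) (auto intro!: nn_integral_cong simp: split: split_indicator)
    also have "\<dots> < \<infinity>"
      using ab t by (simp add: nn_integral_cmult nn_integral_multc ennreal_mult_less_top)
    finally show "(\<integral>\<^sup>+q. ennreal (case q of (r, x) \<Rightarrow> (C * \<eta>) * (indicator {0<..<t} r * indicator {a..b} x)) \<partial>(lborel \<Otimes>\<^sub>M lborel)) < \<infinity>" .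
  qed (use C \<eta>_nonneg in auto)
  then have int: "integrable (lborel \<Otimes>\<^sub>M lborel) (case_prod h)"
    by (rule Bochner_Integration.integrable_bound) (use h_bound C \<eta>_nonneg in \<open>auto simp: abs_mult\<close>)
  have hx: "(LINT r|lborel. h r x) = indicator {a..b} x * lift_deriv t x" for x
    by (simp add: h_def lift_deriv_def)
  have "integrable lborel (\<lambda>x. LINT r|lborel. h r x)" by (rule lborel_pair.integrable_snd[OF int])
  then have i1: "integrable lborel (\<lambda>x. indicator {a..b} x * lift_deriv t x)" unfolding hx .
  then have si: "set_integrable lborel {a..b} (lift_deriv t)" by (simp add: set_integrable_def)
  have ai: "lift_deriv t absolutely_integrable_on {a..b}"
    using i1 by (simp add: set_integrable_def integrable_completion)
  have hr: "(LINT x|lborel. h r x) = indicator {0<..<t} r * boundary_kernel r b * \<psi> (t - r) - indicator {0<..<t} r * boundary_kernel r a * \<psi> (t - r)" for r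
  proof (cases "0 < r \<and> r < t")
    case True
    have D: "(boundary_kernel r has_real_derivative boundary_kernel_deriv r x) (at x within {a..b})" if "a \<le> x" for x
      using boundary_kernel_has_derivative[of r x] True ab that by (auto intro: has_field_derivative_at_within)
    have cont: "continuous_on {a..b} (boundary_kernel_deriv r)"
    proof -
      have "continuous_on {a..b} (\<lambda>x. (1 / r - x\<^sup>2 / (2 * r\<^sup>2)) * heat_kernel r x)"
        unfolding heat_kernel_def using True by (intro continuous_intros) auto
      then show ?thesis
        by (rule continuous_on_eq) (use ab True in \<open>auto simp: boundary_kernel_deriv_def\<close>)
    qed
    have "(LINT x|lborel. indicator {a..b} x *\<^sub>R boundary_kernel_deriv r x) = boundary_kernel r b - boundary_kernel r a"
      using ab D cont by (intro integral_FTC_atLeastAtMost) (auto simp: has_real_derivative_iff_has_vector_derivative)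
    then have "(LINT x|lborel. (indicator {a..b} x * boundary_kernel_deriv r x) * \<psi> (t - r)) = (boundary_kernel r b - boundary_kernel r a) * \<psi> (t - r)"
      by (subst integral_mult_left_zero) simp
    then show ?thesis using True by (simp add: h_def left_diff_distrib mult.assoc)
  qed (auto simp: h_def)
  have "lift t b - lift t a = (LINT r|lborel. LINT x|lborel. h r x)"
    unfolding hr lift_def using nn_integral_lift(1)[OF t] by simp
  also have "\<dots> = (LINT x|lborel. LINT r|lborel. h r x)"
    by (rule lborel_pair.Fubini_integral[OF int, symmetric])
  also have "\<dots> = (LINT x:{a..b}|lborel. lift_deriv t x)"
    by (simp add: hx set_lebesgue_integral_def)
  also have "\<dots> = integral {a..b} (lift_deriv t)"
    by (rule set_borel_integral_eq_integral(2)[OF si])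
  finally show "lift_deriv t absolutely_integrable_on {a..b} \<and> lift t b - lift t a = integral {a..b} (lift_deriv t)"
    using ai by simp
qed

text \<open>The integrand is a time derivative whose primitive \<open>- 2 * heat_kernel r x\<close>
  tends to 0 with \<open>r\<close>, because \<open>x > 0\<close>. It evaluates the term left over
  when \<open>\<psi> t\<close> is subtracted in \<open>nn_integral_lift_deriv\<close>.\<close>

lemma boundary_kernel_deriv_integral:
  assumes t: "0 < t" and x: "0 < x"
  shows "integrable lborel (\<lambda>r. indicator {0<..<t} r * boundary_kernel_deriv r x)"
    and "(LINT r|lborel. indicator {0<..<t} r * boundary_kernel_deriv r x) = - 2 * heat_kernel t x"
proof -
  define F where "F r = (if r = 0 then 0 else - 2 * heat_kernel r x)" for r
  have F_lim: "continuous (at_right 0) F"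
  proof -
    have "((\<lambda>r. heat_kernel r x) \<longlongrightarrow> 0) (at_right 0)"
    proof (rule tendsto_sandwich)
      show "eventually (\<lambda>r. 0 \<le> heat_kernel r x) (at_right 0)"
        by (intro eventually_at_rightI[of 0 1]) (auto simp: heat_kernel_nonneg)
      show "eventually (\<lambda>r. heat_kernel r x \<le> 4 / x\<^sup>2 * sqrt r) (at_right 0)"
      proof (intro eventually_at_rightI[of 0 1])
        fix r :: real assume "r \<in> {0<..<1}"
        then have r: "0 < r" by simp
        have "1 \<le> sqrt pi" using pi_gt3 by simp
        have "exp (- (x\<^sup>2 / (4 * r))) \<le> 1 / (1 + x\<^sup>2 / (4 * r))" using r by (intro exp_minus_le) auto
        also have "\<dots> \<le> 1 / (x\<^sup>2 / (4 * r))" using r x by (intro frac_le) auto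
        also have "\<dots> = 4 * r / x\<^sup>2" by simp
        finally have ex: "exp (- (x\<^sup>2 / (4 * r))) \<le> 4 * r / x\<^sup>2" .
        have "1 / sqrt (4 * pi * r) * exp (- (x\<^sup>2 / (4 * r))) \<le> 1 / (1 * sqrt r) * (4 * r / x\<^sup>2)"
        proof (rule mult_mono[OF _ ex])
          have "sqrt (4 * pi * r) = 2 * sqrt pi * sqrt r" by (simp add: real_sqrt_mult)
          moreover have "1 \<le> 2 * sqrt pi" using \<open>1 \<le> sqrt pi\<close> by linarith
          ultimately show "1 / sqrt (4 * pi * r) \<le> 1 / (1 * sqrt r)"
            using r by (simp only:) (intro divide_left_mono mult_right_mono; simp)
        qed (use r in auto)
        also have "\<dots> = 4 / x\<^sup>2 * (r / sqrt r)" by simp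
        also have "r / sqrt r = sqrt r" using r by (simp add: real_div_sqrt)
        finally show "heat_kernel r x \<le> 4 / x\<^sup>2 * sqrt r" by (simp add: heat_kernel_def)
      qed simp
      have "((\<lambda>r. 4 / x\<^sup>2 * sqrt r) \<longlongrightarrow> 4 / x\<^sup>2 * sqrt 0) (at_right 0)" by (intro tendsto_intros)
      then show "((\<lambda>r. 4 / x\<^sup>2 * sqrt r) \<longlongrightarrow> 0) (at_right 0)" by simp
    qed auto
    then have lim: "((\<lambda>r. - 2 * heat_kernel r x) \<longlongrightarrow> - 2 * 0) (at_right 0)" by (intro tendsto_intros)
    have "eventually (\<lambda>r. - 2 * heat_kernel r x = F r) (at_right 0)"
      by (intro eventually_at_rightI[of 0 1]) (auto simp: F_def)
    from Lim_transform_eventually[OF lim this] have "(F \<longlongrightarrow> 0) (at_right 0)" by simp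
    then show ?thesis by (simp add: continuous_within F_def)
  qed
  have D: "(F has_real_derivative boundary_kernel_deriv r x) (at r)" if "0 < r" for r
    by (rule has_field_derivative_transform_within_open[OF heat_kernel_has_time_derivative[OF that x], where S = "{0<..}"])
       (use that in \<open>auto simp: F_def\<close>)
  have cont: "continuous_on {0..t} F"
  proof (intro continuous_on_eq_continuous_within[THEN iffD2] ballI)
    fix r assume r: "r \<in> {0..t}"
    show "continuous (at r within {0..t}) F"
    proof (cases "r = 0")
      case True
      then show ?thesis using F_lim by (auto intro: continuous_within_subset simp: at_within_Icc_at_right t)
    next
      case False
      then show ?thesis using D[of r] r by (auto intro: DERIV_isCont continuous_at_imp_continuous_at_within)
    qed
  qed
  have hi: "((\<lambda>r. boundary_kernel_deriv r x) has_integral (F t - F 0)) {0..t}"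
    by (rule fundamental_theorem_of_calculus_interior)
       (use t cont D in \<open>auto simp: has_real_derivative_iff_has_vector_derivative\<close>)
  have int: "integrable lborel (\<lambda>r. indicator {0..t} r * boundary_kernel_deriv r x)"
  proof (rule Bochner_Integration.integrable_bound)
    show "integrable lborel (\<lambda>r. (256 * sqrt t / x ^ 4) * indicator {0..t} r)"
      using t by (intro integrable_mult_right integrable_real_indicator) auto
    show "AE r in lborel. norm (indicator {0..t} r * boundary_kernel_deriv r x) \<le> norm ((256 * sqrt t / x ^ 4) * indicator {0..t} r)"
      using AE_lborel_singleton[of 0]
      by eventually_elim (use boundary_kernel_deriv_bounded[of _ t x x] t x in \<open>auto split: split_indicator\<close>)
  qed measurable
  have ae: "AE r in lborel. indicator {0..t} r * boundary_kernel_deriv r x = indicator {0<..<t} r * boundary_kernel_deriv r x"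
    using AE_lborel_singleton[of 0] AE_lborel_singleton[of t] by eventually_elim (auto split: split_indicator)
  show "integrable lborel (\<lambda>r. indicator {0<..<t} r * boundary_kernel_deriv r x)"
    using int by (rule integrable_cong_AE_imp) (use ae in auto)
  have "(LINT r|lborel. indicator {0<..<t} r * boundary_kernel_deriv r x) = (LINT r|lborel. indicator {0..t} r * boundary_kernel_deriv r x)"
    by (rule integral_cong_AE) (use ae in auto)
  also have "\<dots> = (LINT r:{0..t}|lborel. boundary_kernel_deriv r x)" by (simp add: set_lebesgue_integral_def)
  also have "\<dots> = integral {0..t} (\<lambda>r. boundary_kernel_deriv r x)"
    by (rule set_borel_integral_eq_integral(2)) (simp add: set_integrable_def int)
  also have "\<dots> = - 2 * heat_kernel t x" using hi t by (simp add: integral_unique F_def)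
  finally show "(LINT r|lborel. indicator {0<..<t} r * boundary_kernel_deriv r x) = - 2 * heat_kernel t x" .
qed

text \<open>The first term comes from the Hoelder difference, the bracket being the integral of
  \<open>r powr (\<beta> - 5 / 4)\<close> over \<open>(0, T)\<close>. The second comes from the
  subtracted value \<open>\<psi> t\<close>, which is at most \<open>H * t powr \<beta>\<close>
  because \<open>\<psi> 0 = 0\<close>.\<close>

definition lift_const :: real where
  "lift_const = 32 * H\<^sup>2 * (T powr (\<beta> - 1 / 4) / (\<beta> - 1 / 4))\<^sup>2 + 8 * H\<^sup>2 * T powr (2 * \<beta> - 1 / 2)"

text \<open>Subtracting \<open>\<psi> t\<close> under the integral turns the singularity \<open>r powr (-5/4)\<close> of the norm of the
  kernel into \<open>r powr (\<beta> - 5/4)\<close>, which is integrable because \<open>\<beta> > 1/4\<close>.\<close>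

lemma nn_integral_lift_deriv:
  assumes t: "0 < t" "t \<le> T"
  shows "(\<integral>\<^sup>+x. indicator {0<..} x * ennreal ((lift_deriv t x)\<^sup>2) \<partial>lborel) \<le> ennreal lift_const"
proof -
  \<comment> \<open>The power of \<open>r\<close> is divided so that the L2 norm of
    \<open>a r\<close> in \<open>x\<close> does not depend on \<open>r\<close>; all remaining
    singularity goes into the weight \<open>w\<close>.\<close>
  define a where "a r x = r powr (- 1 / 4) * exp (- (x\<^sup>2 / (8 * r)))" for r x :: real
  define w where "w r = indicator {0<..<t} r * r powr (\<beta> - 5 / 4)" for r
  have [measurable]: "(\<lambda>(r, x). a r x) \<in> borel_measurable (borel \<Otimes>\<^sub>M borel)" "w \<in> borel_measurable borel"
    unfolding a_def w_def by measurable
  have w0: "0 \<le> w r" and a0: "0 \<le> a r x" for r x by (auto simp: w_def a_def)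
  define W where "W = t powr (\<beta> - 1 / 4) / (\<beta> - 1 / 4)"
  have W: "0 \<le> W" using \<beta> by (simp add: W_def)
  have int_w: "(\<integral>\<^sup>+r. ennreal (w r) \<partial>lborel) = ennreal W"
    using nn_integral_powr[of "\<beta> - 5 / 4" t] \<beta> t by (simp add: w_def W_def)
  define I where "I x = (\<integral>\<^sup>+r. ennreal (w r * a r x) \<partial>lborel)" for x
  have ptw: "ennreal \<bar>lift_deriv t x\<bar> \<le> ennreal (2 * H) * I x + ennreal (2 * H * t powr \<beta> * heat_kernel t x)" if x: "0 < x" for x
  proof -
    let ?k = "\<lambda>r. indicator {0<..<t} r * boundary_kernel_deriv r x"
    note k = boundary_kernel_deriv_integral[OF t(1) x]
    have i1: "integrable lborel (\<lambda>r. ?k r * \<psi> (t - r))"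
    proof (rule Bochner_Integration.integrable_bound[OF integrable_mult_left[OF k(1), of \<eta>]])
      show "AE r in lborel. norm (?k r * \<psi> (t - r)) \<le> norm (?k r * \<eta>)"
        using \<psi> \<eta>_nonneg by (intro AE_I2) (auto simp: abs_mult intro!: mult_left_mono)
    qed measurable
    have i2: "integrable lborel (\<lambda>r. ?k r * (\<psi> (t - r) - \<psi> t))"
      using Bochner_Integration.integrable_diff[OF i1 integrable_mult_left[OF k(1), of "\<psi> t"]] by (simp add: right_diff_distrib)
    have "lift_deriv t x = (LINT r|lborel. ?k r * (\<psi> (t - r) - \<psi> t)) + \<psi> t * (LINT r|lborel. ?k r)"
    proof -
      have "lift_deriv t x = (LINT r|lborel. ?k r * (\<psi> (t - r) - \<psi> t) + ?k r * \<psi> t)"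
        unfolding lift_deriv_def by (intro Bochner_Integration.integral_cong) (auto simp: algebra_simps)
      also have "\<dots> = (LINT r|lborel. ?k r * (\<psi> (t - r) - \<psi> t)) + (LINT r|lborel. ?k r * \<psi> t)"
        by (rule Bochner_Integration.integral_add[OF i2 integrable_mult_left[OF k(1)]])
      finally show ?thesis by simp
    qed
    then have "\<bar>lift_deriv t x\<bar> \<le> \<bar>LINT r|lborel. ?k r * (\<psi> (t - r) - \<psi> t)\<bar> + \<psi> t * (2 * heat_kernel t x)"
      unfolding k(2) using \<psi>(1)[of t] heat_kernel_nonneg[of t x] t
        abs_triangle_ineq[of "LINT r|lborel. ?k r * (\<psi> (t - r) - \<psi> t)" "\<psi> t * (- 2 * heat_kernel t x)"]
      by (simp add: abs_mult)
    also have "\<psi> t * (2 * heat_kernel t x) \<le> (H * t powr \<beta>) * (2 * heat_kernel t x)"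
      using holder[of t 0] t \<psi>0 \<psi>(1)[of t] heat_kernel_nonneg[of t x] by (intro mult_right_mono) auto
    finally have 1: "\<bar>lift_deriv t x\<bar> \<le> \<bar>LINT r|lborel. ?k r * (\<psi> (t - r) - \<psi> t)\<bar> + 2 * H * t powr \<beta> * heat_kernel t x"
      by (simp add: ac_simps)
    have "ennreal \<bar>LINT r|lborel. ?k r * (\<psi> (t - r) - \<psi> t)\<bar> \<le> (\<integral>\<^sup>+r. ennreal \<bar>?k r * (\<psi> (t - r) - \<psi> t)\<bar> \<partial>lborel)"
      using integral_norm_bound_ennreal[OF i2] by simp
    also have "\<dots> \<le> (\<integral>\<^sup>+r. ennreal (2 * H) * ennreal (w r * a r x) \<partial>lborel)"
    proof (rule nn_integral_mono)
      fix r
      show "ennreal \<bar>?k r * (\<psi> (t - r) - \<psi> t)\<bar> \<le> ennreal (2 * H) * ennreal (w r * a r x)"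
      proof (cases "0 < r \<and> r < t")
        case True
        have "\<bar>boundary_kernel_deriv r x\<bar> * \<bar>\<psi> (t - r) - \<psi> t\<bar> \<le> (2 * (r powr (- 3 / 2) * exp (- (x\<^sup>2 / (8 * r))))) * (H * r powr \<beta>)"
          using boundary_kernel_deriv_le[of r x] holder[of "t - r" t] True t H by (intro mult_mono) auto
        also have "\<dots> = 2 * H * ((r powr (- 3 / 2) * r powr \<beta>) * exp (- (x\<^sup>2 / (8 * r))))" by (simp add: ac_simps)
        also have "r powr (- 3 / 2) * r powr \<beta> = r powr (\<beta> - 5 / 4) * r powr (- 1 / 4)"
          using True by (simp add: powr_add[symmetric])
        finally show ?thesis using True H a0[of r x] by (simp add: w_def a_def abs_mult ennreal_mult'[symmetric] ac_simps ennreal_leI)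
      qed (auto simp: w_def)
    qed
    also have "\<dots> = ennreal (2 * H) * I x"
      unfolding I_def by (rule nn_integral_cmult) measurable
    finally have 2: "ennreal \<bar>LINT r|lborel. ?k r * (\<psi> (t - r) - \<psi> t)\<bar> \<le> ennreal (2 * H) * I x" .
    have "ennreal \<bar>lift_deriv t x\<bar> \<le> ennreal \<bar>LINT r|lborel. ?k r * (\<psi> (t - r) - \<psi> t)\<bar> + ennreal (2 * H * t powr \<beta> * heat_kernel t x)"
      using ennreal_leI[OF 1] H heat_kernel_nonneg[of t x] t by (simp add: ennreal_plus)
    also have "\<dots> \<le> ennreal (2 * H) * I x + ennreal (2 * H * t powr \<beta> * heat_kernel t x)"
      by (rule add_right_mono[OF 2])
    finally show ?thesis .
  qed
  have sq_sum: "(p + q)\<^sup>2 \<le> 2 * p\<^sup>2 + 2 * q\<^sup>2" for p q :: ennreal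
  proof (cases "p = top \<or> q = top")
    case True
    then show ?thesis by (auto simp: power2_eq_square ennreal_mult_top)
  next
    case False
    then obtain p' q' where pq: "p = ennreal p'" "0 \<le> p'" "q = ennreal q'" "0 \<le> q'" by (metis ennreal_cases)
    have "(p' + q')\<^sup>2 \<le> 2 * p'\<^sup>2 + 2 * q'\<^sup>2"
      using sum_squares_ge_zero[of "p' - q'" 0] by (simp add: power2_eq_square algebra_simps)
    then have "ennreal ((p' + q')\<^sup>2) \<le> ennreal (2 * p'\<^sup>2 + 2 * q'\<^sup>2)" by (rule ennreal_leI)
    then show ?thesis using pq by (simp add: ennreal_power[symmetric] ennreal_mult)
  qed
  \<comment> \<open>Cauchy-Schwarz with respect to the weight \<open>w\<close>, in place of
    Minkowski's integral inequality.\<close>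
  have I_sq: "(I x)\<^sup>2 \<le> ennreal W * (\<integral>\<^sup>+r. ennreal (w r * (a r x)\<^sup>2) \<partial>lborel)" for x
  proof -
    have "I x = (\<integral>\<^sup>+r. ennreal (sqrt (w r)) * ennreal (sqrt (w r) * a r x) \<partial>lborel)"
      unfolding I_def using w0 a0 by (intro nn_integral_cong) (simp add: ennreal_mult[symmetric] mult.assoc[symmetric])
    then have "(I x)\<^sup>2 \<le> (\<integral>\<^sup>+r. ennreal (sqrt (w r)) ^ 2 \<partial>lborel) * (\<integral>\<^sup>+r. ennreal (sqrt (w r) * a r x) ^ 2 \<partial>lborel)"
      by (simp only:) (rule Cauchy_Schwarz_nn_integral; measurable)
    also have "\<dots> = ennreal W * (\<integral>\<^sup>+r. ennreal (w r * (a r x)\<^sup>2) \<partial>lborel)"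
      using w0 a0 by (simp add: ennreal_power power_mult_distrib int_w)
    finally show ?thesis .
  qed
  have int_a: "(\<integral>\<^sup>+x. ennreal ((a r x)\<^sup>2) \<partial>lborel) \<le> ennreal 4" if r: "0 < r" for r
  proof -
    have "(a r x)\<^sup>2 = sqrt (4 * pi) * heat_kernel r x" for x
    proof -
      have "(r powr (- 1 / 4))\<^sup>2 = r powr (- 1 / 4) * r powr (- 1 / 4)" by (rule power2_eq_square)
      also have "\<dots> = r powr (- (1 / 2))" using r by (simp add: powr_add[symmetric])
      also have "\<dots> = 1 / sqrt r" using powr_minus_divide[of r "1 / 2"] r by (simp add: powr_half_sqrt)
      finally have "(r powr (- 1 / 4))\<^sup>2 = 1 / sqrt r" .
      moreover have "(exp (- (x\<^sup>2 / (8 * r))))\<^sup>2 = exp (- (x\<^sup>2 / (4 * r)))"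
        by (simp add: power2_eq_square exp_add[symmetric] field_simps)
      ultimately show ?thesis by (simp add: a_def power_mult_distrib heat_kernel_def real_sqrt_mult)
    qed
    then have "(\<integral>\<^sup>+x. ennreal ((a r x)\<^sup>2) \<partial>lborel) = (\<integral>\<^sup>+x. ennreal (sqrt (4 * pi)) * ennreal (heat_kernel r x) \<partial>lborel)"
      using r by (simp add: ennreal_mult heat_kernel_nonneg)
    also have "\<dots> = ennreal (sqrt (4 * pi)) * 1"
      by (subst nn_integral_cmult) (auto simp: nn_integral_heat_kernel[OF r])
    also have "\<dots> \<le> ennreal 4"
    proof -
      have "sqrt (4 * pi) \<le> 4" using pi_less_4 real_sqrt_le_mono[of "4 * pi" 16] by simp
      from ennreal_leI[OF this] show ?thesis by (simp only: mult_1_right)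
    qed
    finally show ?thesis .
  qed
  have int_I: "(\<integral>\<^sup>+x. (I x)\<^sup>2 \<partial>lborel) \<le> ennreal (4 * W\<^sup>2)"
  proof -
    have "(\<integral>\<^sup>+x. (I x)\<^sup>2 \<partial>lborel) \<le> (\<integral>\<^sup>+x. ennreal W * (\<integral>\<^sup>+r. ennreal (w r * (a r x)\<^sup>2) \<partial>lborel) \<partial>lborel)"
      by (intro nn_integral_mono I_sq)
    also have "\<dots> = ennreal W * (\<integral>\<^sup>+x. \<integral>\<^sup>+r. ennreal (w r * (a r x)\<^sup>2) \<partial>lborel \<partial>lborel)"
      by (rule nn_integral_cmult) measurable
    also have "(\<integral>\<^sup>+x. \<integral>\<^sup>+r. ennreal (w r * (a r x)\<^sup>2) \<partial>lborel \<partial>lborel) = (\<integral>\<^sup>+r. \<integral>\<^sup>+x. ennreal (w r * (a r x)\<^sup>2) \<partial>lborel \<partial>lborel)"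
      by (intro lborel_pair.Fubini') measurable
    also have "\<dots> \<le> (\<integral>\<^sup>+r. ennreal (w r) * ennreal 4 \<partial>lborel)"
    proof (rule nn_integral_mono)
      fix r
      have "(\<integral>\<^sup>+x. ennreal (w r * (a r x)\<^sup>2) \<partial>lborel) = (\<integral>\<^sup>+x. ennreal (w r) * ennreal ((a r x)\<^sup>2) \<partial>lborel)"
        using w0 by (simp add: ennreal_mult)
      also have "\<dots> = ennreal (w r) * (\<integral>\<^sup>+x. ennreal ((a r x)\<^sup>2) \<partial>lborel)"
        by (rule nn_integral_cmult) measurable
      also have "\<dots> \<le> ennreal (w r) * ennreal 4"
        using int_a[of r] by (cases "0 < r") (auto intro!: mult_left_mono simp: w_def)
      finally show "(\<integral>\<^sup>+x. ennreal (w r * (a r x)\<^sup>2) \<partial>lborel) \<le> ennreal (w r) * ennreal 4" .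
    qed
    also have "(\<integral>\<^sup>+r. ennreal (w r) * ennreal 4 \<partial>lborel) = ennreal W * ennreal 4"
      by (subst nn_integral_multc) (auto simp: int_w)
    finally have "(\<integral>\<^sup>+x. (I x)\<^sup>2 \<partial>lborel) \<le> ennreal W * (ennreal W * ennreal 4)"
      by (simp add: mult_left_mono)
    moreover have "ennreal (4 * W\<^sup>2) = ennreal W * (ennreal W * ennreal 4)"
      using W by (simp add: power2_eq_square ennreal_mult ac_simps)
    ultimately show ?thesis by simp
  qed
  \<comment> \<open>One factor of the squared heat kernel is bounded by
    \<open>t powr (- (1 / 2))\<close>, the other has mass 1. The resulting power
    \<open>2 * \<beta> - 1 / 2\<close> is positive, so \<open>T\<close> can replace \<open>t\<close>
    later.\<close>
  have int_G: "(\<integral>\<^sup>+x. ennreal ((2 * H * t powr \<beta> * heat_kernel t x)\<^sup>2) \<partial>lborel) \<le> ennreal (4 * H\<^sup>2 * t powr (2 * \<beta> - 1 / 2))"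
  proof -
    have h: "heat_kernel t x \<le> t powr (- (1 / 2))" for x
    proof -
      have "1 \<le> sqrt pi" using pi_gt3 by simp
      have "heat_kernel t x \<le> heat_kernel t 0" using t by (intro heat_kernel_antimono) auto
      also have "\<dots> = 1 / (2 * sqrt pi * sqrt t)" by (simp add: heat_kernel_def real_sqrt_mult)
      also have "\<dots> \<le> 1 / (1 * sqrt t)"
      proof (intro divide_left_mono mult_right_mono)
        show "1 \<le> 2 * sqrt pi" using \<open>1 \<le> sqrt pi\<close> by linarith
      qed (use t in auto)
      also have "\<dots> = t powr (- (1 / 2))" using powr_minus_divide[of t "1 / 2"] t by (simp add: powr_half_sqrt)
      finally show ?thesis .
    qed
    have "(\<integral>\<^sup>+x. ennreal ((2 * H * t powr \<beta> * heat_kernel t x)\<^sup>2) \<partial>lborel)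
      \<le> (\<integral>\<^sup>+x. ennreal (4 * H\<^sup>2 * t powr (2 * \<beta> - 1 / 2)) * ennreal (heat_kernel t x) \<partial>lborel)"
    proof (rule nn_integral_mono)
      fix x
      have "(2 * H * t powr \<beta> * heat_kernel t x)\<^sup>2 = (4 * H\<^sup>2 * (t powr \<beta> * t powr \<beta>)) * (heat_kernel t x * heat_kernel t x)"
        by (simp add: power2_eq_square ac_simps)
      also have "\<dots> \<le> (4 * H\<^sup>2 * (t powr \<beta> * t powr \<beta>)) * (t powr (- (1 / 2)) * heat_kernel t x)"
        using h[of x] t heat_kernel_nonneg[of t x] by (intro mult_left_mono mult_right_mono) auto
      also have "\<dots> = (4 * H\<^sup>2 * ((t powr \<beta> * t powr \<beta>) * t powr (- (1 / 2)))) * heat_kernel t x" by (simp add: ac_simps)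
      also have "(t powr \<beta> * t powr \<beta>) * t powr (- (1 / 2)) = t powr (2 * \<beta> - 1 / 2)"
        by (simp add: powr_add[symmetric])
      finally show "ennreal ((2 * H * t powr \<beta> * heat_kernel t x)\<^sup>2) \<le> ennreal (4 * H\<^sup>2 * t powr (2 * \<beta> - 1 / 2)) * ennreal (heat_kernel t x)"
        using t heat_kernel_nonneg[of t x] by (simp add: ennreal_mult[symmetric] ennreal_leI)
    qed
    also have "\<dots> = ennreal (4 * H\<^sup>2 * t powr (2 * \<beta> - 1 / 2)) * 1"
      using t by (subst nn_integral_cmult) (auto simp: nn_integral_heat_kernel)
    finally show ?thesis by simp
  qed
  have [measurable]: "I \<in> borel_measurable borel" unfolding I_def by measurable
  have "(\<integral>\<^sup>+x. indicator {0<..} x * ennreal ((lift_deriv t x)\<^sup>2) \<partial>lborel)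
    \<le> (\<integral>\<^sup>+x. ennreal (8 * H\<^sup>2) * (I x)\<^sup>2 + 2 * ennreal ((2 * H * t powr \<beta> * heat_kernel t x)\<^sup>2) \<partial>lborel)"
  proof (rule nn_integral_mono)
    fix x
    show "indicator {0<..} x * ennreal ((lift_deriv t x)\<^sup>2) \<le> ennreal (8 * H\<^sup>2) * (I x)\<^sup>2 + 2 * ennreal ((2 * H * t powr \<beta> * heat_kernel t x)\<^sup>2)"
    proof (cases "0 < x")
      case True
      have "ennreal ((lift_deriv t x)\<^sup>2) = (ennreal \<bar>lift_deriv t x\<bar>)\<^sup>2" by (simp add: ennreal_power)
      also have "\<dots> \<le> (ennreal (2 * H) * I x + ennreal (2 * H * t powr \<beta> * heat_kernel t x))\<^sup>2"
        by (intro power_mono ptw[OF True]) auto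
      also have "\<dots> \<le> 2 * (ennreal (2 * H) * I x)\<^sup>2 + 2 * (ennreal (2 * H * t powr \<beta> * heat_kernel t x))\<^sup>2"
        by (rule sq_sum)
      also have "2 * (ennreal (2 * H) * I x)\<^sup>2 = ennreal (8 * H\<^sup>2) * (I x)\<^sup>2"
      proof -
        have "2 * (ennreal (2 * H))\<^sup>2 = ennreal (8 * H\<^sup>2)"
          using H by (simp add: ennreal_power ennreal_mult'[symmetric] power_mult_distrib flip: ennreal_numeral)
        then show ?thesis by (simp add: power_mult_distrib mult.assoc[symmetric])
      qed
      also have "(ennreal (2 * H * t powr \<beta> * heat_kernel t x))\<^sup>2 = ennreal ((2 * H * t powr \<beta> * heat_kernel t x)\<^sup>2)"
        using H t heat_kernel_nonneg[of t x] by (simp add: ennreal_power)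
      finally show ?thesis using True by simp
    qed simp
  qed
  also have "\<dots> = ennreal (8 * H\<^sup>2) * (\<integral>\<^sup>+x. (I x)\<^sup>2 \<partial>lborel) + 2 * (\<integral>\<^sup>+x. ennreal ((2 * H * t powr \<beta> * heat_kernel t x)\<^sup>2) \<partial>lborel)"
    by (simp add: nn_integral_add nn_integral_cmult)
  also have "\<dots> \<le> ennreal (8 * H\<^sup>2) * ennreal (4 * W\<^sup>2) + 2 * ennreal (4 * H\<^sup>2 * t powr (2 * \<beta> - 1 / 2))"
    by (intro add_mono mult_left_mono int_I int_G) auto
  also have "\<dots> = ennreal (32 * H\<^sup>2 * W\<^sup>2 + 8 * H\<^sup>2 * t powr (2 * \<beta> - 1 / 2))"
    by (simp add: ennreal_plus ennreal_mult'[symmetric] mult.assoc flip: ennreal_numeral)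
  also have "\<dots> \<le> ennreal lift_const"
  proof (rule ennreal_leI)
    have "W \<le> T powr (\<beta> - 1 / 4) / (\<beta> - 1 / 4)"
      unfolding W_def using t \<beta> by (intro divide_right_mono powr_mono2) auto
    then have "W\<^sup>2 \<le> (T powr (\<beta> - 1 / 4) / (\<beta> - 1 / 4))\<^sup>2" using W by (intro power_mono) auto
    moreover have "t powr (2 * \<beta> - 1 / 2) \<le> T powr (2 * \<beta> - 1 / 2)"
      using t \<beta> by (intro powr_mono2) auto
    ultimately show "32 * H\<^sup>2 * W\<^sup>2 + 8 * H\<^sup>2 * t powr (2 * \<beta> - 1 / 2) \<le> lift_const"
      unfolding lift_const_def by (intro add_mono mult_left_mono) auto
  qed
  finally show ?thesis .
qed

end

subsection \<open>Borel representatives\<close>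

text \<open>Preimages under \<open>f - g\<close> are null or have null complement, according to
  whether they come from a set without or with 0.\<close>

lemma measurable_completion_AE:
  fixes f g :: "'a \<Rightarrow> real"
  assumes g: "g \<in> borel_measurable M" and eq: "AE x in M. f x = g x"
  shows "f \<in> borel_measurable (completion M)"
proof -
  have "(\<lambda>x. f x - g x) \<in> borel_measurable (completion M)"
  proof (rule measurableI)
    fix A :: "real set" assume "A \<in> sets borel"
    show "(\<lambda>x. f x - g x) -` A \<inter> space (completion M) \<in> sets (completion M)"
    proof (cases "0 \<in> A")
      case True
      have "Measurable.pred (completion M) (\<lambda>x. \<not> (f x - g x \<in> A))"
        by (rule sets_completion_AE) (use eq in eventually_elim, use True in simp)
      then have "space (completion M) - {x \<in> space (completion M). f x - g x \<notin> A} \<in> sets (completion M)"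
        unfolding pred_def by (rule sets.compl_sets)
      also have "space (completion M) - {x \<in> space (completion M). f x - g x \<notin> A} = (\<lambda>x. f x - g x) -` A \<inter> space (completion M)"
        by auto
      finally show ?thesis .
    next
      case False
      have "Measurable.pred (completion M) (\<lambda>x. f x - g x \<in> A)"
        by (rule sets_completion_AE) (use eq in eventually_elim, use False in simp)
      then have "{x \<in> space (completion M). f x - g x \<in> A} \<in> sets (completion M)" unfolding pred_def .
      also have "{x \<in> space (completion M). f x - g x \<in> A} = (\<lambda>x. f x - g x) -` A \<inter> space (completion M)"
        by auto
      finally show ?thesis .
    qed
  qed auto
  from borel_measurable_add[OF this measurable_completion[OF g]] show ?thesis by simp
qed

text \<open>The bridge from the integrals of the problem to Borel integrands. \<open>f\<close> may
  contain an arbitrary version such as \<open>weak_deriv\<close>; its measurability is a consequence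
  of the agreement with \<open>g\<close>.\<close>

lemma integral_lebesgue_on_Borel:
  fixes f g :: "real \<Rightarrow> real"
  assumes [measurable]: "g \<in> borel_measurable borel" "S \<in> sets borel"
    and eq: "AE x in lborel. x \<in> S \<longrightarrow> f x = g x"
  shows "(LINT x|lebesgue_on S. f x) = (LINT x|lborel. indicator S x * g x)"
proof -
  have "(LINT x|lebesgue_on S. f x) = (LINT x|lebesgue. indicator S x *\<^sub>R f x)"
    by (rule integral_restrict_space) simp
  also have "\<dots> = (LINT x|lebesgue. indicator S x * g x)"
  proof (rule integral_cong_AE)
    have ae: "AE x in lborel. indicator S x *\<^sub>R f x = indicator S x * g x"
      using eq by eventually_elim (auto split: split_indicator)
    then show "AE x in lebesgue. indicator S x *\<^sub>R f x = indicator S x * g x" by (rule AE_completion)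
    have g: "(\<lambda>x. indicator S x * g x) \<in> borel_measurable lborel" by measurable
    show "(\<lambda>x. indicator S x *\<^sub>R f x) \<in> borel_measurable lebesgue" by (rule measurable_completion_AE[OF g ae])
    show "(\<lambda>x. indicator S x * g x) \<in> borel_measurable lebesgue" by (rule measurable_completion[OF g])
  qed
  also have "\<dots> = (LINT x|lborel. indicator S x * g x)"
    by (rule integral_completion) measurable
  finally show ?thesis .
qed

lemma nn_integral_lebesgue_on_Borel:
  fixes f g :: "real \<Rightarrow> ennreal"
  assumes [measurable]: "S \<in> sets borel" and eq: "AE x in lborel. x \<in> S \<longrightarrow> f x = g x"
  shows "(\<integral>\<^sup>+x. f x \<partial>lebesgue_on S) = (\<integral>\<^sup>+x. indicator S x * g x \<partial>lborel)"
proof -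
  have "(\<integral>\<^sup>+x. f x \<partial>lebesgue_on S) = (\<integral>\<^sup>+x. f x * indicator S x \<partial>lborel)"
    by (subst nn_integral_restrict_space) (auto simp: nn_integral_completion)
  also have "\<dots> = (\<integral>\<^sup>+x. indicator S x * g x \<partial>lborel)"
  proof (rule nn_integral_cong_AE)
    show "AE x in lborel. f x * indicator S x = indicator S x * g x"
      using eq by eventually_elim (auto split: split_indicator)
  qed
  finally show ?thesis .
qed

lemma AE_lebesgue_on_iff:
  fixes S :: "'a :: euclidean_space set"
  shows "S \<in> sets borel \<Longrightarrow> (AE x in lebesgue_on S. P x) \<longleftrightarrow> (AE x in lborel. x \<in> S \<longrightarrow> P x)"
  by (subst AE_restrict_space_iff) (auto simp: AE_completion_iff)

lemma L2_sq_Borel: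
  assumes "AE x in lborel. 0 < x \<longrightarrow> f x = g x"
  shows "L2_sq f = (\<integral>\<^sup>+x. indicator {0<..} x * ennreal ((g x)\<^sup>2) \<partial>lborel)"
  unfolding L2_sq_def
proof (rule nn_integral_lebesgue_on_Borel)
  show "AE x in lborel. x \<in> {0<..} \<longrightarrow> ennreal ((f x)\<^sup>2) = ennreal ((g x)\<^sup>2)"
    using assms by eventually_elim auto
qed simp

lemma ex_Borel_lebesgue_on:
  fixes f :: "'a :: euclidean_space \<Rightarrow> real"
  assumes f: "f \<in> borel_measurable (lebesgue_on S)" and S: "S \<in> sets borel"
  shows "\<exists>g\<in>borel_measurable borel. AE x in lborel. x \<in> S \<longrightarrow> f x = g x"
proof -
  have "(\<lambda>x. if x \<in> S then f x else 0) \<in> borel_measurable lebesgue"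
    using f S by (intro borel_measurable_if_I) auto
  then obtain g where "g \<in> borel_measurable lborel" "AE x in lborel. (if x \<in> S then f x else 0) = g x"
    using completion_ex_borel_measurable_real by blast
  then show ?thesis by (intro bexI[of _ g]) auto
qed

lemma has_weak_deriv_cong:
  assumes wd: "has_weak_deriv f g" and f: "AE x in lborel. 0 < x \<longrightarrow> f x = f' x" and g: "AE x in lborel. 0 < x \<longrightarrow> g x = g' x"
  shows "has_weak_deriv f' g'"
proof -
  obtain w where w: "primitive_of w g" "AE x in lebesgue. 0 < x \<longrightarrow> f x = w x"
    by (rule weak_deriv_imp_primitive[OF wd])
  have neg: "negligible {x. 0 < x \<and> g x \<noteq> g' x}"
    using AE_completion[OF g] unfolding completion.AE_iff_null_sets negligible_iff_null_sets by simp
  have "primitive_of w g'"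
    unfolding primitive_of_def
  proof (intro allI impI conjI)
    fix a b :: real assume ab: "0 < a \<and> a \<le> b"
    show "g' absolutely_integrable_on {a..b}"
      by (rule absolutely_integrable_spike[OF primitive_ofD(1)[OF w(1)] neg]) (use ab in auto)
    have "integral {a..b} g = integral {a..b} g'"
      by (rule integral_spike[OF neg]) (use ab in auto)
    then show "w b - w a = integral {a..b} g'" using primitive_ofD(3)[OF w(1)] ab by simp
  qed
  moreover have "AE x in lebesgue. 0 < x \<longrightarrow> f' x = w x"
    using w(2) AE_completion[OF f] by eventually_elim auto
  ultimately show ?thesis by (rule primitive_imp_weak_deriv)
qed

lemma loc_integrable_ex_Borel:
  assumes "loc_integrable g"
  shows "\<exists>h\<in>borel_measurable borel. AE x in lborel. 0 < x \<longrightarrow> g x = h x"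
proof -
  have "\<exists>h\<in>borel_measurable borel. AE x in lborel. x \<in> {1 / Suc n..Suc n} \<longrightarrow> g x = h x" for n
  proof (cases n)
    \<comment> \<open>Here the interval is the single point 1, about which
      \<open>loc_integrable\<close> says nothing.\<close>
    case 0
    have "AE x in lborel. x \<in> {1 / Suc n..Suc n} \<longrightarrow> g x = g 1"
      using 0 by (intro AE_I2) auto
    then show ?thesis by (intro bexI[of _ "\<lambda>_. g 1"]) auto
  next
    case (Suc k)
    then have "1 / real (Suc n) < 1" "1 < real (Suc n)" by simp_all
    then have "1 / real (Suc n) < real (Suc n)" by linarith
    then have "integrable (lebesgue_on {1 / Suc n..Suc n}) g"
      using assms unfolding loc_integrable_def by simp
    then have "g \<in> borel_measurable (lebesgue_on {1 / Suc n..Suc n})" by (rule borel_measurable_integrable)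
    then show ?thesis by (rule ex_Borel_lebesgue_on) auto
  qed
  then obtain h where h: "\<And>n. h n \<in> borel_measurable borel" "\<And>n. AE x in lborel. x \<in> {1 / Suc n..Suc n} \<longrightarrow> g x = h n x"
    by metis
  have "AE x in lborel. \<forall>n. x \<in> {1 / Suc n..Suc n} \<longrightarrow> g x = h n x"
    using h(2) unfolding AE_all_countable by blast
  then have "AE x in lborel. 0 < x \<longrightarrow> g x = lim (\<lambda>n. h n x)"
  proof eventually_elim
    case (elim x)
    show ?case
    proof
      assume "0 < x"
      obtain N where N: "max (1 / x) x < real N" using reals_Archimedean2 by blast
      have "h n x = g x" if "N \<le> n" for n
      proof -
        have "1 / x < real (Suc n)" "x < real (Suc n)" using N that by auto
        then have "1 / real (Suc n) < x" using \<open>0 < x\<close> by (simp add: field_simps)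
        then show ?thesis using elim[rule_format, of n] \<open>x < real (Suc n)\<close> by simp
      qed
      then have "eventually (\<lambda>n. h n x = g x) sequentially" unfolding eventually_sequentially by blast
      then have "(\<lambda>n. h n x) \<longlonglongrightarrow> g x" by (rule tendsto_eventually)
      then show "g x = lim (\<lambda>n. h n x)" by (simp add: limI)
    qed
  qed
  moreover have "(\<lambda>x. lim (\<lambda>n. h n x)) \<in> borel_measurable borel"
    using h(1) by measurable
  ultimately show ?thesis by (rule bexI[of _ "\<lambda>x. lim (\<lambda>n. h n x)"])
qed

lemma AE_dense:
  assumes P: "AE x in lborel. P x" and ab: "a < (b :: real)"
  shows "\<exists>x. a < x \<and> x < b \<and> P x"
proof (rule ccontr)
  assume "\<not> ?thesis"
  then have "AE x in lborel. x \<notin> {a<..<b}" using P by (auto elim: eventually_mono)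
  then have "emeasure lborel {x \<in> space lborel. \<not> x \<notin> {a<..<b}} = 0"
    by (subst (asm) AE_iff_measurable[OF _ refl]) auto
  also have "{x \<in> space lborel. \<not> x \<notin> {a<..<b}} = {a<..<b}" by auto
  finally show False using ab by simp
qed

lemma continuous_AE_bounds:
  fixes f :: "real \<Rightarrow> real"
  assumes f: "isCont f x" and P: "AE y in lborel. 0 < y \<longrightarrow> m \<le> f y \<and> f y \<le> M" and x: "0 < x"
  shows "m \<le> f x \<and> f x \<le> M"
proof -
  have "\<exists>y. x < y \<and> y < x + 1 / Suc n \<and> (0 < y \<longrightarrow> m \<le> f y \<and> f y \<le> M)" for n
    by (rule AE_dense[OF P]) simp
  then obtain y where y: "\<And>n. x < y n" "\<And>n. y n < x + 1 / Suc n" "\<And>n. 0 < y n \<longrightarrow> m \<le> f (y n) \<and> f (y n) \<le> M"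
    by metis
  have "(\<lambda>n. x + inverse (real (Suc n))) \<longlonglongrightarrow> x + 0"
    by (intro tendsto_intros LIMSEQ_inverse_real_of_nat)
  then have lim: "(\<lambda>n. x + inverse (real (Suc n))) \<longlonglongrightarrow> x" by simp
  have "y \<longlonglongrightarrow> x"
  proof (rule tendsto_sandwich[OF _ _ tendsto_const lim])
    show "eventually (\<lambda>n. x \<le> y n) sequentially" using y(1) by (intro always_eventually allI less_imp_le)
    show "eventually (\<lambda>n. y n \<le> x + inverse (real (Suc n))) sequentially"
      using y(2) by (intro always_eventually allI less_imp_le) (simp add: inverse_eq_divide)
  qed
  then have "(\<lambda>n. f (y n)) \<longlonglongrightarrow> f x" by (rule isCont_tendsto_compose[OF f])
  moreover have "m \<le> f (y n)" "f (y n) \<le> M" for n using y(1)[of n] y(3)[of n] x by auto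
  ultimately show ?thesis by (metis LIMSEQ_le_const LIMSEQ_le_const2)
qed

text \<open>Continuity carries the bounds from almost every point to every positive point, and
  \<open>w\<close> is set to \<open>m\<close> elsewhere. The locales below can then assume bounds
  without exceptional points.\<close>

lemma weak_deriv_Borel_primitive:
  assumes wd: "has_weak_deriv f g" and bd: "\<And>x. 0 < x \<Longrightarrow> m \<le> f x \<and> f x \<le> M" and mM: "m \<le> M"
  obtains w h where "primitive_of w h" "w \<in> borel_measurable borel" "h \<in> borel_measurable borel"
    "\<And>x. m \<le> w x" "\<And>x. w x \<le> M" "AE x in lborel. 0 < x \<longrightarrow> f x = w x" "AE x in lborel. 0 < x \<longrightarrow> g x = h x"
proof -
  obtain h where h: "h \<in> borel_measurable borel" "AE x in lborel. 0 < x \<longrightarrow> g x = h x"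
    using loc_integrable_ex_Borel wd unfolding has_weak_deriv_def by blast
  have "has_weak_deriv f h" by (rule has_weak_deriv_cong[OF wd _ h(2)]) auto
  then obtain v where v: "primitive_of v h" "AE x in lebesgue. 0 < x \<longrightarrow> f x = v x"
    by (rule weak_deriv_imp_primitive)
  have fv: "AE x in lborel. 0 < x \<longrightarrow> f x = v x" using v(2) by (simp add: AE_completion_iff)
  then have "AE x in lborel. 0 < x \<longrightarrow> m \<le> v x \<and> v x \<le> M"
  proof eventually_elim
    case (elim x) then show ?case using bd[of x] by auto
  qed
  from continuous_AE_bounds[OF primitive_of_continuous[OF v(1)] this]
  have vb: "0 < x \<Longrightarrow> m \<le> v x \<and> v x \<le> M" for x by simp
  define w where "w x = (if 0 < x then v x else m)" for x
  show ?thesis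
  proof (rule that)
    show "primitive_of w h" using v(1) by (auto simp: primitive_of_def w_def)
    have "continuous_on {0<..} v"
      using primitive_of_continuous[OF v(1)] by (auto intro: continuous_at_imp_continuous_on)
    then have "(\<lambda>x. if x \<in> {0<..} then v x else m) \<in> borel_measurable borel"
      by (intro borel_measurable_continuous_on_if) auto
    then show "w \<in> borel_measurable borel" by (simp add: w_def[abs_def])
    show "m \<le> w x" "w x \<le> M" for x using vb mM by (auto simp: w_def)
    show "AE x in lborel. 0 < x \<longrightarrow> f x = w x" using fv by eventually_elim (auto simp: w_def)
  qed (use h in auto)
qed

text \<open>The averages over \<open>[x, x + 1/n]\<close> recover the continuous representative of every slice at
  every point, and the difference quotients of that representative its weak derivative; both
  limits are jointly measurable.\<close>

lemma joint_Borel_representative: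
  fixes s :: "real \<Rightarrow> real \<Rightarrow> real"
  assumes W: "in_Linf_W12 T s" and L: "in_Linf ({0..T} \<times> {0<..}) s"
    and bd: "\<And>t x. t \<in> {0..T} \<Longrightarrow> 0 < x \<Longrightarrow> 0 \<le> s t x \<and> s t x \<le> \<eta>" and \<eta>: "0 \<le> \<eta>"
  obtains u Du :: "real \<Rightarrow> real \<Rightarrow> real" and K :: real where
    "case_prod u \<in> borel_measurable (borel \<Otimes>\<^sub>M borel)" "case_prod Du \<in> borel_measurable (borel \<Otimes>\<^sub>M borel)"
    "\<And>t. primitive_of (u t) (Du t)" "\<And>t x. 0 \<le> u t x" "\<And>t x. u t x \<le> \<eta>"
    "\<And>t x. x \<le> 0 \<Longrightarrow> Du t x = 0"
    "\<And>t. (\<integral>\<^sup>+x. ennreal ((Du t x)\<^sup>2) \<partial>lborel) \<le> ennreal K"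
    "AE t in lborel. t \<in> {0..T} \<longrightarrow> (AE x in lborel. 0 < x \<longrightarrow> s t x = u t x) \<and> has_weak_deriv (s t) (Du t)"
proof -
  have "(\<lambda>(t, x). s t x) \<in> borel_measurable (lebesgue_on ({0..T} \<times> {0<..}))"
    using L by (simp add: in_Linf_def)
  from ex_Borel_lebesgue_on[OF this] obtain r where r: "r \<in> borel_measurable borel"
    "AE p in lborel. p \<in> {0..T} \<times> {0<..} \<longrightarrow> (case p of (t, x) \<Rightarrow> s t x) = r p"
    by (auto simp: borel_Times)
  have [measurable]: "r \<in> borel_measurable (borel \<Otimes>\<^sub>M borel)" using r(1) by (simp add: borel_prod)
  have r_AE: "AE t in lborel. AE x in lborel. (t, x) \<in> {0..T} \<times> {0<..} \<longrightarrow> s t x = r (t, x)"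
  proof -
    have "AE p in lborel \<Otimes>\<^sub>M lborel. p \<in> {0..T} \<times> {0<..} \<longrightarrow> (case p of (t, x) \<Rightarrow> s t x) = r p"
      by (subst lborel_prod) (rule r(2))
    from lborel_pair.AE_pair[OF this] show ?thesis by simp
  qed
  define avg where "avg n t x = real (Suc n) * (LINT z|lborel. indicator {x..x + 1 / Suc n} z * r (t, z))" for n t x
  define w where "w t x = lim (\<lambda>n. avg n t x)" for t x
  define Dw where "Dw t x = (if 0 < x then lim (\<lambda>n. real (Suc n) * (w t (x + 1 / Suc n) - w t x)) else 0)" for t x
  have ind: "indicator {x..x + c} z = (if x \<le> z \<and> z \<le> x + c then 1 else 0 :: real)" for x z c :: real
    by (auto split: split_indicator)
  have avg_meas [measurable]: "(\<lambda>(t, x). avg n t x) \<in> borel_measurable (borel \<Otimes>\<^sub>M borel)" for n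
    unfolding avg_def ind by measurable
  have w_meas [measurable]: "(\<lambda>(t, x). w t x) \<in> borel_measurable (borel \<Otimes>\<^sub>M borel)"
    unfolding w_def by measurable
  have [measurable]: "(\<lambda>(t, x). Dw t x) \<in> borel_measurable (borel \<Otimes>\<^sub>M borel)"
    unfolding Dw_def by measurable
  obtain K' where K': "AE t in lborel. t \<in> {0..T} \<longrightarrow> W12_norm (s t) \<le> K'"
    using W by (auto simp: in_Linf_W12_def AE_lebesgue_on_iff)
  have sW: "AE t in lborel. t \<in> {0..T} \<longrightarrow> in_W12 (s t)"
    using W by (auto simp: in_Linf_W12_def AE_lebesgue_on_iff)
  define K where "K = K'\<^sup>2"
  define good where "good t \<longleftrightarrow> t \<in> {0..T} \<and> primitive_of (w t) (Dw t) \<and> (\<forall>x>0. 0 \<le> w t x \<and> w t x \<le> \<eta>) \<and>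
     (\<integral>\<^sup>+x. ennreal ((Dw t x)\<^sup>2) \<partial>lborel) \<le> ennreal K \<and> (AE x in lborel. 0 < x \<longrightarrow> s t x = w t x) \<and> has_weak_deriv (s t) (Dw t)" for t
  have "AE t in lborel. t \<in> {0..T} \<longrightarrow> good t"
    using r_AE K' sW
  proof eventually_elim
    case (elim t)
    show ?case
    proof
      assume t: "t \<in> {0..T}"
      then have sr: "AE x in lborel. 0 < x \<longrightarrow> s t x = r (t, x)" using elim(1) by auto
      obtain g where g: "has_weak_deriv (s t) g" "in_L2 g" using elim t by (auto simp: in_W12_def)
      let ?g = "weak_deriv (s t)"
      have wd: "has_weak_deriv (s t) ?g" by (rule has_weak_deriv_weak_deriv[OF g(1)])
      obtain v h where vh: "primitive_of v h" "v \<in> borel_measurable borel" "h \<in> borel_measurable borel"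
        "\<And>x. 0 \<le> v x" "\<And>x. v x \<le> \<eta>" "AE x in lborel. 0 < x \<longrightarrow> s t x = v x" "AE x in lborel. 0 < x \<longrightarrow> ?g x = h x"
        using weak_deriv_Borel_primitive[OF wd, of 0 \<eta>] bd[OF t] \<eta> by blast
      have wv: "w t x = v x" if x: "0 < x" for x
      proof -
        have "((\<lambda>d. integral {x..x + d} v / d) \<longlongrightarrow> v x) (at_right 0)"
        proof -
          have cv: "continuous_on {x..x + 1} v"
            using primitive_of_continuous[OF vh(1)] x by (auto intro: continuous_at_imp_continuous_on)
          have "((\<lambda>y. integral {x..y} v) has_real_derivative v x) (at x within {x..x + 1})"
            by (rule integral_has_real_derivative[OF cv]) auto
          then have "((\<lambda>y. (integral {x..y} v - integral {x..x} v) / (y - x)) \<longlongrightarrow> v x) (at x within {x..x + 1})"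
            by (simp add: has_field_derivative_iff)
          then have "((\<lambda>y. integral {x..y} v / (y - x)) \<longlongrightarrow> v x) (at_right x)"
            by (simp add: at_within_Icc_at_right)
          then show ?thesis
            by (simp add: filterlim_at_right_to_0[of _ _ x] add.commute)
        qed
        moreover have "filterlim (\<lambda>n. 1 / real (Suc n)) (at_right 0) sequentially"
          using LIMSEQ_inverse_real_of_nat by (intro tendsto_imp_filterlim_at_right) (auto simp: divide_inverse)
        ultimately have "(\<lambda>n. integral {x..x + 1 / Suc n} v / (1 / Suc n)) \<longlonglongrightarrow> v x"
          by (rule filterlim_compose)
        moreover have "integral {x..x + 1 / Suc n} v / (1 / Suc n) = avg n t x" for n
        proof -
          have "set_integrable lborel {x..x + 1 / Suc n} v"
            unfolding set_integrable_def using x primitive_of_continuous[OF vh(1)]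
            by (intro borel_integrable_compact) (auto intro: continuous_at_imp_continuous_on)
          from set_borel_integral_eq_integral(2)[OF this]
          have "integral {x..x + 1 / Suc n} v = (LINT z|lborel. indicator {x..x + 1 / Suc n} z * v z)"
            by (simp add: set_lebesgue_integral_def)
          also have "\<dots> = (LINT z|lborel. indicator {x..x + 1 / Suc n} z * r (t, z))"
          proof (rule integral_cong_AE)
            show "AE z in lborel. indicator {x..x + 1 / Suc n} z * v z = indicator {x..x + 1 / Suc n} z * r (t, z)"
              using sr vh(6) by eventually_elim (use x in \<open>auto split: split_indicator\<close>)
          qed (use vh in measurable)
          finally show ?thesis by (simp add: avg_def)
        qed
        ultimately show ?thesis unfolding w_def by (simp add: limI)
      qed
      have "AE x in lborel. 0 < x \<longrightarrow> (\<lambda>n. real (Suc n) * (v (x + 1 / Suc n) - v x)) \<longlonglongrightarrow> h x"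
        using primitive_of_AE_difference_quotient[OF vh(1)] by (simp add: AE_completion_iff)
      then have Dh: "AE x in lborel. 0 < x \<longrightarrow> h x = Dw t x"
      proof eventually_elim
        case (elim x)
        show ?case
        proof
          assume x: "0 < x"
          then have "0 < x + 1 / Suc n" for n by (simp add: add_pos_pos)
          then show "h x = Dw t x" using elim x wv by (simp add: Dw_def limI)
        qed
      qed
      then have gD: "AE x in lborel. 0 < x \<longrightarrow> ?g x = Dw t x" using vh(7) by eventually_elim auto
      have sw: "AE x in lborel. 0 < x \<longrightarrow> s t x = w t x" using vh(6) by eventually_elim (use wv in auto)
      have wdD: "has_weak_deriv (s t) (Dw t)" by (rule has_weak_deriv_cong[OF wd _ gD]) auto
      have prim: "primitive_of (w t) (Dw t)"
      proof -
        have wdv: "has_weak_deriv v (Dw t)" by (rule has_weak_deriv_cong[OF wd vh(6) gD])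
        have neg: "negligible {x. 0 < x \<and> h x \<noteq> Dw t x}"
          using AE_completion[OF Dh] unfolding completion.AE_iff_null_sets negligible_iff_null_sets by simp
        show ?thesis
          unfolding primitive_of_def
        proof (intro allI impI conjI)
          fix a b :: real assume ab: "0 < a \<and> a \<le> b"
          show "Dw t absolutely_integrable_on {a..b}" using wdv ab by (auto simp: has_weak_deriv_def loc_integrable_iff)
          have "integral {a..b} h = integral {a..b} (Dw t)"
            by (rule integral_spike[OF neg]) (use ab in auto)
          then show "w t b - w t a = integral {a..b} (Dw t)"
            using primitive_ofD(3)[OF vh(1), of a b] wv ab by simp
        qed
      qed
      have L2D: "L2_sq ?g = (\<integral>\<^sup>+x. ennreal ((Dw t x)\<^sup>2) \<partial>lborel)"
        unfolding L2_sq_Borel[OF gD] by (intro nn_integral_cong) (auto simp: Dw_def split: split_indicator)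
      have "L2_sq ?g = L2_sq g"
        using L2_sq_Borel[OF weak_deriv_unique[OF wd g(1)]] L2_sq_Borel[of g g] by simp
      then have "L2_sq ?g < \<infinity>" using g(2) by (simp add: in_L2_def)
      then have "L2_sq ?g = ennreal ((L2_norm_Rplus ?g)\<^sup>2)"
        by (simp add: L2_norm_Rplus_def ennreal_enn2real)
      also have "\<dots> \<le> ennreal K"
      proof (rule ennreal_leI)
        have "W12_norm (s t) \<le> K'" using elim(2) t by blast
        then have "(W12_norm (s t))\<^sup>2 \<le> K'\<^sup>2" by (intro power_mono) (auto simp: W12_norm_def)
        then show "(L2_norm_Rplus ?g)\<^sup>2 \<le> K" by (simp add: W12_norm_def K_def) (smt (verit) zero_le_power2)
      qed
      finally have "(\<integral>\<^sup>+x. ennreal ((Dw t x)\<^sup>2) \<partial>lborel) \<le> ennreal K" unfolding L2D .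
      then show "good t"
        unfolding good_def using t prim sw wdD wv vh(4,5) by auto
    qed
  qed
  then obtain N where N: "N \<in> null_sets lborel" "\<And>t. t \<notin> N \<Longrightarrow> t \<in> {0..T} \<Longrightarrow> good t"
    by (auto simp: eventually_ae_filter)
  have [measurable]: "N \<in> sets borel" using N(1) by auto
  define G where "G = {0..T} - N"
  have [measurable]: "G \<in> sets borel" by (auto simp: G_def)
  have G: "t \<in> G \<Longrightarrow> good t" for t using N(2) by (auto simp: G_def)
  \<comment> \<open>At the exceptional times both functions are 0, which satisfies every property
    demanded at all times.\<close>
  define u where "u t x = (if t \<in> G \<and> 0 < x then w t x else 0)" for t x
  define Du where "Du t x = (if t \<in> G then Dw t x else 0)" for t x
  show ?thesis
  proof (rule that[of u Du K])
    show "case_prod u \<in> borel_measurable (borel \<Otimes>\<^sub>M borel)" "case_prod Du \<in> borel_measurable (borel \<Otimes>\<^sub>M borel)"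
      unfolding u_def Du_def by measurable
    show "primitive_of (u t) (Du t)" for t
    proof (cases "t \<in> G")
      case True
      then have "primitive_of (w t) (Dw t)" using G by (simp add: good_def)
      then show ?thesis using True by (auto simp: primitive_of_def u_def Du_def[abs_def])
    next
      case False
      then show ?thesis by (auto simp: primitive_of_def u_def Du_def[abs_def])
    qed
    show "0 \<le> u t x" "u t x \<le> \<eta>" for t x using G[of t] \<eta> by (auto simp: u_def good_def)
    show "Du t x = 0" if "x \<le> 0" for t x using that by (simp add: Du_def Dw_def)
    show "(\<integral>\<^sup>+x. ennreal ((Du t x)\<^sup>2) \<partial>lborel) \<le> ennreal K" for t
      using G[of t] by (cases "t \<in> G") (auto simp: Du_def good_def)
    have "AE t in lborel. t \<notin> N" using N(1) by (rule AE_not_in)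
    then show "AE t in lborel. t \<in> {0..T} \<longrightarrow> (AE x in lborel. 0 < x \<longrightarrow> s t x = u t x) \<and> has_weak_deriv (s t) (Du t)"
    proof eventually_elim
      case (elim t)
      show ?case
      proof
        assume "t \<in> {0..T}"
        then have "t \<in> G" using elim by (simp add: G_def)
        with G[OF this] show "(AE x in lborel. 0 < x \<longrightarrow> s t x = u t x) \<and> has_weak_deriv (s t) (Du t)"
          by (auto simp: good_def u_def Du_def[abs_def])
      qed
    qed
  qed
qed

subsection \<open>The concentration and the source terms\<close>

text \<open>The explicit formula for \<open>c\<close>, with first argument the value of
  \<open>c0\<close> at \<open>x\<close> and second argument the time integral of \<open>s\<close> at
  \<open>x\<close>. The next two definitions are its partial derivatives.\<close>

definition conc_fun :: "real \<Rightarrow> real \<Rightarrow> real \<times> real \<Rightarrow> real" where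
  "conc_fun B lam p = fst p / ((1 + B * fst p) * exp (lam * snd p) - B * fst p)"

definition conc_fun_1 :: "real \<Rightarrow> real \<Rightarrow> real \<times> real \<Rightarrow> real" where
  "conc_fun_1 B lam p = exp (lam * snd p) / ((1 + B * fst p) * exp (lam * snd p) - B * fst p)\<^sup>2"

definition conc_fun_2 :: "real \<Rightarrow> real \<Rightarrow> real \<times> real \<Rightarrow> real" where
  "conc_fun_2 B lam p = - (lam * fst p * (1 + B * fst p) * exp (lam * snd p)) / ((1 + B * fst p) * exp (lam * snd p) - B * fst p)\<^sup>2"

text \<open>The denominator is D = X (E - 1) + 1 \<ge> 1, and X E / D = 1 + B c. The second identity
  cancels the growing exponential, so the bounds do not depend on \<open>b\<close>.\<close>

lemma conc_fun_bounds:
  assumes B: "B \<in> {1, - 1}" and lam: "0 < lam" and a: "0 \<le> a" "a \<le> C0" and b: "0 \<le> b"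
    and pm: "0 < pm" "\<forall>c. 0 \<le> c \<and> c \<le> C0 \<longrightarrow> pm \<le> 1 + B * c"
  shows "1 \<le> (1 + B * a) * exp (lam * b) - B * a"
    and "0 \<le> conc_fun B lam (a, b)" "conc_fun B lam (a, b) \<le> C0"
    and "\<bar>conc_fun_1 B lam (a, b)\<bar> \<le> (1 + C0) / pm"
    and "\<bar>conc_fun_2 B lam (a, b)\<bar> \<le> lam * (C0 * (1 + C0))"
proof -
  define E X D where "E = exp (lam * b)" and "X = 1 + B * a" and "D = X * E - B * a"
  have E: "1 \<le> E" using lam b by (simp add: E_def)
  have X: "pm \<le> X" "0 < X" using pm a by (auto simp: X_def)
  have "D = X * (E - 1) + 1" by (simp add: D_def X_def algebra_simps)
  moreover have "0 \<le> X * (E - 1)" using E X by simp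
  ultimately have D: "1 \<le> D" by simp
  then show "1 \<le> (1 + B * a) * exp (lam * b) - B * a" by (simp add: D_def X_def E_def)
  define c where "c = a / D"
  have c: "conc_fun B lam (a, b) = c" by (simp add: conc_fun_def c_def D_def X_def E_def)
  have c0: "0 \<le> c" using a D by (simp add: c_def)
  have "c \<le> a" using a D mult_right_mono[of 1 D a] by (simp add: c_def field_simps)
  then have cC: "c \<le> C0" using a by simp
  show "0 \<le> conc_fun B lam (a, b)" "conc_fun B lam (a, b) \<le> C0" using c c0 cC by auto
  have C0: "0 \<le> C0" using a by simp
  have XE: "X * E / D = 1 + B * c" using D by (simp add: c_def D_def field_simps)
  have Bc: "1 + B * c \<le> 1 + C0" using B c0 cC C0 by auto
  \<comment> \<open>Since \<open>c\<close> lies in \<open>[0, C0]\<close> again, the lower bound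
    \<open>pm\<close> applies to it as well.\<close>
  have Bc0: "0 \<le> 1 + B * c" using pm c0 cC by force
  have "\<bar>conc_fun_1 B lam (a, b)\<bar> = E / D / D" using D E by (simp add: conc_fun_1_def D_def X_def E_def power2_eq_square)
  also have "\<dots> \<le> E / D" using D E by (simp add: divide_le_eq mult_left_mono)
  also have "\<dots> = (1 + B * c) / X" using XE X by (simp add: field_simps)
  also have "\<dots> \<le> (1 + C0) / pm" using Bc Bc0 X pm(1) by (intro frac_le) auto
  finally show "\<bar>conc_fun_1 B lam (a, b)\<bar> \<le> (1 + C0) / pm" .
  have "\<bar>conc_fun_2 B lam (a, b)\<bar> = lam * ((a / D) * (X * E / D))"
    using D E X a lam by (simp add: conc_fun_2_def D_def X_def E_def power2_eq_square abs_mult)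
  also have "\<dots> = lam * (c * (1 + B * c))" unfolding XE c_def ..
  also have "\<dots> \<le> lam * (C0 * (1 + C0))"
    using lam c0 cC Bc Bc0 C0 by (intro mult_left_mono mult_mono) auto
  finally show "\<bar>conc_fun_2 B lam (a, b)\<bar> \<le> lam * (C0 * (1 + C0))" .
qed

lemma conc_fun_has_derivative:
  assumes D: "(1 + B * fst p) * exp (lam * snd p) - B * fst p \<noteq> 0"
  shows "(conc_fun B lam has_derivative (\<lambda>q. conc_fun_1 B lam p * fst q + conc_fun_2 B lam p * snd q)) (at p within S)"
proof -
  define E D where "E = exp (lam * snd p)" and "D = (1 + B * fst p) * E - B * fst p"
  have D0: "D \<noteq> 0" using D by (simp add: D_def E_def)
  have "(conc_fun B lam has_derivative (\<lambda>q. (fst q * D - fst p * ((B * fst q) * E + (1 + B * fst p) * (E * (lam * snd q)) - B * fst q)) / (D * D))) (at p within S)"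
    unfolding conc_fun_def[abs_def]
    using D0 by (auto intro!: derivative_eq_intros simp: D_def E_def algebra_simps)
  moreover have "(fst q * D - fst p * ((B * fst q) * E + (1 + B * fst p) * (E * (lam * snd q)) - B * fst q)) / (D * D)
      = conc_fun_1 B lam p * fst q + conc_fun_2 B lam p * snd q" for q
  proof -
    have "conc_fun_1 B lam p * fst q + conc_fun_2 B lam p * snd q = (E * fst q - lam * fst p * (1 + B * fst p) * E * snd q) / (D * D)"
      by (simp add: conc_fun_1_def conc_fun_2_def D_def E_def power2_eq_square diff_divide_distrib)
    also have "E * fst q - lam * fst p * (1 + B * fst p) * E * snd q = fst q * D - fst p * ((B * fst q) * E + (1 + B * fst p) * (E * (lam * snd q)) - B * fst q)"
      by (simp add: D_def algebra_simps)
    finally show ?thesis by simp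
  qed
  ultimately show ?thesis by simp
qed

lemma primitive_of_diff:
  assumes "primitive_of f h" "primitive_of g k"
  shows "primitive_of (\<lambda>x. f x - g x) (\<lambda>x. h x - k x)"
  unfolding primitive_of_def
proof (intro allI impI conjI)
  fix a b :: real assume ab: "0 < a \<and> a \<le> b"
  note f = primitive_ofD[OF assms(1), of a b] and g = primitive_ofD[OF assms(2), of a b]
  show "(\<lambda>x. h x - k x) absolutely_integrable_on {a..b}" using f(1) g(1) ab by (intro set_integral_diff) auto
  show "f b - g b - (f a - g a) = integral {a..b} (\<lambda>x. h x - k x)"
    using f(2,3) g(2,3) ab by (subst Henstock_Kurzweil_Integration.integral_diff) auto
qed

lemma ennreal_integral_le: "ennreal \<bar>LINT x|M. f x\<bar> \<le> (\<integral>\<^sup>+x. ennreal \<bar>f x\<bar> \<partial>M)" for f :: "'a \<Rightarrow> real"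
  using integral_norm_bound_ennreal[of M f] by (cases "integrable M f") (auto simp: not_integrable_integral_eq)

lemma nn_integral_indicator_Ioo: "0 \<le> t \<Longrightarrow> (\<integral>\<^sup>+r. c * indicator {0<..<t} r \<partial>lborel) = c * ennreal t"
  by (simp add: nn_integral_cmult)

text \<open>\<open>u\<close> and \<open>Du\<close> stand for jointly Borel representatives of the solution \<open>s\<close> and of its weak derivative,
  changed on a null set of times so that all properties hold at every time; \<open>pm\<close> is \<open>\<phi>\<^sub>m\<close>.\<close>

locale reaction = boundary_data \<psi> \<eta> H \<beta> Tf
  for \<psi> :: "real \<Rightarrow> real" and \<eta> H \<beta> Tf :: real +
  fixes B lam C0 pm T l1 K :: real and c1 g1 :: "real \<Rightarrow> real" and u Du :: "real \<Rightarrow> real \<Rightarrow> real"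
  assumes B: "B \<in> {1, - 1}" and lam: "0 < lam" and T: "0 < T" "T \<le> Tf"
    and pm: "0 < pm" "\<forall>c. 0 \<le> c \<and> c \<le> C0 \<longrightarrow> pm \<le> 1 + B * c"
    and \<eta>1: "B = 1 \<Longrightarrow> \<eta> < 1"
    and c1 [measurable]: "c1 \<in> borel_measurable borel" and g1 [measurable]: "g1 \<in> borel_measurable borel"
    and c1_prim: "primitive_of c1 g1" and c1_bd: "\<And>x. 0 \<le> c1 x" "\<And>x. c1 x \<le> C0"
    and g1_L2: "(\<integral>\<^sup>+x. indicator {0<..} x * ennreal ((g1 x)\<^sup>2) \<partial>lborel) \<le> ennreal (l1\<^sup>2)"
    and u [measurable]: "case_prod u \<in> borel_measurable (borel \<Otimes>\<^sub>M borel)"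
    and Du [measurable]: "case_prod Du \<in> borel_measurable (borel \<Otimes>\<^sub>M borel)"
    and u_prim: "\<And>t. primitive_of (u t) (Du t)" and u_bd: "\<And>t x. 0 \<le> u t x" "\<And>t x. u t x \<le> \<eta>"
    and Du_0: "\<And>t x. x \<le> 0 \<Longrightarrow> Du t x = 0"
    and Du_L2: "\<And>t. (\<integral>\<^sup>+x. ennreal ((Du t x)\<^sup>2) \<partial>lborel) \<le> ennreal K"
begin

section \<open>The time integral of the solution and its spatial derivative\<close>

definition \<sigma> :: "real \<Rightarrow> real \<Rightarrow> real" where
  "\<sigma> t x = (LINT r|lborel. indicator {0<..<t} r * u r x)"

definition D\<sigma> :: "real \<Rightarrow> real \<Rightarrow> real" where
  "D\<sigma> t x = (LINT r|lborel. indicator {0<..<t} r * Du r x)"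

lemma indicator_Ioo: "indicator {0<..<t} r = (if 0 < r \<and> r < t then 1 else 0 :: 'c :: zero_neq_one)" for t r :: real
  by (auto split: split_indicator)

lemma measurable_\<sigma> [measurable]:
  "case_prod \<sigma> \<in> borel_measurable (borel \<Otimes>\<^sub>M borel)" "case_prod D\<sigma> \<in> borel_measurable (borel \<Otimes>\<^sub>M borel)"
  unfolding \<sigma>_def D\<sigma>_def indicator_Ioo by measurable

lemma C0_nonneg: "0 \<le> C0" using c1_bd[of 0] by simp

lemma \<sigma>_nonneg: "0 \<le> \<sigma> t x"
  unfolding \<sigma>_def by (intro integral_nonneg_AE AE_I2) (simp add: u_bd)

definition grad_energy :: "real \<Rightarrow> ennreal" where
  "grad_energy t = (\<integral>\<^sup>+r. indicator {0<..<t} r * (\<integral>\<^sup>+x. ennreal ((Du r x)\<^sup>2) \<partial>lborel) \<partial>lborel)"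

lemma measurable_grad_energy [measurable]: "grad_energy \<in> borel_measurable borel"
  unfolding grad_energy_def indicator_Ioo by measurable

text \<open>A qualitative bound by the unspecified \<open>K\<close>. It provides the finiteness
  needed for absorbing terms and for Gronwall's inequality, but enters no final constant.\<close>

lemma grad_energy_fin: "0 \<le> t \<Longrightarrow> grad_energy t \<le> ennreal K * ennreal t"
proof -
  assume t: "0 \<le> t"
  have "grad_energy t \<le> (\<integral>\<^sup>+r. ennreal K * indicator {0<..<t} r \<partial>lborel)"
    unfolding grad_energy_def using Du_L2 by (intro nn_integral_mono) (auto split: split_indicator)
  then show ?thesis by (simp add: nn_integral_indicator_Ioo[OF t])
qed

lemma integrable_u: "0 \<le> t \<Longrightarrow> integrable lborel (\<lambda>r. indicator {0<..<t} r * u r x)"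
proof (rule Bochner_Integration.integrable_bound)
  assume t: "0 \<le> t"
  show "integrable lborel (\<lambda>r. \<eta> * indicator {0<..<t} r)"
    using t by (intro integrable_mult_right integrable_real_indicator) auto
  show "AE r in lborel. norm (indicator {0<..<t} r * u r x) \<le> norm (\<eta> * indicator {0<..<t} r)"
    using u_bd \<eta>_nonneg by (intro AE_I2) (auto split: split_indicator)
qed measurable

lemma primitive_of_\<sigma>:
  assumes t: "0 \<le> t"
  shows "primitive_of (\<sigma> t) (D\<sigma> t)"
  unfolding primitive_of_def
proof (intro allI impI)
  fix a b :: real assume ab: "0 < a \<and> a \<le> b"
  define h where "h r x = indicator {a..b} x * (indicator {0<..<t} r * Du r x)" for r x
  have [measurable]: "case_prod h \<in> borel_measurable (lborel \<Otimes>\<^sub>M lborel)" unfolding h_def by measurable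
  have int: "integrable (lborel \<Otimes>\<^sub>M lborel) (case_prod h)"
  proof (rule integrableI_bounded)
    have "(\<integral>\<^sup>+q. ennreal (norm (case_prod h q)) \<partial>(lborel \<Otimes>\<^sub>M lborel)) = (\<integral>\<^sup>+r. \<integral>\<^sup>+x. ennreal (norm (h r x)) \<partial>lborel \<partial>lborel)"
      by (subst lborel.nn_integral_fst[symmetric]) auto
    also have "\<dots> \<le> (\<integral>\<^sup>+r. (ennreal (b - a) + ennreal K) * indicator {0<..<t} r \<partial>lborel)"
    proof (rule nn_integral_mono)
      fix r
      have "(\<integral>\<^sup>+x. ennreal (norm (h r x)) \<partial>lborel) \<le> (\<integral>\<^sup>+x. indicator {0<..<t} r * (indicator {a..b} x + ennreal ((Du r x)\<^sup>2)) \<partial>lborel)"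
      proof (rule nn_integral_mono)
        fix x
        have "\<bar>Du r x\<bar> \<le> 1 + (Du r x)\<^sup>2"
          \<comment> \<open>On a bounded interval the constant 1 is integrable, so square
            integrability is enough for Fubini's theorem.\<close>
          using zero_le_power2[of "\<bar>Du r x\<bar> - 1"] by (simp add: power2_eq_square algebra_simps)
        then have "ennreal \<bar>Du r x\<bar> \<le> 1 + ennreal ((Du r x)\<^sup>2)"
          by (metis ennreal_1 ennreal_leI ennreal_plus zero_le_one zero_le_power2)
        then show "ennreal (norm (h r x)) \<le> indicator {0<..<t} r * (indicator {a..b} x + ennreal ((Du r x)\<^sup>2))"
          by (auto simp: h_def split: split_indicator)
      qed
      also have "\<dots> = indicator {0<..<t} r * (ennreal (b - a) + (\<integral>\<^sup>+x. ennreal ((Du r x)\<^sup>2) \<partial>lborel))"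
        using ab by (subst nn_integral_cmult) (auto simp: nn_integral_add)
      also have "\<dots> \<le> indicator {0<..<t} r * (ennreal (b - a) + ennreal K)"
        by (intro mult_left_mono add_left_mono Du_L2) auto
      finally show "(\<integral>\<^sup>+x. ennreal (norm (h r x)) \<partial>lborel) \<le> (ennreal (b - a) + ennreal K) * indicator {0<..<t} r"
        by (simp add: mult.commute)
    qed
    also have "\<dots> < \<infinity>" using t by (simp add: nn_integral_cmult ennreal_mult_less_top)
    finally show "(\<integral>\<^sup>+q. ennreal (norm (case_prod h q)) \<partial>(lborel \<Otimes>\<^sub>M lborel)) < \<infinity>" .
  qed measurable
  have hx: "(LINT r|lborel. h r x) = indicator {a..b} x * D\<sigma> t x" for x
    by (simp add: h_def D\<sigma>_def)
  have i1: "integrable lborel (\<lambda>x. indicator {a..b} x * D\<sigma> t x)"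
    using lborel_pair.integrable_snd[OF int] unfolding hx .
  then have si: "set_integrable lborel {a..b} (D\<sigma> t)" by (simp add: set_integrable_def)
  have ai: "D\<sigma> t absolutely_integrable_on {a..b}"
    using i1 by (simp add: set_integrable_def integrable_completion)
  have hr: "(LINT x|lborel. h r x) = indicator {0<..<t} r * u r b - indicator {0<..<t} r * u r a" for r
  proof (cases "0 < r \<and> r < t")
    case True
    have "integrable lebesgue (\<lambda>x. indicator {a..b} x * Du r x)" "(LINT x|lebesgue. indicator {a..b} x * Du r x) = integral {a..b} (Du r)"
      using primitive_ofD(1)[OF u_prim, of a b r] ab by (auto intro!: integral_lebesgue_indicator)
    then have "(LINT x|lborel. indicator {a..b} x * Du r x) = u r b - u r a"
      using primitive_ofD(3)[OF u_prim, of a b r] ab by (subst (asm) integral_completion) auto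
    then show ?thesis using True by (simp add: h_def)
  qed (auto simp: h_def)
  have "\<sigma> t b - \<sigma> t a = (LINT r|lborel. LINT x|lborel. h r x)"
    unfolding hr \<sigma>_def using integrable_u[OF t] by simp
  also have "\<dots> = (LINT x|lborel. LINT r|lborel. h r x)"
    by (rule lborel_pair.Fubini_integral[OF int, symmetric])
  also have "\<dots> = (LINT x:{a..b}|lborel. D\<sigma> t x)"
    by (simp add: hx set_lebesgue_integral_def)
  also have "\<dots> = integral {a..b} (D\<sigma> t)"
    by (rule set_borel_integral_eq_integral(2)[OF si])
  finally show "D\<sigma> t absolutely_integrable_on {a..b} \<and> \<sigma> t b - \<sigma> t a = integral {a..b} (D\<sigma> t)"
    using ai by simp
qed

text \<open>Cauchy-Schwarz in time, at the cost of the factor \<open>t\<close>. This is how the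
  history of the gradient of \<open>s\<close> enters the gradient of \<open>c\<close>.\<close>

lemma nn_integral_D\<sigma>:
  assumes t: "0 \<le> t"
  shows "(\<integral>\<^sup>+x. ennreal ((D\<sigma> t x)\<^sup>2) \<partial>lborel) \<le> ennreal t * grad_energy t"
proof -
  have "(\<integral>\<^sup>+x. ennreal ((D\<sigma> t x)\<^sup>2) \<partial>lborel) \<le> (\<integral>\<^sup>+x. ennreal t * (\<integral>\<^sup>+r. indicator {0<..<t} r * ennreal ((Du r x)\<^sup>2) \<partial>lborel) \<partial>lborel)"
  proof (rule nn_integral_mono)
    fix x
    have "ennreal ((D\<sigma> t x)\<^sup>2) = (ennreal \<bar>D\<sigma> t x\<bar>)\<^sup>2" by (simp add: ennreal_power)
    also have "\<dots> \<le> (\<integral>\<^sup>+r. ennreal \<bar>indicator {0<..<t} r * Du r x\<bar> \<partial>lborel)\<^sup>2"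
      unfolding D\<sigma>_def by (intro power_mono ennreal_integral_le) auto
    also have "(\<integral>\<^sup>+r. ennreal \<bar>indicator {0<..<t} r * Du r x\<bar> \<partial>lborel) = (\<integral>\<^sup>+r. indicator {0<..<t} r * (indicator {0<..<t} r * ennreal \<bar>Du r x\<bar>) \<partial>lborel)"
      by (intro nn_integral_cong) (auto split: split_indicator)
    also have "(\<integral>\<^sup>+r. indicator {0<..<t} r * (indicator {0<..<t} r * ennreal \<bar>Du r x\<bar>) \<partial>lborel)\<^sup>2
      \<le> (\<integral>\<^sup>+r. indicator {0<..<t} r ^ 2 \<partial>lborel) * (\<integral>\<^sup>+r. (indicator {0<..<t} r * ennreal \<bar>Du r x\<bar>)\<^sup>2 \<partial>lborel)"
      by (rule Cauchy_Schwarz_nn_integral) measurable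
    also have "(\<integral>\<^sup>+r. indicator {0<..<t} r ^ 2 \<partial>lborel) = ennreal t"
      using t by (simp add: power2_eq_square indicator_inter_arith[symmetric])
    also have "(\<integral>\<^sup>+r. (indicator {0<..<t} r * ennreal \<bar>Du r x\<bar>)\<^sup>2 \<partial>lborel) = (\<integral>\<^sup>+r. indicator {0<..<t} r * ennreal ((Du r x)\<^sup>2) \<partial>lborel)"
      by (intro nn_integral_cong) (auto simp: ennreal_power split: split_indicator)
    finally show "ennreal ((D\<sigma> t x)\<^sup>2) \<le> ennreal t * (\<integral>\<^sup>+r. indicator {0<..<t} r * ennreal ((Du r x)\<^sup>2) \<partial>lborel)" .
  qed
  also have "\<dots> = ennreal t * (\<integral>\<^sup>+x. \<integral>\<^sup>+r. indicator {0<..<t} r * ennreal ((Du r x)\<^sup>2) \<partial>lborel \<partial>lborel)"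
    by (rule nn_integral_cmult) measurable
  also have "(\<integral>\<^sup>+x. \<integral>\<^sup>+r. indicator {0<..<t} r * ennreal ((Du r x)\<^sup>2) \<partial>lborel \<partial>lborel)
     = (\<integral>\<^sup>+r. \<integral>\<^sup>+x. indicator {0<..<t} r * ennreal ((Du r x)\<^sup>2) \<partial>lborel \<partial>lborel)"
    by (intro lborel_pair.Fubini') measurable
  also have "\<dots> = grad_energy t"
    unfolding grad_energy_def by (intro nn_integral_cong nn_integral_cmult) measurable
  finally show ?thesis .
qed

section \<open>The concentration and its gradient\<close>

definition conc :: "real \<Rightarrow> real \<Rightarrow> real" where
  "conc t x = conc_fun B lam (c1 x, \<sigma> t x)"

definition Dconc :: "real \<Rightarrow> real \<Rightarrow> real" where
  "Dconc t x = conc_fun_1 B lam (c1 x, \<sigma> t x) * g1 x + conc_fun_2 B lam (c1 x, \<sigma> t x) * D\<sigma> t x"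

lemma measurable_conc [measurable]:
  "case_prod conc \<in> borel_measurable (borel \<Otimes>\<^sub>M borel)" "case_prod Dconc \<in> borel_measurable (borel \<Otimes>\<^sub>M borel)"
  unfolding conc_def Dconc_def conc_fun_def conc_fun_1_def conc_fun_2_def fst_conv snd_conv by measurable

definition P1 :: real where "P1 = (1 + C0) / pm"
definition P2 :: real where "P2 = lam * (C0 * (1 + C0))"

lemma P_nonneg: "0 \<le> P1" "0 \<le> P2"
  using C0_nonneg pm lam by (auto simp: P1_def P2_def)

lemma conc_bounds:
  "0 \<le> conc t x" "conc t x \<le> C0"
  "\<bar>conc_fun_1 B lam (c1 x, \<sigma> t x)\<bar> \<le> P1" "\<bar>conc_fun_2 B lam (c1 x, \<sigma> t x)\<bar> \<le> P2"
  using conc_fun_bounds[OF B lam c1_bd(1)[of x] c1_bd(2)[of x] \<sigma>_nonneg[of t x] pm]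
  by (auto simp: conc_def P1_def P2_def)

lemma primitive_of_conc:
  assumes t: "0 \<le> t"
  shows "primitive_of (conc t) (Dconc t)"
  unfolding conc_def[abs_def] Dconc_def[abs_def]
\<comment> \<open>On this closed set the denominator of \<open>conc_fun\<close> is at least 1; for
  negative second argument it may vanish.\<close>
proof (rule primitive_of_chain2[OF c1_prim primitive_of_\<sigma>[OF t], where S = "{0..C0} \<times> {0..}"])
  show "(c1 x, \<sigma> t x) \<in> {0..C0} \<times> {0..}" for x using c1_bd \<sigma>_nonneg by auto
  have den: "(1 + B * fst p) * exp (lam * snd p) - B * fst p \<noteq> 0" if "p \<in> {0..C0} \<times> {0..}" for p
    using conc_fun_bounds(1)[OF B lam _ _ _ pm, of "fst p" "snd p"] that by (auto simp: mem_Times_iff)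
  show "(conc_fun B lam has_derivative (\<lambda>q. conc_fun_1 B lam p * fst q + conc_fun_2 B lam p * snd q)) (at p within {0..C0} \<times> {0..})"
    if "p \<in> {0..C0} \<times> {0..}" for p
    by (rule conc_fun_has_derivative[OF den[OF that]])
  show "continuous_on ({0..C0} \<times> {0..}) (conc_fun_1 B lam)" "continuous_on ({0..C0} \<times> {0..}) (conc_fun_2 B lam)"
    unfolding conc_fun_1_def[abs_def] conc_fun_2_def[abs_def]
    by (intro continuous_intros ballI; use den in simp)+
qed

lemma Dconc_sq: "(Dconc t x)\<^sup>2 \<le> 2 * P1\<^sup>2 * (g1 x)\<^sup>2 + 2 * P2\<^sup>2 * (D\<sigma> t x)\<^sup>2"
proof -
  let ?a = "conc_fun_1 B lam (c1 x, \<sigma> t x)" and ?b = "conc_fun_2 B lam (c1 x, \<sigma> t x)"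
  have "(p + q)\<^sup>2 \<le> 2 * p\<^sup>2 + 2 * q\<^sup>2" for p q :: real
    using zero_le_power2[of "p - q"] by (simp add: power2_eq_square algebra_simps)
  then have "(Dconc t x)\<^sup>2 \<le> 2 * (?a * g1 x)\<^sup>2 + 2 * (?b * D\<sigma> t x)\<^sup>2" unfolding Dconc_def .
  also have "\<dots> = 2 * (?a\<^sup>2 * (g1 x)\<^sup>2) + 2 * (?b\<^sup>2 * (D\<sigma> t x)\<^sup>2)" by (simp add: power_mult_distrib)
  also have "\<dots> \<le> 2 * (P1\<^sup>2 * (g1 x)\<^sup>2) + 2 * (P2\<^sup>2 * (D\<sigma> t x)\<^sup>2)"
  proof -
    have "?a\<^sup>2 \<le> P1\<^sup>2" "?b\<^sup>2 \<le> P2\<^sup>2"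
      using conc_bounds(3,4)[where x = x and t = t] P_nonneg by (simp_all add: abs_le_square_iff[symmetric])
    then show ?thesis by (intro add_mono mult_left_mono mult_right_mono) auto
  qed
  finally show ?thesis by (simp add: mult.assoc)
qed

lemma nn_integral_Dconc:
  assumes t: "0 \<le> t" "t \<le> Tf"
  shows "(\<integral>\<^sup>+x. indicator {0<..} x * ennreal ((Dconc t x)\<^sup>2) \<partial>lborel) \<le> ennreal (2 * P1\<^sup>2 * l1\<^sup>2) + ennreal (2 * P2\<^sup>2 * Tf) * grad_energy t"
proof -
  have "(\<integral>\<^sup>+x. indicator {0<..} x * ennreal ((Dconc t x)\<^sup>2) \<partial>lborel)
    \<le> (\<integral>\<^sup>+x. ennreal (2 * P1\<^sup>2) * (indicator {0<..} x * ennreal ((g1 x)\<^sup>2)) + ennreal (2 * P2\<^sup>2) * ennreal ((D\<sigma> t x)\<^sup>2) \<partial>lborel)"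
  proof (rule nn_integral_mono)
    fix x
    show "indicator {0<..} x * ennreal ((Dconc t x)\<^sup>2) \<le> ennreal (2 * P1\<^sup>2) * (indicator {0<..} x * ennreal ((g1 x)\<^sup>2)) + ennreal (2 * P2\<^sup>2) * ennreal ((D\<sigma> t x)\<^sup>2)"
      using ennreal_leI[OF Dconc_sq[of t x]]
      by (auto simp: ennreal_plus ennreal_mult' ennreal_mult'' mult.assoc split: split_indicator)
  qed
  also have "\<dots> = ennreal (2 * P1\<^sup>2) * (\<integral>\<^sup>+x. indicator {0<..} x * ennreal ((g1 x)\<^sup>2) \<partial>lborel) + ennreal (2 * P2\<^sup>2) * (\<integral>\<^sup>+x. ennreal ((D\<sigma> t x)\<^sup>2) \<partial>lborel)"
    by (simp add: nn_integral_add nn_integral_cmult)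
  also have "\<dots> \<le> ennreal (2 * P1\<^sup>2) * ennreal (l1\<^sup>2) + ennreal (2 * P2\<^sup>2) * (ennreal Tf * grad_energy t)"
  proof (intro add_mono mult_left_mono g1_L2)
    have "(\<integral>\<^sup>+x. ennreal ((D\<sigma> t x)\<^sup>2) \<partial>lborel) \<le> ennreal t * grad_energy t" by (rule nn_integral_D\<sigma>[OF t(1)])
    also have "\<dots> \<le> ennreal Tf * grad_energy t" using t by (intro mult_right_mono ennreal_leI) auto
    finally show "(\<integral>\<^sup>+x. ennreal ((D\<sigma> t x)\<^sup>2) \<partial>lborel) \<le> ennreal Tf * grad_energy t" .
  qed auto
  also have "\<dots> = ennreal (2 * P1\<^sup>2 * l1\<^sup>2) + ennreal (2 * P2\<^sup>2 * Tf) * grad_energy t"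
    using t by (simp add: ennreal_mult mult.assoc)
  finally show ?thesis .
qed

section \<open>The drift and absorption terms\<close>

definition F1 :: "real \<Rightarrow> real \<Rightarrow> real" where
  "F1 r y = (if 0 < r \<and> r < T \<and> 0 < y then B * Dconc r y / (1 + B * conc r y) * Du r y else 0)"

definition F2 :: "real \<Rightarrow> real \<Rightarrow> real" where
  "F2 r y = lam * conc r y * u r y * (B * u r y - 1)"

definition M2 :: real where "M2 = lam * C0 * \<eta> * (1 + \<eta>)"

lemma measurable_F [measurable]:
  "case_prod F1 \<in> borel_measurable (borel \<Otimes>\<^sub>M borel)" "case_prod F2 \<in> borel_measurable (borel \<Otimes>\<^sub>M borel)"
  unfolding F1_def F2_def by measurable

text \<open>Young's inequality with a free parameter, the denominator
  \<open>1 + B * conc r y\<close> being at least \<open>pm\<close>. A small \<open>\<kappa>\<close>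
  keeps the gradient of the solution absorbable.\<close>

lemma abs_F1_le:
  assumes "0 < \<kappa>"
  shows "\<bar>F1 r y\<bar> \<le> \<kappa> / pm * (Du r y)\<^sup>2 + 1 / (4 * \<kappa> * pm) * (indicator {0<..} y * (Dconc r y)\<^sup>2)"
proof (cases "0 < r \<and> r < T \<and> 0 < y")
  case True
  have c: "pm \<le> 1 + B * conc r y" using pm(2) conc_bounds(1,2) by blast
  have "0 \<le> (2 * \<kappa> * \<bar>Du r y\<bar> - \<bar>Dconc r y\<bar>)\<^sup>2" by simp
  also have "\<dots> = 4 * \<kappa> * (\<kappa> * (Du r y)\<^sup>2 - \<bar>Dconc r y\<bar> * \<bar>Du r y\<bar> + 1 / (4 * \<kappa>) * (Dconc r y)\<^sup>2)"
    using assms by (simp add: power2_diff power_mult_distrib field_simps power2_eq_square[of \<kappa>])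
  finally have Young: "\<bar>Dconc r y\<bar> * \<bar>Du r y\<bar> \<le> \<kappa> * (Du r y)\<^sup>2 + 1 / (4 * \<kappa>) * (Dconc r y)\<^sup>2"
    using assms by (simp add: zero_le_mult_iff)
  have "\<bar>F1 r y\<bar> = \<bar>Dconc r y\<bar> * \<bar>Du r y\<bar> / (1 + B * conc r y)"
    using True B c pm(1) by (auto simp: F1_def abs_mult)
  also have "\<dots> \<le> (\<kappa> * (Du r y)\<^sup>2 + 1 / (4 * \<kappa>) * (Dconc r y)\<^sup>2) / pm"
    using Young c pm(1) assms by (intro frac_le) auto
  also have "\<dots> = \<kappa> / pm * (Du r y)\<^sup>2 + 1 / (4 * \<kappa> * pm) * (Dconc r y)\<^sup>2"
    by (simp add: add_divide_distrib)
  finally show ?thesis using True by simp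
qed (use assms pm in \<open>auto simp: F1_def\<close>)

text \<open>Two kinds of gradient terms arise: one at time \<open>t\<close> with a small factor, to
  be absorbed, and one integrated over earlier times, for Gronwall's inequality. The latter comes
  from \<open>Dconc\<close>, which depends on the solution up to time \<open>r\<close>.\<close>

lemma nn_integral_F1_le:
  assumes \<kappa>: "0 < \<kappa>" and t: "0 \<le> t" "t \<le> T"
  shows "(\<integral>\<^sup>+r. indicator {0<..<t} r * (\<integral>\<^sup>+y. ennreal \<bar>F1 r y\<bar> \<partial>lborel) \<partial>lborel)
    \<le> ennreal (\<kappa> / pm) * grad_energy t + ennreal (1 / (4 * \<kappa> * pm)) * (ennreal (2 * P1\<^sup>2 * l1\<^sup>2 * Tf)
        + ennreal (2 * P2\<^sup>2 * Tf) * (\<integral>\<^sup>+r. indicator {0<..<t} r * grad_energy r \<partial>lborel))"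
proof -
  let ?G = "\<lambda>r. \<integral>\<^sup>+y. ennreal ((Du r y)\<^sup>2) \<partial>lborel" and ?k = "ennreal (1 / (4 * \<kappa> * pm))"
  have "(\<integral>\<^sup>+r. indicator {0<..<t} r * (\<integral>\<^sup>+y. ennreal \<bar>F1 r y\<bar> \<partial>lborel) \<partial>lborel)
    \<le> (\<integral>\<^sup>+r. ennreal (\<kappa> / pm) * (indicator {0<..<t} r * ?G r) + ?k * (ennreal (2 * P1\<^sup>2 * l1\<^sup>2) * indicator {0<..<t} r + ennreal (2 * P2\<^sup>2 * Tf) * (indicator {0<..<t} r * grad_energy r)) \<partial>lborel)"
  proof (rule nn_integral_mono)
    fix r
    show "indicator {0<..<t} r * (\<integral>\<^sup>+y. ennreal \<bar>F1 r y\<bar> \<partial>lborel)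
      \<le> ennreal (\<kappa> / pm) * (indicator {0<..<t} r * ?G r) + ?k * (ennreal (2 * P1\<^sup>2 * l1\<^sup>2) * indicator {0<..<t} r + ennreal (2 * P2\<^sup>2 * Tf) * (indicator {0<..<t} r * grad_energy r))"
    proof (cases "0 < r \<and> r < t")
      case True
      have "(\<integral>\<^sup>+y. ennreal \<bar>F1 r y\<bar> \<partial>lborel) \<le> (\<integral>\<^sup>+y. ennreal (\<kappa> / pm) * ennreal ((Du r y)\<^sup>2) + ?k * (indicator {0<..} y * ennreal ((Dconc r y)\<^sup>2)) \<partial>lborel)"
      proof (rule nn_integral_mono)
        fix y
        show "ennreal \<bar>F1 r y\<bar> \<le> ennreal (\<kappa> / pm) * ennreal ((Du r y)\<^sup>2) + ?k * (indicator {0<..} y * ennreal ((Dconc r y)\<^sup>2))"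
        proof -
          define a b where "a = \<kappa> / pm" and "b = 1 / (4 * \<kappa> * pm)"
          have "0 \<le> a" "0 \<le> b" using \<kappa> pm(1) by (auto simp: a_def b_def)
          moreover have "ennreal \<bar>F1 r y\<bar> \<le> ennreal (a * (Du r y)\<^sup>2 + b * (indicator {0<..} y * (Dconc r y)\<^sup>2))"
            unfolding a_def b_def by (rule ennreal_leI[OF abs_F1_le[OF \<kappa>]])
          ultimately show ?thesis
            unfolding a_def[symmetric] b_def[symmetric]
            by (cases "0 < y") (simp_all add: ennreal_plus ennreal_mult)
        qed
      qed
      also have "\<dots> = ennreal (\<kappa> / pm) * ?G r + ?k * (\<integral>\<^sup>+y. indicator {0<..} y * ennreal ((Dconc r y)\<^sup>2) \<partial>lborel)"
        by (simp add: nn_integral_add nn_integral_cmult)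
      also have "\<dots> \<le> ennreal (\<kappa> / pm) * ?G r + ?k * (ennreal (2 * P1\<^sup>2 * l1\<^sup>2) + ennreal (2 * P2\<^sup>2 * Tf) * grad_energy r)"
        using True t T by (intro add_left_mono mult_left_mono nn_integral_Dconc) auto
      finally show ?thesis using True by simp
    qed auto
  qed
  also have "\<dots> = ennreal (\<kappa> / pm) * grad_energy t + ?k * (ennreal (2 * P1\<^sup>2 * l1\<^sup>2) * ennreal t + ennreal (2 * P2\<^sup>2 * Tf) * (\<integral>\<^sup>+r. indicator {0<..<t} r * grad_energy r \<partial>lborel))"
    using t by (simp add: nn_integral_add nn_integral_cmult grad_energy_def[of t])
  also have "\<dots> \<le> ennreal (\<kappa> / pm) * grad_energy t + ?k * (ennreal (2 * P1\<^sup>2 * l1\<^sup>2 * Tf) + ennreal (2 * P2\<^sup>2 * Tf) * (\<integral>\<^sup>+r. indicator {0<..<t} r * grad_energy r \<partial>lborel))"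
  proof (intro add_left_mono mult_left_mono add_right_mono)
    show "ennreal (2 * P1\<^sup>2 * l1\<^sup>2) * ennreal t \<le> ennreal (2 * P1\<^sup>2 * l1\<^sup>2 * Tf)"
      using t T by (simp add: ennreal_mult[symmetric] ennreal_leI mult_left_mono)
  qed auto
  finally show ?thesis .
qed

lemma nn_integral_grad_energy_fin: "0 \<le> t \<Longrightarrow> (\<integral>\<^sup>+r. indicator {0<..<t} r * grad_energy r \<partial>lborel) < \<infinity>"
proof -
  assume t: "0 \<le> t"
  have "(\<integral>\<^sup>+r. indicator {0<..<t} r * grad_energy r \<partial>lborel) \<le> (\<integral>\<^sup>+r. (ennreal K * ennreal t) * indicator {0<..<t} r \<partial>lborel)"
  proof (rule nn_integral_mono)
    fix r
    show "indicator {0<..<t} r * grad_energy r \<le> (ennreal K * ennreal t) * indicator {0<..<t} r"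
    proof (cases "0 < r \<and> r < t")
      case True
      then have "grad_energy r \<le> ennreal K * ennreal r" by (intro grad_energy_fin) auto
      also have "\<dots> \<le> ennreal K * ennreal t" using True by (intro mult_left_mono ennreal_leI) auto
      finally show ?thesis using True by simp
    qed auto
  qed
  also have "\<dots> < \<infinity>" using t by (simp add: nn_integral_indicator_Ioo ennreal_mult_less_top)
  finally show ?thesis .
qed

text \<open>The sign is where \<open>\<eta> < 1\<close> for \<open>B = 1\<close> enters: it makes
  \<open>B * u - 1\<close> nonpositive.\<close>

lemma F2_bounds: "F2 r y \<le> 0" "- M2 \<le> F2 r y"
proof -
  define a where "a = lam * conc r y * u r y"
  have c: "0 \<le> conc r y" "conc r y \<le> C0" by (rule conc_bounds)+
  have a0: "0 \<le> a" using lam c(1) u_bd(1) by (simp add: a_def)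
  have a1: "a \<le> lam * C0 * \<eta>" unfolding a_def using lam c u_bd \<eta>_nonneg C0_nonneg by (intro mult_mono) auto
  have b: "B * u r y - 1 \<le> 0" "- (1 + \<eta>) \<le> B * u r y - 1"
    using B u_bd[of r y] \<eta>1 \<eta>_nonneg by auto
  have F: "F2 r y = a * (B * u r y - 1)" by (simp add: F2_def a_def)
  show "F2 r y \<le> 0" unfolding F using a0 b(1) by (rule mult_nonneg_nonpos)
  have "a * (1 + \<eta>) \<le> M2" unfolding M2_def using a1 \<eta>_nonneg by (intro mult_right_mono) auto
  moreover have "a * (- (1 + \<eta>)) \<le> a * (B * u r y - 1)" using a0 b(2) by (rule mult_left_mono[rotated])
  ultimately show "- M2 \<le> F2 r y" unfolding F by (simp add: algebra_simps)
qed

sublocale heat_source F1 F2 M2 T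
proof
  show "(\<integral>\<^sup>+s. indicator {0<..<T} s * (\<integral>\<^sup>+y. ennreal \<bar>F1 s y\<bar> \<partial>lborel) \<partial>lborel) < \<infinity>"
  proof -
    have "grad_energy T < \<infinity>"
      using grad_energy_fin[of T] T by (auto simp: ennreal_mult_less_top intro: le_less_trans)
    then show ?thesis
      using nn_integral_grad_energy_fin[of T] T
      by (intro le_less_trans[OF nn_integral_F1_le[of 1 T]]) (auto simp: ennreal_mult_less_top)
  qed
qed (auto simp: F2_bounds)

end

subsection \<open>The energy estimate\<close>

text \<open>With the weight \<open>exp (- (2 * b * t))\<close> the supremum \<open>Z\<close>
  satisfies \<open>Z \<le> a + Z / 2\<close>; the rate \<open>2 * b\<close> is chosen to produce the
  1/2. Boundedness of \<open>Y\<close> makes \<open>Z\<close> a genuine real supremum, so continuity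
  of \<open>Y\<close> is not involved.\<close>

lemma gronwall_nn_integral:
  fixes Y :: "real \<Rightarrow> ennreal"
  assumes [measurable]: "Y \<in> borel_measurable borel" and a: "0 \<le> a" and b: "0 < b" and T: "0 < T"
    and bound: "\<And>t. 0 < t \<Longrightarrow> t \<le> T \<Longrightarrow> Y t \<le> ennreal a + ennreal b * (\<integral>\<^sup>+r. indicator {0<..<t} r * Y r \<partial>lborel)"
    and fin: "\<And>t. 0 < t \<Longrightarrow> t \<le> T \<Longrightarrow> Y t \<le> ennreal K"
    and t: "0 < t" "t \<le> T"
  shows "Y t \<le> ennreal (2 * a * exp (2 * b * t))"
proof -
  define y where "y t = enn2real (Y t) * exp (- (2 * b * t))" for t
  define Z where "Z = (SUP t\<in>{0<..T}. y t)"
  have Yy: "Y t = ennreal (y t * exp (2 * b * t))" if "0 < t" "t \<le> T" for t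
  proof -
    have "Y t < top" using fin[OF that] by (auto intro: le_less_trans)
    then show ?thesis by (simp add: y_def mult.assoc exp_add[symmetric])
  qed
  have bdd: "bdd_above (y ` {0<..T})"
  proof (rule bdd_aboveI2)
    fix t assume t: "t \<in> {0<..T}"
    have "enn2real (Y t) \<le> max K 0"
      using fin[of t] t by (intro enn2real_leI) (auto simp: max_def ennreal_neg split: if_splits)
    moreover have "exp (- (2 * b * t)) \<le> 1" using b t by simp
    ultimately show "y t \<le> max K 0 * 1" unfolding y_def by (intro mult_mono) auto
  qed
  have yZ: "y t \<le> Z" if "0 < t" "t \<le> T" for t
    unfolding Z_def using that by (intro cSUP_upper bdd) auto
  have y0: "0 \<le> y t" for t by (simp add: y_def)
  have Z0: "0 \<le> Z" using y0 yZ[of T] T order_trans by blast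
  have step: "y t \<le> a + Z / 2" if t: "0 < t" "t \<le> T" for t
  proof -
    have "(\<integral>\<^sup>+r. indicator {0<..<t} r * Y r \<partial>lborel) \<le> (\<integral>\<^sup>+r. ennreal (Z * exp (2 * b * r)) * indicator {0..t} r \<partial>lborel)"
    proof (rule nn_integral_mono)
      fix r
      show "indicator {0<..<t} r * Y r \<le> ennreal (Z * exp (2 * b * r)) * indicator {0..t} r"
      proof (cases "0 < r \<and> r < t")
        case True
        then have "Y r \<le> ennreal (Z * exp (2 * b * r))"
          using t Yy[of r] yZ[of r] by (simp add: ennreal_leI)
        then show ?thesis using True by simp
      qed auto
    qed
    also have "\<dots> = ennreal (Z * exp (2 * b * t) / (2 * b) - Z * exp (2 * b * 0) / (2 * b))"
      by (rule nn_integral_FTC_Icc[where F = "\<lambda>r. Z * exp (2 * b * r) / (2 * b)"])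
         (use b t Z0 in \<open>auto intro!: derivative_eq_intros\<close>)
    also have "\<dots> \<le> ennreal (Z * exp (2 * b * t) / (2 * b))"
      using b Z0 by (intro ennreal_leI) simp
    finally have "ennreal b * (\<integral>\<^sup>+r. indicator {0<..<t} r * Y r \<partial>lborel) \<le> ennreal b * ennreal (Z * exp (2 * b * t) / (2 * b))"
      by (rule mult_left_mono) simp
    also have "\<dots> = ennreal (Z / 2 * exp (2 * b * t))" using b Z0 by (simp add: ennreal_mult[symmetric])
    finally have "Y t \<le> ennreal a + ennreal (Z / 2 * exp (2 * b * t))"
      using bound[OF t] by (meson add_left_mono order_trans)
    then have "ennreal (y t * exp (2 * b * t)) \<le> ennreal (a + Z / 2 * exp (2 * b * t))"
      using a Z0 by (simp add: Yy[OF t])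
    then have "y t * exp (2 * b * t) \<le> a + Z / 2 * exp (2 * b * t)"
      using a Z0 by (subst (asm) ennreal_le_iff) auto
    also have "\<dots> \<le> a * exp (2 * b * t) + Z / 2 * exp (2 * b * t)"
      using a b t mult_left_mono[of 1 "exp (2 * b * t)" a] by simp
    also have "\<dots> = (a + Z / 2) * exp (2 * b * t)" by (simp add: distrib_right)
    finally show ?thesis by simp
  qed
  have "Z \<le> a + Z / 2" unfolding Z_def using T step[unfolded Z_def] by (intro cSUP_least) auto
  then have "y t \<le> 2 * a" using yZ[OF t] by simp
  then show ?thesis unfolding Yy[OF t] by (intro ennreal_leI mult_right_mono) auto
qed

text \<open>Moving a term to the other side is legitimate in \<open>ennreal\<close> only for finite
  \<open>Y\<close>; \<open>c \<le> 1 / 2\<close> accounts for the factor 2.\<close>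

lemma ennreal_absorb:
  fixes Y X :: ennreal
  assumes Y: "Y \<le> X + ennreal c * Y" and c: "0 \<le> c" "c \<le> 1 / 2" and fin: "Y < top"
  shows "Y \<le> 2 * X"
proof (cases "X = top")
  case False
  then obtain x where x: "X = ennreal x" "0 \<le> x" by (metis ennreal_cases)
  obtain y where y: "Y = ennreal y" "0 \<le> y" using fin by (metis ennreal_cases less_irrefl)
  have "ennreal y \<le> ennreal (x + c * y)" using Y c x y by (simp add: ennreal_mult)
  then have "y \<le> x + c * y" using x y c by (subst (asm) ennreal_le_iff) auto
  moreover have "c * y \<le> 1 / 2 * y" using c y by (intro mult_right_mono) auto
  ultimately have "y \<le> 2 * x" by simp
  from ennreal_leI[OF this] show ?thesis using x y by (simp add: ennreal_mult)
qed (simp add: ennreal_mult_top)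

lemma ennreal_square_sum: "ennreal ((a + b)\<^sup>2) \<le> 2 * ennreal (a\<^sup>2) + 2 * ennreal (b\<^sup>2)" for a b :: real
proof -
  have "(a + b)\<^sup>2 \<le> 2 * a\<^sup>2 + 2 * b\<^sup>2"
    using zero_le_power2[of "a - b"] by (simp add: power2_eq_square algebra_simps)
  then have "ennreal ((a + b)\<^sup>2) \<le> ennreal (2 * a\<^sup>2 + 2 * b\<^sup>2)" by (rule ennreal_leI)
  then show ?thesis by (simp add: ennreal_mult)
qed

text \<open>The bounds on \<open>lift + mild\<close> are assumed at every time, as the supremum over
  times requires, while the representative \<open>u\<close>, and with it \<open>Du\<close>, is tied
  to them at almost every time only.\<close>

locale reaction_solution = reaction \<psi> \<eta> H \<beta> Tf B lam C0 pm T l1 K c1 g1 u Du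
  for \<psi> :: "real \<Rightarrow> real" and \<eta> H \<beta> Tf B lam C0 pm T l1 K :: real and c1 g1 :: "real \<Rightarrow> real"
    and u Du :: "real \<Rightarrow> real \<Rightarrow> real" +
  fixes v0 :: "real \<Rightarrow> real" and l0 :: real
  assumes v0 [measurable]: "v0 \<in> borel_measurable borel" and v0_bd: "\<And>x. \<bar>v0 x\<bar> \<le> \<eta>"
    and v0_L2: "(\<integral>\<^sup>+x. ennreal ((v0 x)\<^sup>2) \<partial>lborel) \<le> ennreal (l0\<^sup>2)"
    and mild_bd: "\<And>t. 0 < t \<Longrightarrow> t \<le> T \<Longrightarrow> AE x in lborel. 0 < x \<longrightarrow> 0 \<le> lift t x + mild v0 t x \<and> lift t x + mild v0 t x \<le> \<eta>"
    and mild_u: "AE t in lborel. 0 < t \<and> t < T \<longrightarrow> (AE x in lborel. 0 < x \<longrightarrow> u t x = lift t x + mild v0 t x)"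
begin

lemma lift_eq_0: "x \<le> 0 \<Longrightarrow> lift t x = 0"
  by (simp add: lift_def boundary_kernel_def)

lemma mild_eq_0: "x \<le> 0 \<Longrightarrow> mild v0 t x = 0"
  by (simp add: mild_def dsg_def duhamel_def duhamel_kernel_def dirichlet_kernel_def)

definition A :: real where "A = 2 * \<eta> * sqrt Tf"

lemma A_nonneg: "0 \<le> A" using \<eta>_nonneg T by (simp add: A_def)

text \<open>From \<open>0 \<le> lift + mild \<le> \<eta>\<close> and
  \<open>0 \<le> lift \<le> 2 * \<eta>\<close>; the lower bound is positivity of the
  solution.\<close>

lemma mild_AE_bounds:
  assumes t: "0 < t" "t \<le> T"
  shows "AE x in lborel. \<bar>mild v0 t x\<bar> \<le> 2 * \<eta> \<and> - lift t x \<le> mild v0 t x"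
  using mild_bd[OF t]
proof eventually_elim
  case (elim x)
  then show ?case
    using lift_nonneg[of t x] nn_integral_lift(3)[OF t(1), of x] \<eta>_nonneg mild_eq_0[of x t] lift_eq_0[of x t]
    by (cases "0 < x") auto
qed

lemma lift_int: "0 < t \<Longrightarrow> t \<le> T \<Longrightarrow> (\<integral>\<^sup>+x. ennreal (lift t x) \<partial>lborel) \<le> ennreal A"
proof -
  assume t: "0 < t" "t \<le> T"
  have "(\<integral>\<^sup>+x. ennreal (lift t x) \<partial>lborel) \<le> ennreal (2 * \<eta> * sqrt t)" by (rule nn_integral_lift_space[OF t(1)])
  also have "\<dots> \<le> ennreal A" unfolding A_def using t T \<eta>_nonneg by (intro ennreal_leI mult_left_mono) auto
  finally show ?thesis .
qed

lemmas mild_energy = energy_le[OF v0 v0_bd measurable_lift(1) lift_nonneg lift_int mild_AE_bounds _ A_nonneg]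
lemmas mild_dissipation = dissipation_le[OF v0 v0_bd measurable_lift(1) lift_nonneg lift_int mild_AE_bounds _ A_nonneg]

section \<open>Closing the gradient estimate\<close>

abbreviation k1_int :: "real \<Rightarrow> ennreal" where
  "k1_int t \<equiv> (\<integral>\<^sup>+s. indicator {0<..<t} s * k1 s \<partial>lborel)"

text \<open>The \<open>n\<close>-th term is the Dirichlet form at
  \<open>d = 1 / (real (Suc n))\<^sup>2\<close> divided by \<open>d\<close>. It substitutes for the
  gradient norm and is measurable in time by construction.\<close>

definition slope :: "real \<Rightarrow> ennreal" where
  "slope t = liminf (\<lambda>n. ennreal ((real (Suc n))\<^sup>2) * dirichlet_form (1 / (real (Suc n))\<^sup>2) (mild v0 t))"

text \<open>\<open>Du\<close> is the derivative of \<open>u - lift\<close> plus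
  \<open>lift_deriv\<close>. The 6 is the product of the 2 from squaring this sum and the 3 from
  \<open>dirichlet_form_liminf\<close>.\<close>

lemma Du_le_slope:
  "AE t in lborel. 0 < t \<and> t < T \<longrightarrow> (\<integral>\<^sup>+x. ennreal ((Du t x)\<^sup>2) \<partial>lborel) \<le> ennreal (6 / form_const) * slope t + ennreal (2 * lift_const)"
  using mild_u
proof eventually_elim
  case (elim t)
  show ?case
  proof
    assume t: "0 < t \<and> t < T"
    let ?w = "\<lambda>x. u t x - lift t x" and ?g = "\<lambda>x. Du t x - lift_deriv t x"
    have prim: "primitive_of ?w ?g"
      using t by (intro primitive_of_diff u_prim primitive_of_lift) auto
    have ae: "AE x in lborel. 0 < x \<longrightarrow> mild v0 t x = ?w x"
      using elim t by (auto elim!: eventually_mono)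
    define X where "X = (\<integral>\<^sup>+x. indicator {0<..} x * ennreal ((?g x)\<^sup>2) \<partial>lborel)"
    have "ennreal (form_const / 3) * X \<le> slope t"
      unfolding X_def slope_def by (rule dirichlet_form_liminf[OF prim _ _ ae]) measurable
    then have "ennreal (3 / form_const) * (ennreal (form_const / 3) * X) \<le> ennreal (3 / form_const) * slope t"
      by (rule mult_left_mono) simp
    moreover have "ennreal (3 / form_const) * ennreal (form_const / 3) = 1"
      using form_const_pos by (subst ennreal_mult[symmetric]) auto
    ultimately have X: "X \<le> ennreal (3 / form_const) * slope t" by (simp add: mult.assoc[symmetric])
    have "(\<integral>\<^sup>+x. ennreal ((Du t x)\<^sup>2) \<partial>lborel)
      \<le> (\<integral>\<^sup>+x. 2 * (indicator {0<..} x * ennreal ((?g x)\<^sup>2)) + 2 * (indicator {0<..} x * ennreal ((lift_deriv t x)\<^sup>2)) \<partial>lborel)"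
    proof (rule nn_integral_mono)
      fix x
      show "ennreal ((Du t x)\<^sup>2) \<le> 2 * (indicator {0<..} x * ennreal ((?g x)\<^sup>2)) + 2 * (indicator {0<..} x * ennreal ((lift_deriv t x)\<^sup>2))"
        using ennreal_square_sum[of "?g x" "lift_deriv t x"] Du_0[of x t] by (cases "0 < x") auto
    qed
    also have "\<dots> = 2 * X + 2 * (\<integral>\<^sup>+x. indicator {0<..} x * ennreal ((lift_deriv t x)\<^sup>2) \<partial>lborel)"
      unfolding X_def by (simp add: nn_integral_add nn_integral_cmult)
    also have "\<dots> \<le> 2 * (ennreal (3 / form_const) * slope t) + 2 * ennreal lift_const"
      using t T by (intro add_mono mult_left_mono X nn_integral_lift_deriv) auto
    also have "2 * (ennreal (3 / form_const) * slope t) = ennreal (6 / form_const) * slope t"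
    proof -
      have "2 * ennreal (3 / form_const) = ennreal (6 / form_const)"
        using form_const_pos by (subst ennreal_numeral[symmetric], subst ennreal_mult[symmetric]) auto
      then show ?thesis by (simp add: mult.assoc[symmetric])
    qed
    also have "2 * ennreal lift_const = ennreal (2 * lift_const)" by (simp add: ennreal_mult')
    finally show "(\<integral>\<^sup>+x. ennreal ((Du t x)\<^sup>2) \<partial>lborel) \<le> ennreal (6 / form_const) * slope t + ennreal (2 * lift_const)" .
  qed
qed

lemma measurable_form [measurable]: "(\<lambda>t. dirichlet_form d (mild v0 t)) \<in> borel_measurable borel"
  unfolding dirichlet_form_def by measurable

lemma measurable_slope [measurable]: "slope \<in> borel_measurable borel"
  unfolding slope_def by measurable

text \<open>Fatou's lemma in time applied to \<open>dissipation_le\<close> divided by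
  \<open>d n\<close>. That lemma reaches only up to time \<open>t - d n\<close>, hence the cutoff in
  \<open>\<Phi>\<close>, which disappears in the limit.\<close>

lemma nn_integral_slope_le:
  assumes t: "0 < t" "t \<le> T"
  shows "(\<integral>\<^sup>+r. indicator {0<..<t} r * slope r \<partial>lborel) \<le> 2 * ennreal (l0\<^sup>2) + 2 * remainder (2 * \<eta>) A 0 t"
proof -
  define d where "d n = 1 / (real (Suc n))\<^sup>2" for n
  define \<Phi> where "\<Phi> n r = indicator {0<..<t - d n} r * (ennreal ((real (Suc n))\<^sup>2) * dirichlet_form (d n) (mild v0 r))" for n r
  have d0: "0 < d n" for n by (simp add: d_def)
  have d_lim: "d \<longlonglongrightarrow> 0"
  proof -
    have "(\<lambda>n. (inverse (real (Suc n)))\<^sup>2) \<longlonglongrightarrow> 0\<^sup>2"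
      by (intro tendsto_intros LIMSEQ_inverse_real_of_nat)
    moreover have "d = (\<lambda>n. (inverse (real (Suc n)))\<^sup>2)"
      by (rule ext) (simp only: d_def power_inverse inverse_eq_divide[symmetric])
    ultimately show ?thesis by simp
  qed
  have "indicator {0<..<t} r * slope r \<le> liminf (\<lambda>n. \<Phi> n r)" for r
  proof (cases "0 < r \<and> r < t")
    case True
    have "eventually (\<lambda>n. d n < t - r) sequentially"
      using d_lim True by (intro order_tendstoD) auto
    then have "eventually (\<lambda>n. ennreal ((real (Suc n))\<^sup>2) * dirichlet_form (1 / (real (Suc n))\<^sup>2) (mild v0 r) \<le> \<Phi> n r) sequentially"
      by eventually_elim (use True in \<open>auto simp: \<Phi>_def d_def\<close>)
    then have "slope r \<le> liminf (\<lambda>n. \<Phi> n r)" unfolding slope_def by (rule Liminf_mono)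
    then show ?thesis using True by simp
  qed auto
  then have "(\<integral>\<^sup>+r. indicator {0<..<t} r * slope r \<partial>lborel) \<le> (\<integral>\<^sup>+r. liminf (\<lambda>n. \<Phi> n r) \<partial>lborel)"
    by (intro nn_integral_mono)
  also have "\<dots> \<le> liminf (\<lambda>n. \<integral>\<^sup>+r. \<Phi> n r \<partial>lborel)"
    unfolding \<Phi>_def by (intro nn_integral_liminf) measurable
  also have "\<dots> \<le> 2 * ennreal (l0\<^sup>2) + 2 * remainder (2 * \<eta>) A 0 t"
  proof -
    have "eventually (\<lambda>n. d n < t / 2) sequentially"
      using d_lim t by (intro order_tendstoD) auto
    then have "eventually (\<lambda>n. (\<integral>\<^sup>+r. \<Phi> n r \<partial>lborel) \<le> 2 * ennreal (l0\<^sup>2) + 2 * remainder (2 * \<eta>) A 0 t) sequentially"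
    proof eventually_elim
      case (elim n)
      have "(\<integral>\<^sup>+r. \<Phi> n r \<partial>lborel) = ennreal ((real (Suc n))\<^sup>2) * (\<integral>\<^sup>+r. indicator {0<..<t - d n} r * dirichlet_form (d n) (mild v0 r) \<partial>lborel)"
        unfolding \<Phi>_def by (subst nn_integral_cmult[symmetric]) (auto simp: ac_simps)
      also have "\<dots> \<le> ennreal ((real (Suc n))\<^sup>2) * (ennreal (d n) * (2 * (\<integral>\<^sup>+x. ennreal ((v0 x)\<^sup>2) \<partial>lborel) + 2 * remainder (2 * \<eta>) A 0 t))"
        using elim t d0[of n] \<eta>_nonneg v0_L2
        by (intro mult_left_mono mild_dissipation) (auto intro: le_less_trans)
      also have "\<dots> = (ennreal ((real (Suc n))\<^sup>2) * ennreal (d n)) * (2 * (\<integral>\<^sup>+x. ennreal ((v0 x)\<^sup>2) \<partial>lborel) + 2 * remainder (2 * \<eta>) A 0 t)"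
        by (simp add: mult.assoc)
      also have "ennreal ((real (Suc n))\<^sup>2) * ennreal (d n) = 1"
        by (subst ennreal_mult[symmetric]) (auto simp: d_def simp del: of_nat_Suc)
      also have "1 * (2 * (\<integral>\<^sup>+x. ennreal ((v0 x)\<^sup>2) \<partial>lborel) + 2 * remainder (2 * \<eta>) A 0 t) \<le> 2 * ennreal (l0\<^sup>2) + 2 * remainder (2 * \<eta>) A 0 t"
        using v0_L2 by (simp add: add_right_mono mult_left_mono)
      finally show ?case .
    qed
    then have "liminf (\<lambda>n. \<integral>\<^sup>+r. \<Phi> n r \<partial>lborel) \<le> liminf (\<lambda>n. 2 * ennreal (l0\<^sup>2) + 2 * remainder (2 * \<eta>) A 0 t)"
      by (rule Liminf_mono)
    then show ?thesis by (simp add: Liminf_const)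
  qed
  finally show ?thesis .
qed

text \<open>With \<open>2 * \<eta>\<close> as the bound on \<open>mild\<close>, the first
  coefficient of \<open>remainder\<close> is \<open>8 * \<eta>\<close>;
  \<open>nn_integral_slope_le\<close> doubles the remainder. The same doubling gives the
  \<open>8 * M2 * A * Tf\<close> in \<open>A0\<close>.\<close>

definition A1 :: real where "A1 = 6 / form_const * (16 * \<eta>)"
definition A0 :: real where "A0 = 6 / form_const * (2 * l0\<^sup>2 + 8 * M2 * A * Tf) + 2 * lift_const * Tf"

lemma lift_const_nonneg: "0 \<le> lift_const"
  by (simp add: lift_const_def)

lemma A01_nonneg: "0 \<le> A0" "0 \<le> A1"
  using form_const_pos \<eta>_nonneg M2_nonneg A_nonneg T lift_const_nonneg by (auto simp: A0_def A1_def)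

text \<open>The first half of the loop: the gradient energy is controlled by the L1 norm of the
  drift, which by \<open>k1_int_le\<close> contains the gradient energy again.\<close>

lemma grad_energy_le_k1:
  assumes t: "0 < t" "t \<le> T"
  shows "grad_energy t \<le> ennreal A0 + ennreal A1 * k1_int t"
proof -
  have "grad_energy t \<le> (\<integral>\<^sup>+r. ennreal (6 / form_const) * (indicator {0<..<t} r * slope r) + ennreal (2 * lift_const) * indicator {0<..<t} r \<partial>lborel)"
    unfolding grad_energy_def
  proof (rule nn_integral_mono_AE)
    show "AE r in lborel. indicator {0<..<t} r * (\<integral>\<^sup>+x. ennreal ((Du r x)\<^sup>2) \<partial>lborel)
       \<le> ennreal (6 / form_const) * (indicator {0<..<t} r * slope r) + ennreal (2 * lift_const) * indicator {0<..<t} r"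
      using Du_le_slope by eventually_elim (use t in \<open>auto split: split_indicator\<close>)
  qed
  also have "\<dots> = ennreal (6 / form_const) * (\<integral>\<^sup>+r. indicator {0<..<t} r * slope r \<partial>lborel) + ennreal (2 * lift_const) * ennreal t"
    using t by (simp add: nn_integral_add nn_integral_cmult)
  also have "\<dots> \<le> ennreal (6 / form_const) * (2 * ennreal (l0\<^sup>2) + 2 * remainder (2 * \<eta>) A 0 t) + ennreal (2 * lift_const) * ennreal t"
    by (intro add_right_mono mult_left_mono nn_integral_slope_le t) auto
  also have "2 * remainder (2 * \<eta>) A 0 t = ennreal (16 * \<eta>) * k1_int t + ennreal (8 * M2 * A * t)"
  proof -
    have "2 * (4 * ennreal (2 * \<eta>)) = ennreal (16 * \<eta>)" using \<eta>_nonneg by (simp add: ennreal_mult mult.assoc[symmetric])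
    moreover have "2 * ennreal (4 * M2 * A * t) = ennreal (8 * M2 * A * t)"
      using M2_nonneg A_nonneg t by (subst ennreal_numeral[symmetric], subst ennreal_mult[symmetric]) auto
    ultimately show ?thesis by (simp add: remainder_def distrib_left mult.assoc[symmetric])
  qed
  also have "ennreal (6 / form_const) * (2 * ennreal (l0\<^sup>2) + (ennreal (16 * \<eta>) * k1_int t + ennreal (8 * M2 * A * t))) + ennreal (2 * lift_const) * ennreal t
    = ennreal (6 / form_const * (2 * l0\<^sup>2 + 8 * M2 * A * t) + 2 * lift_const * t) + ennreal A1 * k1_int t"
  proof -
    have "ennreal A1 = ennreal (6 / form_const) * ennreal (16 * \<eta>)"
      unfolding A1_def using form_const_pos \<eta>_nonneg by (subst ennreal_mult) auto
    moreover have "ennreal (6 / form_const * (2 * l0\<^sup>2 + 8 * M2 * A * t) + 2 * lift_const * t)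
      = ennreal (6 / form_const) * (2 * ennreal (l0\<^sup>2) + ennreal (8 * M2 * A * t)) + ennreal (2 * lift_const) * ennreal t"
    proof -
      have "ennreal (6 / form_const * (2 * l0\<^sup>2 + 8 * M2 * A * t) + 2 * lift_const * t)
        = ennreal (6 / form_const * (2 * l0\<^sup>2 + 8 * M2 * A * t)) + ennreal (2 * lift_const * t)"
        using form_const_pos M2_nonneg A_nonneg t lift_const_nonneg by (subst ennreal_plus) auto
      also have "ennreal (6 / form_const * (2 * l0\<^sup>2 + 8 * M2 * A * t)) = ennreal (6 / form_const) * ennreal (2 * l0\<^sup>2 + 8 * M2 * A * t)"
        using form_const_pos M2_nonneg A_nonneg t by (subst ennreal_mult) auto
      also have "ennreal (2 * l0\<^sup>2 + 8 * M2 * A * t) = 2 * ennreal (l0\<^sup>2) + ennreal (8 * M2 * A * t)"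
        using M2_nonneg A_nonneg t by (subst ennreal_plus) (auto simp: ennreal_mult')
      also have "ennreal (2 * lift_const * t) = ennreal (2 * lift_const) * ennreal t"
        using t lift_const_nonneg by (subst ennreal_mult) auto
      finally show ?thesis .
    qed
    ultimately show ?thesis by (simp add: distrib_left mult.assoc ac_simps)
  qed
  also have "\<dots> \<le> ennreal A0 + ennreal A1 * k1_int t"
    unfolding A0_def using t T M2_nonneg A_nonneg lift_const_nonneg form_const_pos
    by (intro add_right_mono ennreal_leI add_mono mult_left_mono) auto
  finally show ?thesis .
qed

text \<open>The parameter in Young's inequality, small enough that \<open>A1 * (\<kappa> / pm) \<le> 1 / 2\<close> and the gradient term
  can be absorbed.\<close>

definition \<kappa> :: real where "\<kappa> = pm / (2 * (A1 + 1))"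
definition q :: real where "q = 1 / (4 * \<kappa> * pm)"
definition p1 :: real where "p1 = 2 * P1\<^sup>2 * l1\<^sup>2 * Tf"
definition p2 :: real where "p2 = 2 * P2\<^sup>2 * Tf"
definition A2 :: real where "A2 = 2 * (A0 + A1 * q * p1)"
definition A3 :: real where "A3 = 2 * (A1 * q * p2)"

lemma consts_nonneg: "0 < \<kappa>" "0 \<le> q" "0 \<le> p1" "0 \<le> p2" "0 \<le> A2" "0 \<le> A3"
proof -
  show \<kappa>: "0 < \<kappa>" using pm A01_nonneg by (simp add: \<kappa>_def)
  show q: "0 \<le> q" using \<kappa> pm by (simp add: q_def)
  show p: "0 \<le> p1" "0 \<le> p2" using T by (auto simp: p1_def p2_def)
  show "0 \<le> A2" "0 \<le> A3" using A01_nonneg q p by (auto simp: A2_def A3_def)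
qed

lemma k1_int_le:
  assumes t: "0 \<le> t" "t \<le> T"
  shows "k1_int t \<le> ennreal (\<kappa> / pm) * grad_energy t + ennreal q * (ennreal p1 + ennreal p2 * (\<integral>\<^sup>+r. indicator {0<..<t} r * grad_energy r \<partial>lborel))"
  unfolding k1_def q_def p1_def p2_def by (rule nn_integral_F1_le[OF consts_nonneg(1) t])

lemma grad_energy_finite: "0 \<le> t \<Longrightarrow> grad_energy t < top"
  using grad_energy_fin[of t] by (auto simp: ennreal_mult_less_top intro: le_less_trans)

text \<open>Both halves of the loop combined. The current gradient energy returns with a factor of
  at most 1/2 and is absorbed, being finite, so that only its past remains on the right.\<close>

lemma grad_energy_gronwall:
  assumes t: "0 < t" "t \<le> T"
  shows "grad_energy t \<le> ennreal A2 + ennreal A3 * (\<integral>\<^sup>+r. indicator {0<..<t} r * grad_energy r \<partial>lborel)"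
proof -
  let ?I = "\<integral>\<^sup>+r. indicator {0<..<t} r * grad_energy r \<partial>lborel"
  have "grad_energy t \<le> ennreal A0 + ennreal A1 * k1_int t" by (rule grad_energy_le_k1[OF t])
  also have "\<dots> \<le> ennreal A0 + ennreal A1 * (ennreal (\<kappa> / pm) * grad_energy t + ennreal q * (ennreal p1 + ennreal p2 * ?I))"
    using t by (intro add_left_mono mult_left_mono k1_int_le) auto
  also have "\<dots> = (ennreal A0 + ennreal (A1 * q * p1) + ennreal (A1 * q * p2) * ?I) + ennreal (A1 * (\<kappa> / pm)) * grad_energy t"
    using A01_nonneg consts_nonneg pm by (simp add: ennreal_mult distrib_left ac_simps del: times_divide_eq_right)
  finally have "grad_energy t \<le> 2 * (ennreal A0 + ennreal (A1 * q * p1) + ennreal (A1 * q * p2) * ?I)"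
  proof (rule ennreal_absorb)
    show "0 \<le> A1 * (\<kappa> / pm)" using A01_nonneg consts_nonneg pm by simp
    have "A1 * (\<kappa> / pm) = A1 / (2 * (A1 + 1))" using pm by (simp add: \<kappa>_def)
    also have "\<dots> \<le> 1 / 2" using A01_nonneg by (simp add: divide_le_eq)
    finally show "A1 * (\<kappa> / pm) \<le> 1 / 2" .
    show "grad_energy t < top" using t by (intro grad_energy_finite) auto
  qed
  also have "\<dots> = ennreal A2 + ennreal A3 * ?I"
  proof -
    have "2 * (ennreal A0 + ennreal (A1 * q * p1)) = ennreal A2"
      unfolding A2_def using A01_nonneg consts_nonneg by (subst ennreal_plus[symmetric]) (auto simp: ennreal_mult')
    moreover have "2 * ennreal (A1 * q * p2) = ennreal A3"
      unfolding A3_def using A01_nonneg consts_nonneg by (simp add: ennreal_mult')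
    ultimately show ?thesis by (simp only: distrib_left mult.assoc[symmetric])
  qed
  finally show ?thesis .
qed

text \<open>The rate is \<open>A3 + 1\<close> because \<open>gronwall_nn_integral\<close> asks for a
  positive rate and \<open>A3\<close> vanishes when \<open>\<eta> = 0\<close>; \<open>Tf\<close> in
  place of the time makes the bound uniform.\<close>

definition grad_bound :: real where "grad_bound = 2 * A2 * exp (2 * (A3 + 1) * Tf)"

lemma grad_bound_nonneg: "0 \<le> grad_bound"
  using consts_nonneg by (simp add: grad_bound_def)

lemma grad_energy_le:
  assumes t: "0 < t" "t \<le> T"
  shows "grad_energy t \<le> ennreal grad_bound"
proof -
  have "grad_energy t \<le> ennreal (2 * A2 * exp (2 * (A3 + 1) * t))"
  proof (rule gronwall_nn_integral[where K = "max K 0 * T", OF measurable_grad_energy _ _ T(1) _ _ t])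
    show "grad_energy t \<le> ennreal A2 + ennreal (A3 + 1) * (\<integral>\<^sup>+r. indicator {0<..<t} r * grad_energy r \<partial>lborel)"
      if "0 < t" "t \<le> T" for t
    proof -
      have "ennreal A3 * (\<integral>\<^sup>+r. indicator {0<..<t} r * grad_energy r \<partial>lborel) \<le> ennreal (A3 + 1) * (\<integral>\<^sup>+r. indicator {0<..<t} r * grad_energy r \<partial>lborel)"
        by (intro mult_right_mono ennreal_leI) auto
      then show ?thesis using grad_energy_gronwall[OF that] by (meson add_left_mono order_trans)
    qed
    show "grad_energy t \<le> ennreal (max K 0 * T)" if "0 < t" "t \<le> T" for t
    proof -
      have "grad_energy t \<le> ennreal K * ennreal t" using that by (intro grad_energy_fin) auto
      also have "\<dots> \<le> ennreal (max K 0) * ennreal T" using that by (intro mult_mono ennreal_leI) auto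
      finally show ?thesis using T by (simp add: ennreal_mult)
    qed
  qed (use consts_nonneg in auto)
  also have "\<dots> \<le> ennreal grad_bound"
    unfolding grad_bound_def using t T consts_nonneg by (intro ennreal_leI mult_left_mono) auto
  finally show ?thesis .
qed

section \<open>From the gradient bound to the energy bound\<close>

definition k1_bound :: real where "k1_bound = \<kappa> / pm * grad_bound + q * (p1 + p2 * (Tf * grad_bound))"

lemma k1_bound_nonneg: "0 \<le> k1_bound"
  using consts_nonneg grad_bound_nonneg pm T by (simp add: k1_bound_def)

lemma k1_int_bound:
  assumes t: "0 < t" "t \<le> T"
  shows "k1_int t \<le> ennreal k1_bound"
proof -
  have "(\<integral>\<^sup>+r. indicator {0<..<t} r * grad_energy r \<partial>lborel) \<le> (\<integral>\<^sup>+r. ennreal grad_bound * indicator {0<..<t} r \<partial>lborel)"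
  proof (rule nn_integral_mono)
    show "indicator {0<..<t} r * grad_energy r \<le> ennreal grad_bound * indicator {0<..<t} r" for r
      using grad_energy_le[of r] t by (cases "0 < r \<and> r < t") auto
  qed
  also have "\<dots> = ennreal grad_bound * ennreal t" using t by (simp add: nn_integral_indicator_Ioo)
  also have "\<dots> \<le> ennreal grad_bound * ennreal Tf" using t T by (intro mult_left_mono ennreal_leI) auto
  also have "\<dots> = ennreal (Tf * grad_bound)" using T grad_bound_nonneg by (simp add: ennreal_mult mult.commute)
  finally have I: "(\<integral>\<^sup>+r. indicator {0<..<t} r * grad_energy r \<partial>lborel) \<le> ennreal (Tf * grad_bound)" .
  have "k1_int t \<le> ennreal (\<kappa> / pm) * grad_energy t + ennreal q * (ennreal p1 + ennreal p2 * (\<integral>\<^sup>+r. indicator {0<..<t} r * grad_energy r \<partial>lborel))"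
    using t by (intro k1_int_le) auto
  also have "\<dots> \<le> ennreal (\<kappa> / pm) * ennreal grad_bound + ennreal q * (ennreal p1 + ennreal p2 * ennreal (Tf * grad_bound))"
    by (intro add_mono mult_left_mono I grad_energy_le t order_refl) auto
  also have "\<dots> = ennreal k1_bound"
    unfolding k1_bound_def using consts_nonneg grad_bound_nonneg pm T
    by (simp add: ennreal_plus ennreal_mult del: times_divide_eq_right times_divide_eq_left)
  finally show ?thesis .
qed

text \<open>A bound for twice the sum of the squared L2 norms of \<open>lift\<close> and
  \<open>mild\<close>. The last term uses that
  \<open>(lift t x)\<^sup>2 \<le> 2 * \<eta> * lift t x\<close>; the others come from
  \<open>mild_energy\<close>.\<close>

definition energy_bound :: real where
  "energy_bound = 2 * l0\<^sup>2 + 8 * \<eta> * k1_bound + 4 * M2 * A * Tf + 4 * \<eta> * A"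

lemma solution_energy_le:
  assumes t: "0 < t" "t \<le> T"
  shows "(\<integral>\<^sup>+x. indicator {0<..} x * ennreal ((lift t x + mild v0 t x)\<^sup>2) \<partial>lborel) \<le> ennreal energy_bound"
proof -
  have e: "2 * (\<integral>\<^sup>+x. ennreal ((mild v0 t x)\<^sup>2) \<partial>lborel) \<le> ennreal (2 * l0\<^sup>2 + 8 * \<eta> * k1_bound + 4 * M2 * A * Tf)"
  proof -
    have "2 * (\<integral>\<^sup>+x. ennreal ((mild v0 t x)\<^sup>2) \<partial>lborel) \<le> 2 * (\<integral>\<^sup>+x. ennreal ((v0 x)\<^sup>2) \<partial>lborel) + remainder (2 * \<eta>) A 0 t"
      using mild_energy[of t] \<eta>_nonneg t by (simp add: energy_def)
    also have "\<dots> \<le> 2 * ennreal (l0\<^sup>2) + (4 * ennreal (2 * \<eta>) * ennreal k1_bound + ennreal (4 * M2 * A * Tf))"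
      unfolding remainder_def using t T M2_nonneg A_nonneg
      by (intro add_mono mult_left_mono v0_L2 k1_int_bound ennreal_leI) auto
    also have "\<dots> = ennreal (2 * l0\<^sup>2 + 8 * \<eta> * k1_bound + 4 * M2 * A * Tf)"
    proof -
      have "4 * ennreal (2 * \<eta>) * ennreal k1_bound = ennreal (8 * \<eta> * k1_bound)"
        using \<eta>_nonneg k1_bound_nonneg by (simp add: ennreal_mult mult.assoc[symmetric])
      moreover have "2 * ennreal (l0\<^sup>2) = ennreal (2 * l0\<^sup>2)" by (simp add: ennreal_mult')
      ultimately show ?thesis
        using \<eta>_nonneg k1_bound_nonneg M2_nonneg A_nonneg T by (simp add: ennreal_plus add.assoc)
    qed
    finally show ?thesis .
  qed
  have l: "2 * (\<integral>\<^sup>+x. ennreal ((lift t x)\<^sup>2) \<partial>lborel) \<le> ennreal (4 * \<eta> * A)"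
  proof -
    have "(\<integral>\<^sup>+x. ennreal ((lift t x)\<^sup>2) \<partial>lborel) \<le> (\<integral>\<^sup>+x. ennreal (2 * \<eta>) * ennreal (lift t x) \<partial>lborel)"
    proof (rule nn_integral_mono)
      fix x
      have "(lift t x)\<^sup>2 \<le> 2 * \<eta> * lift t x"
        using nn_integral_lift(3)[OF t(1), of x] lift_nonneg[of t x] by (simp add: power2_eq_square mult_right_mono)
      then show "ennreal ((lift t x)\<^sup>2) \<le> ennreal (2 * \<eta>) * ennreal (lift t x)"
        using \<eta>_nonneg lift_nonneg[of t x] by (simp add: ennreal_mult[symmetric] ennreal_leI)
    qed
    also have "\<dots> = ennreal (2 * \<eta>) * (\<integral>\<^sup>+x. ennreal (lift t x) \<partial>lborel)"
      by (rule nn_integral_cmult) measurable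
    also have "\<dots> \<le> ennreal (2 * \<eta>) * ennreal A"
      by (intro mult_left_mono lift_int t) auto
    finally have "2 * (\<integral>\<^sup>+x. ennreal ((lift t x)\<^sup>2) \<partial>lborel) \<le> 2 * (ennreal (2 * \<eta>) * ennreal A)"
      by (rule mult_left_mono) simp
    also have "\<dots> = ennreal (4 * \<eta> * A)"
      using \<eta>_nonneg A_nonneg by (simp add: ennreal_mult mult.assoc[symmetric])
    finally show ?thesis .
  qed
  have "(\<integral>\<^sup>+x. indicator {0<..} x * ennreal ((lift t x + mild v0 t x)\<^sup>2) \<partial>lborel)
    \<le> (\<integral>\<^sup>+x. 2 * ennreal ((lift t x)\<^sup>2) + 2 * ennreal ((mild v0 t x)\<^sup>2) \<partial>lborel)"
    by (intro nn_integral_mono) (auto split: split_indicator intro: ennreal_square_sum)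
  also have "\<dots> = 2 * (\<integral>\<^sup>+x. ennreal ((lift t x)\<^sup>2) \<partial>lborel) + 2 * (\<integral>\<^sup>+x. ennreal ((mild v0 t x)\<^sup>2) \<partial>lborel)"
    by (simp add: nn_integral_add nn_integral_cmult)
  also have "\<dots> \<le> ennreal (4 * \<eta> * A) + ennreal (2 * l0\<^sup>2 + 8 * \<eta> * k1_bound + 4 * M2 * A * Tf)"
    by (rule add_mono[OF l e])
  also have "\<dots> = ennreal energy_bound"
    unfolding energy_bound_def using \<eta>_nonneg k1_bound_nonneg M2_nonneg A_nonneg T
    by (subst ennreal_plus[symmetric]) (auto simp: add.commute)
  finally show ?thesis .
qed

end

subsection \<open>Mild solutions in Borel form\<close>

lemma L2_norm_sq: "L2_sq f < \<infinity> \<Longrightarrow> ennreal ((L2_norm_Rplus f)\<^sup>2) = L2_sq f"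
  by (simp add: L2_norm_Rplus_def)

text \<open>The full Hoelder norm serves as Hoelder constant, since its supremum part is
  nonnegative. Extending by 0 preserves the bounds at all times, while the Hoelder estimate is asked
  for only on \<open>[0, T]\<close>.\<close>

lemma holder_boundary_data:
  assumes h: "in_holder \<beta> {0..T} \<psi>" and T: "0 < T" and \<beta>: "1 / 4 < \<beta>" and \<psi>0: "\<psi> 0 = 0"
    and bd: "\<And>t. t \<in> {0..T} \<Longrightarrow> 0 \<le> \<psi> t \<and> \<psi> t \<le> \<eta>" and \<eta>: "0 \<le> \<eta>"
  shows "boundary_data (\<lambda>t. if t \<in> {0..T} then \<psi> t else 0) \<eta> (holder_norm \<beta> {0..T} \<psi>) \<beta> T"
proof -
  let ?Q = "holder_quotients \<beta> {0..T} \<psi>"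
  define H where "H = holder_norm \<beta> {0..T} \<psi>"
  have bddQ: "bdd_above ?Q" using h by (simp add: in_holder_def)
  have "bdd_above ((\<lambda>x. \<bar>\<psi> x\<bar>) ` {0..T})"
    using h by (auto simp: in_holder_def bounded_iff bdd_above_def)
  then have "\<bar>\<psi> 0\<bar> \<le> (SUP x\<in>{0..T}. \<bar>\<psi> x\<bar>)" using T by (intro cSUP_upper) auto
  then have sup0: "0 \<le> (SUP x\<in>{0..T}. \<bar>\<psi> x\<bar>)" by simp
  have Q_le: "\<bar>\<psi> x - \<psi> y\<bar> / \<bar>x - y\<bar> powr \<beta> \<le> Sup ?Q" if "x \<in> {0..T}" "y \<in> {0..T}" "x \<noteq> y" for x y
    using that by (intro cSup_upper bddQ) (auto simp: holder_quotients_def)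
  have "0 \<le> \<bar>\<psi> T - \<psi> 0\<bar> / \<bar>T - 0\<bar> powr \<beta>" by simp
  also have "\<dots> \<le> Sup ?Q" using T by (intro Q_le) auto
  finally have H0: "0 \<le> H" using sup0 by (simp add: H_def holder_norm_def)
  have hold: "\<bar>\<psi> t - \<psi> r\<bar> \<le> H * \<bar>t - r\<bar> powr \<beta>" if "t \<in> {0..T}" "r \<in> {0..T}" for t r
  proof (cases "t = r")
    case False
    have "\<bar>\<psi> t - \<psi> r\<bar> / \<bar>t - r\<bar> powr \<beta> \<le> H"
      using Q_le[OF that False] sup0 by (simp add: H_def holder_norm_def)
    then show ?thesis using False by (simp add: divide_le_eq)
  qed simp
  have "continuous_on {0..T} \<psi>"
    unfolding continuous_on_def
  proof
    fix a assume a: "a \<in> {0..T}"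
    have "((\<lambda>x. \<bar>x - a\<bar>) \<longlongrightarrow> 0) (at a within {0..T})"
      by (rule tendsto_rabs_zero) (auto intro!: tendsto_eq_intros)
    then have "((\<lambda>x. \<bar>x - a\<bar> powr \<beta>) \<longlongrightarrow> 0) (at a within {0..T})"
      using \<beta> by (intro tendsto_zero_powrI[where b = \<beta>] tendsto_const) auto
    then have "((\<lambda>x. H * \<bar>x - a\<bar> powr \<beta>) \<longlongrightarrow> 0) (at a within {0..T})" by (rule tendsto_mult_right_zero)
    then have "((\<lambda>x. \<psi> x - \<psi> a) \<longlongrightarrow> 0) (at a within {0..T})"
      by (rule Lim_null_comparison[rotated])
         (use hold a in \<open>auto simp: eventually_at_filter intro!: always_eventually\<close>)
    then show "(\<psi> \<longlongrightarrow> \<psi> a) (at a within {0..T})" by (simp add: LIM_zero_iff)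
  qed
  then have meas: "(\<lambda>t. if t \<in> {0..T} then \<psi> t else 0) \<in> borel_measurable borel"
    by (intro borel_measurable_continuous_on_if) auto
  show ?thesis
    by unfold_locales (use meas bd \<eta> hold \<psi>0 \<beta> H0 T in \<open>auto simp: H_def\<close>)
qed

lemma phi_min:
  assumes B: "B \<in> {1, - 1}" and C0: "0 \<le> C0" "B = - 1 \<Longrightarrow> C0 < 1"
  shows "0 < phi_min B C0" "\<forall>c. 0 \<le> c \<and> c \<le> C0 \<longrightarrow> phi_min B C0 \<le> 1 + B * c"
proof -
  define l where "l = (if B = 1 then 1 else 1 - C0)"
  have l: "l \<le> phi B c" if "c \<in> {0..C0}" for c using B that by (auto simp: l_def phi_def)
  have "0 < l" using B C0 by (auto simp: l_def)
  also have "l \<le> phi_min B C0" unfolding phi_min_def using C0 l by (intro cINF_greatest) auto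
  finally show "0 < phi_min B C0" .
  show "\<forall>c. 0 \<le> c \<and> c \<le> C0 \<longrightarrow> phi_min B C0 \<le> 1 + B * c"
  proof (intro allI impI)
    fix c assume "0 \<le> c \<and> c \<le> C0"
    then have "phi_min B C0 \<le> phi B c"
      unfolding phi_min_def using l by (intro cINF_lower bdd_belowI2[where m = l]) auto
    then show "phi_min B C0 \<le> 1 + B * c" by (simp add: phi_def)
  qed
qed

text \<open>The set where \<open>s\<close> and \<open>u\<close> agree is not known to be Borel, so
  the quantifiers cannot be exchanged for it directly. They are exchanged for a Borel function
  \<open>r\<close> equal to \<open>s\<close> off a Borel null set \<open>N\<close>, and for
  \<open>N\<close> itself.\<close>

lemma AE_swap_representative:
  assumes L: "in_Linf ({0..T} \<times> {0<..}) s" and [measurable]: "case_prod u \<in> borel_measurable (borel \<Otimes>\<^sub>M borel)"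
    and su: "AE t in lborel. t \<in> {0..T} \<longrightarrow> (AE x in lborel. 0 < x \<longrightarrow> s t x = u t x)"
  shows "AE x in lborel. 0 < x \<longrightarrow> (AE t in lborel. t \<in> {0..T} \<longrightarrow> s t x = u t x)"
proof -
  have "(\<lambda>(t, x). s t x) \<in> borel_measurable (lebesgue_on ({0..T} \<times> {0<..}))"
    using L by (simp add: in_Linf_def)
  from ex_Borel_lebesgue_on[OF this] obtain r where r: "r \<in> borel_measurable borel"
    "AE p in lborel. p \<in> {0..T} \<times> {0<..} \<longrightarrow> (case p of (t, x) \<Rightarrow> s t x) = r p"
    by (auto simp: borel_Times)
  have [measurable]: "r \<in> borel_measurable (borel \<Otimes>\<^sub>M borel)" using r(1) by (simp add: borel_prod)
  have "AE p in lborel \<Otimes>\<^sub>M lborel. p \<in> {0..T} \<times> {0<..} \<longrightarrow> (case p of (t, x) \<Rightarrow> s t x) = r p"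
    by (subst lborel_prod) (rule r(2))
  then obtain N where N0: "N \<in> null_sets (lborel \<Otimes>\<^sub>M lborel)"
    "{p \<in> space (lborel \<Otimes>\<^sub>M lborel). \<not> (p \<in> {0..T} \<times> {0<..} \<longrightarrow> (case p of (t, x) \<Rightarrow> s t x) = r p)} \<subseteq> N"
    unfolding eventually_ae_filter by blast
  have N: "N \<in> null_sets (lborel \<Otimes>\<^sub>M lborel)"
    "\<And>t x. (t, x) \<notin> N \<Longrightarrow> t \<in> {0..T} \<Longrightarrow> 0 < x \<Longrightarrow> s t x = r (t, x)"
  proof -
    show "N \<in> null_sets (lborel \<Otimes>\<^sub>M lborel)" by (rule N0(1))
    show "s t x = r (t, x)" if "(t, x) \<notin> N" "t \<in> {0..T}" "0 < x" for t x
      using subsetD[OF N0(2), of "(t, x)"] that by (auto simp: space_pair_measure)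
  qed
  have [measurable]: "N \<in> sets (borel \<Otimes>\<^sub>M borel)"
    using N(1) by (auto simp: null_sets_def cong: sets_pair_measure_cong)
  have "AE p in lborel \<Otimes>\<^sub>M lborel. p \<notin> N" using N(1) by (rule AE_not_in)
  then have N1: "AE t in lborel. AE x in lborel. (t, x) \<notin> N" by (rule lborel_pair.AE_pair)
  have "{p \<in> space (lborel \<Otimes>\<^sub>M lborel). p \<notin> N} \<in> sets (borel \<Otimes>\<^sub>M borel)"
    using sets.compl_sets[OF \<open>N \<in> sets (borel \<Otimes>\<^sub>M borel)\<close>] by (simp add: space_pair_measure set_diff_eq)
  with N1 have N2: "AE x in lborel. AE t in lborel. (t, x) \<notin> N"
    by (subst (asm) lborel_pair.AE_commute) auto
  let ?P = "\<lambda>t x. 0 \<le> t \<and> t \<le> T \<longrightarrow> 0 < x \<longrightarrow> r (t, x) - u t x = 0"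
  have "AE t in lborel. AE x in lborel. ?P t x"
    using su N1
  proof eventually_elim
    case (elim t)
    show ?case
    proof (cases "t \<in> {0..T}")
      case True
      then have "AE x in lborel. 0 < x \<longrightarrow> s t x = u t x" using elim by blast
      then show ?thesis using elim(2) by eventually_elim (use N(2) True in auto)
    next
      case False
      then show ?thesis by (intro AE_I2) auto
    qed
  qed
  moreover have "{p \<in> space (lborel \<Otimes>\<^sub>M lborel). ?P (fst p) (snd p)} \<in> sets (lborel \<Otimes>\<^sub>M lborel)"
    by measurable
  ultimately have "AE x in lborel. AE t in lborel. ?P t x"
    by (subst (asm) lborel_pair.AE_commute)
  then show ?thesis using N2
  proof eventually_elim
    case (elim x)
    show ?case
    proof
      assume x: "0 < x"
      show "AE t in lborel. t \<in> {0..T} \<longrightarrow> s t x = u t x"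
        using elim(1) elim(2)
      proof eventually_elim
        case (elim t)
        then show ?case using N(2)[of t x] x by auto
      qed
    qed
  qed
qed

section \<open>The mild formula in terms of Borel kernels\<close>

lemma dirichlet_conv_eq_dsg:
  assumes t: "0 < t" and x: "0 < x" and [measurable]: "g \<in> borel_measurable borel"
    and fg: "AE y in lborel. 0 < y \<longrightarrow> f y = g y"
  shows "dirichlet_conv t f x = dsg t g x"
proof -
  have "dirichlet_conv t f x = (LINT y|Rplus. (heat_kernel t (x - y) - heat_kernel t (x + y)) * f y)"
    using t by (simp add: dirichlet_conv_def)
  also have "\<dots> = (LINT y|lborel. indicator {0<..} y * ((heat_kernel t (x - y) - heat_kernel t (x + y)) * g y))"
    by (rule integral_lebesgue_on_Borel) (use fg in \<open>auto elim!: eventually_mono\<close>)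
  also have "\<dots> = dsg t g x"
    unfolding dsg_def using t x
    by (intro Bochner_Integration.integral_cong) (auto simp: dirichlet_kernel_def split: split_indicator)
  finally show ?thesis .
qed

lemma indicator_Icc_AE:
  fixes f :: "real \<Rightarrow> real"
  shows "AE r in lborel. indicator {0..t} r * f r = indicator {0<..<t} r * (f r :: real)"
  using AE_lborel_singleton[of 0] AE_lborel_singleton[of t] by eventually_elim (auto simp: less_le split: split_indicator)

lemma integral_Icc_eq_Ioo:
  fixes f :: "real \<Rightarrow> real"
  assumes [measurable]: "f \<in> borel_measurable borel"
  shows "(LINT r|lborel. indicator {0..t} r * f r) = (LINT r|lborel. indicator {0<..<t} r * (f r :: real))"
  by (rule integral_cong_AE[OF _ _ indicator_Icc_AE]) measurable

lemma (in boundary_data) boundary_integral_eq_lift: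
  assumes t: "0 < t" and x: "0 < x" and eq: "\<And>r. r \<in> {0..t} \<Longrightarrow> \<psi>' r = \<psi> r"
  shows "- 2 * (LINT r|lebesgue_on {0..t}. deriv (heat_kernel (t - r)) x * \<psi>' r) = lift t x"
proof -
  have "(LINT r|lebesgue_on {0..t}. deriv (heat_kernel (t - r)) x * \<psi>' r)
    = (LINT r|lborel. indicator {0..t} r * (- (1 / 2) * boundary_kernel (t - r) x * \<psi> r))"
  proof (rule integral_lebesgue_on_Borel)
    show "AE r in lborel. r \<in> {0..t} \<longrightarrow> deriv (heat_kernel (t - r)) x * \<psi>' r = - (1 / 2) * boundary_kernel (t - r) x * \<psi> r"
    proof (intro AE_I2 impI)
      fix r assume "r \<in> {0..t}"
      show "deriv (heat_kernel (t - r)) x * \<psi>' r = - (1 / 2) * boundary_kernel (t - r) x * \<psi> r"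
      proof -
        have "deriv (heat_kernel (t - r)) x = - (1 / 2) * boundary_kernel (t - r) x"
          using deriv_heat_kernel[OF x, of "t - r"] \<open>r \<in> {0..t}\<close> by auto
        then show ?thesis using eq[OF \<open>r \<in> {0..t}\<close>] by simp
      qed
    qed
  qed measurable
  then have "- 2 * (LINT r|lebesgue_on {0..t}. deriv (heat_kernel (t - r)) x * \<psi>' r)
    = - 2 * (LINT r|lborel. indicator {0..t} r * (- (1 / 2) * boundary_kernel (t - r) x * \<psi> r))" by simp
  also have "\<dots> = (LINT r|lborel. - 2 * (indicator {0..t} r * (- (1 / 2) * boundary_kernel (t - r) x * \<psi> r)))"
    by (rule integral_mult_right_zero[symmetric])
  also have "\<dots> = (LINT r|lborel. indicator {0..t} r * (boundary_kernel (t - r) x * \<psi> r))"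
    by (intro Bochner_Integration.integral_cong) auto
  also have "\<dots> = (LINT r|lborel. indicator {0..t} (t + - 1 * r) * (boundary_kernel (t - (t + - 1 * r)) x * \<psi> (t + - 1 * r)))"
    by (subst lborel_integral_real_affine[of "- 1" _ t]) auto
  also have "\<dots> = (LINT r|lborel. indicator {0..t} r * (boundary_kernel r x * \<psi> (t - r)))"
    by (intro Bochner_Integration.integral_cong) (auto split: split_indicator)
  also have "\<dots> = (LINT r|lborel. indicator {0<..<t} r * (boundary_kernel r x * \<psi> (t - r)))"
    by (rule integral_Icc_eq_Ioo) measurable
  finally show ?thesis by (simp add: lift_def mult.assoc)
qed

text \<open>The mild formula contains an iterated integral. It agrees with the space-time integral
  wherever the latter converges absolutely, that is at almost every \<open>x\<close>.\<close>

lemma (in heat_source) duhamel_eq_iterated: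
  assumes t: "0 \<le> t" "t \<le> T"
  shows "AE x in lborel. (LINT r|lborel. indicator {0<..<t} r * dsg (t - r) (F r) x) = duhamel 0 t F x"
  using duhamel_abs_F1_fin[OF order_refl t(2)]
proof eventually_elim
  case (elim x)
  have Fm: "case_prod F \<in> borel_measurable (borel \<Otimes>\<^sub>M borel)" by measurable
  have "integrable (lborel \<Otimes>\<^sub>M lborel) (\<lambda>p. duhamel_kernel 0 t x p * F (fst p) (snd p))"
    by (rule integrable_duhamel[OF Fm duhamel_abs_F_fin[OF t(1) elim]])
  then have "integrable (lborel \<Otimes>\<^sub>M lborel) (\<lambda>(r, y). duhamel_kernel 0 t x (r, y) * F r y)"
    by (simp add: case_prod_beta')
  from lborel_pair.integral_fst[OF this]
  have "(LINT r|lborel. LINT y|lborel. duhamel_kernel 0 t x (r, y) * F r y) = duhamel 0 t F x"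
    by (simp add: duhamel_def case_prod_beta')
  moreover have "(LINT y|lborel. duhamel_kernel 0 t x (r, y) * F r y) = indicator {0<..<t} r * dsg (t - r) (F r) x" for r
    by (simp add: duhamel_kernel_def dsg_def mult.assoc)
  ultimately show ?case by simp
qed

lemma primitive_of_const: "primitive_of (\<lambda>_. c) (\<lambda>_. 0)"
  by (simp add: primitive_of_def)

lemma has_weak_deriv_const_minus:
  assumes "has_weak_deriv (\<lambda>x. C - f x) g"
  shows "has_weak_deriv f (\<lambda>x. - g x)"
proof -
  obtain w where w: "primitive_of w g" "AE x in lebesgue. 0 < x \<longrightarrow> C - f x = w x"
    by (rule weak_deriv_imp_primitive[OF assms])
  show ?thesis
  proof (rule primitive_imp_weak_deriv)
    show "primitive_of (\<lambda>x. C - w x) (\<lambda>x. - g x)"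
      using primitive_of_diff[OF primitive_of_const w(1), of C] by simp
    show "AE x in lebesgue. 0 < x \<longrightarrow> f x = C - w x" using w(2) by eventually_elim auto
  qed
qed

lemma lebesgue_on_singleton_integral: "(LINT r|lebesgue_on {c..c}. f r) = (0 :: real)" for c :: real
proof -
  have "AE r in lborel. r \<in> {c..c} \<longrightarrow> f r = 0"
    using AE_lborel_singleton[of c] by eventually_elim auto
  then have "(LINT r|lebesgue_on {c..c}. f r) = (LINT r|lborel. indicator {c..c} r * 0)"
    by (intro integral_lebesgue_on_Borel) auto
  then show ?thesis by simp
qed

text \<open>At time 0 both time integrals extend over a single point and vanish, and
  \<open>dirichlet_conv 0\<close> is the identity. This time needs its own argument because
  \<open>mild v0 0\<close> is 0 and not \<open>v0\<close>.\<close>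

lemma mild_solution_at_0:
  assumes sol: "bounded_positive_mild_solution B lam \<eta> \<psi> s0 c0 T s c" and T: "0 \<le> T"
  shows "L2_sq (s 0) = L2_sq s0"
proof -
  have s_eq: "AE x in Rplus. s t x = - 2 * (LINT \<tau>|lebesgue_on {0..t}. deriv (heat_kernel (t - \<tau>)) x * \<psi> \<tau>)
          + dirichlet_conv t s0 x
          + (LINT \<tau>|lebesgue_on {0..t}. dirichlet_conv (t - \<tau>)
               (\<lambda>y. b_coeff B c \<tau> y * weak_deriv (s \<tau>) y
                  + gamma_coeff lam c \<tau> y * s \<tau> y * (B * s \<tau> y - 1)) x)" if "t \<in> {0..T}" for t
    using sol that unfolding bounded_positive_mild_solution_def by auto
  have "AE x in Rplus. s 0 x = s0 x"
    using s_eq[of 0] T unfolding lebesgue_on_singleton_integral by (simp add: dirichlet_conv_def)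
  then have ae: "AE x in lborel. 0 < x \<longrightarrow> s 0 x = s0 x" by (simp add: AE_lebesgue_on_iff)
  have "L2_sq (s 0) = (\<integral>\<^sup>+x. indicator {0<..} x * ennreal ((s0 x)\<^sup>2) \<partial>lborel)" by (rule L2_sq_Borel[OF ae])
  also have "\<dots> = L2_sq s0" by (rule L2_sq_Borel[symmetric]) simp
  finally show ?thesis .
qed

text \<open>The constants are those of the locale, exported with their parameters. Their arguments
  include neither \<open>T\<close> nor \<open>K\<close> nor any representative of the solution,
  which is the uniformity required of \<mu>.\<close>

lemma mild_solution_bounds:
  assumes lam: "lam > 0" and B: "B \<in> {1, -1}" and Tfin: "Tfin > 0"
    and data: "data_assumption B \<beta> \<eta> C0 m Tfin \<psi> s0 c0"
    and T: "0 < T" "T \<le> Tfin"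
    and sol: "bounded_positive_mild_solution B lam \<eta> \<psi> s0 c0 T s c"
  defines "EB \<equiv> reaction_solution.energy_bound \<eta> (holder_norm \<beta> {0..Tfin} \<psi>) \<beta> Tfin lam C0 (phi_min B C0) (L2_norm_Rplus (weak_deriv c0)) (L2_norm_Rplus s0)"
    and "GB \<equiv> reaction_solution.grad_bound \<eta> (holder_norm \<beta> {0..Tfin} \<psi>) \<beta> Tfin lam C0 (phi_min B C0) (L2_norm_Rplus (weak_deriv c0)) (L2_norm_Rplus s0)"
  shows "\<And>t. 0 < t \<Longrightarrow> t \<le> T \<Longrightarrow> L2_sq (s t) \<le> ennreal EB"
    and "(\<integral>\<^sup>+t. L2_sq (weak_deriv (s t)) \<partial>lebesgue_on {0..T}) \<le> ennreal GB"
proof -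
  define H pm l1 l0 where "H = holder_norm \<beta> {0..Tfin} \<psi>" and "pm = phi_min B C0"
    and "l1 = L2_norm_Rplus (weak_deriv c0)" and "l0 = L2_norm_Rplus s0"
  define \<psi>1 where "\<psi>1 t = (if t \<in> {0..Tfin} then \<psi> t else 0)" for t
  have \<eta>: "0 \<le> \<eta>" and m: "0 < m" "m \<le> C0" and \<beta>: "1 / 4 < \<beta>"
    and c0_bd: "\<And>x. 0 < x \<Longrightarrow> m \<le> c0 x \<and> c0 x \<le> C0" and s0_bd: "\<And>x. 0 < x \<Longrightarrow> 0 \<le> s0 x \<and> s0 x \<le> \<eta>"
    and C0: "B = - 1 \<Longrightarrow> C0 < 1" and s0W: "in_W12 s0" and c0W: "in_W12 (\<lambda>x. C0 - c0 x)" and \<eta>1: "B = 1 \<Longrightarrow> \<eta> < 1"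
    using data unfolding data_assumption_def by auto
  interpret bd: boundary_data \<psi>1 \<eta> H \<beta> Tfin
    unfolding \<psi>1_def H_def
    using data Tfin \<eta> by (intro holder_boundary_data) (auto simp: data_assumption_def)
  have pm: "0 < pm" "\<forall>c. 0 \<le> c \<and> c \<le> C0 \<longrightarrow> pm \<le> 1 + B * c"
    unfolding pm_def using phi_min[OF B _ C0] m by auto
  obtain v where v: "v \<in> borel_measurable borel" "AE x in lborel. x \<in> {0<..} \<longrightarrow> s0 x = v x"
    using ex_Borel_lebesgue_on[of s0 "{0<..}"] s0W by (auto simp: in_W12_def in_L2_def)
  \<comment> \<open>Truncation changes nothing at points where \<open>s0 x = v x\<close>, and it
    makes the bound by \<open>\<eta>\<close> hold everywhere.\<close>
  define v0 where "v0 x = (if 0 < x then max 0 (min \<eta> (v x)) else 0)" for x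
  have v0_meas [measurable]: "v0 \<in> borel_measurable borel" using v(1) unfolding v0_def[abs_def] by measurable
  have v0_bd: "\<bar>v0 x\<bar> \<le> \<eta>" for x using \<eta> by (auto simp: v0_def)
  have s0v0: "AE x in lborel. 0 < x \<longrightarrow> s0 x = v0 x"
    using v(2)
  proof eventually_elim
    case (elim x)
    then show ?case using s0_bd[of x] by (auto simp: v0_def)
  qed
  have s0_L2: "L2_sq s0 < \<infinity>" using s0W by (simp add: in_W12_def in_L2_def)
  have v0_L2: "(\<integral>\<^sup>+x. ennreal ((v0 x)\<^sup>2) \<partial>lborel) \<le> ennreal (l0\<^sup>2)"
  proof -
    have "(\<integral>\<^sup>+x. ennreal ((v0 x)\<^sup>2) \<partial>lborel) = L2_sq s0"
      unfolding L2_sq_Borel[OF s0v0] by (intro nn_integral_cong) (auto simp: v0_def split: split_indicator)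
    then show ?thesis using L2_norm_sq[OF s0_L2] by (simp add: l0_def)
  qed
  obtain g where g: "has_weak_deriv (\<lambda>x. C0 - c0 x) g" "in_L2 g" using c0W by (auto simp: in_W12_def)
  have c0g: "has_weak_deriv c0 (\<lambda>x. - g x)" by (rule has_weak_deriv_const_minus[OF g(1)])
  have c0wd: "has_weak_deriv c0 (weak_deriv c0)" by (rule has_weak_deriv_weak_deriv[OF c0g])
  obtain c1 g1 where c1: "primitive_of c1 g1" "c1 \<in> borel_measurable borel" "g1 \<in> borel_measurable borel"
    "\<And>x. m \<le> c1 x" "\<And>x. c1 x \<le> C0" "AE x in lborel. 0 < x \<longrightarrow> c0 x = c1 x" "AE x in lborel. 0 < x \<longrightarrow> weak_deriv c0 x = g1 x"
    using weak_deriv_Borel_primitive[OF c0wd c0_bd m(2)] by blast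
  have g1_L2: "(\<integral>\<^sup>+x. indicator {0<..} x * ennreal ((g1 x)\<^sup>2) \<partial>lborel) \<le> ennreal (l1\<^sup>2)"
  proof -
    have "L2_sq (weak_deriv c0) = L2_sq g"
      using L2_sq_Borel[OF weak_deriv_unique[OF c0wd c0g]] L2_sq_Borel[of g g] by simp
    then have "L2_sq (weak_deriv c0) < \<infinity>" using g(2) by (simp add: in_L2_def)
    from L2_norm_sq[OF this] show ?thesis using L2_sq_Borel[OF c1(7)] by (simp add: l1_def)
  qed
  have s_bd: "\<And>t x. t \<in> {0..T} \<Longrightarrow> 0 < x \<Longrightarrow> 0 \<le> s t x \<and> s t x \<le> \<eta>" and sW: "in_Linf_W12 T s" and sL: "in_Linf ({0..T} \<times> {0<..}) s"
    and c_eq: "\<And>t x. t \<in> {0..T} \<Longrightarrow> 0 < x \<Longrightarrow> c t x = c0 x / (phi B (c0 x) * exp (lam * (LINT \<tau>|lebesgue_on {0..t}. s \<tau> x)) - B * c0 x)"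
    using sol unfolding bounded_positive_mild_solution_def by auto
  have s_eq: "AE x in Rplus. s t x = - 2 * (LINT \<tau>|lebesgue_on {0..t}. deriv (heat_kernel (t - \<tau>)) x * \<psi> \<tau>)
          + dirichlet_conv t s0 x
          + (LINT \<tau>|lebesgue_on {0..t}. dirichlet_conv (t - \<tau>)
               (\<lambda>y. b_coeff B c \<tau> y * weak_deriv (s \<tau>) y
                  + gamma_coeff lam c \<tau> y * s \<tau> y * (B * s \<tau> y - 1)) x)" if "t \<in> {0..T}" for t
    using sol that unfolding bounded_positive_mild_solution_def by auto
  obtain u Du K where u: "case_prod u \<in> borel_measurable (borel \<Otimes>\<^sub>M borel)" "case_prod Du \<in> borel_measurable (borel \<Otimes>\<^sub>M borel)"
    "\<And>t. primitive_of (u t) (Du t)" "\<And>t x. 0 \<le> u t x" "\<And>t x. u t x \<le> \<eta>" "\<And>t x. x \<le> 0 \<Longrightarrow> Du t x = 0"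
    "\<And>t. (\<integral>\<^sup>+x. ennreal ((Du t x)\<^sup>2) \<partial>lborel) \<le> ennreal K"
    and su: "AE t in lborel. t \<in> {0..T} \<longrightarrow> (AE x in lborel. 0 < x \<longrightarrow> s t x = u t x) \<and> has_weak_deriv (s t) (Du t)"
    using joint_Borel_representative[OF sW sL s_bd \<eta>] by blast
  \<comment> \<open>Interpretation takes two stages: the source terms and \<open>R.mild\<close> must
    exist before the assumptions of \<open>reaction_solution\<close> about them can be
    verified.\<close>
  interpret R: reaction \<psi>1 \<eta> H \<beta> Tfin B lam C0 pm T l1 K c1 g1 u Du
    using B lam T pm \<eta>1 c1 g1_L2 u m order_trans[OF less_imp_le[OF m(1)] c1(4)]
    by unfold_locales auto
  have su1: "AE t in lborel. t \<in> {0..T} \<longrightarrow> (AE x in lborel. 0 < x \<longrightarrow> s t x = u t x)"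
    using su by eventually_elim blast
  have su2: "AE x in lborel. 0 < x \<longrightarrow> (AE t in lborel. t \<in> {0..T} \<longrightarrow> s t x = u t x)"
    by (rule AE_swap_representative[OF sL u(1) su1])
  \<comment> \<open>The formula for \<open>c\<close> integrates \<open>s\<close> over time at fixed
    \<open>x\<close>, so the agreement of \<open>s\<close> and \<open>u\<close> is needed in the
    exchanged form \<open>su2\<close>.\<close>
  have c_conc: "AE x in lborel. 0 < x \<longrightarrow> c t x = R.conc t x" if t: "t \<in> {0..T}" for t
    using su2 c1(6)
  proof eventually_elim
    case (elim x)
    show ?case
    proof
      assume x: "0 < x"
      have [measurable]: "(\<lambda>r. u r x) \<in> borel_measurable borel" using u(1) by measurable
      have "(LINT \<tau>|lebesgue_on {0..t}. s \<tau> x) = (LINT r|lborel. indicator {0..t} r * u r x)"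
        by (rule integral_lebesgue_on_Borel) (use elim(1) x t in \<open>auto elim!: eventually_mono\<close>)
      also have "\<dots> = R.\<sigma> t x" unfolding R.\<sigma>_def by (rule integral_Icc_eq_Ioo) measurable
      finally show "c t x = R.conc t x"
        using c_eq[OF t x] elim(2) x by (simp add: R.conc_def conc_fun_def phi_def)
    qed
  qed
  have c_deriv: "AE x in lborel. 0 < x \<longrightarrow> weak_deriv (c t) x = R.Dconc t x" if t: "t \<in> {0..T}" for t
  proof -
    have "has_weak_deriv (c t) (R.Dconc t)"
      using t by (intro primitive_imp_weak_deriv[OF R.primitive_of_conc] AE_completion c_conc) auto
    then show ?thesis by (intro weak_deriv_unique[OF has_weak_deriv_weak_deriv])
  qed
  let ?S = "\<lambda>r y. b_coeff B c r y * weak_deriv (s r) y + gamma_coeff lam c r y * s r y * (B * s r y - 1)"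
  have source: "AE r in lborel. 0 < r \<and> r < T \<longrightarrow> (AE y in lborel. 0 < y \<longrightarrow> ?S r y = R.F1 r y + R.F2 r y)"
    using su
  proof eventually_elim
    case (elim r)
    show ?case
    proof
      assume r: "0 < r \<and> r < T"
      then have rT: "r \<in> {0..T}" by auto
      have w: "AE y in lborel. 0 < y \<longrightarrow> weak_deriv (s r) y = Du r y"
        using elim rT by (intro weak_deriv_unique[OF has_weak_deriv_weak_deriv]) auto
      have "AE y in lborel. 0 < y \<longrightarrow> s r y = u r y" using elim rT by blast
      then show "AE y in lborel. 0 < y \<longrightarrow> ?S r y = R.F1 r y + R.F2 r y"
        using w c_conc[OF rT] c_deriv[OF rT]
        by eventually_elim (use r in \<open>auto simp: b_coeff_def gamma_coeff_def R.F1_def R.F2_def\<close>)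
    qed
  qed
  \<comment> \<open>Valid at every positive time, not just almost every one: the source enters only
    under the time integral, where exceptional times do not count.\<close>
  have s_mild: "AE x in lborel. 0 < x \<longrightarrow> s t x = bd.lift t x + R.mild v0 t x" if t: "0 < t" "t \<le> T" for t
  proof -
    have "AE x in lborel. 0 < x \<longrightarrow> s t x = - 2 * (LINT \<tau>|lebesgue_on {0..t}. deriv (heat_kernel (t - \<tau>)) x * \<psi> \<tau>)
          + dirichlet_conv t s0 x + (LINT \<tau>|lebesgue_on {0..t}. dirichlet_conv (t - \<tau>) (?S \<tau>) x)"
      using s_eq[of t] t by (simp add: AE_lebesgue_on_iff)
    moreover have "AE x in lborel. (LINT r|lborel. indicator {0<..<t} r * dsg (t - r) (R.F r) x) = duhamel 0 t R.F x"
      using t by (intro R.duhamel_eq_iterated) auto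
    ultimately show ?thesis
    proof eventually_elim
      case (elim x)
      show ?case
      proof
        assume x: "0 < x"
        have 1: "- 2 * (LINT \<tau>|lebesgue_on {0..t}. deriv (heat_kernel (t - \<tau>)) x * \<psi> \<tau>) = bd.lift t x"
          using t T by (intro bd.boundary_integral_eq_lift x) (auto simp: \<psi>1_def)
        have 2: "dirichlet_conv t s0 x = dsg t v0 x"
          by (rule dirichlet_conv_eq_dsg[OF t(1) x v0_meas s0v0])
        have Fm: "case_prod R.F \<in> borel_measurable (borel \<Otimes>\<^sub>M borel)" by measurable
        have dm: "(\<lambda>r. dsg (t - r) (R.F r) x) \<in> borel_measurable borel"
          unfolding dsg_def by measurable
        have "(LINT \<tau>|lebesgue_on {0..t}. dirichlet_conv (t - \<tau>) (?S \<tau>) x) = (LINT r|lborel. indicator {0..t} r * dsg (t - r) (R.F r) x)"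
        proof (rule integral_lebesgue_on_Borel[OF dm])
          show "AE r in lborel. r \<in> {0..t} \<longrightarrow> dirichlet_conv (t - r) (?S r) x = dsg (t - r) (R.F r) x"
            using source AE_lborel_singleton[of 0] AE_lborel_singleton[of t]
          proof eventually_elim
            case (elim r)
            show ?case
            proof
              assume "r \<in> {0..t}"
              then have r: "0 < r" "r < t" using elim by auto
              have [measurable]: "R.F r \<in> borel_measurable borel" by measurable
              show "dirichlet_conv (t - r) (?S r) x = dsg (t - r) (R.F r) x"
                by (rule dirichlet_conv_eq_dsg) (use elim r t x in auto)
            qed
          qed
        qed simp
        also have "\<dots> = (LINT r|lborel. indicator {0<..<t} r * dsg (t - r) (R.F r) x)"
          by (rule integral_Icc_eq_Ioo[OF dm])
        also have "\<dots> = duhamel 0 t R.F x" by (rule elim(2))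
        finally show "s t x = bd.lift t x + R.mild v0 t x"
          using elim(1) x 1 2 by (simp add: R.mild_def)
      qed
    qed
  qed
  interpret RS: reaction_solution \<psi>1 \<eta> H \<beta> Tfin B lam C0 pm T l1 K c1 g1 u Du v0 l0
  proof unfold_locales
    show "AE x in lborel. 0 < x \<longrightarrow> 0 \<le> bd.lift t x + R.mild v0 t x \<and> bd.lift t x + R.mild v0 t x \<le> \<eta>" if "0 < t" "t \<le> T" for t
      using s_mild[OF that]
    proof eventually_elim
      case (elim x)
      then show ?case using s_bd[of t x] that by auto
    qed
    show "AE t in lborel. 0 < t \<and> t < T \<longrightarrow> (AE x in lborel. 0 < x \<longrightarrow> u t x = bd.lift t x + R.mild v0 t x)"
      using su1
    proof eventually_elim
      case (elim t)
      show ?case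
      proof
        assume t: "0 < t \<and> t < T"
        then have "AE x in lborel. 0 < x \<longrightarrow> s t x = u t x" using elim by auto
        moreover have "AE x in lborel. 0 < x \<longrightarrow> s t x = bd.lift t x + R.mild v0 t x" using t by (intro s_mild) auto
        ultimately show "AE x in lborel. 0 < x \<longrightarrow> u t x = bd.lift t x + R.mild v0 t x" by eventually_elim auto
      qed
    qed
  qed (use v0_bd v0_L2 in auto)
  show "L2_sq (s t) \<le> ennreal EB" if "0 < t" "t \<le> T" for t
    unfolding L2_sq_Borel[OF s_mild[OF that]] EB_def
    using RS.solution_energy_le[OF that] by (simp add: H_def pm_def l1_def l0_def)
  have "(\<integral>\<^sup>+t. L2_sq (weak_deriv (s t)) \<partial>lebesgue_on {0..T}) = (\<integral>\<^sup>+t. indicator {0..T} t * (\<integral>\<^sup>+x. ennreal ((Du t x)\<^sup>2) \<partial>lborel) \<partial>lborel)"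
  proof (rule nn_integral_lebesgue_on_Borel)
    show "AE t in lborel. t \<in> {0..T} \<longrightarrow> L2_sq (weak_deriv (s t)) = (\<integral>\<^sup>+x. ennreal ((Du t x)\<^sup>2) \<partial>lborel)"
      using su
    proof eventually_elim
      case (elim t)
      show ?case
      proof
        assume "t \<in> {0..T}"
        then have "has_weak_deriv (s t) (Du t)" using elim by blast
        then have "AE x in lborel. 0 < x \<longrightarrow> weak_deriv (s t) x = Du t x"
          by (intro weak_deriv_unique[OF has_weak_deriv_weak_deriv])
        from L2_sq_Borel[OF this] show "L2_sq (weak_deriv (s t)) = (\<integral>\<^sup>+x. ennreal ((Du t x)\<^sup>2) \<partial>lborel)"
          by (simp only:) (intro nn_integral_cong, auto simp: u(6) split: split_indicator)
      qed
    qed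
  qed simp
  also have "\<dots> = R.grad_energy T"
    unfolding R.grad_energy_def
  proof (rule nn_integral_cong_AE)
    show "AE t in lborel. indicator {0..T} t * (\<integral>\<^sup>+x. ennreal ((Du t x)\<^sup>2) \<partial>lborel) = indicator {0<..<T} t * (\<integral>\<^sup>+x. ennreal ((Du t x)\<^sup>2) \<partial>lborel)"
      using AE_lborel_singleton[of 0] AE_lborel_singleton[of T] by eventually_elim (auto split: split_indicator)
  qed
  also have "\<dots> \<le> ennreal GB"
    unfolding GB_def using RS.grad_energy_le[OF T(1) order_refl] by (simp add: H_def pm_def l1_def l0_def)
  finally show "(\<integral>\<^sup>+t. L2_sq (weak_deriv (s t)) \<partial>lebesgue_on {0..T}) \<le> ennreal GB" .
qed

theorem proposition40:
  fixes \<beta> :: real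
  shows "\<exists>\<mu> :: real \<Rightarrow> real \<Rightarrow> real \<Rightarrow> real \<Rightarrow> real \<Rightarrow> real \<Rightarrow> real \<Rightarrow> real \<Rightarrow> real \<Rightarrow> real.
    \<forall>lam B Tfin \<eta> C0 m \<psi> s0 c0.
      lam > 0 \<longrightarrow> B \<in> {1, -1} \<longrightarrow> Tfin > 0 \<longrightarrow>
      data_assumption B \<beta> \<eta> C0 m Tfin \<psi> s0 c0 \<longrightarrow>
      (let M = \<mu> m C0 (phi_min B C0) lam \<eta> Tfin (holder_norm \<beta> {0..Tfin} \<psi>)
                 (L2_norm_Rplus s0) (L2_norm_Rplus (weak_deriv c0))
       in M \<ge> 0 \<and>
          (\<forall>T\<in>{0..Tfin}. \<forall>s c.
             bounded_positive_mild_solution B lam \<eta> \<psi> s0 c0 T s c \<longrightarrow>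
             (SUP t\<in>{0..T}. L2_sq (s t))
               + (\<integral>\<^sup>+ t. L2_sq (weak_deriv (s t)) \<partial>lebesgue_on {0..T})
             \<le> ennreal (2 * M)))"
proof -
  let ?EB = "\<lambda>C0 pm lam \<eta> Tfin H l0 l1. reaction_solution.energy_bound \<eta> H \<beta> Tfin lam C0 pm l1 l0"
  let ?GB = "\<lambda>C0 pm lam \<eta> Tfin H l0 l1. reaction_solution.grad_bound \<eta> H \<beta> Tfin lam C0 pm l1 l0"
  \<comment> \<open>The maximum with \<open>l0\<^sup>2\<close> covers \<open>t = 0\<close>, the
    maximum with 0 ensures nonnegativity, and the division by 2 matches the factor 2 in the
    claim.\<close>
  define \<mu> :: "real \<Rightarrow> real \<Rightarrow> real \<Rightarrow> real \<Rightarrow> real \<Rightarrow> real \<Rightarrow> real \<Rightarrow> real \<Rightarrow> real \<Rightarrow> real" where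
    "\<mu> m C0 pm lam \<eta> Tfin H l0 l1 =
       (max (l0\<^sup>2) (?EB C0 pm lam \<eta> Tfin H l0 l1) + max 0 (?GB C0 pm lam \<eta> Tfin H l0 l1)) / 2"
    for m C0 pm lam \<eta> Tfin H l0 l1
  show ?thesis
  proof (intro exI[of _ \<mu>] allI impI)
    fix lam B Tfin \<eta> C0 m :: real and \<psi> s0 c0 :: "real \<Rightarrow> real"
    assume lam: "lam > 0" and B: "B \<in> {1, - 1}" and Tfin: "Tfin > 0"
      and data: "data_assumption B \<beta> \<eta> C0 m Tfin \<psi> s0 c0"
    let ?H = "holder_norm \<beta> {0..Tfin} \<psi>" and ?l0 = "L2_norm_Rplus s0" and ?l1 = "L2_norm_Rplus (weak_deriv c0)"
    let ?M = "\<mu> m C0 (phi_min B C0) lam \<eta> Tfin ?H ?l0 ?l1"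
    define E G where "E = max (?l0\<^sup>2) (?EB C0 (phi_min B C0) lam \<eta> Tfin ?H ?l0 ?l1)"
      and "G = max 0 (?GB C0 (phi_min B C0) lam \<eta> Tfin ?H ?l0 ?l1)"
    have M: "2 * ?M = E + G" by (simp add: \<mu>_def E_def G_def)
    have "0 \<le> ?l0\<^sup>2" by simp
    then have E: "0 \<le> E" "?l0\<^sup>2 \<le> E" and G: "0 \<le> G" by (simp_all add: E_def G_def le_max_iff_disj)
    have bound: "(SUP t\<in>{0..T}. L2_sq (s t)) + (\<integral>\<^sup>+ t. L2_sq (weak_deriv (s t)) \<partial>lebesgue_on {0..T}) \<le> ennreal (2 * ?M)"
      if T: "T \<in> {0..Tfin}" and sol: "bounded_positive_mild_solution B lam \<eta> \<psi> s0 c0 T s c" for T s c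
    proof -
      have L2_0: "L2_sq (s 0) \<le> ennreal E"
      proof -
        have "L2_sq (s 0) = L2_sq s0" using mild_solution_at_0[OF sol] T by simp
        also have "\<dots> = ennreal (?l0\<^sup>2)"
          using data by (intro L2_norm_sq[symmetric]) (auto simp: data_assumption_def in_W12_def in_L2_def)
        also have "\<dots> \<le> ennreal E" by (rule ennreal_leI[OF E(2)])
        finally show ?thesis .
      qed
      have "(SUP t\<in>{0..T}. L2_sq (s t)) \<le> ennreal E \<and> (\<integral>\<^sup>+ t. L2_sq (weak_deriv (s t)) \<partial>lebesgue_on {0..T}) \<le> ennreal G"
      proof (cases "T = 0")
        \<comment> \<open>The locales require a positive time horizon, so \<open>T = 0\<close> is
          separate: the time integral is over a null set and only the initial value counts.\<close>
        case True
        have "(\<integral>\<^sup>+ t. L2_sq (weak_deriv (s t)) \<partial>lebesgue_on {0..0}) = (\<integral>\<^sup>+ t. indicator {0..0 :: real} t * 0 \<partial>lborel)"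
        proof (rule nn_integral_lebesgue_on_Borel)
          show "AE t in lborel. t \<in> {0..0} \<longrightarrow> L2_sq (weak_deriv (s t)) = 0"
            using AE_lborel_singleton[of 0] by eventually_elim auto
        qed simp
        then show ?thesis using True L2_0 by simp
      next
        case False
        then have T': "0 < T" "T \<le> Tfin" using T by auto
        note b = mild_solution_bounds[OF lam B Tfin data T' sol]
        have "L2_sq (s t) \<le> ennreal E" if "t \<in> {0..T}" for t
        proof (cases "t = 0")
          case False
          then have "L2_sq (s t) \<le> ennreal (?EB C0 (phi_min B C0) lam \<eta> Tfin ?H ?l0 ?l1)"
            using that by (intro b(1)) auto
          also have "\<dots> \<le> ennreal E" by (intro ennreal_leI) (simp add: E_def)
          finally show ?thesis .
        qed (use L2_0 in simp)
        moreover have "(\<integral>\<^sup>+ t. L2_sq (weak_deriv (s t)) \<partial>lebesgue_on {0..T}) \<le> ennreal G"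
          by (rule order_trans[OF b(2)]) (intro ennreal_leI, simp add: G_def)
        ultimately show ?thesis by (auto intro: SUP_least)
      qed
      then have "(SUP t\<in>{0..T}. L2_sq (s t)) + (\<integral>\<^sup>+ t. L2_sq (weak_deriv (s t)) \<partial>lebesgue_on {0..T}) \<le> ennreal E + ennreal G"
        by (intro add_mono) auto
      then show ?thesis unfolding M using E G by simp
    qed
    show "let M = ?M in M \<ge> 0 \<and>
          (\<forall>T\<in>{0..Tfin}. \<forall>s c.
             bounded_positive_mild_solution B lam \<eta> \<psi> s0 c0 T s c \<longrightarrow>
             (SUP t\<in>{0..T}. L2_sq (s t))
               + (\<integral>\<^sup>+ t. L2_sq (weak_deriv (s t)) \<partial>lebesgue_on {0..T})
             \<le> ennreal (2 * M))"
      unfolding Let_def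
    proof (intro conjI ballI allI impI)
      show "0 \<le> ?M" using M E G by simp
    qed (rule bound)
  qed
qed

end
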